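(* Let $M,E,\rho,h,A,q$ and the family $g_s$, $s\in[0,1]$, be as in the context. Let $\{s_n\}_{n\in\mathbb{N}}\subset(0,1]$ be any sequence with $s_n\to0$ and let $$G_{\overline\partial^{g_{s_n},h}_{E,m,q,\max}}:L^2\Omega^{m,q+1}(A,E|_A,h|_A,\rho|_A)\to L^2\Omega^{m,q}(A,E|_A,g_{s_n}|_A,\rho|_A)$$ be the Green operator of $\overline\partial^{g_{s_n},h}_{E,m,q,\max}:L^2\Omega^{m,q}(A,E|_A,g_{s_n}|_A,\rho|_A)\to L^2\Omega^{m,q+1}(A,E|_A,h|_A,\rho|_A)$. If $$G_{\overline\partial^{h,h}_{E,m,q,\max}}:L^2\Omega^{m,q+1}(A,E|_A,h|_A,\rho|_A)\to L^2\Omega^{m,q}(A,E|_A,h|_A,\rho|_A)$$ is compact and $\mathrm{im}(\overline\partial^{h,h}_{E,m,q,\max})=\mathrm{im}(\overline\partial^{g_1,h}_{E,m,q,\max})$, then $$G_{\overline\partial^{g_{s_n},h}_{E,m,q,\max}}\to G_{\overline\partial^{h,h}_{E,m,q,\max}}\quad\text{compactly as } n\to\infty .$$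
   Context: Setting. $(M,J)$ is a compact complex manifold of complex dimension $m$, $(E,\rho)\to M$ is a Hermitian holomorphic vector bundle, and $h$ is a Hermitian pseudometric on $M$, i.e. a smooth positive semidefinite Hermitian ($J$-invariant) product on $M$ which is positive definite on an open dense subset $A\subset M$. Standing assumptions: (i) $(A,g|_A)$ is parabolic for some (equivalently any) Riemannian metric $g$ on $M$, i.e. for every compact $K\subset A$ the infimum of $\int_A|d\varphi|_g^2\,\mathrm{dvol}_g$ over compactly supported Lipschitz functions $\varphi$ on $A$ with $\varphi\ge1$ on $K$ is $0$ (this implies that $M\setminus A$ has measure zero); (ii) for the fixed $q\in\{0,\dots,m\}$, the group $H^{m,q+1}_{2,\overline\partial_{\max}}(A,E|_A,h|_A,\rho|_A)=\ker(\overline\partial^{h,h}_{E,m,q+1,\max})/\mathrm{im}(\overline\partial^{h,h}_{E,m,q,\max})$ is finite dimensional. Family of metrics: $g_s$ is a smooth section of $p^*T^*M\otimes p^*T^*M\to M\times[0,1]$ ($p:M\times[0,1]\to M$ the projection) such that each $g_s$ is $J$-invariant, $g_s$ is a Hermitian metric on $M$ for $s\in(0,1]$, $g_0=h$, and there is a constant $\mathfrak{a}>0$ with $g_0\le\mathfrak{a}g_s$ for all $s\in[0,1]$. Operators. $L^2\Omega^{m,q}(A,E|_A,g|_A,\rho|_A)$ is the Hilbert space of $L^2$ $E$-valued $(m,q)$-forms on $A$; write $L^2\Omega^{m,q}(A,g)$ for short. For metrics $g,g'$ on $A$, $\overline\partial^{g,g'}_{E,m,q,\max}:L^2\Omega^{m,q}(A,g)\to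 L^2\Omega^{m,q+1}(A,g')$ is the maximal extension of $\overline\partial_E$: $\omega$ is in the domain iff $\omega\in L^2\Omega^{m,q}(A,g)$ and its distributional $\overline\partial_E\omega$ lies in $L^2\Omega^{m,q+1}(A,g')$. Operators in degree $m$ are zero. Green operator. If $T:H_1\to H_2$ is densely defined, closed, with closed range, $G_T:H_2\to H_1$ is the bounded operator that is $0$ on $\ker(T^* )$ and sends $u\in\mathrm{im}(T)$ to the unique $v\in\mathcal{D}(T)\cap\mathrm{im}(T^* )$ with $Tv=u$. (The operators in the claim have closed range.) Convergence. $\Phi_s:L^2\Omega^{m,q}(A,h)\to L^2\Omega^{m,q}(A,g_s)$ is the continuous inclusion given by the identity; $\lim_n\|\Phi_{s_n}u\|=\|u\|$ for all $u$. A sequence $u_n\in K_n:=L^2\Omega^{m,q}(A,g_{s_n})$ converges strongly to $u\in K:=L^2\Omega^{m,q}(A,h)$ if there is a net $v_\beta\to u$ in $K$ with $\lim_\beta\limsup_n\|\Phi_{s_n}v_\beta-u_n\|_{K_n}=0$. Bounded operators $B_n:H\to K_n$ ($H=L^2\Omega^{m,q+1}(A,h)$ fixed) converge compactly to a bounded operator $B:H\to K$ if $B_n\alpha_n\to B\alpha$ strongly in this sense whenever $\alpha_n\rightharpoonup\alpha$ weakly in $H$. *)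

theory Defs
  imports "HOL-Analysis.Analysis" "HOL-Library.Function_Algebras"
begin

section \<open>Smooth and holomorphic maps\<close>

text \<open>The derivative is taken within \<open>S\<close>, so that \<open>S = U \<times> [0,1]\<close> with \<open>U\<close> open
  (smoothness up to the boundary) is covered along with open \<open>S\<close>; for such \<open>S\<close> it is unique.\<close>

primrec Ck_on ::
  "nat \<Rightarrow> 'v::euclidean_space set \<Rightarrow> ('v \<Rightarrow> 'w::real_normed_vector) \<Rightarrow> bool" where
  "Ck_on 0 S f \<longleftrightarrow> continuous_on S f"
| "Ck_on (Suc k) S f \<longleftrightarrow>
     (\<exists>f'. (\<forall>x\<in>S. (f has_derivative f' x) (at x within S)) \<and> (\<forall>v. Ck_on k S (\<lambda>x. f' x v)))"

definition smooth_on :: "'v::euclidean_space set \<Rightarrow> ('v \<Rightarrow> 'w::real_normed_vector) \<Rightarrow> bool" where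
  "smooth_on S f \<longleftrightarrow> (\<forall>k. Ck_on k S f)"

definition hol_on :: "(complex^'m::finite) set \<Rightarrow> (complex^'m \<Rightarrow> complex) \<Rightarrow> bool" where
  "hol_on S f \<longleftrightarrow>
     (\<forall>z\<in>S. \<exists>f'. (f has_derivative f') (at z) \<and> (\<forall>c v. f' (c *s v) = c * f' v))"


section \<open>Complex manifolds\<close>

text \<open>A chart is a domain together with a coordinate map, which is relevant on the domain only.\<close>

type_synonym ('a, 'm) chart = "'a set \<times> ('a \<Rightarrow> complex^'m)"

definition cinv :: "('a, 'm::finite) chart \<Rightarrow> complex^'m \<Rightarrow> 'a" where
  "cinv c = inv_into (fst c) (snd c)"

definition complex_manifold :: "('a::t2_space, 'm::finite) chart set \<Rightarrow> bool" where
  "complex_manifold atlas \<longleftrightarrow>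
     (\<Union>c\<in>atlas. fst c) = UNIV \<and>
     (\<forall>c\<in>atlas. open (fst c) \<and> open (snd c ` fst c) \<and>
        homeomorphism (fst c) (snd c ` fst c) (snd c) (cinv c)) \<and>
     (\<forall>c\<in>atlas. \<forall>d\<in>atlas. \<forall>j. hol_on (snd c ` (fst c \<inter> fst d)) (\<lambda>z. snd d (cinv c z) $ j))"

text \<open>The tangent space at \<open>x\<close> is \<open>complex^'m\<close>, via the coordinates of a chart chosen at \<open>x\<close>;
  the complex structure \<open>J\<close> is multiplication by \<open>\<i>\<close>. The map \<open>tangent atlas c x\<close> takes the
  components of a tangent vector in the chart \<open>c\<close> to this representation.
  Hence a field of objects on the tangent spaces is just a function of \<open>x\<close>, and
  its expression in the chart \<open>c\<close> is obtained by precomposing with \<open>tangent atlas c x\<close>.\<close>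

definition chart_at :: "('a, 'm::finite) chart set \<Rightarrow> 'a \<Rightarrow> ('a, 'm) chart" where
  "chart_at atlas x = (SOME c. c \<in> atlas \<and> x \<in> fst c)"

definition tangent ::
  "('a, 'm::finite) chart set \<Rightarrow> ('a, 'm) chart \<Rightarrow> 'a \<Rightarrow> complex^'m \<Rightarrow> complex^'m" where
  "tangent atlas c x = frechet_derivative (snd (chart_at atlas x) \<circ> cinv c) (at (snd c x))"


section \<open>Metrics\<close>

type_synonym ('a, 'm) metric = "'a \<Rightarrow> complex^'m \<Rightarrow> complex^'m \<Rightarrow> real"

definition local_metric ::
  "('a, 'm::finite) chart set \<Rightarrow> ('a, 'm) chart \<Rightarrow> ('a, 'm) metric \<Rightarrow>
     complex^'m \<Rightarrow> complex^'m \<Rightarrow> complex^'m \<Rightarrow> real" where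
  "local_metric atlas c g z v w =
     (let x = cinv c z in g x (tangent atlas c x v) (tangent atlas c x w))"

definition smooth_metric :: "('a, 'm::finite) chart set \<Rightarrow> ('a, 'm) metric \<Rightarrow> bool" where
  "smooth_metric atlas g \<longleftrightarrow>
     (\<forall>c\<in>atlas. \<forall>v w. smooth_on (snd c ` fst c) (\<lambda>z. local_metric atlas c g z v w))"

definition symmetric_bilinear :: "(complex^'m::finite \<Rightarrow> complex^'m \<Rightarrow> real) \<Rightarrow> bool" where
  "symmetric_bilinear b \<longleftrightarrow> bilinear b \<and> (\<forall>v w. b v w = b w v)"

definition pos_def :: "(complex^'m::finite \<Rightarrow> complex^'m \<Rightarrow> real) \<Rightarrow> bool" where
  "pos_def b \<longleftrightarrow> (\<forall>v. v \<noteq> 0 \<longrightarrow> b v v > 0)"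

definition J_invariant :: "('a, 'm::finite) metric \<Rightarrow> bool" where
  "J_invariant g \<longleftrightarrow> (\<forall>x v w. g x (\<i> *s v) (\<i> *s w) = g x v w)"

definition riemannian_metric :: "('a, 'm::finite) chart set \<Rightarrow> ('a, 'm) metric \<Rightarrow> bool" where
  "riemannian_metric atlas g \<longleftrightarrow>
     smooth_metric atlas g \<and> (\<forall>x. symmetric_bilinear (g x) \<and> pos_def (g x))"

definition hermitian_metric :: "('a, 'm::finite) chart set \<Rightarrow> ('a, 'm) metric \<Rightarrow> bool" where
  "hermitian_metric atlas g \<longleftrightarrow> riemannian_metric atlas g \<and> J_invariant g"

definition hermitian_pseudometric ::
  "('a::topological_space, 'm::finite) chart set \<Rightarrow> 'a set \<Rightarrow> ('a, 'm) metric \<Rightarrow> bool" where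
  "hermitian_pseudometric atlas A h \<longleftrightarrow>
     smooth_metric atlas h \<and> J_invariant h \<and>
     (\<forall>x. symmetric_bilinear (h x) \<and> (\<forall>v. h x v v \<ge> 0)) \<and>
     open A \<and> closure A = UNIV \<and> (\<forall>x\<in>A. pos_def (h x))"

definition metric_family ::
  "('a, 'm::finite) chart set \<Rightarrow> ('a, 'm) metric \<Rightarrow> (real \<Rightarrow> ('a, 'm) metric) \<Rightarrow> bool" where
  "metric_family atlas h g \<longleftrightarrow>
     (\<forall>c\<in>atlas. \<forall>v w. smooth_on ((snd c ` fst c) \<times> {0..1})
        (\<lambda>(z, s). local_metric atlas c (g s) z v w)) \<and>
     (\<forall>s\<in>{0..1}. J_invariant (g s)) \<and>
     (\<forall>s\<in>{0<..1}. hermitian_metric atlas (g s)) \<and>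
     g 0 = h \<and>
     (\<exists>a>0. \<forall>s\<in>{0..1}. \<forall>x v. g 0 x v v \<le> a * g s x v v)"

text \<open>The real basis \<open>(e_j, \<i> e_j)\<close> of \<open>complex^'m\<close>, whose coordinates are those to which
  the measure \<open>lborel\<close> refers, and an orthonormal basis for an arbitrary inner product.\<close>

definition real_basis :: "'m + 'm \<Rightarrow> complex^'m::finite" where
  "real_basis a = (case a of Inl j \<Rightarrow> axis j 1 | Inr j \<Rightarrow> axis j \<i>)"

definition orthonormal_basis ::
  "(complex^'m::finite \<Rightarrow> complex^'m \<Rightarrow> real) \<Rightarrow> 'm + 'm \<Rightarrow> complex^'m" where
  "orthonormal_basis b = (SOME e. \<forall>i j. b (e i) (e j) = (if i = j then 1 else 0))"

text \<open>The Riemannian measure of a metric on a compact manifold: the domains of a finite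
  cover by charts are made disjoint, and \<open>sqrt (det g)\<close> is integrated over the pieces.
  By the change of variables formula, the result does not depend on the cover.\<close>

definition finite_cover :: "('a, 'm::finite) chart set \<Rightarrow> ('a, 'm) chart list" where
  "finite_cover atlas = (SOME cs. set cs \<subseteq> atlas \<and> (\<Union>c\<in>set cs. fst c) = UNIV)"

definition volume_density ::
  "('a, 'm::finite) chart set \<Rightarrow> ('a, 'm) chart \<Rightarrow> ('a, 'm) metric \<Rightarrow> complex^'m \<Rightarrow> real" where
  "volume_density atlas c g z =
     sqrt (det (\<chi> a b. local_metric atlas c g z (real_basis a) (real_basis b)))"

definition dvol ::
  "('a::topological_space, 'm::finite) chart set \<Rightarrow> ('a, 'm) metric \<Rightarrow> 'a measure" where
  "dvol atlas g = measure_of UNIV (sets borel) (\<lambda>S.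
     let cs = finite_cover atlas;
         piece = (\<lambda>k. fst (cs ! k) - (\<Union>j<k. fst (cs ! j)))
     in \<Sum>k<length cs. \<integral>\<^sup>+z. ennreal (volume_density atlas (cs ! k) g z)
                              * indicator (snd (cs ! k) ` (S \<inter> piece k)) z \<partial>lborel)"


section \<open>Parabolicity\<close>

text \<open>For functions with compact support in \<open>A\<close>, being Lipschitz for the Riemannian distance
  amounts to being locally Lipschitz in charts.\<close>

definition locally_lipschitz ::
  "('a::topological_space, 'm::finite) chart set \<Rightarrow> ('a \<Rightarrow> real) \<Rightarrow> bool" where
  "locally_lipschitz atlas \<phi> \<longleftrightarrow>
     (\<forall>c\<in>atlas. \<forall>x\<in>fst c. \<exists>N L. open N \<and> x \<in> N \<and> N \<subseteq> fst c \<and>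
        L-lipschitz_on (snd c ` N) (\<phi> \<circ> cinv c))"

text \<open>The next value is meaningful where \<open>\<phi>\<close> is differentiable, which for locally Lipschitz
  \<open>\<phi>\<close> is almost everywhere.\<close>

definition norm_differential_sq ::
  "('a, 'm::finite) chart set \<Rightarrow> ('a, 'm) metric \<Rightarrow> ('a \<Rightarrow> real) \<Rightarrow> 'a \<Rightarrow> real" where
  "norm_differential_sq atlas g \<phi> x =
     (let c = chart_at atlas x; D = frechet_derivative (\<phi> \<circ> cinv c) (at (snd c x))
      in \<Sum>i\<in>UNIV. (D (orthonormal_basis (g x) i))\<^sup>2)"

definition parabolic ::
  "('a::topological_space, 'm::finite) chart set \<Rightarrow> 'a set \<Rightarrow> ('a, 'm) metric \<Rightarrow> bool" where
  "parabolic atlas A g \<longleftrightarrow>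
     (\<forall>K. compact K \<and> K \<subseteq> A \<longrightarrow>
        (INF \<phi>\<in>{\<phi>. locally_lipschitz atlas \<phi> \<and> compact (closure {x. \<phi> x \<noteq> 0}) \<and>
                   closure {x. \<phi> x \<noteq> 0} \<subseteq> A \<and> (\<forall>x\<in>K. \<phi> x \<ge> 1)}.
           \<integral>\<^sup>+x. ennreal (norm_differential_sq atlas g \<phi> x) * indicator A x \<partial>dvol atlas g) = 0)"


section \<open>Hermitian holomorphic vector bundles\<close>

text \<open>As a set, the total space is \<open>M \<times> \<complex>^r\<close>: each fibre is identified with \<open>\<complex>^r\<close> by a basis,
  chosen without any regularity in the base point. The bundle structure is carried by the local
  trivializations: \<open>(V, \<tau>)\<close> maps the fibre at \<open>x \<in> V\<close> to \<open>\<complex>^r\<close> by the matrix \<open>\<tau> x\<close>.\<close>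

type_synonym ('a, 'r) triv = "'a set \<times> ('a \<Rightarrow> complex^'r^'r)"

type_synonym ('a, 'r) fibre_metric = "'a \<Rightarrow> complex^'r \<Rightarrow> complex^'r \<Rightarrow> complex"

definition holomorphic_bundle ::
  "('a::topological_space, 'm::finite) chart set \<Rightarrow> ('a, 'r::finite) triv set \<Rightarrow> bool" where
  "holomorphic_bundle atlas trivs \<longleftrightarrow>
     (\<Union>t\<in>trivs. fst t) = UNIV \<and>
     (\<forall>t\<in>trivs. open (fst t) \<and> (\<forall>x\<in>fst t. invertible (snd t x))) \<and>
     (\<forall>c\<in>atlas. \<forall>t\<in>trivs. \<forall>u\<in>trivs. \<forall>i j.
        hol_on (snd c ` (fst c \<inter> fst t \<inter> fst u))
          (\<lambda>z. (snd u (cinv c z) ** matrix_inv (snd t (cinv c z))) $ i $ j))"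

definition hermitian_fibre_metric ::
  "('a, 'm::finite) chart set \<Rightarrow> ('a, 'r::finite) triv set \<Rightarrow> ('a, 'r) fibre_metric \<Rightarrow> bool" where
  "hermitian_fibre_metric atlas trivs \<rho> \<longleftrightarrow>
     (\<forall>x u v w a. \<rho> x (u + v) w = \<rho> x u w + \<rho> x v w \<and> \<rho> x (a *s v) w = a * \<rho> x v w) \<and>
     (\<forall>x v w. \<rho> x w v = cnj (\<rho> x v w)) \<and>
     (\<forall>x v. v \<noteq> 0 \<longrightarrow> Re (\<rho> x v v) > 0) \<and>
     (\<forall>c\<in>atlas. \<forall>t\<in>trivs. \<forall>v w. smooth_on (snd c ` (fst c \<inter> fst t))
        (\<lambda>z. let x = cinv c z; \<sigma> = matrix_inv (snd t x) in \<rho> x (\<sigma> *v v) (\<sigma> *v w)))"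


section \<open>Vector-valued forms\<close>

text \<open>A k-covector is a function of sequences of tangent vectors that depends on the first
  k of them only.\<close>

type_synonym ('a, 'm, 'r) form = "'a \<Rightarrow> (nat \<Rightarrow> complex^'m) \<Rightarrow> complex^'r"

definition wedge ::
  "nat \<Rightarrow> (nat \<Rightarrow> complex^'m::finite \<Rightarrow> complex) \<Rightarrow> (nat \<Rightarrow> complex^'m) \<Rightarrow> complex" where
  "wedge k \<theta> v = (\<Sum>\<pi> | \<pi> permutes {..<k}. of_int (sign \<pi>) * (\<Prod>i<k. \<theta> i (v (\<pi> i))))"

definition complex_linear :: "(complex^'m::finite \<Rightarrow> complex) \<Rightarrow> bool" where
  "complex_linear f \<longleftrightarrow> (\<forall>v w. f (v + w) = f v + f w) \<and> (\<forall>c v. f (c *s v) = c * f v)"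

definition complex_antilinear :: "(complex^'m::finite \<Rightarrow> complex) \<Rightarrow> bool" where
  "complex_antilinear f \<longleftrightarrow> (\<forall>v w. f (v + w) = f v + f w) \<and> (\<forall>c v. f (c *s v) = cnj c * f v)"

definition pq_covectors ::
  "nat \<Rightarrow> nat \<Rightarrow> ((nat \<Rightarrow> complex^'m::finite) \<Rightarrow> complex^'r::finite) set" where
  "pq_covectors p q =
     {\<lambda>v. \<Sum>j<N. wedge (p + q) (\<theta> j) v *s e j | (N::nat) \<theta> e.
        \<forall>j<N. (\<forall>i<p. complex_linear (\<theta> j i)) \<and> (\<forall>i\<in>{p..<p + q}. complex_antilinear (\<theta> j i))}"

text \<open>The coefficients of a form in a chart and a trivialization.\<close>

definition local_form ::
  "('a, 'm::finite) chart set \<Rightarrow> ('a, 'm) chart \<Rightarrow> ('a, 'r::finite) triv \<Rightarrow> ('a, 'm, 'r) form \<Rightarrow>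
     complex^'m \<Rightarrow> (nat \<Rightarrow> complex^'m) \<Rightarrow> complex^'r" where
  "local_form atlas c t \<omega> z v =
     (let x = cinv c z in snd t x *v \<omega> x (\<lambda>i. tangent atlas c x (v i)))"

definition measurable_form ::
  "('a::topological_space, 'm::finite) chart set \<Rightarrow> ('a, 'r::finite) triv set \<Rightarrow> 'a set \<Rightarrow>
     ('a, 'm, 'r) form \<Rightarrow> bool" where
  "measurable_form atlas trivs A \<omega> \<longleftrightarrow>
     (\<forall>c\<in>atlas. \<forall>t\<in>trivs. \<forall>v. set_borel_measurable borel (snd c ` (fst c \<inter> fst t \<inter> A))
        (\<lambda>z. local_form atlas c t \<omega> z v))"

text \<open>The sum runs over all families of k basis vectors, so that each increasing
  multi-index contributes \<open>fact k\<close> equal terms.\<close>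

definition pointwise_inner ::
  "('a, 'm::finite) metric \<Rightarrow> ('a, 'r::finite) fibre_metric \<Rightarrow> nat \<Rightarrow>
     ('a, 'm, 'r) form \<Rightarrow> ('a, 'm, 'r) form \<Rightarrow> 'a \<Rightarrow> complex" where
  "pointwise_inner g \<rho> k \<omega> \<eta> x =
     (let e = orthonormal_basis (g x)
      in (\<Sum>I\<in>{..<k} \<rightarrow>\<^sub>E UNIV. \<rho> x (\<omega> x (\<lambda>i. e (I i))) (\<eta> x (\<lambda>i. e (I i)))) / fact k)"

definition cscale ::
  "complex \<Rightarrow> ('a, 'm::finite, 'r::finite) form \<Rightarrow> ('a, 'm, 'r) form" where
  "cscale a \<omega> = (\<lambda>x v. a *s \<omega> x v)"


section \<open>Hilbert spaces and operators\<close>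

text \<open>Elements of \<open>L^2\<close> spaces are represented by forms, and forms at distance zero represent
  the same element. Only values on \<open>A\<close> matter. Unbounded operators are represented by
  their graphs.\<close>

record 'f hilbert =
  carr :: "'f set"
  ip :: "'f \<Rightarrow> 'f \<Rightarrow> complex"

definition hnorm :: "'f hilbert \<Rightarrow> 'f \<Rightarrow> real" where
  "hnorm H u = sqrt (Re (ip H u u))"

definition L2 ::
  "('a::topological_space, 'm::finite) chart set \<Rightarrow> ('a, 'r::finite) triv set \<Rightarrow>
     ('a, 'r) fibre_metric \<Rightarrow> 'a set \<Rightarrow> nat \<Rightarrow> nat \<Rightarrow> ('a, 'm) metric \<Rightarrow>
     ('a, 'm, 'r) form hilbert" where
  "L2 atlas trivs \<rho> A p q g =
     \<lparr>carr = {\<omega>. measurable_form atlas trivs A \<omega> \<and> (\<forall>x\<in>A. \<omega> x \<in> pq_covectors p q) \<and>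
                 set_integrable (dvol atlas g) A (pointwise_inner g \<rho> (p + q) \<omega> \<omega>)},
      ip = (\<lambda>\<omega> \<eta>. set_lebesgue_integral (dvol atlas g) A (pointwise_inner g \<rho> (p + q) \<omega> \<eta>))\<rparr>"

definition op_kernel :: "'f hilbert \<Rightarrow> ('f \<times> 'f) set \<Rightarrow> 'f set" where
  "op_kernel H2 T = {u. \<exists>w. (u, w) \<in> T \<and> hnorm H2 w = 0}"

definition adjoint_op ::
  "'f hilbert \<Rightarrow> 'f hilbert \<Rightarrow> ('f \<times> 'f) set \<Rightarrow> ('f \<times> 'f) set" where
  "adjoint_op H1 H2 T =
     {(y, w). y \<in> carr H2 \<and> w \<in> carr H1 \<and> (\<forall>(u, v)\<in>T. ip H2 v y = ip H1 u w)}"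

definition bounded_op ::
  "('a, 'm::finite, 'r::finite) form hilbert \<Rightarrow> ('a, 'm, 'r) form hilbert \<Rightarrow>
     (('a, 'm, 'r) form \<Rightarrow> ('a, 'm, 'r) form) \<Rightarrow> bool" where
  "bounded_op H K B \<longleftrightarrow>
     (\<forall>u\<in>carr H. B u \<in> carr K) \<and>
     (\<forall>u\<in>carr H. \<forall>v\<in>carr H. hnorm K (B (u + v) - (B u + B v)) = 0) \<and>
     (\<forall>u\<in>carr H. \<forall>a. hnorm K (B (cscale a u) - cscale a (B u)) = 0) \<and>
     (\<exists>C. \<forall>u\<in>carr H. hnorm K (B u) \<le> C * hnorm H u)"

text \<open>For densely defined closed \<open>T\<close> with closed range, these conditions determine \<open>G\<close> up to
  the choice of representatives of its values.\<close>

definition is_green ::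
  "('a, 'm::finite, 'r::finite) form hilbert \<Rightarrow> ('a, 'm, 'r) form hilbert \<Rightarrow>
     (('a, 'm, 'r) form \<times> ('a, 'm, 'r) form) set \<Rightarrow>
     (('a, 'm, 'r) form \<Rightarrow> ('a, 'm, 'r) form) \<Rightarrow> bool" where
  "is_green H1 H2 T G \<longleftrightarrow>
     bounded_op H2 H1 G \<and>
     (\<forall>u\<in>op_kernel H1 (adjoint_op H1 H2 T). hnorm H1 (G u) = 0) \<and>
     (\<forall>u\<in>Range T. G u \<in> Range (adjoint_op H1 H2 T) \<and> (G u, u) \<in> T)"

definition green ::
  "('a, 'm::finite, 'r::finite) form hilbert \<Rightarrow> ('a, 'm, 'r) form hilbert \<Rightarrow>
     (('a, 'm, 'r) form \<times> ('a, 'm, 'r) form) set \<Rightarrow>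
     ('a, 'm, 'r) form \<Rightarrow> ('a, 'm, 'r) form" where
  "green H1 H2 T = (SOME G. is_green H1 H2 T G)"

definition compact_op ::
  "('a, 'm::finite, 'r::finite) form hilbert \<Rightarrow> ('a, 'm, 'r) form hilbert \<Rightarrow>
     (('a, 'm, 'r) form \<Rightarrow> ('a, 'm, 'r) form) \<Rightarrow> bool" where
  "compact_op H K B \<longleftrightarrow>
     bounded_op H K B \<and>
     (\<forall>u. (\<forall>n::nat. u n \<in> carr H) \<and> (\<exists>C. \<forall>n. hnorm H (u n) \<le> C) \<longrightarrow>
        (\<exists>r w. strict_mono r \<and> w \<in> carr K \<and> (\<lambda>n. hnorm K (B (u (r n)) - w)) \<longlonglongrightarrow> 0))"

definition finite_dim_quotient ::
  "('a, 'm::finite, 'r::finite) form set \<Rightarrow> ('a, 'm, 'r) form set \<Rightarrow> bool" where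
  "finite_dim_quotient V W \<longleftrightarrow>
     (\<exists>B. finite B \<and> B \<subseteq> V \<and> (\<forall>u\<in>V. \<exists>a. u - (\<Sum>b\<in>B. cscale (a b) b) \<in> W))"

definition weakly_converges :: "'f hilbert \<Rightarrow> (nat \<Rightarrow> 'f) \<Rightarrow> 'f \<Rightarrow> bool" where
  "weakly_converges H \<alpha> \<alpha>' \<longleftrightarrow>
     (\<forall>n. \<alpha> n \<in> carr H) \<and> \<alpha>' \<in> carr H \<and> (\<forall>\<eta>\<in>carr H. (\<lambda>n. ip H (\<alpha> n) \<eta>) \<longlonglongrightarrow> ip H \<alpha>' \<eta>)"

text \<open>Strong convergence along spaces \<open>Kn n\<close> into which \<open>K\<close> is included by the identity.
  A net in \<open>K\<close> is given by the proper filter of its tails; conversely, every proper filter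
  is the filter of tails of a net.\<close>

definition strongly_converges ::
  "('f::minus) hilbert \<Rightarrow> (nat \<Rightarrow> 'f hilbert) \<Rightarrow> (nat \<Rightarrow> 'f) \<Rightarrow> 'f \<Rightarrow> bool" where
  "strongly_converges K Kn u u' \<longleftrightarrow>
     (\<forall>n. u n \<in> carr (Kn n)) \<and> u' \<in> carr K \<and>
     (\<exists>F. F \<noteq> bot \<and> (\<forall>\<^sub>F v in F. v \<in> carr K) \<and>
        ((\<lambda>v. hnorm K (v - u')) \<longlongrightarrow> 0) F \<and>
        ((\<lambda>v. limsup (\<lambda>n. ereal (hnorm (Kn n) (v - u n)))) \<longlongrightarrow> 0) F)"

definition compactly_converges ::
  "('a, 'm::finite, 'r::finite) form hilbert \<Rightarrow> ('a, 'm, 'r) form hilbert \<Rightarrow>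
     (nat \<Rightarrow> ('a, 'm, 'r) form hilbert) \<Rightarrow> (nat \<Rightarrow> ('a, 'm, 'r) form \<Rightarrow> ('a, 'm, 'r) form) \<Rightarrow>
     (('a, 'm, 'r) form \<Rightarrow> ('a, 'm, 'r) form) \<Rightarrow> bool" where
  "compactly_converges H K Kn Bn B \<longleftrightarrow>
     (\<forall>n. bounded_op H (Kn n) (Bn n)) \<and> bounded_op H K B \<and>
     (\<forall>\<alpha> \<alpha>'. weakly_converges H \<alpha> \<alpha>' \<longrightarrow> strongly_converges K Kn (\<lambda>n. Bn n (\<alpha> n)) (B \<alpha>'))"


section \<open>The maximal extension of the Dolbeault operator\<close>

text \<open>The antilinear part of the differential of \<open>f\<close>.\<close>

definition dbar_fun :: "(complex^'m::finite \<Rightarrow> complex) \<Rightarrow> complex^'m \<Rightarrow> complex^'m \<Rightarrow> complex" where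
  "dbar_fun f z v =
     (frechet_derivative f (at z) v + \<i> * frechet_derivative f (at z) (\<i> *s v)) / 2"

definition test_function :: "(complex^'m::finite) set \<Rightarrow> (complex^'m \<Rightarrow> complex) \<Rightarrow> bool" where
  "test_function S f \<longleftrightarrow>
     smooth_on UNIV f \<and> compact (closure {z. f z \<noteq> 0}) \<and> closure {z. f z \<noteq> 0} \<subseteq> S"

text \<open>In a chart and a holomorphic frame, for a smooth k-form \<open>\<omega>\<close> and constant vector fields,
  \<open>(dbar \<omega>)(v 0, \<dots>, v k)\<close> is the sum over \<open>i \<le> k\<close> of \<open>(-1)^i\<close> times the antilinear
  derivative, in direction \<open>v i\<close>, of \<open>\<omega>(v 0, \<dots>, v k)\<close> with \<open>v i\<close> omitted. In the
  distributional version, the derivatives are moved to a test function.\<close>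

definition weak_dbar ::
  "('a, 'm::finite) chart set \<Rightarrow> ('a, 'r::finite) triv set \<Rightarrow> 'a set \<Rightarrow> nat \<Rightarrow>
     ('a, 'm, 'r) form \<Rightarrow> ('a, 'm, 'r) form \<Rightarrow> bool" where
  "weak_dbar atlas trivs A k \<omega> \<eta> \<longleftrightarrow>
     (\<forall>c\<in>atlas. \<forall>t\<in>trivs. \<forall>f v. test_function (snd c ` (fst c \<inter> fst t \<inter> A)) f \<longrightarrow>
        (\<integral>z. f z *s local_form atlas c t \<eta> z v \<partial>lborel) =
        - (\<Sum>i\<le>k. (-1) ^ i *s
             (\<integral>z. dbar_fun f z (v i) *s
                local_form atlas c t \<omega> z (\<lambda>j. if j < i then v j else v (Suc j)) \<partial>lborel)))"

definition dbar_max ::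
  "('a::topological_space, 'm::finite) chart set \<Rightarrow> ('a, 'r::finite) triv set \<Rightarrow>
     ('a, 'r) fibre_metric \<Rightarrow> 'a set \<Rightarrow> nat \<Rightarrow> nat \<Rightarrow> ('a, 'm) metric \<Rightarrow> ('a, 'm) metric \<Rightarrow>
     (('a, 'm, 'r) form \<times> ('a, 'm, 'r) form) set" where
  "dbar_max atlas trivs \<rho> A p q g g' =
     {(\<omega>, \<eta>). \<omega> \<in> carr (L2 atlas trivs \<rho> A p q g) \<and>
              \<eta> \<in> carr (L2 atlas trivs \<rho> A p (q + 1) g') \<and>
              weak_dbar atlas trivs A (p + q) \<omega> \<eta>}"

definition green_dbar ::
  "('a::topological_space, 'm::finite) chart set \<Rightarrow> ('a, 'r::finite) triv set \<Rightarrow>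
     ('a, 'r) fibre_metric \<Rightarrow> 'a set \<Rightarrow> nat \<Rightarrow> nat \<Rightarrow> ('a, 'm) metric \<Rightarrow> ('a, 'm) metric \<Rightarrow>
     ('a, 'm, 'r) form \<Rightarrow> ('a, 'm, 'r) form" where
  "green_dbar atlas trivs \<rho> A p q g g' =
     green (L2 atlas trivs \<rho> A p q g) (L2 atlas trivs \<rho> A p (q + 1) g')
       (dbar_max atlas trivs \<rho> A p q g g')"

text \<open>Finite dimensionality of the \<open>L^2\<close> cohomology in bidegree \<open>(p, q + 1)\<close>. In bidegree
  \<open>(m, m + 1)\<close> all forms vanish, so that no convention is needed for operators in degree \<open>m\<close>.\<close>

definition finite_dim_cohomology ::
  "('a::topological_space, 'm::finite) chart set \<Rightarrow> ('a, 'r::finite) triv set \<Rightarrow>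
     ('a, 'r) fibre_metric \<Rightarrow> 'a set \<Rightarrow> nat \<Rightarrow> nat \<Rightarrow> ('a, 'm) metric \<Rightarrow> bool" where
  "finite_dim_cohomology atlas trivs \<rho> A p q g \<longleftrightarrow>
     finite_dim_quotient
       (op_kernel (L2 atlas trivs \<rho> A p (q + 2) g) (dbar_max atlas trivs \<rho> A p (q + 1) g g))
       (Range (dbar_max atlas trivs \<rho> A p q g g))"

end

theory Submission
  imports Defs
begin

text \<open>
  The weak equation \<open>dbar \<omega> = \<eta>\<close> is a family of scalar equations \<open>a i \<omega> = b i \<eta>\<close>
  between bounded functionals, each of which only sees a compact part of \<open>A\<close>. On
  \<open>(m, q)\<close>-forms, the integrand \<open>|\<omega>|\<^sup>2 dvol\<close> is antitone in the metric up to the power \<open>q\<close>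
  of a scaling constant, by simultaneous diagonalization; so \<open>g_0 \<le> a g_s \<le> a C g_1\<close> gives
  \<open>L\<^sup>2(h) \<subseteq> L\<^sup>2(g_s) \<subseteq> L\<^sup>2(g_1)\<close>, and all the operators have the same range. It is closed,
  having finite codimension in a closed subspace.

  If \<open>\<alpha>\<close> lies in that range and \<open>y = G \<alpha>\<close> is the solution of minimal norm for \<open>h\<close>, then
  \<open>y - G_s \<alpha>\<close> is the projection of \<open>y\<close> to the kernel of the operator for \<open>g_s\<close>. As \<open>y\<close> is a limit
  of vectors representing combinations of the functionals \<open>a i\<close>, and \<open>g_s\<close> converges to \<open>h\<close>
  uniformly on compact subsets of \<open>A\<close>, cutting off shows that \<open>y\<close> becomes orthogonal to these
  kernels, so that the projections tend to \<open>0\<close>. The compactness of \<open>G\<close> makes this uniform along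
  weakly convergent sequences.
\<close>

section \<open>Semi-inner product spaces\<close>

text \<open>The obstacle is that the solutions for different metrics live in different Hilbert
  spaces, and that truncating a form destroys membership in the domain of dbar. Duality avoids both
  problems: not solutions are compared, but the vectors representing one and the same functional
  \<open>a i\<close> in the spaces for \<open>h\<close> and for \<open>g s\<close>. Such a
  functional integrates a form against derivatives of one test function, so multiplication by the
  indicator of the support leaves it unchanged and no smooth cut-off is needed. As the metrics are
  close on this compact set, the squared norms of both representing vectors are controlled, while
  their inner product is known exactly; hence their distance tends to 0.

  The power q comes from the volume form: it contributes one factor for each complex eigenvalue of
  the metric, and these cancel m of the m + q inverse factors of a nonvanishing component. This is
  what makes bidegree (m, q) special.

  Since forms are functions and not classes, the Hilbert space theory is carried out for seminorms
  on carrier sets, with equality replaced by distance 0.\<close>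

lemma real_le_zero_if_quadratic:
  fixes a b :: real
  assumes "b \<ge> 0" and "\<And>t. 2 * t * a \<le> t\<^sup>2 * b"
  shows "a = 0"
proof (rule ccontr)
  assume "a \<noteq> 0"
  \<comment> \<open>For small t of the sign of \<open>a\<close> the linear term would dominate; b +
    1 in place of b keeps the denominator positive when b = 0.\<close>
  let ?t = "a / (b + 1)"
  have pos: "b + 1 > 0" using assms(1) by simp
  have "2 * ?t * a \<le> ?t\<^sup>2 * b" by (rule assms(2))
  also have "\<dots> \<le> ?t\<^sup>2 * (b + 1)" by (intro mult_left_mono) auto
  also have "\<dots> = ?t * a" using pos by (simp add: power2_eq_square)
  finally have "?t * a \<le> 0" by linarith
  moreover have "0 < a * a / (b + 1)" 
    by (rule divide_pos_pos[OF _ pos]) (metis not_real_square_gt_zero \<open>a \<noteq> 0\<close>)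
  ultimately show False by simp
qed

text \<open>Positivity is only semidefinite and the axioms are relative to a carrier:
  square-integrable forms for different metrics share one type, and forms that agree almost
  everywhere are distinct elements at distance 0.\<close>

locale semi_inner = vector_space sc
  for sc :: "complex \<Rightarrow> 'f::ab_group_add \<Rightarrow> 'f" +
  fixes H :: "'f hilbert"
  assumes zero_carr: "0 \<in> carr H"
    and add_carr: "\<And>u v. u \<in> carr H \<Longrightarrow> v \<in> carr H \<Longrightarrow> u + v \<in> carr H"
    and scale_carr: "\<And>a u. u \<in> carr H \<Longrightarrow> sc a u \<in> carr H"
    and ip_add: "\<And>u v w. u \<in> carr H \<Longrightarrow> v \<in> carr H \<Longrightarrow> w \<in> carr H \<Longrightarrow>
      ip H (u + v) w = ip H u w + ip H v w"
    and ip_scale: "\<And>a u w. u \<in> carr H \<Longrightarrow> w \<in> carr H \<Longrightarrow> ip H (sc a u) w = a * ip H u w"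
    and ip_cnj: "\<And>u v. u \<in> carr H \<Longrightarrow> v \<in> carr H \<Longrightarrow> ip H v u = cnj (ip H u v)"
    and ip_nonneg: "\<And>u. u \<in> carr H \<Longrightarrow> 0 \<le> Re (ip H u u)"
begin

abbreviation nrm where "nrm \<equiv> hnorm H"

lemma minus_eq_scale: "- u = sc (- 1) u"
  by (metis scale_minus_left scale_one)

lemma minus_carr: "u \<in> carr H \<Longrightarrow> - u \<in> carr H"
  using scale_carr[of u "- 1"] by simp

lemma diff_carr: "u \<in> carr H \<Longrightarrow> v \<in> carr H \<Longrightarrow> u - v \<in> carr H"
  using add_carr[of u "- v"] minus_carr by simp

lemma ip_minus: "u \<in> carr H \<Longrightarrow> w \<in> carr H \<Longrightarrow> ip H (- u) w = - ip H u w"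
  using ip_scale[of u w "- 1"] by simp

lemma ip_diff: "u \<in> carr H \<Longrightarrow> v \<in> carr H \<Longrightarrow> w \<in> carr H \<Longrightarrow> ip H (u - v) w = ip H u w - ip H v w"
  using ip_add[of u "- v" w] by (simp add: minus_carr ip_minus)

lemma ip_add_right: "u \<in> carr H \<Longrightarrow> v \<in> carr H \<Longrightarrow> w \<in> carr H \<Longrightarrow> ip H w (u + v) = ip H w u + ip H w v"
  using ip_cnj[of "u + v" w] ip_cnj[of u w] ip_cnj[of v w] by (simp add: add_carr ip_add)

lemma ip_scale_right: "u \<in> carr H \<Longrightarrow> w \<in> carr H \<Longrightarrow> ip H w (sc a u) = cnj a * ip H w u"
  using ip_cnj[of "sc a u" w] ip_cnj[of u w] by (simp add: scale_carr ip_scale)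

lemma ip_minus_right: "u \<in> carr H \<Longrightarrow> w \<in> carr H \<Longrightarrow> ip H w (- u) = - ip H w u"
  using ip_scale_right[of u w "- 1"] by simp

lemma ip_diff_right: "u \<in> carr H \<Longrightarrow> v \<in> carr H \<Longrightarrow> w \<in> carr H \<Longrightarrow> ip H w (u - v) = ip H w u - ip H w v"
  using ip_add_right[of u "- v" w] by (simp add: minus_carr ip_minus_right)

lemma ip_zero [simp]: "w \<in> carr H \<Longrightarrow> ip H 0 w = 0"
  using ip_scale[of w w 0] by simp

lemma ip_zero_right [simp]: "w \<in> carr H \<Longrightarrow> ip H w 0 = 0"
  using ip_scale_right[of w w 0] by simp

lemma nrm_nonneg: "u \<in> carr H \<Longrightarrow> 0 \<le> nrm u"
  by (simp add: hnorm_def ip_nonneg)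

lemma nrm_sq: "u \<in> carr H \<Longrightarrow> (nrm u)\<^sup>2 = Re (ip H u u)"
  by (simp add: hnorm_def ip_nonneg)

lemma ip_self: "u \<in> carr H \<Longrightarrow> ip H u u = of_real ((nrm u)\<^sup>2)"
  using ip_cnj[of u u] by (simp add: nrm_sq complex_eq_iff)

lemma nrm_zero [simp]: "nrm 0 = 0"
  using zero_carr by (simp add: hnorm_def)

lemma nrm_scale: "u \<in> carr H \<Longrightarrow> nrm (sc a u) = cmod a * nrm u"
proof -
  assume u: "u \<in> carr H"
  have "ip H (sc a u) (sc a u) = a * cnj a * ip H u u"
    using u by (simp add: ip_scale ip_scale_right scale_carr)
  also have "\<dots> = of_real ((cmod a)\<^sup>2 * (nrm u)\<^sup>2)"
    using u by (simp add: ip_self flip: complex_norm_square)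
  finally have "(nrm (sc a u))\<^sup>2 = (cmod a * nrm u)\<^sup>2"
    using u by (simp add: nrm_sq scale_carr power_mult_distrib)
  then show ?thesis
    using u by (simp add: nrm_nonneg scale_carr)
qed

lemma nrm_minus: "u \<in> carr H \<Longrightarrow> nrm (- u) = nrm u"
  using nrm_scale[of u "- 1"] by simp

lemma nrm_diff_sym: "u \<in> carr H \<Longrightarrow> v \<in> carr H \<Longrightarrow> nrm (u - v) = nrm (v - u)"
  using nrm_minus[of "u - v"] by (simp add: diff_carr)

lemma nrm_add_sq: "u \<in> carr H \<Longrightarrow> v \<in> carr H \<Longrightarrow>
    (nrm (u + v))\<^sup>2 = (nrm u)\<^sup>2 + 2 * Re (ip H u v) + (nrm v)\<^sup>2"
  using ip_cnj[of u v] by (simp add: nrm_sq add_carr ip_add ip_add_right)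

lemma nrm_diff_sq: "u \<in> carr H \<Longrightarrow> v \<in> carr H \<Longrightarrow>
    (nrm (u - v))\<^sup>2 = (nrm u)\<^sup>2 - 2 * Re (ip H u v) + (nrm v)\<^sup>2"
  using ip_cnj[of u v] by (simp add: nrm_sq diff_carr ip_diff ip_diff_right)

lemma Re_ip_le: assumes u: "u \<in> carr H" and v: "v \<in> carr H" shows "Re (ip H u v) \<le> nrm u * nrm v"
proof (cases "nrm v = 0")
  \<comment> \<open>Without definiteness a null vector v needs its own argument: 0 <= |u - s v|^2 =
    |u|^2 - 2 s Re <u, v> for all real s, so a linear function of s is bounded above and must
    vanish.\<close>
  case True
  have "Re (ip H u v) = 0"
  proof (rule real_le_zero_if_quadratic[of "0::real"])
  next
    show "2 * t * Re (ip H u v) \<le> t\<^sup>2 * 0" for t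
    proof (rule field_le_epsilon)
      fix e :: real assume "e > 0"
      \<comment> \<open>Scaling t up by this factor scales the bound |u|^2 + 1 down to e.\<close>
      define s where "s = t * ((nrm u)\<^sup>2 + 1) / e"
      show "2 * t * Re (ip H u v) \<le> t\<^sup>2 * 0 + e"
      proof (cases "t = 0")
        case True then show ?thesis using \<open>e > 0\<close> by simp
      next
        case False
        have n: "(nrm u)\<^sup>2 + 1 > 0" by (simp add: add_nonneg_pos)
        have "0 \<le> (nrm (u - sc (of_real s) v))\<^sup>2" by simp
        also have "\<dots> = (nrm u)\<^sup>2 - 2 * s * Re (ip H u v)"
          using u v True by (simp add: nrm_diff_sq scale_carr ip_scale_right nrm_scale)
        finally have "2 * s * Re (ip H u v) \<le> (nrm u)\<^sup>2 + 1" by simp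
        moreover have "2 * s * Re (ip H u v) = 2 * t * Re (ip H u v) * (((nrm u)\<^sup>2 + 1) / e)"
          by (simp add: s_def)
        moreover have "(nrm u)\<^sup>2 + 1 = e * (((nrm u)\<^sup>2 + 1) / e)" using \<open>e > 0\<close> by simp
        ultimately have "2 * t * Re (ip H u v) * (((nrm u)\<^sup>2 + 1) / e) \<le> e * (((nrm u)\<^sup>2 + 1) / e)"
          by metis
        then have "2 * t * Re (ip H u v) \<le> e"
          by (rule mult_right_le_imp_le) (use n \<open>e > 0\<close> in auto)
        then show ?thesis by simp
      qed
    qed
  qed simp
  then show ?thesis using True by simp
next
  case False
  then have pos: "nrm v > 0" using nrm_nonneg[OF v] by simp
  let ?s = "Re (ip H u v) / (nrm v)\<^sup>2"
  have "0 \<le> (nrm (u - sc (of_real ?s) v))\<^sup>2" by simp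
  also have "\<dots> = (nrm u)\<^sup>2 - 2 * ?s * Re (ip H u v) + (\<bar>?s\<bar> * nrm v)\<^sup>2"
    using u v by (simp only: nrm_diff_sq scale_carr ip_scale_right nrm_scale norm_of_real complex_cnj_complex_of_real) simp
  also have "\<dots> = (nrm u)\<^sup>2 - (Re (ip H u v))\<^sup>2 / (nrm v)\<^sup>2"
    using pos by (simp add: power_mult_distrib power2_eq_square field_simps)
  finally have "(Re (ip H u v))\<^sup>2 \<le> (nrm u * nrm v)\<^sup>2"
    using pos by (simp add: field_simps power_mult_distrib)
  then show ?thesis
    using nrm_nonneg[OF u] nrm_nonneg[OF v] by (meson abs_le_square_iff abs_le_D1 mult_nonneg_nonneg power2_le_imp_le)
qed

lemma ip_le: assumes u: "u \<in> carr H" and v: "v \<in> carr H" shows "cmod (ip H u v) \<le> nrm u * nrm v"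
proof (cases "ip H u v = 0")
  case True then show ?thesis using assms by (simp add: nrm_nonneg)
next
  case False
  let ?a = "cnj (ip H u v) / cmod (ip H u v)"
  have "ip H u v * cnj (ip H u v) = of_real (cmod (ip H u v)) * of_real (cmod (ip H u v))"
    using complex_norm_square[of "ip H u v"] by (simp add: power2_eq_square)
  then have "ip H (sc ?a u) v = of_real (cmod (ip H u v))"
    using u v False by (simp add: ip_scale mult.commute[of "cnj _"])
  moreover have "Re (ip H (sc ?a u) v) \<le> nrm (sc ?a u) * nrm v"
    by (intro Re_ip_le scale_carr u v)
  moreover have "nrm (sc ?a u) = nrm u" using u False by (simp add: nrm_scale norm_divide)
  ultimately show ?thesis by simp
qed

lemma nrm_triangle: assumes "u \<in> carr H" "v \<in> carr H" shows "nrm (u + v) \<le> nrm u + nrm v"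
proof (rule power2_le_imp_le)
  show "(nrm (u + v))\<^sup>2 \<le> (nrm u + nrm v)\<^sup>2"
    using Re_ip_le[OF assms] by (simp add: nrm_add_sq assms power2_sum)
qed (use assms nrm_nonneg in auto)

lemma nrm_triangle_diff: assumes "u \<in> carr H" "v \<in> carr H" "w \<in> carr H"
  shows "nrm (u - w) \<le> nrm (u - v) + nrm (v - w)"
  using nrm_triangle[of "u - v" "v - w"] assms by (simp add: diff_carr)

lemma nrm_le_add_diff: assumes "u \<in> carr H" "v \<in> carr H"
  shows "nrm u \<le> nrm v + nrm (u - v)"
  using nrm_triangle[of v "u - v"] assms by (simp add: diff_carr)

lemma parallelogram: "u \<in> carr H \<Longrightarrow> v \<in> carr H \<Longrightarrow>
    (nrm (u + v))\<^sup>2 + (nrm (u - v))\<^sup>2 = 2 * (nrm u)\<^sup>2 + 2 * (nrm v)\<^sup>2"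
  by (simp add: nrm_add_sq nrm_diff_sq)

end

locale semi_hilbert = semi_inner sc H for sc :: "complex \<Rightarrow> 'f::ab_group_add \<Rightarrow> 'f" and H +
  assumes complete: "\<And>X. (\<And>n::nat. X n \<in> carr H) \<Longrightarrow>
      (\<And>e. e > 0 \<Longrightarrow> \<exists>N. \<forall>m\<ge>N. \<forall>n\<ge>N. hnorm H (X m - X n) < e) \<Longrightarrow>
      \<exists>l\<in>carr H. (\<lambda>n. hnorm H (X n - l)) \<longlonglongrightarrow> 0"
begin

definition csub :: "'f set \<Rightarrow> bool" where
  "csub V \<longleftrightarrow> V \<subseteq> carr H \<and> 0 \<in> V \<and> (\<forall>u\<in>V. \<forall>v\<in>V. u + v \<in> V) \<and> (\<forall>a. \<forall>u\<in>V. sc a u \<in> V)"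

text \<open>Constant sequences show that such a set contains, with each element, every element of
  the carrier at distance 0 from it.\<close>

definition closedH :: "'f set \<Rightarrow> bool" where
  "closedH V \<longleftrightarrow> (\<forall>X l. (\<forall>n::nat. X n \<in> V) \<longrightarrow> l \<in> carr H \<longrightarrow> (\<lambda>n. nrm (X n - l)) \<longlonglongrightarrow> 0 \<longrightarrow> l \<in> V)"

lemma csub_diff: "csub V \<Longrightarrow> u \<in> V \<Longrightarrow> v \<in> V \<Longrightarrow> u - v \<in> V"
  unfolding csub_def using minus_eq_scale by (metis diff_conv_add_uminus)

text \<open>Riesz representation and uniform boundedness are later applied inside the closed range
  of an operator, which this makes a space of its own.\<close>

lemma subspace_semi_hilbert:
  assumes V: "csub V" and cl: "closedH V"
  shows "semi_hilbert sc (H\<lparr>carr := V\<rparr>)"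
proof -
  have sub: "\<And>u. u \<in> V \<Longrightarrow> u \<in> carr H" using V by (auto simp: csub_def)
  have hn: "hnorm (H\<lparr>carr := V\<rparr>) = nrm" by (simp add: hnorm_def fun_eq_iff)
  show ?thesis
  proof (unfold_locales, goal_cases)
    case (8 X)
    then have XV: "\<And>n. X n \<in> V" by simp
    have "\<exists>l\<in>carr H. (\<lambda>n. nrm (X n - l)) \<longlonglongrightarrow> 0"
      using 8 by (intro complete) (auto simp: hn intro: sub)
    then obtain l where l: "l \<in> carr H" "(\<lambda>n. nrm (X n - l)) \<longlonglongrightarrow> 0" by blast
    then have "l \<in> V" using cl XV unfolding closedH_def by blast
    then show ?case using l by (auto simp: hn)
  qed (use V in \<open>auto simp: csub_def ip_scale sub intro!: ip_add ip_cnj ip_nonneg dest!: sub\<close>)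
qed

lemma tendsto_ip_left:
  assumes "\<And>n::nat. X n \<in> carr H" "l \<in> carr H" "w \<in> carr H" "(\<lambda>n. nrm (X n - l)) \<longlonglongrightarrow> 0"
  shows "(\<lambda>n. ip H (X n) w) \<longlonglongrightarrow> ip H l w"
proof -
  have "(\<lambda>n. ip H (X n) w - ip H l w) \<longlonglongrightarrow> 0"
  proof (rule Lim_null_comparison)
    show "\<forall>\<^sub>F n in sequentially. norm (ip H (X n) w - ip H l w) \<le> nrm (X n - l) * nrm w"
      using ip_le[OF diff_carr[OF assms(1,2)] assms(3)] assms by (auto simp: ip_diff)
    show "(\<lambda>n. nrm (X n - l) * nrm w) \<longlonglongrightarrow> 0"
      using tendsto_mult_right[OF assms(4), of "nrm w"] by simp
  qed
  then show ?thesis by (simp add: LIM_zero_iff)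
qed

lemma closedH_perp: assumes Y: "Y \<subseteq> carr H" shows "closedH {u \<in> carr H. \<forall>y\<in>Y. ip H u y = 0}"
  unfolding closedH_def
proof (intro allI impI CollectI conjI ballI)
  fix X l y
  assume *: "\<forall>n. X n \<in> {u \<in> carr H. \<forall>y\<in>Y. ip H u y = 0}" "l \<in> carr H"
    "(\<lambda>n. nrm (X n - l)) \<longlonglongrightarrow> 0" "y \<in> Y"
  then have "(\<lambda>n. ip H (X n) y) \<longlonglongrightarrow> ip H l y" using Y by (intro tendsto_ip_left) auto
  moreover have "(\<lambda>n. ip H (X n) y) = (\<lambda>n. 0)" using * by auto
  ultimately show "ip H l y = 0" by (metis LIMSEQ_const_iff)
qed auto

lemma csub_perp: assumes Y: "Y \<subseteq> carr H" shows "csub {u \<in> carr H. \<forall>y\<in>Y. ip H u y = 0}"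
  using Y by (auto simp: csub_def zero_carr add_carr scale_carr subset_iff ip_add ip_scale)

text \<open>By the parallelogram law: the midpoint of X m and X n lies in V, so its distance to u is
  at least d, which leaves little room for the difference.\<close>

lemma minimizing_Cauchy:
  assumes V: "csub V" and X: "\<And>n::nat. X n \<in> V" and u: "u \<in> carr H" and d: "d \<ge> 0"
    and low: "\<And>v. v \<in> V \<Longrightarrow> d \<le> nrm (u - v)" and lim: "\<And>n. (nrm (u - X n))\<^sup>2 < d\<^sup>2 + 1 / Suc n"
  shows "(nrm (X m - X n))\<^sup>2 \<le> 2 / Suc m + 2 / Suc n"
proof -
  have sub: "\<And>u. u \<in> V \<Longrightarrow> u \<in> carr H" using V by (auto simp: csub_def)
  let ?a = "u - X m" and ?b = "u - X n"
  have c: "?a \<in> carr H" "?b \<in> carr H" using X sub u by (auto intro: diff_carr)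
  have mid: "sc (1/2) (X m + X n) \<in> V" using V X by (auto simp: csub_def)
  have "?a + ?b = sc 2 (u - sc (1/2) (X m + X n))"
  proof -
    have "sc 2 u = u + u" by (metis one_add_one scale_left_distrib scale_one)
    then show ?thesis by (simp add: scale_right_diff_distrib)
  qed
  then have "nrm (?a + ?b) = 2 * nrm (u - sc (1/2) (X m + X n))"
    using nrm_scale[OF diff_carr[OF u sub[OF mid]], of 2] by simp
  then have "2 * d \<le> nrm (?a + ?b)" using low[OF mid] by simp
  then have "(2 * d)\<^sup>2 \<le> (nrm (?a + ?b))\<^sup>2" using d by (intro power_mono) auto
  then have "(nrm (?a - ?b))\<^sup>2 \<le> 2 / Suc m + 2 / Suc n"
    using parallelogram[OF c] lim[of m] lim[of n] by (simp add: power_mult_distrib)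
  moreover have "nrm (?a - ?b) = nrm (X m - X n)"
    using nrm_diff_sym[OF sub[OF X] sub[OF X], of m n] by simp
  ultimately show ?thesis by simp
qed

lemma projection:
  assumes V: "csub V" and cl: "closedH V" and u: "u \<in> carr H"
  shows "\<exists>p\<in>V. \<forall>v\<in>V. ip H (u - p) v = 0"
proof -
  have sub: "\<And>u. u \<in> V \<Longrightarrow> u \<in> carr H" using V by (auto simp: csub_def)
  define d where "d = (INF v\<in>V. nrm (u - v))"
  have ne: "V \<noteq> {}" using V by (auto simp: csub_def)
  have bdd: "bdd_below ((\<lambda>v. nrm (u - v)) ` V)"
    by (rule bdd_belowI2[of _ 0]) (auto intro!: nrm_nonneg diff_carr[OF u sub])
  have low: "\<And>v. v \<in> V \<Longrightarrow> d \<le> nrm (u - v)" unfolding d_def by (rule cINF_lower[OF bdd])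
  have d0: "d \<ge> 0" unfolding d_def
    by (rule cINF_greatest[OF ne]) (auto intro!: nrm_nonneg diff_carr[OF u sub])
  have "\<exists>v\<in>V. (nrm (u - v))\<^sup>2 < d\<^sup>2 + 1 / Suc n" for n
  proof -
    have "d < sqrt (d\<^sup>2 + 1 / Suc n)" using d0 by (intro real_less_rsqrt) simp
    then obtain v where v: "v \<in> V" "nrm (u - v) < sqrt (d\<^sup>2 + 1 / Suc n)"
      using cINF_less_iff[OF ne bdd] by (auto simp: d_def)
    have "(nrm (u - v))\<^sup>2 < (sqrt (d\<^sup>2 + 1 / Suc n))\<^sup>2"
      using v sub u by (intro power_strict_mono) (auto intro!: nrm_nonneg diff_carr)
    then show ?thesis using v by auto
  qed
  then obtain X where X: "\<And>n. X n \<in> V" "\<And>n. (nrm (u - X n))\<^sup>2 < d\<^sup>2 + 1 / Suc n" by metis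
  have C: "(nrm (X m - X n))\<^sup>2 \<le> 2 / Suc m + 2 / Suc n" for m n
    by (rule minimizing_Cauchy[OF V X(1) u d0 low X(2)])
  have "\<exists>l\<in>carr H. (\<lambda>n. nrm (X n - l)) \<longlonglongrightarrow> 0"
  proof (rule complete)
    fix e :: real assume e: "e > 0"
    obtain N :: nat where N: "4 / e\<^sup>2 < N" using reals_Archimedean2 by blast
    show "\<exists>N. \<forall>m\<ge>N. \<forall>n\<ge>N. nrm (X m - X n) < e"
    proof (intro exI allI impI)
      fix m n assume mn: "N \<le> m" "N \<le> n"
      have "0 \<le> 4 / e\<^sup>2" by simp
      then have N0: "real N > 0" using N by linarith
      have "(nrm (X m - X n))\<^sup>2 \<le> 2 / Suc m + 2 / Suc n" by (rule C)
      also have "\<dots> \<le> 2 / N + 2 / N" using mn N0 by (intro add_mono divide_left_mono) auto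
      also have "\<dots> < e\<^sup>2" using N N0 e by (simp add: field_simps)
      finally show "nrm (X m - X n) < e" using e by (simp add: power2_less_imp_less)
    qed
  qed (use X sub in auto)
  then obtain l where l: "l \<in> carr H" "(\<lambda>n. nrm (X n - l)) \<longlonglongrightarrow> 0" by blast
  have lV: "l \<in> V" using cl X(1) l unfolding closedH_def by blast
  have nd: "nrm (u - l) \<le> d"
  proof (rule LIMSEQ_le_const[of "\<lambda>n. sqrt (d\<^sup>2 + 1 / Suc n) + nrm (X n - l)"])
    have "(\<lambda>n. sqrt (d\<^sup>2 + 1 / Suc n) + nrm (X n - l)) \<longlonglongrightarrow> sqrt (d\<^sup>2 + 0) + 0"
      by (intro tendsto_intros l) (rule LIMSEQ_Suc[OF lim_1_over_n])
    then show "(\<lambda>n. sqrt (d\<^sup>2 + 1 / Suc n) + nrm (X n - l)) \<longlonglongrightarrow> d" using d0 by simp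
    have "nrm (u - l) \<le> sqrt (d\<^sup>2 + 1 / Suc n) + nrm (X n - l)" for n
    proof -
      have "nrm (u - X n) \<le> sqrt (d\<^sup>2 + 1 / Suc n)" using X(2)[of n] by (intro real_le_rsqrt) simp
      then show ?thesis using nrm_triangle_diff[OF u sub[OF X(1)] l(1), of n] by linarith
    qed
    then show "\<exists>N. \<forall>n\<ge>N. nrm (u - l) \<le> sqrt (d\<^sup>2 + 1 / Suc n) + nrm (X n - l)" by blast
  qed
  have c: "u - l \<in> carr H" using u l by (intro diff_carr)
  \<comment> \<open>The point l minimizes the distance to u along every real line through l in V, so
    the first-order term of the squared distance vanishes.\<close>
  have Re0: "Re (ip H (u - l) v) = 0" if v: "v \<in> V" for v
  proof (rule real_le_zero_if_quadratic[of "(nrm v)\<^sup>2"])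
    fix t :: real
    have tv: "sc (of_real t) v \<in> V" "sc (of_real t) v \<in> carr H" using V v sub by (auto simp: csub_def)
    have "l + sc (of_real t) v \<in> V" using V lV tv by (auto simp: csub_def)
    then have "nrm (u - l) \<le> nrm (u - l - sc (of_real t) v)" using low[of "l + sc (of_real t) v"] nd by (simp add: diff_diff_eq)
    then have "(nrm (u - l))\<^sup>2 \<le> (nrm (u - l - sc (of_real t) v))\<^sup>2"
      using nrm_nonneg[OF c] by (intro power_mono)
    also have "\<dots> = (nrm (u - l))\<^sup>2 - 2 * t * Re (ip H (u - l) v) + t\<^sup>2 * (nrm v)\<^sup>2"
      using c tv v sub by (simp only: nrm_diff_sq ip_scale_right nrm_scale)
        (simp add: power_mult_distrib)
    finally show "2 * t * Re (ip H (u - l) v) \<le> t\<^sup>2 * (nrm v)\<^sup>2" by simp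
  qed simp
  have "ip H (u - l) v = 0" if v: "v \<in> V" for v
  proof -
    \<comment> \<open>Multiplying the test vector by \<i> turns the imaginary part into a real
      one.\<close>
    have "sc \<i> v \<in> V" using V v by (auto simp: csub_def)
    from Re0[OF this] have "Im (ip H (u - l) v) = 0" using c v sub by (simp add: ip_scale_right)
    then show ?thesis using Re0[OF v] by (simp add: complex_eq_iff)
  qed
  then show ?thesis using lV by blast
qed

text \<open>Project u to the closure V of Y: the remainder is orthogonal to Y, hence by
  \<open>perp\<close> to u, and it is also orthogonal to the projection, so its norm is 0. The
  assumption concerns the single vector u, and no double orthogonal complement is formed.\<close>

lemma dense_of_perp:
  assumes Y: "csub Y" and u: "u \<in> carr H"
    and perp: "\<And>w. w \<in> carr H \<Longrightarrow> (\<And>y. y \<in> Y \<Longrightarrow> ip H w y = 0) \<Longrightarrow> ip H w u = 0"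
    and e: "e > 0"
  shows "\<exists>y\<in>Y. nrm (u - y) < e"
proof -
  define V where "V = {v\<in>carr H. \<forall>e>0. \<exists>y\<in>Y. nrm (v - y) < e}"
  have Yc: "\<And>y. y \<in> Y \<Longrightarrow> y \<in> carr H" using Y by (auto simp: csub_def)
  have YV: "Y \<subseteq> V" using Yc by (auto simp: V_def intro!: bexI)
  have "csub V"
    unfolding csub_def
  proof (intro conjI ballI allI)
    show "0 \<in> V" using YV Y by (auto simp: csub_def)
  next
    fix v w assume v: "v \<in> V" and w: "w \<in> V"
    show "v + w \<in> V" unfolding V_def
    proof (intro CollectI conjI allI impI)
      show "v + w \<in> carr H" using v w by (auto simp: V_def add_carr)
      fix e :: real assume "e > 0"
      then obtain a b where ab: "a \<in> Y" "nrm (v - a) < e/2" "b \<in> Y" "nrm (w - b) < e/2"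
        using v w half_gt_zero[of e] unfolding V_def by blast
      have "nrm (v + w - (a + b)) \<le> nrm (v - a) + nrm (w - b)"
        using nrm_triangle[of "v - a" "w - b"] v w ab Yc by (simp add: V_def diff_carr algebra_simps)
      then show "\<exists>y\<in>Y. nrm (v + w - y) < e" using ab Y by (intro bexI[of _ "a + b"]) (auto simp: csub_def)
    qed
  next
    fix a v assume v: "v \<in> V"
    show "sc a v \<in> V" unfolding V_def
    proof (intro CollectI conjI allI impI)
      show "sc a v \<in> carr H" using v by (auto simp: V_def scale_carr)
      fix e :: real assume e: "e > 0"
      then have "e / (cmod a + 1) > 0" by (simp add: add_nonneg_pos)
      then obtain y where y: "y \<in> Y" "nrm (v - y) < e / (cmod a + 1)" using v unfolding V_def by blast
      have "nrm (sc a v - sc a y) = cmod a * nrm (v - y)"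
        using nrm_scale[of "v - y" a] v y Yc by (simp add: V_def diff_carr scale_right_diff_distrib)
      also have "\<dots> \<le> (cmod a + 1) * nrm (v - y)"
        using v y Yc by (intro mult_right_mono) (auto simp: V_def intro!: nrm_nonneg diff_carr)
      also have "\<dots> < e" using y(2) by (subst mult.commute) (simp add: pos_less_divide_eq add_nonneg_pos)
      finally show "\<exists>y\<in>Y. nrm (sc a v - y) < e" using y Y by (auto simp: csub_def)
    qed
  qed (auto simp: V_def)
  moreover have "closedH V"
    unfolding closedH_def
  proof (intro allI impI)
    fix X l assume X: "\<forall>n. X n \<in> V" and l: "l \<in> carr H" and lim: "(\<lambda>n. nrm (X n - l)) \<longlonglongrightarrow> 0"
    have "\<exists>y\<in>Y. nrm (l - y) < e" if e: "e > 0" for e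
    proof -
      have "\<forall>\<^sub>F n in sequentially. nrm (X n - l) < e / 2" using order_tendstoD(2)[OF lim, of "e/2"] e by simp
      then obtain n where n: "nrm (X n - l) < e / 2" by (meson eventually_sequentially order_refl)
      obtain y where y: "y \<in> Y" "nrm (X n - y) < e / 2"
        using X half_gt_zero[OF e] unfolding V_def by blast
      have "X n \<in> carr H" using X by (auto simp: V_def)
      then have "nrm (l - y) \<le> nrm (X n - l) + nrm (X n - y)"
        using nrm_triangle_diff[of l "X n" y] l y Yc nrm_diff_sym by metis
      then show ?thesis using n y by (intro bexI[of _ y]) auto
    qed
    then show "l \<in> V" using l by (auto simp: V_def)
  qed
  ultimately obtain p where p: "p \<in> V" "\<forall>v\<in>V. ip H (u - p) v = 0" using projection u by blast
  have pc: "p \<in> carr H" using p by (auto simp: V_def)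
  have "ip H (u - p) u = 0" using p YV u pc by (intro perp diff_carr) auto
  moreover have "ip H (u - p) p = 0" using p by auto
  ultimately have "nrm (u - p) = 0"
    using u pc nrm_sq[OF diff_carr[OF u pc]] by (simp add: ip_diff_right diff_carr)
  moreover obtain y where y: "y \<in> Y" "nrm (p - y) < e" using p e unfolding V_def by blast
  ultimately show ?thesis using nrm_triangle_diff[OF u pc Yc[OF y(1)]] by (intro bexI[of _ y]) auto
qed

lemma riesz:
  assumes add: "\<And>u v. u \<in> carr H \<Longrightarrow> v \<in> carr H \<Longrightarrow> F (u + v) = F u + F v"
    and scl: "\<And>a u. u \<in> carr H \<Longrightarrow> F (sc a u) = a * F u"
    and bd: "\<And>u. u \<in> carr H \<Longrightarrow> cmod (F u) \<le> C * nrm u"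
  shows "\<exists>y\<in>carr H. \<forall>u\<in>carr H. F u = ip H u y"
proof (cases "\<forall>u\<in>carr H. F u = 0")
  case True then show ?thesis using zero_carr by (intro bexI[of _ 0]) auto
next
  case False
  then obtain u where u: "u \<in> carr H" "F u \<noteq> 0" by blast
  define V where "V = {v\<in>carr H. F v = 0}"
  have F0: "F 0 = 0" using scl[OF zero_carr, of 0] by simp
  have Fd: "F (a - b) = F a - F b" if "a \<in> carr H" "b \<in> carr H" for a b
    using add[of a "- b"] scl[of b "- 1"] that by (simp add: minus_carr)
  have "csub V" using F0 by (auto simp: csub_def V_def zero_carr add_carr scale_carr add scl)
  moreover have "closedH V"
    unfolding closedH_def
  proof (intro allI impI)
    fix X l assume X: "\<forall>n. X n \<in> V" and l: "l \<in> carr H" and lim: "(\<lambda>n. nrm (X n - l)) \<longlonglongrightarrow> 0"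
    have "cmod (F l) \<le> C * nrm (X n - l)" for n
      using bd[of "X n - l"] Fd[of "X n" l] X l by (auto simp: V_def diff_carr)
    moreover have "(\<lambda>n. C * nrm (X n - l)) \<longlonglongrightarrow> C * 0" by (intro tendsto_intros lim)
    ultimately have "cmod (F l) \<le> C * 0" by (intro LIMSEQ_le_const) auto
    then show "l \<in> V" using l by (simp add: V_def)
  qed
  ultimately obtain p where p: "p \<in> V" "\<forall>v\<in>V. ip H (u - p) v = 0" using projection u by blast
  have pc: "p \<in> carr H" "F p = 0" using p by (auto simp: V_def)
  define w where "w = u - p"
  have w: "w \<in> carr H" "F w \<noteq> 0" using u pc by (auto simp: w_def diff_carr Fd)
  \<comment> \<open>Boundedness excludes null vectors outside the kernel, so the usual division by
    the squared norm is possible.\<close>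
  have nw: "nrm w \<noteq> 0" using bd[OF w(1)] w(2) by auto
  let ?y = "sc (cnj (F w) / of_real ((nrm w)\<^sup>2)) w"
  have "F v = ip H v ?y" if v: "v \<in> carr H" for v
  proof -
    have "v - sc (F v / F w) w \<in> V"
      using v w by (auto simp: V_def Fd scale_carr diff_carr scl)
    then have "ip H w (v - sc (F v / F w) w) = 0" using p by (auto simp: w_def)
    then have "ip H (v - sc (F v / F w) w) w = 0"
      using ip_cnj[of w "v - sc (F v / F w) w"] v w by (simp add: diff_carr scale_carr)
    then have "ip H v w = F v / F w * of_real ((nrm w)\<^sup>2)"
      using v w by (simp add: ip_diff scale_carr ip_scale ip_self)
    then show ?thesis using v w nw by (simp add: ip_scale_right)
  qed
  moreover have "?y \<in> carr H" using w by (intro scale_carr)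
  ultimately show ?thesis by blast
qed

end

section \<open>Operators given by families of functionals\<close>

context semi_hilbert begin

text \<open>A gliding hump: the point \<open>x'\<close> moves from \<open>x\<close> by at most \<open>r\<close> and
  pairs largely with \<open>z\<close>.\<close>

lemma gliding_step:
  assumes "x \<in> carr H" "z \<in> carr H" "r \<ge> 0"
  shows "\<exists>x'\<in>carr H. nrm (x' - x) \<le> r \<and> r * nrm z \<le> cmod (ip H x' z)"
proof (cases "nrm z = 0")
  case True then show ?thesis using assms by (intro bexI[of _ x]) auto
next
  case False
  let ?e = "sc (of_real (r / nrm z)) z"
  have e: "?e \<in> carr H" "nrm ?e = r"
    using assms False nrm_nonneg[of z] by (auto simp: scale_carr nrm_scale norm_divide)
  have ez: "ip H ?e z = of_real (r * nrm z)"
    using assms False by (simp add: ip_scale ip_self power2_eq_square)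
  have "ip H (x + ?e) z - ip H (x - ?e) z = 2 * of_real (r * nrm z)"
    using assms e ez by (simp add: ip_add ip_diff)
  then have "2 * (r * nrm z) = cmod (ip H (x + ?e) z - ip H (x - ?e) z)"
    using assms by (simp add: norm_mult nrm_nonneg)
  also have "\<dots> \<le> cmod (ip H (x + ?e) z) + cmod (ip H (x - ?e) z)" by (rule norm_triangle_ineq4)
  finally have "r * nrm z \<le> cmod (ip H (x + ?e) z) \<or> r * nrm z \<le> cmod (ip H (x - ?e) z)"
    by linarith
  moreover have "nrm (x + ?e - x) = r" "nrm (x - ?e - x) = r"
    using e nrm_minus[OF e(1)] by simp_all
  moreover have "x + ?e \<in> carr H" "x - ?e \<in> carr H"
    using assms e by (auto intro: add_carr diff_carr)
  ultimately show ?thesis by (metis order_refl)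
qed

text \<open>The gliding hump replaces a category argument. The k-th step has length at most 3^-k, so
  all later steps together move the point by at most half of that; the limit therefore still pairs
  with z k to at least half of 3^-k |z k|, which exceeds (4/3)^k / 2 because |z k| > 4^k.\<close>

theorem uniform_boundedness:
  assumes Z: "Z \<subseteq> carr H" and pb: "\<And>w. w \<in> carr H \<Longrightarrow> \<exists>M. \<forall>z\<in>Z. cmod (ip H w z) \<le> M"
  shows "\<exists>C. \<forall>z\<in>Z. nrm z \<le> C"
proof (rule ccontr)
  assume "\<not> ?thesis"
  then have "\<forall>n::nat. \<exists>z\<in>Z. 4 ^ n < nrm z" by (metis not_le_imp_less)
  then obtain z where z: "\<And>n::nat. z n \<in> Z" "\<And>n. 4 ^ n < nrm (z n)" by metis
  have zc: "z n \<in> carr H" for n using z Z by auto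
  obtain st where st: "\<And>x z r. x \<in> carr H \<Longrightarrow> z \<in> carr H \<Longrightarrow> r \<ge> 0 \<Longrightarrow>
      st x z r \<in> carr H \<and> nrm (st x z r - x) \<le> r \<and> r * nrm z \<le> cmod (ip H (st x z r) z)"
    using gliding_step by metis
  define x where "x = rec_nat 0 (\<lambda>k y. st y (z k) ((1/3) ^ k))"
  have xS: "x (Suc k) = st (x k) (z k) ((1/3) ^ k)" and x0: "x 0 = 0" for k by (auto simp: x_def)
  have xc: "x n \<in> carr H" for n by (induction n) (auto simp: xS x0 zero_carr st zc)
  have step: "nrm (x (Suc k) - x k) \<le> (1/3) ^ k"
    and big: "(1/3) ^ k * nrm (z k) \<le> cmod (ip H (x (Suc k)) (z k))" for k
    using st[OF xc zc, of "(1/3)^k"] by (auto simp: xS)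
  have tail: "nrm (x (n + j) - x n) \<le> 3 / 2 * ((1/3) ^ n - (1/3) ^ (n + j))" for n j
  proof (induction j)
    case (Suc j)
    have "nrm (x (n + Suc j) - x n) \<le> nrm (x (Suc (n + j)) - x (n + j)) + nrm (x (n + j) - x n)"
      using nrm_triangle_diff[OF xc xc xc] by simp
    then show ?case using Suc step[of "n + j"] by simp
  qed simp
  have tail': "nrm (x m - x n) \<le> 3 / 2 * (1/3) ^ n" if "n \<le> m" for m n
  proof -
    have "nrm (x m - x n) \<le> 3 / 2 * ((1/3) ^ n - (1/3) ^ m)" using tail[of n "m - n"] that by simp
    also have "\<dots> \<le> 3 / 2 * (1/3) ^ n" by simp
    finally show ?thesis .
  qed
  have "\<exists>l\<in>carr H. (\<lambda>n. nrm (x n - l)) \<longlonglongrightarrow> 0"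
  proof (rule complete)
    fix e :: real assume e: "e > 0"
    obtain N where N: "(1/3::real) ^ N < e / 3" using real_arch_pow_inv[of "e/3" "1/3"] e by auto
    show "\<exists>N. \<forall>m\<ge>N. \<forall>n\<ge>N. nrm (x m - x n) < e"
    proof (intro exI allI impI)
      fix m n assume mn: "N \<le> m" "N \<le> n"
      have "nrm (x m - x n) \<le> nrm (x m - x N) + nrm (x N - x n)"
        by (rule nrm_triangle_diff[OF xc xc xc])
      also have "\<dots> \<le> 3 * (1/3) ^ N"
        using tail'[OF mn(1)] tail'[OF mn(2)] nrm_diff_sym[OF xc xc, of N n] by simp
      finally show "nrm (x m - x n) < e" using N by simp
    qed
  qed (rule xc)
  then obtain l where l: "l \<in> carr H" "(\<lambda>n. nrm (x n - l)) \<longlonglongrightarrow> 0" by blast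
  obtain M where M: "\<And>z. z \<in> Z \<Longrightarrow> cmod (ip H l z) \<le> M" using pb[OF l(1)] by blast
  have close: "nrm (x (Suc n) - l) \<le> (1/3) ^ n / 2" for n
  proof (rule LIMSEQ_le_const)
    show "(\<lambda>m. nrm (x m - l) + (1/3) ^ n / 2) \<longlonglongrightarrow> (1/3) ^ n / 2"
      using tendsto_add[OF l(2) tendsto_const, of "(1/3)^n/2"] by simp
    have "nrm (x (Suc n) - l) \<le> nrm (x m - l) + (1/3) ^ n / 2" if "m \<ge> Suc n" for m
      using nrm_triangle_diff[OF xc xc l(1), of "Suc n" m] tail'[OF that]
        nrm_diff_sym[OF xc xc, of m "Suc n"] by simp
    then show "\<exists>N. \<forall>m\<ge>N. nrm (x (Suc n) - l) \<le> nrm (x m - l) + (1/3) ^ n / 2" by blast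
  qed
  have lower: "(4/3) ^ n / 2 \<le> M" for n
  proof -
    have "(1/3) ^ n * nrm (z n) \<le> cmod (ip H (x (Suc n)) (z n))" by (rule big)
    also have "\<dots> = cmod (ip H l (z n) + ip H (x (Suc n) - l) (z n))"
      using xc l zc by (simp add: ip_diff)
    also have "\<dots> \<le> cmod (ip H l (z n)) + cmod (ip H (x (Suc n) - l) (z n))"
      by (rule norm_triangle_ineq)
    also have "\<dots> \<le> M + (1/3) ^ n / 2 * nrm (z n)"
    proof (intro add_mono M z)
      have "cmod (ip H (x (Suc n) - l) (z n)) \<le> nrm (x (Suc n) - l) * nrm (z n)"
        using xc l zc by (intro ip_le diff_carr)
      also have "\<dots> \<le> (1/3) ^ n / 2 * nrm (z n)"
        by (intro mult_right_mono close nrm_nonneg zc)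
      finally show "cmod (ip H (x (Suc n) - l) (z n)) \<le> (1/3) ^ n / 2 * nrm (z n)" .
    qed
    finally have "(1/3) ^ n * nrm (z n) / 2 \<le> M" by simp
    moreover have "(1/3) ^ n * 4 ^ n \<le> (1/3) ^ n * nrm (z n)"
      using z(2)[of n] by (intro mult_left_mono) auto
    moreover have "(1/3) ^ n * 4 ^ n = (4/3 :: real) ^ n" by (simp flip: power_mult_distrib)
    ultimately show ?thesis by linarith
  qed
  obtain n where "2 * M < (4/3 :: real) ^ n" using real_arch_pow[of "4/3" "2 * M"] by auto
  then show False using lower[of n] by simp
qed

definition bfun :: "('f \<Rightarrow> complex) \<Rightarrow> bool" where
  "bfun F \<longleftrightarrow> (\<forall>u\<in>carr H. \<forall>v\<in>carr H. F (u + v) = F u + F v) \<and>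
     (\<forall>a. \<forall>u\<in>carr H. F (sc a u) = a * F u) \<and> (\<exists>C. \<forall>u\<in>carr H. cmod (F u) \<le> C * nrm u)"

lemma bfun_add: "bfun F \<Longrightarrow> u \<in> carr H \<Longrightarrow> v \<in> carr H \<Longrightarrow> F (u + v) = F u + F v"
  by (simp add: bfun_def)

lemma bfun_scale: "bfun F \<Longrightarrow> u \<in> carr H \<Longrightarrow> F (sc a u) = a * F u"
  by (simp add: bfun_def)

lemma bfun_zero: "bfun F \<Longrightarrow> F 0 = 0"
  using bfun_scale[of F 0 0] zero_carr by simp

lemma bfun_diff: "bfun F \<Longrightarrow> u \<in> carr H \<Longrightarrow> v \<in> carr H \<Longrightarrow> F (u - v) = F u - F v"
  using bfun_add[of F u "- v"] bfun_scale[of F v "- 1"] minus_carr by simp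

lemma bfun_null: "bfun F \<Longrightarrow> u \<in> carr H \<Longrightarrow> nrm u = 0 \<Longrightarrow> F u = 0"
  unfolding bfun_def by (metis mult_zero_right norm_le_zero_iff)

lemma bfun_eq: "bfun F \<Longrightarrow> u \<in> carr H \<Longrightarrow> v \<in> carr H \<Longrightarrow> nrm (u - v) = 0 \<Longrightarrow> F u = F v"
  using bfun_null[of F "u - v"] bfun_diff[of F u v] diff_carr by simp

lemma bfun_riesz: "bfun F \<Longrightarrow> \<exists>y\<in>carr H. \<forall>u\<in>carr H. F u = ip H u y"
  unfolding bfun_def by (elim conjE exE) (rule riesz, auto)

lemma bfun_tendsto:
  assumes F: "bfun F" and X: "\<And>n::nat. X n \<in> carr H" "l \<in> carr H" "(\<lambda>n. nrm (X n - l)) \<longlonglongrightarrow> 0"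
  shows "(\<lambda>n. F (X n)) \<longlonglongrightarrow> F l"
  using bfun_riesz[OF F] tendsto_ip_left[OF X(1,2) _ X(3)] X by auto

lemma csub_kernel: "(\<And>i. i \<in> I \<Longrightarrow> bfun (a i)) \<Longrightarrow> csub {v \<in> carr H. \<forall>i\<in>I. a i v = 0}"
  by (auto simp: csub_def zero_carr add_carr scale_carr bfun_zero bfun_add bfun_scale)

lemma closed_kernel:
  assumes "\<And>i. i \<in> I \<Longrightarrow> bfun (a i)" shows "closedH {v \<in> carr H. \<forall>i\<in>I. a i v = 0}"
  unfolding closedH_def
proof (intro allI impI CollectI conjI ballI)
  fix X l i
  assume *: "\<forall>n. X n \<in> {v \<in> carr H. \<forall>i\<in>I. a i v = 0}" "l \<in> carr H"
    "(\<lambda>n. nrm (X n - l)) \<longlonglongrightarrow> 0" "i \<in> I"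
  then have "(\<lambda>n. a i (X n)) \<longlonglongrightarrow> a i l" by (intro bfun_tendsto assms) auto
  moreover have "(\<lambda>n. a i (X n)) = (\<lambda>n. 0)" using * by auto
  ultimately show "a i l = 0" by (metis LIMSEQ_const_iff)
qed auto

end

definition weak_graph ::
  "'f hilbert \<Rightarrow> 'g hilbert \<Rightarrow> ('i \<Rightarrow> 'f \<Rightarrow> complex) \<Rightarrow> ('i \<Rightarrow> 'g \<Rightarrow> complex) \<Rightarrow> 'i set \<Rightarrow>
     ('f \<times> 'g) set" where
  "weak_graph K H a b I = {(v, w). v \<in> carr K \<and> w \<in> carr H \<and> (\<forall>i\<in>I. a i v = b i w)}"

text \<open>Operators given by a family of scalar equations, like weak derivatives, are closed.\<close>

locale weak_operator = K: semi_hilbert sc1 K + H: semi_hilbert sc2 H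
  for sc1 :: "complex \<Rightarrow> 'f::ab_group_add \<Rightarrow> 'f" and K
    and sc2 :: "complex \<Rightarrow> 'g::ab_group_add \<Rightarrow> 'g" and H +
  fixes a :: "'i \<Rightarrow> 'f \<Rightarrow> complex" and b :: "'i \<Rightarrow> 'g \<Rightarrow> complex" and I :: "'i set"
  assumes bfun_a: "\<And>i. i \<in> I \<Longrightarrow> K.bfun (a i)" and bfun_b: "\<And>i. i \<in> I \<Longrightarrow> H.bfun (b i)"
begin

abbreviation T where "T \<equiv> weak_graph K H a b I"

lemmas T_def = weak_graph_def[of K H a b I]

definition ker where "ker = {v \<in> carr K. \<forall>i\<in>I. a i v = 0}"

definition perp where "perp = {v \<in> carr K. \<forall>k\<in>ker. ip K v k = 0}"

text \<open>Restates \<open>adjoint_op\<close> for spaces over two different types, since the finite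
  codimension argument enlarges only the domain space. It is a relation: values are determined up to
  vectors orthogonal to the domain of \<open>T\<close>.\<close>

definition Tadj where
  "Tadj = {(z, y). z \<in> carr H \<and> y \<in> carr K \<and> (\<forall>(v, w)\<in>T. ip H w z = ip K v y)}"

lemma T_carr: "(v, w) \<in> T \<Longrightarrow> v \<in> carr K \<and> w \<in> carr H"
  by (auto simp: T_def)

lemma T_diff: "(v, w) \<in> T \<Longrightarrow> (v', w') \<in> T \<Longrightarrow> (v - v', w - w') \<in> T"
  by (auto simp: T_def K.diff_carr H.diff_carr K.bfun_diff[OF bfun_a] H.bfun_diff[OF bfun_b])

lemma T_add: "(v, w) \<in> T \<Longrightarrow> (v', w') \<in> T \<Longrightarrow> (v + v', w + w') \<in> T"
  by (auto simp: T_def K.add_carr H.add_carr K.bfun_add[OF bfun_a] H.bfun_add[OF bfun_b])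

lemma T_scale: "(v, w) \<in> T \<Longrightarrow> (sc1 c v, sc2 c w) \<in> T"
  by (auto simp: T_def K.scale_carr H.scale_carr K.bfun_scale[OF bfun_a] H.bfun_scale[OF bfun_b])

lemma T_zero: "(0, 0) \<in> T"
  by (auto simp: T_def K.zero_carr H.zero_carr K.bfun_zero[OF bfun_a] H.bfun_zero[OF bfun_b])

lemma csub_Range: "H.csub (Range T)"
  unfolding H.csub_def
proof (intro conjI ballI allI)
  show "Range T \<subseteq> carr H" using T_carr by blast
  show "0 \<in> Range T" using T_zero by blast
  show "w + w' \<in> Range T" if "w \<in> Range T" "w' \<in> Range T" for w w'
    using that T_add by blast
  show "sc2 c w \<in> Range T" if "w \<in> Range T" for c w using that T_scale by blast
qed

lemma csub_ker: "K.csub ker"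
  unfolding ker_def by (rule K.csub_kernel[OF bfun_a])

lemma closed_ker: "K.closedH ker"
  unfolding ker_def by (rule K.closed_kernel[OF bfun_a])

lemma ker_carr: "k \<in> ker \<Longrightarrow> k \<in> carr K" by (simp add: ker_def)

lemma csub_perp: "K.csub perp"
  unfolding perp_def by (rule K.csub_perp) (auto simp: ker_carr)

lemma closed_perp: "K.closedH perp"
  unfolding perp_def by (rule K.closedH_perp) (auto simp: ker_carr)

lemma T_eq_ker: "(v, w) \<in> T \<Longrightarrow> (v', w) \<in> T \<Longrightarrow> v - v' \<in> ker"
  using T_diff[of v w v' w] by (auto simp: T_def ker_def H.bfun_zero[OF bfun_b])

lemma T_null: "(v, w) \<in> T \<Longrightarrow> w' \<in> carr H \<Longrightarrow> H.nrm (w - w') = 0 \<Longrightarrow> (v, w') \<in> T"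
  using H.bfun_eq[OF bfun_b, of _ w w'] by (simp add: T_def)

lemma ker_iff: "v \<in> ker \<longleftrightarrow> (\<exists>w. (v, w) \<in> T \<and> H.nrm w = 0)"
proof
  assume "v \<in> ker"
  then have "(v, 0) \<in> T" using H.zero_carr H.bfun_zero[OF bfun_b] by (auto simp: T_def ker_def)
  then show "\<exists>w. (v, w) \<in> T \<and> H.nrm w = 0" using H.nrm_zero by blast
next
  assume "\<exists>w. (v, w) \<in> T \<and> H.nrm w = 0"
  then obtain w where w: "(v, w) \<in> T" "H.nrm w = 0" by blast
  then have "b i w = 0" if "i \<in> I" for i using H.bfun_null[OF bfun_b[OF that]] T_carr by blast
  then show "v \<in> ker" using w by (auto simp: T_def ker_def)
qed

text \<open>Subtracting the projection to the closed kernel changes the value of no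
  \<open>a i\<close>.\<close>

lemma perp_preimage: assumes "w \<in> Range T" shows "\<exists>v\<in>perp. (v, w) \<in> T"
proof -
  obtain v where v: "(v, w) \<in> T" using assms by blast
  then have vc: "v \<in> carr K" using T_carr by blast
  obtain p where p: "p \<in> ker" "\<forall>k\<in>ker. ip K (v - p) k = 0"
    using K.projection[OF csub_ker closed_ker vc] by blast
  then have "v - p \<in> perp" using vc ker_carr by (auto simp: perp_def K.diff_carr)
  moreover have "(v - p, w) \<in> T"
    using T_diff[OF v, of p 0] p(1) H.bfun_zero[OF bfun_b] H.zero_carr by (auto simp: T_def ker_def)
  ultimately show ?thesis by blast
qed

lemma perp_ker_null: assumes "v \<in> perp" "v \<in> ker" shows "K.nrm v = 0"
  using assms K.nrm_sq[of v] by (auto simp: perp_def)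

lemma csub_Range_adj: "K.csub (Range Tadj)"
  unfolding K.csub_def
proof (intro conjI ballI allI)
  show "Range Tadj \<subseteq> carr K" by (auto simp: Tadj_def)
  have "(0, 0) \<in> Tadj" using T_carr by (auto simp: Tadj_def K.zero_carr H.zero_carr)
  then show "0 \<in> Range Tadj" by blast
next
  fix u v assume "u \<in> Range Tadj" "v \<in> Range Tadj"
  then obtain z z' where "(z, u) \<in> Tadj" "(z', v) \<in> Tadj" by blast
  then have "(z + z', u + v) \<in> Tadj"
    using T_carr by (fastforce simp: Tadj_def K.add_carr H.add_carr K.ip_add_right H.ip_add_right)
  then show "u + v \<in> Range Tadj" by blast
next
  fix c u assume "u \<in> Range Tadj"
  then obtain z where "(z, u) \<in> Tadj" by blast
  then have "(sc2 c z, sc1 c u) \<in> Tadj"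
    using T_carr by (fastforce simp: Tadj_def K.scale_carr H.scale_carr K.ip_scale_right H.ip_scale_right)
  then show "sc1 c u \<in> Range Tadj" by blast
qed

text \<open>The adjoint maps the vector representing \<open>b i\<close> to the one representing
  \<open>a i\<close>, because the equations defining \<open>T\<close> say that the two functionals
  agree along its graph.\<close>

lemma functional_in_Range_adj: assumes "i \<in> I" "y \<in> carr K" "\<And>v. v \<in> carr K \<Longrightarrow> a i v = ip K v y"
  shows "y \<in> Range Tadj"
proof -
  obtain z where "z \<in> carr H" "\<forall>w\<in>carr H. b i w = ip H w z"
    using H.bfun_riesz[OF bfun_b[OF assms(1)]] by blast
  then have "(z, y) \<in> Tadj" using assms by (auto simp: Tadj_def T_def)
  then show ?thesis by blast
qed

lemma perp_functionals_ker:
  assumes w: "w \<in> carr K"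
    and 0: "\<And>i y. i \<in> I \<Longrightarrow> y \<in> carr K \<Longrightarrow> (\<And>v. v \<in> carr K \<Longrightarrow> a i v = ip K v y) \<Longrightarrow> ip K w y = 0"
  shows "w \<in> ker"
  using K.bfun_riesz[OF bfun_a] 0 w by (auto simp: ker_def) metis

text \<open>The kernel is the common zero set of the \<open>a i\<close>, so its orthogonal
  complement is the closure of the span of their representing vectors. \<open>Y\<close> is left
  arbitrary because it is taken once as the range of the adjoint and once as the set of vectors
  asymptotically orthogonal to the kernels of the varying operators.\<close>

lemma perp_approx:
  assumes Y: "K.csub Y" and v: "v \<in> perp" and e: "e > 0"
    and sub: "\<And>i y. i \<in> I \<Longrightarrow> y \<in> carr K \<Longrightarrow> (\<And>v. v \<in> carr K \<Longrightarrow> a i v = ip K v y) \<Longrightarrow> y \<in> Y"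
  shows "\<exists>y\<in>Y. K.nrm (v - y) < e"
proof (rule K.dense_of_perp[OF Y _ _ e])
  show vc: "v \<in> carr K" using v by (simp add: perp_def)
  fix w assume w: "w \<in> carr K" "\<And>y. y \<in> Y \<Longrightarrow> ip K w y = 0"
  then have "w \<in> ker" using sub by (intro perp_functionals_ker) auto
  then show "ip K w v = 0" using v K.ip_cnj[OF vc w(1)] by (simp add: perp_def)
qed

text \<open>By duality: the adjoint is bounded below on the range of \<open>T\<close>, and uniform
  boundedness proves this. If z has an adjoint value y of norm at most 1, then |<w, z>| = |<v, y>|
  <= |v| whenever v is mapped to w, so such z are pointwise bounded on the complete space
  \<open>Range T\<close>. The estimate is carried over to v by approximating v by adjoint
  values.\<close>

theorem bounded_inverse:
  assumes cl: "H.closedH (Range T)"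
  shows "\<exists>C\<ge>0. \<forall>v\<in>perp. \<forall>w. (v, w) \<in> T \<longrightarrow> K.nrm v \<le> C * H.nrm w"
proof -
  let ?R = "H\<lparr>carr := Range T\<rparr>"
  interpret R: semi_hilbert sc2 ?R by (rule H.subspace_semi_hilbert[OF csub_Range cl])
  have Rn: "R.nrm = H.nrm" by (simp add: hnorm_def fun_eq_iff)
  have Rc: "w \<in> carr H" if "w \<in> Range T" for w using that T_carr by blast
  \<comment> \<open>Adjoint values are attained at arbitrary z; here z' is the projection of z to
    the range, characterized by its pairings there.\<close>
  define Z where "Z = {z'\<in>Range T. \<exists>(z, y)\<in>Tadj. K.nrm y \<le> 1 \<and> (\<forall>w\<in>Range T. ip H w z' = ip H w z)}"
  have "\<exists>C. \<forall>z\<in>Z. R.nrm z \<le> C"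
  proof (rule R.uniform_boundedness)
    show "Z \<subseteq> carr ?R" by (auto simp: Z_def)
    fix w assume "w \<in> carr ?R"
    then have wR: "w \<in> Range T" by simp
    then obtain v where v: "(v, w) \<in> T" by blast
    have "cmod (ip H w z') \<le> K.nrm v" if z': "z' \<in> Z" for z'
    proof -
      obtain z y where zy: "(z, y) \<in> Tadj" "K.nrm y \<le> 1" "ip H w z' = ip H w z"
        using z' wR by (auto simp: Z_def)
      have c: "v \<in> carr K" "y \<in> carr K" using v zy T_carr by (auto simp: Tadj_def)
      have "ip H w z = ip K v y" using zy v by (auto simp: Tadj_def)
      then have "cmod (ip H w z') \<le> K.nrm v * K.nrm y" using K.ip_le[OF c] zy by simp
      also have "\<dots> \<le> K.nrm v * 1" using zy K.nrm_nonneg c by (intro mult_left_mono) auto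
      finally show ?thesis by simp
    qed
    then show "\<exists>M. \<forall>z\<in>Z. cmod (ip ?R w z) \<le> M" by auto
  qed
  then obtain C0 where C0: "\<And>z. z \<in> Z \<Longrightarrow> H.nrm z \<le> C0" by (auto simp: Rn)
  define C where "C = max C0 0"
  have C: "C \<ge> 0" "\<And>z. z \<in> Z \<Longrightarrow> H.nrm z \<le> C" using C0 by (auto simp: C_def le_max_iff_disj)
  have "K.nrm v \<le> C * H.nrm w" if v: "v \<in> perp" and w: "(v, w) \<in> T" for v w
  proof -
    have vc: "v \<in> carr K" and wc: "w \<in> carr H" using w T_carr by auto
    \<comment> \<open>With y an adjoint value of z within e of v, and p the projection of z to the
      range, |v|^2 is <v, y> = <w, p> up to e |v|, and after scaling y to the unit ball |p| <= C
      (|v| + e). Then e tends to 0 and one factor |v| cancels.\<close>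
    have main: "(K.nrm v)\<^sup>2 \<le> C * H.nrm w * (K.nrm v + e) + e * K.nrm v" if e: "e > 0" for e
    proof -
      have "\<exists>y\<in>Range Tadj. K.nrm (v - y) < e"
        using functional_in_Range_adj by (intro perp_approx[OF csub_Range_adj v e]) auto
      then obtain z y where zy: "(z, y) \<in> Tadj" "K.nrm (v - y) < e" by blast
      have c: "z \<in> carr H" "y \<in> carr K" using zy by (auto simp: Tadj_def)
      have zy2: "ip H w z = ip K v y" using zy w by (auto simp: Tadj_def)
      define t where "t = K.nrm v + e"
      have t: "t > 0" using e K.nrm_nonneg[OF vc] by (simp add: t_def)
      have ny: "K.nrm y \<le> t"
        using K.nrm_le_add_diff[OF c(2) vc] K.nrm_diff_sym[OF c(2) vc] zy by (simp add: t_def)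
      obtain p where p: "p \<in> Range T" "\<forall>w\<in>Range T. ip H (z - p) w = 0"
        using H.projection[OF csub_Range cl c(1)] by blast
      have pw: "ip H w' p = ip H w' z" if "w' \<in> Range T" for w'
      proof -
        have "ip H w' (z - p) = 0"
          using p that Rc c H.ip_cnj[of "z - p" w'] by (simp add: H.diff_carr)
        then show ?thesis using p that Rc c by (simp add: H.ip_diff_right)
      qed
      let ?s = "of_real (1 / t) :: complex"
      have "sc1 ?s y \<in> carr K" "sc2 ?s z \<in> carr H" using c by (auto simp: K.scale_carr H.scale_carr)
      then have adj: "(sc2 ?s z, sc1 ?s y) \<in> Tadj"
        using zy(1) c T_carr by (fastforce simp: Tadj_def H.ip_scale_right K.ip_scale_right)
      have "K.nrm (sc1 ?s y) \<le> 1" using c ny t by (simp add: K.nrm_scale norm_divide)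
      moreover have "sc2 ?s p \<in> Range T" using csub_Range p by (auto simp: H.csub_def)
      moreover have "\<forall>w\<in>Range T. ip H w (sc2 ?s p) = ip H w (sc2 ?s z)"
        using pw p Rc c by (simp add: H.ip_scale_right)
      ultimately have "sc2 ?s p \<in> Z" using adj unfolding Z_def by blast
      then have "H.nrm (sc2 ?s p) \<le> C" by (rule C)
      then have np: "H.nrm p \<le> C * t" using p Rc t by (simp add: H.nrm_scale norm_divide field_simps)
      have "(K.nrm v)\<^sup>2 = Re (ip K v y) + Re (ip K v (v - y))"
        using vc c by (simp add: K.nrm_sq K.ip_diff_right)
      also have "ip K v y = ip H w p" using pw[of w] w zy2 by force
      also have "Re (ip H w p) \<le> H.nrm w * H.nrm p" using p Rc wc by (intro H.Re_ip_le) auto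
      also have "\<dots> \<le> H.nrm w * (C * t)" using np wc H.nrm_nonneg by (intro mult_left_mono) auto
      also have "Re (ip K v (v - y)) \<le> K.nrm v * K.nrm (v - y)"
        using vc c by (intro K.Re_ip_le K.diff_carr)
      also have "\<dots> \<le> K.nrm v * e" using zy(2) K.nrm_nonneg[OF vc] by (intro mult_left_mono) auto
      finally show ?thesis by (simp add: t_def mult_ac)
    qed
    have lim: "((\<lambda>e. C * H.nrm w * (K.nrm v + e) + e * K.nrm v) \<longlongrightarrow> C * H.nrm w * (K.nrm v + 0) + 0 * K.nrm v) (at_right 0)"
      by (intro tendsto_intros)
    have "(K.nrm v)\<^sup>2 \<le> C * H.nrm w * (K.nrm v + 0) + 0 * K.nrm v"
      by (rule tendsto_lowerbound[OF lim]) (auto simp: eventually_at_right_less eventually_at_filter main)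
    then have "K.nrm v * K.nrm v \<le> (C * H.nrm w) * K.nrm v" by (simp add: power2_eq_square)
    then show ?thesis
      using K.nrm_nonneg[OF vc] C(1) H.nrm_nonneg[OF wc] by (cases "K.nrm v = 0") auto
  qed
  then show ?thesis using C(1) by blast
qed

text \<open>Preimages in \<open>perp\<close> of a Cauchy sequence are again Cauchy, and the limit
  solves the limit equations because every \<open>a i\<close> and \<open>b i\<close> is
  continuous.\<close>

lemma closed_Range_of_bound:
  assumes C: "\<And>v w. v \<in> perp \<Longrightarrow> (v, w) \<in> T \<Longrightarrow> K.nrm v \<le> C * H.nrm w"
  shows "H.closedH (Range T)"
  unfolding H.closedH_def
proof (intro allI impI)
  fix X l assume X: "\<forall>n::nat. X n \<in> Range T" and l: "l \<in> carr H" and lim: "(\<lambda>n. H.nrm (X n - l)) \<longlonglongrightarrow> 0"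
  have "\<forall>n. \<exists>v. v \<in> perp \<and> (v, X n) \<in> T" using perp_preimage X by blast
  then obtain v where v: "\<And>n. v n \<in> perp" "\<And>n. (v n, X n) \<in> T" by metis
  have c: "v n \<in> carr K" "X n \<in> carr H" for n using v(2) T_carr by blast+
  \<comment> \<open>Nothing forces C to be nonnegative, hence the absolute value.\<close>
  have vd: "K.nrm (v m - v n) \<le> \<bar>C\<bar> * H.nrm (X m - X n)" for m n
  proof -
    have "K.nrm (v m - v n) \<le> C * H.nrm (X m - X n)"
      by (intro C T_diff v K.csub_diff[OF csub_perp])
    also have "\<dots> \<le> \<bar>C\<bar> * H.nrm (X m - X n)" using c by (intro mult_right_mono H.nrm_nonneg H.diff_carr) auto
    finally show ?thesis .
  qed
  have "\<exists>v'\<in>carr K. (\<lambda>n. K.nrm (v n - v')) \<longlonglongrightarrow> 0"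
  proof (rule K.complete)
    fix e :: real assume e: "e > 0"
    then have "e / (2 * (\<bar>C\<bar> + 1)) > 0" by simp
    from order_tendstoD(2)[OF lim this] obtain N where N: "\<And>n. n \<ge> N \<Longrightarrow> H.nrm (X n - l) < e / (2 * (\<bar>C\<bar> + 1))"
      by (auto simp: eventually_sequentially)
    show "\<exists>N. \<forall>m\<ge>N. \<forall>n\<ge>N. K.nrm (v m - v n) < e"
    proof (intro exI allI impI)
      fix m n assume mn: "N \<le> m" "N \<le> n"
      have "H.nrm (X m - X n) \<le> H.nrm (X m - l) + H.nrm (X n - l)"
        using H.nrm_triangle_diff[OF c(2) l c(2)] H.nrm_diff_sym[OF l c(2)] by metis
      also have "\<dots> < e / (\<bar>C\<bar> + 1)" using N[OF mn(1)] N[OF mn(2)] by (simp add: field_simps)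
      finally have "(\<bar>C\<bar> + 1) * H.nrm (X m - X n) < e" by (simp add: field_simps)
      moreover have "0 \<le> H.nrm (X m - X n)" using c by (intro H.nrm_nonneg H.diff_carr)
      ultimately show "K.nrm (v m - v n) < e" using vd[of m n] by (simp add: distrib_right)
    qed
  qed (rule c)
  then obtain v' where v': "v' \<in> carr K" "(\<lambda>n. K.nrm (v n - v')) \<longlonglongrightarrow> 0" by blast
  have "a i v' = b i l" if i: "i \<in> I" for i
  proof (rule LIMSEQ_unique)
    show "(\<lambda>n. a i (v n)) \<longlonglongrightarrow> a i v'" by (rule K.bfun_tendsto[OF bfun_a[OF i] c(1) v'])
    have "(\<lambda>n. b i (X n)) \<longlonglongrightarrow> b i l" by (rule H.bfun_tendsto[OF bfun_b[OF i] c(2) l lim])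
    moreover have "(\<lambda>n. a i (v n)) = (\<lambda>n. b i (X n))" using v(2) i by (auto simp: T_def)
    ultimately show "(\<lambda>n. a i (v n)) \<longlonglongrightarrow> b i l" by simp
  qed
  then have "(v', l) \<in> T" using v' l by (auto simp: T_def)
  then show "l \<in> Range T" by blast
qed

text \<open>For y orthogonal to the kernel, sending w to <v, y> with v any preimage of w is a
  functional on the range, bounded by \<open>bounded_inverse\<close>; its Riesz vector is mapped to
  y by the adjoint.\<close>

theorem Range_adj: assumes cl: "H.closedH (Range T)" shows "Range Tadj = perp"
proof
  show "Range Tadj \<subseteq> perp"
  proof
    fix y assume "y \<in> Range Tadj"
    then obtain z where zy: "(z, y) \<in> Tadj" by blast
    have c: "z \<in> carr H" "y \<in> carr K" using zy by (auto simp: Tadj_def)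
    have "ip K y k = 0" if k: "k \<in> ker" for k
    proof -
      have "(k, 0) \<in> T" using k H.bfun_zero[OF bfun_b] H.zero_carr by (auto simp: T_def ker_def)
      then have "ip H 0 z = ip K k y" using zy by (auto simp: Tadj_def)
      then show ?thesis using c K.ip_cnj[OF ker_carr[OF k] c(2)] by simp
    qed
    then show "y \<in> perp" using c by (auto simp: perp_def)
  qed
next
  show "perp \<subseteq> Range Tadj"
  proof
    fix y assume y: "y \<in> perp"
    then have yc: "y \<in> carr K" by (simp add: perp_def)
    obtain C where C: "C \<ge> 0" "\<And>v w. v \<in> perp \<Longrightarrow> (v, w) \<in> T \<Longrightarrow> K.nrm v \<le> C * H.nrm w"
      using bounded_inverse[OF cl] by blast
    let ?R = "H\<lparr>carr := Range T\<rparr>"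
    interpret R: semi_hilbert sc2 ?R by (rule H.subspace_semi_hilbert[OF csub_Range cl])
    have Rn: "R.nrm = H.nrm" by (simp add: hnorm_def fun_eq_iff)
    define G where "G w = (SOME v. v \<in> perp \<and> (v, w) \<in> T)" for w
    have G: "G w \<in> perp \<and> (G w, w) \<in> T" if "w \<in> Range T" for w
      unfolding G_def by (rule someI_ex) (use perp_preimage[OF that] in blast)
    define F where "F w = ip K (G w) y" for w
    have ker0: "ip K k y = 0" if "k \<in> ker" for k
      using y that K.ip_cnj[OF yc ker_carr[OF that]] by (simp add: perp_def)
    \<comment> \<open>Independence of the chosen preimage: two preimages differ by a kernel element,
      which is orthogonal to y.\<close>
    have F: "F w = ip K v y" if vw: "(v, w) \<in> T" for v w
    proof -
      have g: "(G w, w) \<in> T" using G vw by blast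
      have "G w - v \<in> ker" by (rule T_eq_ker[OF g vw])
      then have "ip K (G w - v) y = 0" by (rule ker0)
      then show ?thesis using T_carr[OF g] T_carr[OF vw] yc by (simp add: F_def K.ip_diff)
    qed
    have "\<exists>z\<in>carr ?R. \<forall>u\<in>carr ?R. F u = ip ?R u z"
    proof (rule R.riesz)
      fix u v assume "u \<in> carr ?R" "v \<in> carr ?R"
      then obtain u' v' where "(u', u) \<in> T" "(v', v) \<in> T" by auto
      then show "F (u + v) = F u + F v"
        using F[OF T_add] F T_carr yc by (metis K.ip_add)
    next
      fix c u assume "u \<in> carr ?R"
      then obtain u' where "(u', u) \<in> T" by auto
      then show "F (sc2 c u) = c * F u" using F[OF T_scale] F T_carr yc by (metis K.ip_scale)
    next
      fix u assume "u \<in> carr ?R"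
      then have u: "u \<in> Range T" by simp
      have gc: "G u \<in> carr K" using G[OF u] T_carr by blast
      have "cmod (F u) \<le> K.nrm (G u) * K.nrm y" unfolding F_def by (rule K.ip_le[OF gc yc])
      also have "\<dots> \<le> (C * H.nrm u) * K.nrm y"
        using G[OF u] C(2) K.nrm_nonneg[OF yc] by (intro mult_right_mono) auto
      finally show "cmod (F u) \<le> (C * K.nrm y) * R.nrm u" by (simp add: Rn mult_ac)
    qed
    then obtain z where z: "z \<in> Range T" "\<And>u. u \<in> Range T \<Longrightarrow> F u = ip H u z" by auto
    have "(z, y) \<in> Tadj" using z F T_carr yc by (fastforce simp: Tadj_def)
    then show "y \<in> Range Tadj" by blast
  qed
qed

end

section \<open>Closed range from finite codimension\<close>

definition prod_scale ::
  "(complex \<Rightarrow> 'f \<Rightarrow> 'f) \<Rightarrow> complex \<Rightarrow> 'f \<times> ('b \<Rightarrow> complex) \<Rightarrow> 'f \<times> ('b \<Rightarrow> complex)" where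
  "prod_scale sc c = (\<lambda>(v, f). (sc c v, \<lambda>b. c * f b))"

definition prod_hilbert :: "'f hilbert \<Rightarrow> 'b set \<Rightarrow> ('f \<times> ('b \<Rightarrow> complex)) hilbert" where
  "prod_hilbert K B =
     \<lparr>carr = carr K \<times> UNIV, ip = (\<lambda>(v, f) (w, g). ip K v w + (\<Sum>b\<in>B. f b * cnj (g b)))\<rparr>"

lemma carr_prod [simp]: "carr (prod_hilbert K B) = carr K \<times> UNIV"
  by (simp add: prod_hilbert_def)

lemma ip_prod [simp]:
  "ip (prod_hilbert K B) (v, f) (w, g) = ip K v w + (\<Sum>b\<in>B. f b * cnj (g b))"
  by (simp add: prod_hilbert_def)

lemma prod_scale_Pair [simp]: "prod_scale sc c (v, f) = (sc c v, \<lambda>b. c * f b)"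
  by (simp add: prod_scale_def)

context semi_hilbert begin

lemma hnorm_prod:
  "v \<in> carr H \<Longrightarrow> hnorm (prod_hilbert H B) (v, f) = sqrt ((nrm v)\<^sup>2 + (\<Sum>b\<in>B. (cmod (f b))\<^sup>2))"
  by (simp add: hnorm_def[of "prod_hilbert H B"] nrm_sq cmod_power2) (simp add: power2_eq_square)

lemma semi_hilbert_prod:
  assumes B: "finite B"
  shows "semi_hilbert (prod_scale sc) (prod_hilbert H (B :: 'b set))"
proof -
  let ?P = "prod_hilbert H B"
  have le1: "nrm v \<le> hnorm ?P (v, f)" if "v \<in> carr H" for v and f :: "'b \<Rightarrow> complex"
    using that by (auto simp: hnorm_prod intro!: real_le_rsqrt sum_nonneg)
  have le2: "cmod (f b) \<le> hnorm ?P (v, f)" if "v \<in> carr H" "b \<in> B" for v b and f :: "'b \<Rightarrow> complex"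
  proof -
    have "(cmod (f b))\<^sup>2 \<le> (\<Sum>b\<in>B. (cmod (f b))\<^sup>2)" using that B by (intro member_le_sum) auto
    then have "(cmod (f b))\<^sup>2 \<le> (nrm v)\<^sup>2 + (\<Sum>b\<in>B. (cmod (f b))\<^sup>2)" by (simp add: add_increasing)
    then show ?thesis using that by (simp add: hnorm_prod real_le_rsqrt)
  qed
  show ?thesis
  proof (unfold_locales, goal_cases)
    case (12 X)
    define v where "v n = fst (X n)" for n
    define f where "f n = snd (X n)" for n
    have X: "X n = (v n, f n)" for n by (simp add: v_def f_def)
    have vc: "v n \<in> carr H" for n using 12(1)[of n] by (simp add: v_def prod_hilbert_def mem_Times_iff)
    have Xd: "X m - X n = (v m - v n, f m - f n)" for m n by (simp add: X)
    have "\<exists>l\<in>carr H. (\<lambda>n. nrm (v n - l)) \<longlonglongrightarrow> 0"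
    proof (rule complete[OF vc])
      fix e :: real assume "e > 0"
      from 12(2)[OF this] show "\<exists>N. \<forall>m\<ge>N. \<forall>n\<ge>N. nrm (v m - v n) < e"
        unfolding Xd using le1[OF diff_carr[OF vc vc]] by (meson le_less_trans)
    qed
    then obtain l where l: "l \<in> carr H" "(\<lambda>n. nrm (v n - l)) \<longlonglongrightarrow> 0" by blast
    have "\<exists>z. (\<lambda>n. f n b) \<longlonglongrightarrow> z" if b: "b \<in> B" for b
    proof -
      have "Cauchy (\<lambda>n. f n b)"
      proof (rule CauchyI)
        fix e :: real assume "e > 0"
        from 12(2)[OF this] show "\<exists>M. \<forall>m\<ge>M. \<forall>n\<ge>M. norm (f m b - f n b) < e"
          unfolding Xd using le2[OF diff_carr[OF vc vc] b, of "f _ - f _"]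
          by (metis (no_types, lifting) fun_diff_def le_less_trans)
      qed
      then show ?thesis using Cauchy_convergent convergent_def by blast
    qed
    then obtain g where g: "\<And>b. b \<in> B \<Longrightarrow> (\<lambda>n. f n b) \<longlonglongrightarrow> g b" by metis
    have "hnorm ?P (X n - (l, g)) = sqrt ((nrm (v n - l))\<^sup>2 + (\<Sum>b\<in>B. (cmod (f n b - g b))\<^sup>2))" for n
      using vc l by (simp add: X hnorm_prod diff_carr)
    moreover have "(\<lambda>n. sqrt ((nrm (v n - l))\<^sup>2 + (\<Sum>b\<in>B. (cmod (f n b - g b))\<^sup>2)))
        \<longlonglongrightarrow> sqrt (0\<^sup>2 + (\<Sum>b\<in>B. (cmod (g b - g b))\<^sup>2))"
      by (intro tendsto_intros l g)
    ultimately have "(\<lambda>n. hnorm ?P (X n - (l, g))) \<longlonglongrightarrow> 0" by simp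
    then show ?case using l by (intro bexI[of _ "(l, g)"]) auto
  next
    case (8 u v w)
    then show ?case
      by (cases u; cases v; cases w) (simp add: ip_add distrib_right sum.distrib)
  next
    case (9 c u w)
    then show ?case
      by (cases u; cases w) (simp add: ip_scale distrib_left sum_distrib_left mult.assoc)
  next
    case (10 u v)
    obtain u1 f v1 g where uv: "u = (u1, f)" "v = (v1, g)" by fastforce
    then have "ip H v1 u1 = cnj (ip H u1 v1)" using 10 by (intro ip_cnj) auto
    then show ?case by (simp add: uv mult.commute)
  next
    case (11 u)
    then show ?case
      by (cases u) (auto intro!: add_nonneg_nonneg sum_nonneg ip_nonneg)
  qed (auto simp: zero_carr add_carr scale_carr scale_right_distrib scale_left_distrib fun_eq_iff
      distrib_left distrib_right zero_prod_def split: prod.splits)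
qed

lemma csub_sum: "csub V \<Longrightarrow> (\<And>b. b \<in> B \<Longrightarrow> f b \<in> V) \<Longrightarrow> (\<Sum>b\<in>B. f b) \<in> V"
  by (induction B rule: infinite_finite_induct) (auto simp: csub_def)

lemma csub_carr: "csub (carr H)"
  by (auto simp: csub_def zero_carr add_carr scale_carr)

lemma bfun_sum: "bfun F \<Longrightarrow> (\<And>b. b \<in> B \<Longrightarrow> f b \<in> carr H) \<Longrightarrow> F (\<Sum>b\<in>B. f b) = (\<Sum>b\<in>B. F (f b))"
  by (induction B rule: infinite_finite_induct)
    (auto simp: bfun_zero bfun_add csub_sum[OF csub_carr])

end

context weak_operator begin

text \<open>Finitely many coordinates are added to the domain: sending (v, f) to T v plus the
  combination of \<open>B\<close> with coefficients f is again an operator given by functionals, and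
  its range is the closed space \<open>N\<close>. Its inverse is bounded by
  \<open>bounded_inverse\<close>, and restricting the estimate to f = 0 bounds the inverse of
  \<open>T\<close>.\<close>

theorem closed_Range_finite_codim:
  assumes N: "H.csub N" "H.closedH N" and RN: "Range T \<subseteq> N"
    and fin: "finite B0" "B0 \<subseteq> N" and gen0: "\<And>u. u \<in> N \<Longrightarrow> \<exists>c. u - (\<Sum>\<beta>\<in>B0. sc2 (c \<beta>) \<beta>) \<in> Range T"
  shows "H.closedH (Range T)"
proof -
  let ?good = "\<lambda>B. finite B \<and> B \<subseteq> N \<and> (\<forall>u\<in>N. \<exists>c. u - (\<Sum>\<beta>\<in>B. sc2 (c \<beta>) \<beta>) \<in> Range T)"
  have "?good B0" using fin gen0 by blast
  \<comment> \<open>Least cardinality makes \<open>B\<close> linearly independent modulo the range,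
    which determines the kernel of the enlarged operator below.\<close>
  from ex_has_least_nat[where P = ?good and m = card, OF this]
  obtain B where "?good B" and minimal: "\<And>B'. ?good B' \<Longrightarrow> card B \<le> card B'" by blast
  then have B: "finite B" "B \<subseteq> N" and gen: "\<And>u. u \<in> N \<Longrightarrow> \<exists>c. u - (\<Sum>\<beta>\<in>B. sc2 (c \<beta>) \<beta>) \<in> Range T"
    by auto
  have Nc: "u \<in> carr H" if "u \<in> N" for u using that N by (auto simp: H.csub_def)
  define s where "s f = (\<Sum>\<beta>\<in>B. sc2 (f \<beta>) \<beta>)" for f
  have sN: "s f \<in> N" for f
    unfolding s_def using N B by (intro H.csub_sum) (auto simp: H.csub_def)
  have bs: "b i (s f) = (\<Sum>\<beta>\<in>B. f \<beta> * b i \<beta>)" if "i \<in> I" for i f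
    using B Nc unfolding s_def
    by (subst H.bfun_sum[OF bfun_b[OF that]]) (auto simp: H.scale_carr H.bfun_scale[OF bfun_b[OF that]] subset_iff)
  have indep: "f \<beta> = 0" if f: "s f \<in> Range T" and \<beta>: "\<beta> \<in> B" for f \<beta>
  proof (rule ccontr)
    assume nz: "f \<beta> \<noteq> 0"
    have "?good (B - {\<beta>})"
    proof (intro conjI ballI)
      fix u assume "u \<in> N"
      then obtain c where c: "u - s c \<in> Range T" using gen unfolding s_def by blast
      \<comment> \<open>Subtracting this multiple of the relation \<open>s f\<close> cancels the
        coefficient of \<beta>.\<close>
      let ?r = "c \<beta> / f \<beta>"
      define c' where "c' x = c x - ?r * f x" for x
      have "s c' = s c - sc2 ?r (s f)"
        unfolding s_def c'_def by (simp add: H.scale_left_diff_distrib sum_subtractf H.scale_sum_right)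
      then have "u - s c' = (u - s c) + sc2 ?r (s f)" by simp
      also have "\<dots> \<in> Range T" using csub_Range c f unfolding H.csub_def by blast
      finally have "u - s c' \<in> Range T" .
      moreover have "s c' = (\<Sum>x\<in>B - {\<beta>}. sc2 (c' x) x)"
        unfolding s_def using B \<beta> nz by (subst sum.remove[of B \<beta>]) (auto simp: c'_def)
      ultimately show "\<exists>c. u - (\<Sum>x\<in>B - {\<beta>}. sc2 (c x) x) \<in> Range T" by metis
    qed (use B in auto)
    from minimal[OF this] have "card B \<le> card (B - {\<beta>})" .
    then show False using B \<beta> by (meson card_Diff1_less not_le)
  qed
  \<comment> \<open>Chosen so that the equations for ((v, f), w) are those of \<open>T\<close> for v
    and w - s f.\<close>
  define a' where "a' i = (\<lambda>(v, f). a i v + (\<Sum>\<beta>\<in>B. f \<beta> * b i \<beta>))" for i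
  let ?K = "prod_hilbert K B"
  interpret P0: semi_hilbert "prod_scale sc1" ?K by (rule K.semi_hilbert_prod[OF B(1)])
  interpret P: weak_operator "prod_scale sc1" ?K sc2 H a' b I
  proof unfold_locales
    fix i assume i: "i \<in> I"
    obtain C where C: "\<And>u. u \<in> carr K \<Longrightarrow> cmod (a i u) \<le> C * K.nrm u"
      using bfun_a[OF i] unfolding K.bfun_def by blast
    have "cmod (a' i (v, f)) \<le> (\<bar>C\<bar> + (\<Sum>\<beta>\<in>B. cmod (b i \<beta>))) * P0.nrm (v, f)" if v: "v \<in> carr K" for v f
    proof -
      have n1: "K.nrm v \<le> P0.nrm (v, f)"
        using v by (auto simp: K.hnorm_prod intro!: real_le_rsqrt sum_nonneg)
      have n2: "cmod (f \<beta>) \<le> P0.nrm (v, f)" if "\<beta> \<in> B" for \<beta>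
      proof -
        have "(cmod (f \<beta>))\<^sup>2 \<le> (\<Sum>\<beta>\<in>B. (cmod (f \<beta>))\<^sup>2)" using that B by (intro member_le_sum) auto
        then have "(cmod (f \<beta>))\<^sup>2 \<le> (K.nrm v)\<^sup>2 + (\<Sum>\<beta>\<in>B. (cmod (f \<beta>))\<^sup>2)" by (simp add: add_increasing)
        then show ?thesis using v by (simp add: K.hnorm_prod real_le_rsqrt)
      qed
      have "cmod (a' i (v, f)) \<le> cmod (a i v) + (\<Sum>\<beta>\<in>B. cmod (f \<beta> * b i \<beta>))"
        unfolding a'_def by (auto intro!: order_trans[OF norm_triangle_ineq] norm_sum)
      also have "\<dots> \<le> \<bar>C\<bar> * P0.nrm (v, f) + (\<Sum>\<beta>\<in>B. P0.nrm (v, f) * cmod (b i \<beta>))"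
      proof (intro add_mono sum_mono)
        have "cmod (a i v) \<le> C * K.nrm v" by (rule C[OF v])
        also have "\<dots> \<le> \<bar>C\<bar> * P0.nrm (v, f)" using n1 K.nrm_nonneg[OF v] by (intro mult_mono) auto
        finally show "cmod (a i v) \<le> \<bar>C\<bar> * P0.nrm (v, f)" .
      qed (auto simp: norm_mult intro!: mult_right_mono n2)
      finally show ?thesis by (simp add: algebra_simps sum_distrib_left)
    qed
    then show "P0.bfun (a' i)"
      unfolding P0.bfun_def
    proof (intro conjI ballI allI, goal_cases)
      case (1 u v)
      then show ?case using K.bfun_add[OF bfun_a[OF i]]
        by (cases u; cases v) (simp add: a'_def sum.distrib distrib_right)
    next
      case (2 c u)
      then show ?case using K.bfun_scale[OF bfun_a[OF i]]
        by (cases u) (simp add: a'_def sum_distrib_left distrib_left mult.assoc)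
    next
      case 3
      then show ?case by (intro exI[of _ "\<bar>C\<bar> + (\<Sum>\<beta>\<in>B. cmod (b i \<beta>))"]) auto
    qed
  qed (rule bfun_b)
  have T': "((v, f), w) \<in> P.T \<longleftrightarrow> v \<in> carr K \<and> w \<in> carr H \<and> (v, w - s f) \<in> T" for v f w
    using Nc[OF sN] by (auto simp: weak_graph_def a'_def H.bfun_diff[OF bfun_b] bs H.diff_carr eq_diff_eq)
  have "Range P.T = N"
  proof
    show "Range P.T \<subseteq> N"
    proof
      fix w assume "w \<in> Range P.T"
      then obtain v f where "(v, w - s f) \<in> T" using T' by auto
      then have "w - s f \<in> N" using RN by blast
      then have "(w - s f) + s f \<in> N" using N sN unfolding H.csub_def by blast
      then show "w \<in> N" by simp
    qed
    show "N \<subseteq> Range P.T"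
    proof
      fix w assume w: "w \<in> N"
      then obtain c where "w - s c \<in> Range T" using gen unfolding s_def by blast
      then obtain v where "(v, w - s c) \<in> T" by blast
      then have "((v, c), w) \<in> P.T" using T' T_carr Nc[OF w] by blast
      then show "w \<in> Range P.T" by blast
    qed
  qed
  then obtain C where C: "\<And>v w. v \<in> P.perp \<Longrightarrow> (v, w) \<in> P.T \<Longrightarrow> P0.nrm v \<le> C * H.nrm w"
    using P.bounded_inverse N by auto
  show ?thesis
  proof (rule closed_Range_of_bound)
    fix v w assume v: "v \<in> perp" and vw: "(v, w) \<in> T"
    have vc: "v \<in> carr K" using v by (simp add: perp_def)
    have s0: "s (\<lambda>_. 0) = 0" by (simp add: s_def)
    \<comment> \<open>For (k', f) in the enlarged kernel, \<open>T\<close> sends k' to - s f, so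
      independence gives f = 0 on \<open>B\<close> and k' lies in \<open>ker\<close>. Thus
      \<open>perp\<close> embeds into the complement of the enlarged kernel.\<close>
    have "ip ?K (v, \<lambda>_. 0) k = 0" if "k \<in> P.ker" for k
    proof -
      obtain k' f where k: "k = (k', f)" by fastforce
      have kc: "k' \<in> carr K" using that by (auto simp: k P.ker_def)
      have "(k', 0 - s f) \<in> T"
        using that H.zero_carr H.bfun_zero[OF bfun_b] T'[of k' f 0] kc
        by (auto simp: k P.ker_def weak_graph_def)
      then have m: "(k', - s f) \<in> T" by simp
      then have "sc2 (- 1) (- s f) \<in> Range T" using csub_Range unfolding H.csub_def by blast
      then have "s f \<in> Range T" by simp
      then have "\<And>\<beta>. \<beta> \<in> B \<Longrightarrow> f \<beta> = 0" by (rule indep)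
      then have "s f = 0" by (simp add: s_def)
      then have "k' \<in> ker" using m ker_iff H.nrm_zero by (metis neg_equal_0_iff_equal)
      then show ?thesis using v by (simp add: k perp_def)
    qed
    then have "(v, \<lambda>_. 0) \<in> P.perp" using vc by (simp add: P.perp_def)
    moreover have "((v, \<lambda>_. 0), w) \<in> P.T" using T' vw T_carr s0 by auto
    ultimately have "P0.nrm (v, \<lambda>_. 0) \<le> C * H.nrm w" by (rule C)
    then show "K.nrm v \<le> C * H.nrm w" using vc by (simp add: K.hnorm_prod K.nrm_nonneg)
  qed
qed

end

section \<open>Green operators\<close>

locale form_operator = weak_operator cscale K cscale H a b I
  for K H :: "('a, 'm::finite, 'r::finite) form hilbert" and a b :: "'i \<Rightarrow> ('a, 'm, 'r) form \<Rightarrow> complex"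
    and I :: "'i set"
begin

lemma adjoint_eq: "adjoint_op K H T = Tadj"
  by (simp add: adjoint_op_def Tadj_def)

lemma perp_of_Range:
  assumes u: "u \<in> carr H" and 0: "\<forall>w\<in>Range T. ip H u w = 0"
  shows "u \<in> op_kernel K (adjoint_op K H T)"
proof -
  have "ip H w u = 0" if "(v, w) \<in> T" for v w
    using 0 that T_carr[OF that] H.ip_cnj[OF u, of w] by force
  then have "(u, 0) \<in> Tadj" using u T_carr K.zero_carr by (fastforce simp: Tadj_def)
  then show ?thesis using K.nrm_zero by (auto simp: op_kernel_def adjoint_eq)
qed

lemma Range_projection:
  assumes cl: "H.closedH (Range T)" and u: "u \<in> carr H"
  shows "\<exists>p\<in>Range T. \<forall>w\<in>Range T. ip H (u - p) w = 0"
  by (rule H.projection[OF csub_Range cl u])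

text \<open>The projection P to the range followed by the inverse on \<open>perp\<close>. Both are
  chosen pointwise and determined up to norm 0 only, so linearity is verified up to norm 0. The
  closed range enters through the projection and through the bounded inverse.\<close>

lemma green_exists: assumes cl: "H.closedH (Range T)" shows "\<exists>G. is_green K H T G"
proof -
  have Rc: "w \<in> carr H" if "w \<in> Range T" for w using that T_carr by blast
  obtain P where P: "\<And>u. u \<in> carr H \<Longrightarrow> P u \<in> Range T"
    "\<And>u w. u \<in> carr H \<Longrightarrow> w \<in> Range T \<Longrightarrow> ip H (u - P u) w = 0"
    using Range_projection[OF cl] by metis
  have "\<forall>u\<in>carr H. \<exists>v. v \<in> perp \<and> (v, P u) \<in> T" using perp_preimage P(1) by blast
  then obtain G where G: "\<And>u. u \<in> carr H \<Longrightarrow> G u \<in> perp" "\<And>u. u \<in> carr H \<Longrightarrow> (G u, P u) \<in> T" by metis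
  have Pc: "P u \<in> carr H" if "u \<in> carr H" for u using P(1) that Rc by blast
  have null: "H.nrm w = 0" if w: "w \<in> Range T" "\<And>w'. w' \<in> Range T \<Longrightarrow> ip H w w' = 0" for w
    using w H.nrm_sq[OF Rc[OF w(1)]] by simp
  have pk: "K.nrm v = 0" if "v \<in> perp" "(v, w) \<in> T" "H.nrm w = 0" for v w
    using perp_ker_null that ker_iff by blast
  obtain C where C: "C \<ge> 0" "\<And>v w. v \<in> perp \<Longrightarrow> (v, w) \<in> T \<Longrightarrow> K.nrm v \<le> C * H.nrm w"
    using bounded_inverse[OF cl] by blast
  have perp: "u + v \<in> perp" "cscale c u \<in> perp" "u - v \<in> perp" if "u \<in> perp" "v \<in> perp" for u v c
    using that csub_perp K.csub_diff[OF csub_perp] unfolding K.csub_def by blast+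
  have Rsub: "u + v \<in> Range T" "cscale c u \<in> Range T" "u - v \<in> Range T"
    if "u \<in> Range T" "v \<in> Range T" for u v c
    using that csub_Range H.csub_diff[OF csub_Range] unfolding H.csub_def by blast+
  have "bounded_op H K G"
    unfolding bounded_op_def
  proof (intro conjI ballI allI)
    fix u assume "u \<in> carr H" then show "G u \<in> carr K" using G by (auto simp: perp_def)
  next
    fix u v assume u: "u \<in> carr H" and v: "v \<in> carr H"
    have uv: "u + v \<in> carr H" by (rule H.add_carr[OF u v])
    have "H.nrm (P (u + v) - (P u + P v)) = 0"
    proof (rule null)
      fix w assume w: "w \<in> Range T"
      show "ip H (P (u + v) - (P u + P v)) w = 0"
        using P(2)[OF u w] P(2)[OF v w] P(2)[OF uv w] u v uv w Rc
        by (simp add: H.ip_diff H.ip_add Pc H.add_carr)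
    qed (intro Rsub P uv u v)
    moreover have "(G (u + v) - (G u + G v), P (u + v) - (P u + P v)) \<in> T"
      by (intro T_diff T_add G u v uv)
    ultimately show "K.nrm (G (u + v) - (G u + G v)) = 0"
      by (intro pk[where w = "P (u + v) - (P u + P v)"] perp G u v uv)
  next
    fix u c assume u: "u \<in> carr H"
    have cu: "cscale c u \<in> carr H" by (rule H.scale_carr[OF u])
    have "H.nrm (P (cscale c u) - cscale c (P u)) = 0"
    proof (rule null)
      fix w assume w: "w \<in> Range T"
      show "ip H (P (cscale c u) - cscale c (P u)) w = 0"
        using P(2)[OF u w] P(2)[OF cu w] u cu w Rc
        by (simp add: H.ip_diff H.ip_scale Pc H.scale_carr)
    next
      show "P (cscale c u) - cscale c (P u) \<in> Range T"
        using Rsub(2)[OF P(1)[OF u] P(1)[OF u]] Rsub(3)[OF P(1)[OF cu]] by blast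
    qed
    moreover have "(G (cscale c u) - cscale c (G u), P (cscale c u) - cscale c (P u)) \<in> T"
      by (intro T_diff T_scale G u cu)
    moreover have "G (cscale c u) - cscale c (G u) \<in> perp" using perp G u cu by blast
    ultimately show "K.nrm (G (cscale c u) - cscale c (G u)) = 0" using pk by blast
  next
    have "K.nrm (G u) \<le> C * H.nrm u" if u: "u \<in> carr H" for u
    proof -
      have pc: "P u \<in> carr H" by (rule Pc[OF u])
      have "ip H (u - P u) (P u) = 0" by (rule P(2)[OF u P(1)[OF u]])
      then have "(H.nrm (P u))\<^sup>2 = Re (ip H u (P u))" using u pc by (simp add: H.ip_diff H.nrm_sq)
      also have "\<dots> \<le> H.nrm u * H.nrm (P u)" by (rule H.Re_ip_le[OF u pc])
      finally have "H.nrm (P u) \<le> H.nrm u"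
        using H.nrm_nonneg[OF pc] H.nrm_nonneg[OF u] by (cases "H.nrm (P u) = 0") (auto simp: power2_eq_square)
      then have "C * H.nrm (P u) \<le> C * H.nrm u" using C(1) by (intro mult_left_mono)
      then show ?thesis using C(2)[OF G(1,2)[OF u]] by linarith
    qed
    then show "\<exists>C. \<forall>u\<in>carr H. K.nrm (G u) \<le> C * H.nrm u" by blast
  qed
  moreover have "K.nrm (G u) = 0" if "u \<in> op_kernel K (adjoint_op K H T)" for u
  proof -
    have "\<exists>w. (u, w) \<in> Tadj \<and> K.nrm w = 0"
      using that unfolding op_kernel_def adjoint_eq by simp
    then obtain w where w: "(u, w) \<in> Tadj" "K.nrm w = 0" by blast
    have u: "u \<in> carr H" and wc: "w \<in> carr K" using w by (auto simp: Tadj_def)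
    have "H.nrm (P u) = 0"
    proof (rule null[OF P(1)[OF u]])
      fix x assume x: "x \<in> Range T"
      then obtain v where v: "(v, x) \<in> T" by blast
      then have c: "v \<in> carr K" "x \<in> carr H" using T_carr by auto
      have "ip H x u = ip K v w" using w v by (auto simp: Tadj_def)
      also have "\<dots> = 0" using K.ip_le[OF c(1) wc] w(2) by simp
      finally have "ip H u x = 0" using H.ip_cnj[OF c(2) u] by simp
      then show "ip H (P u) x = 0" using P(2)[OF u x] u c Pc by (simp add: H.ip_diff)
    qed
    then show ?thesis using pk G u by blast
  qed
  moreover have "G u \<in> Range (adjoint_op K H T) \<and> (G u, u) \<in> T" if uR: "u \<in> Range T" for u
  proof -
    have u: "u \<in> carr H" by (rule Rc[OF uR])
    have "H.nrm (u - P u) = 0" using P u uR by (intro null Rsub) auto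
    then have "H.nrm (P u - u) = 0" using H.nrm_diff_sym[OF u Pc[OF u]] by simp
    then have "(G u, u) \<in> T" using T_null G(2) u by blast
    moreover have "G u \<in> Range Tadj" using Range_adj[OF cl] G u by blast
    ultimately show ?thesis by (simp add: adjoint_eq)
  qed
  ultimately have "is_green K H T G" unfolding is_green_def by blast
  then show ?thesis by blast
qed

lemma is_green_green: "H.closedH (Range T) \<Longrightarrow> is_green K H T (green K H T)"
  unfolding green_def using green_exists by (rule someI_ex[where P = "is_green K H T"])

text \<open>Only the conditions of \<open>is_green\<close> are used, since \<open>green\<close> is
  an arbitrary choice. The component u - p is orthogonal to the range, hence in the kernel of the
  adjoint, and \<open>G\<close> annihilates it up to norm 0.\<close>

lemma green_decomp:
  assumes cl: "H.closedH (Range T)" and G: "is_green K H T G" and u: "u \<in> carr H"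
    and p: "p \<in> Range T" "\<forall>w\<in>Range T. ip H (u - p) w = 0"
  shows "G p \<in> perp" "(G p, p) \<in> T" "G u \<in> carr K" "K.nrm (G u - G p) = 0"
proof -
  show "G p \<in> perp" "(G p, p) \<in> T"
    using G p Range_adj[OF cl] unfolding is_green_def adjoint_eq by blast+
  have pc: "p \<in> carr H" using p T_carr by blast
  have d: "u - p \<in> carr H" by (rule H.diff_carr[OF u pc])
  have "u - p \<in> op_kernel K (adjoint_op K H T)" by (rule perp_of_Range[OF d p(2)])
  then have 0: "K.nrm (G (u - p)) = 0" using G by (simp add: is_green_def)
  have c: "G x \<in> carr K" if "x \<in> carr H" for x using G that by (auto simp: is_green_def bounded_op_def)
  show "G u \<in> carr K" by (rule c[OF u])
  have "K.nrm (G (p + (u - p)) - (G p + G (u - p))) = 0"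
    using G pc d unfolding is_green_def bounded_op_def by blast
  then have "K.nrm (G u - G p - G (u - p)) = 0" by (simp add: diff_diff_eq)
  then have "K.nrm (G u - G p) \<le> 0"
    using K.nrm_le_add_diff[OF K.diff_carr[OF c[OF u] c[OF pc]] c[OF d]] 0 by simp
  then show "K.nrm (G u - G p) = 0" using K.nrm_nonneg[OF K.diff_carr[OF c[OF u] c[OF pc]]] by simp
qed

end

section \<open>Operators on varying spaces\<close>

text \<open>Every pairing converges and is therefore bounded, so uniform boundedness applies to the
  range of the sequence.\<close>

lemma (in semi_hilbert) weakly_convergent_bounded:
  assumes "weakly_converges H \<alpha> \<alpha>'" shows "\<exists>C. \<forall>n. nrm (\<alpha> n) \<le> C"
proof -
  have c: "\<alpha> n \<in> carr H" for n using assms by (simp add: weakly_converges_def)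
  have "\<exists>C. \<forall>z\<in>range \<alpha>. nrm z \<le> C"
  proof (rule uniform_boundedness)
    fix w assume w: "w \<in> carr H"
    then have "(\<lambda>n. ip H (\<alpha> n) w) \<longlonglongrightarrow> ip H \<alpha>' w" using assms by (simp add: weakly_converges_def)
    then have "Bseq (\<lambda>n. ip H (\<alpha> n) w)" by (intro convergent_imp_Bseq convergentI)
    then obtain M where "\<And>n. cmod (ip H (\<alpha> n) w) \<le> M" by (auto simp: Bseq_def)
    then show "\<exists>M. \<forall>z\<in>range \<alpha>. cmod (ip H w z) \<le> M"
      using ip_cnj[OF c w] by (intro exI[of _ M]) auto
  qed (use c in auto)
  then show ?thesis by auto
qed

text \<open>The kernels of the operators on the varying spaces become orthogonal to \<open>y\<close>, uniformly
  on their unit balls.\<close>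

definition asymp_perp ::
  "(nat \<Rightarrow> 'f hilbert) \<Rightarrow> ('i \<Rightarrow> 'f \<Rightarrow> complex) \<Rightarrow> 'i set \<Rightarrow> 'f \<Rightarrow> bool" where
  "asymp_perp Kn a I y \<longleftrightarrow> (\<exists>\<epsilon>. \<epsilon> \<longlonglongrightarrow> (0::real) \<and>
     (\<forall>n. \<forall>w\<in>carr (Kn n). (\<forall>i\<in>I. a i w = 0) \<longrightarrow> cmod (ip (Kn n) w y) \<le> \<epsilon> n * hnorm (Kn n) w))"

locale varying_operators = W: form_operator K H a b I
  for K H :: "('a, 'm::finite, 'r::finite) form hilbert" and a b :: "'i \<Rightarrow> ('a, 'm, 'r) form \<Rightarrow> complex"
    and I :: "'i set" +
  fixes Kn :: "nat \<Rightarrow> ('a, 'm, 'r) form hilbert" and C :: real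
  assumes Wn: "\<And>n. form_operator (Kn n) H a b I"
    and C_nonneg: "C \<ge> 0"
    and carr_Kn: "\<And>n v. v \<in> carr K \<Longrightarrow> v \<in> carr (Kn n)"
    and nrm_Kn: "\<And>n v. v \<in> carr K \<Longrightarrow> hnorm (Kn n) v \<le> C * hnorm K v"
    and cutoff: "\<And>i. i \<in> I \<Longrightarrow> \<exists>\<kappa>.
      (\<forall>n. \<forall>u\<in>carr (Kn n). \<kappa> u \<in> carr K \<and> a i (\<kappa> u) = a i u) \<and>
      (\<forall>u\<in>carr K. hnorm K (\<kappa> u) \<le> hnorm K u) \<and>
      (\<forall>c>1. \<forall>\<^sub>F n in sequentially. (\<forall>u\<in>carr (Kn n). (hnorm K (\<kappa> u))\<^sup>2 \<le> c * (hnorm (Kn n) u)\<^sup>2) \<and>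
         (\<forall>u\<in>carr K. (hnorm (Kn n) (\<kappa> u))\<^sup>2 \<le> c * (hnorm K u)\<^sup>2))"
begin

lemma null_Kn: "v \<in> carr K \<Longrightarrow> hnorm K v = 0 \<Longrightarrow> hnorm (Kn n) v = 0"
proof -
  assume v: "v \<in> carr K" "hnorm K v = 0"
  interpret Wn: form_operator "Kn n" H a b I by (rule Wn)
  show ?thesis using nrm_Kn[OF v(1), of n] v Wn.K.nrm_nonneg[OF carr_Kn[OF v(1)]] by simp
qed

text \<open>Let z n represent \<open>a i\<close> in \<open>Kn n\<close>. The inner product of y and
  z n there is exactly the squared \<open>K\<close>-norm of y, and \<open>cutoff\<close> bounds the
  squared norms of both vectors by c times that. So their squared distance is at most 2 (c - 1)
  times it, and kernel elements, being orthogonal to z n, are nearly orthogonal to y.\<close>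

lemma asymp_perp_functional:
  assumes i: "i \<in> I" and y: "y \<in> carr K" and rep: "\<And>v. v \<in> carr K \<Longrightarrow> a i v = ip K v y"
  shows "asymp_perp Kn a I y"
proof -
  have "\<exists>z. z \<in> carr (Kn n) \<and> (\<forall>u\<in>carr (Kn n). a i u = ip (Kn n) u z)" for n
  proof -
    interpret Wn: form_operator "Kn n" H a b I by (rule Wn)
    show ?thesis using Wn.K.bfun_riesz[OF Wn.bfun_a[OF i]] by blast
  qed
  then obtain z where z: "\<And>n. z n \<in> carr (Kn n)" "\<And>n u. u \<in> carr (Kn n) \<Longrightarrow> a i u = ip (Kn n) u (z n)"
    by metis
  obtain \<kappa> where \<kappa>: "\<And>n u. u \<in> carr (Kn n) \<Longrightarrow> \<kappa> u \<in> carr K" "\<And>n u. u \<in> carr (Kn n) \<Longrightarrow> a i (\<kappa> u) = a i u"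
      "\<And>u. u \<in> carr K \<Longrightarrow> hnorm K (\<kappa> u) \<le> hnorm K u"
    and ev: "\<And>c. c > 1 \<Longrightarrow> \<forall>\<^sub>F n in sequentially. (\<forall>u\<in>carr (Kn n). (hnorm K (\<kappa> u))\<^sup>2 \<le> c * (hnorm (Kn n) u)\<^sup>2) \<and>
         (\<forall>u\<in>carr K. (hnorm (Kn n) (\<kappa> u))\<^sup>2 \<le> c * (hnorm K u)\<^sup>2)"
    using cutoff[OF i] by blast
  define \<epsilon> where "\<epsilon> n = hnorm (Kn n) (y - z n)" for n
  have \<kappa>y: "\<kappa> y \<in> carr K" "a i (\<kappa> y) = a i y" using \<kappa>(1,2)[OF carr_Kn[OF y]] by auto
  \<comment> \<open>Truncation changes y only by a null vector, since <\<kappa> y, y> = a i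
    (\<kappa> y) = |y|^2 while |\<kappa> y| <= |y|.\<close>
  have "(W.K.nrm (y - \<kappa> y))\<^sup>2 = (W.K.nrm (\<kappa> y))\<^sup>2 - (W.K.nrm y)\<^sup>2"
  proof -
    have "Re (ip K y (\<kappa> y)) = Re (ip K (\<kappa> y) y)" using W.K.ip_cnj[OF y \<kappa>y(1)] by simp
    also have "\<dots> = (W.K.nrm y)\<^sup>2" using rep[OF \<kappa>y(1)] rep[OF y] \<kappa>y y by (simp add: W.K.nrm_sq)
    finally show ?thesis using y \<kappa>y by (simp add: W.K.nrm_diff_sq)
  qed
  also have "\<dots> \<le> 0" using \<kappa>(3)[OF y] W.K.nrm_nonneg[OF \<kappa>y(1)] by (simp add: power_mono)
  finally have y\<kappa>: "W.K.nrm (y - \<kappa> y) = 0" by simp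
  have bound: "(\<epsilon> n)\<^sup>2 \<le> 2 * (c - 1) * (W.K.nrm y)\<^sup>2"
    if n: "(\<forall>u\<in>carr (Kn n). (hnorm K (\<kappa> u))\<^sup>2 \<le> c * (hnorm (Kn n) u)\<^sup>2) \<and>
         (\<forall>u\<in>carr K. (hnorm (Kn n) (\<kappa> u))\<^sup>2 \<le> c * (hnorm K u)\<^sup>2)" for n c
  proof -
    interpret Wn: form_operator "Kn n" H a b I by (rule Wn)
    have yc: "y \<in> carr (Kn n)" by (rule carr_Kn[OF y])
    have e: "(\<epsilon> n)\<^sup>2 = (Wn.K.nrm y)\<^sup>2 - 2 * (W.K.nrm y)\<^sup>2 + (Wn.K.nrm (z n))\<^sup>2"
      using yc z(1)[of n] rep[OF y] z(2)[OF yc]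
      by (simp add: \<epsilon>_def Wn.K.nrm_diff_sq W.K.nrm_sq[OF y])
    have "Wn.K.nrm y \<le> Wn.K.nrm (\<kappa> y) + Wn.K.nrm (y - \<kappa> y)"
      by (intro Wn.K.nrm_le_add_diff yc carr_Kn \<kappa>y)
    also have "Wn.K.nrm (y - \<kappa> y) = 0" by (intro null_Kn y\<kappa> W.K.diff_carr y \<kappa>y)
    finally have "(Wn.K.nrm y)\<^sup>2 \<le> (Wn.K.nrm (\<kappa> y))\<^sup>2"
      using Wn.K.nrm_nonneg[OF yc] by (intro power_mono) auto
    also have "\<dots> \<le> c * (W.K.nrm y)\<^sup>2" using n y by blast
    finally have 1: "(Wn.K.nrm y)\<^sup>2 \<le> c * (W.K.nrm y)\<^sup>2" .
    have \<kappa>z: "\<kappa> (z n) \<in> carr K" by (rule \<kappa>(1)[OF z(1)])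
    let ?p = "W.K.nrm (\<kappa> (z n))" and ?q = "(Wn.K.nrm (z n))\<^sup>2" and ?r = "(W.K.nrm y)\<^sup>2"
    \<comment> \<open>The squared norm of z n is the functional evaluated at z n itself. Truncation
      moves this evaluation to \<open>K\<close>, where it is bounded by means of y; squaring the
      estimate and cancelling \<open>?q\<close> then gives the bound.\<close>
    have "?q = Re (a i (z n))" using z(2)[OF z(1)[of n]] by (simp add: Wn.K.nrm_sq z(1))
    also have "a i (z n) = a i (\<kappa> (z n))" using \<kappa>(2)[OF z(1)] by simp
    also have "\<dots> = ip K (\<kappa> (z n)) y" by (rule rep[OF \<kappa>z])
    also have "Re \<dots> \<le> ?p * W.K.nrm y" by (rule W.K.Re_ip_le[OF \<kappa>z y])
    finally have "?q\<^sup>2 \<le> (?p * W.K.nrm y)\<^sup>2" by (intro power_mono) auto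
    also have "\<dots> = ?p\<^sup>2 * ?r" by (rule power_mult_distrib)
    also have "\<dots> \<le> (c * ?q) * ?r" using n z by (intro mult_right_mono) auto
    finally have qq: "?q * ?q \<le> (c * ?r) * ?q" by (simp add: power2_eq_square mult_ac)
    have 2: "?q \<le> c * ?r"
    proof (cases "?q = 0")
      case True
      then show ?thesis using order_trans[OF zero_le_power2 1] by simp
    next
      case False
      then have "?q > 0" by simp
      show ?thesis by (rule mult_right_le_imp_le[OF qq \<open>?q > 0\<close>])
    qed
    have "2 * (c - 1) * ?r = c * ?r - 2 * ?r + c * ?r" by (simp add: algebra_simps)
    then show ?thesis using 1 2 unfolding e by linarith
  qed
  have "(\<lambda>n. (\<epsilon> n)\<^sup>2) \<longlonglongrightarrow> 0"
  proof (rule LIMSEQ_I)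
    fix e :: real assume e: "e > 0"
    let ?r = "(W.K.nrm y)\<^sup>2"
    \<comment> \<open>Makes 2 (c - 1) times the squared norm of y smaller than e; the summand 1 in
      the denominator allows that norm to vanish.\<close>
    define c where "c = 1 + e / (2 * (?r + 1))"
    have r: "?r + 1 > 0" by (simp add: add_nonneg_pos)
    have c: "c > 1" using e r by (simp add: c_def)
    have "2 * (c - 1) * ?r = e * (?r / (?r + 1))" using r by (simp add: c_def field_simps)
    also have "\<dots> < e * 1" using e r by (intro mult_strict_left_mono) (auto simp: divide_less_eq)
    finally have ce: "2 * (c - 1) * ?r < e" by simp
    have "\<forall>\<^sub>F n in sequentially. (\<epsilon> n)\<^sup>2 \<le> 2 * (c - 1) * ?r"
      by (rule eventually_mono[OF ev[OF c]]) (rule bound)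
    then obtain N where "\<And>n. n \<ge> N \<Longrightarrow> (\<epsilon> n)\<^sup>2 \<le> 2 * (c - 1) * ?r"
      unfolding eventually_sequentially by blast
    then have "norm ((\<epsilon> n)\<^sup>2 - 0) < e" if "n \<ge> N" for n using that ce by fastforce
    then show "\<exists>N. \<forall>n\<ge>N. norm ((\<epsilon> n)\<^sup>2 - 0) < e" by blast
  qed
  then have "\<epsilon> \<longlonglongrightarrow> 0" by (simp add: tendsto_null_power)
  moreover have "cmod (ip (Kn n) w y) \<le> \<epsilon> n * hnorm (Kn n) w"
    if w: "w \<in> carr (Kn n)" "\<forall>i\<in>I. a i w = 0" for n w
  proof -
    interpret Wn: form_operator "Kn n" H a b I by (rule Wn)
    have yc: "y \<in> carr (Kn n)" by (rule carr_Kn[OF y])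
    have "ip (Kn n) w (z n) = 0" using z(2)[OF w(1)] w i by simp
    then have "ip (Kn n) w y = ip (Kn n) w (y - z n)" using w yc z by (simp add: Wn.K.ip_diff_right)
    also have "cmod \<dots> \<le> Wn.K.nrm w * Wn.K.nrm (y - z n)"
      by (intro Wn.K.ip_le Wn.K.diff_carr w yc z)
    finally show ?thesis by (simp only: \<epsilon>_def mult.commute)
  qed
  ultimately show ?thesis unfolding asymp_perp_def by blast
qed

lemma csub_asymp_perp: "W.K.csub {y \<in> carr K. asymp_perp Kn a I y}"
  unfolding W.K.csub_def
proof (intro conjI ballI allI)
  have "cmod (ip (Kn n) w 0) \<le> 0 * hnorm (Kn n) w" if "w \<in> carr (Kn n)" for n w
  proof -
    interpret Wn: form_operator "Kn n" H a b I by (rule Wn)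
    show ?thesis using that by simp
  qed
  then have "asymp_perp Kn a I 0" unfolding asymp_perp_def by (intro exI[of _ "\<lambda>_. 0"]) auto
  then show "0 \<in> {y \<in> carr K. asymp_perp Kn a I y}" by (simp add: W.K.zero_carr)
next
  fix u v assume "u \<in> {y \<in> carr K. asymp_perp Kn a I y}" "v \<in> {y \<in> carr K. asymp_perp Kn a I y}"
  then have u: "u \<in> carr K" "asymp_perp Kn a I u" and v: "v \<in> carr K" "asymp_perp Kn a I v" by auto
  obtain \<epsilon> \<delta> where e: "\<epsilon> \<longlonglongrightarrow> (0::real)" "\<delta> \<longlonglongrightarrow> (0::real)"
    "\<And>n w. w \<in> carr (Kn n) \<Longrightarrow> \<forall>i\<in>I. a i w = 0 \<Longrightarrow> cmod (ip (Kn n) w u) \<le> \<epsilon> n * hnorm (Kn n) w"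
    "\<And>n w. w \<in> carr (Kn n) \<Longrightarrow> \<forall>i\<in>I. a i w = 0 \<Longrightarrow> cmod (ip (Kn n) w v) \<le> \<delta> n * hnorm (Kn n) w"
    using u(2) v(2) unfolding asymp_perp_def by blast
  have "cmod (ip (Kn n) w (u + v)) \<le> (\<epsilon> n + \<delta> n) * hnorm (Kn n) w"
    if w: "w \<in> carr (Kn n)" "\<forall>i\<in>I. a i w = 0" for n w
  proof -
    interpret Wn: form_operator "Kn n" H a b I by (rule Wn)
    have "cmod (ip (Kn n) w (u + v)) \<le> cmod (ip (Kn n) w u) + cmod (ip (Kn n) w v)"
      using w u v carr_Kn by (simp add: Wn.K.ip_add_right norm_triangle_ineq)
    then show ?thesis using e(3)[OF w] e(4)[OF w] by (simp add: distrib_right)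
  qed
  moreover have "(\<lambda>n. \<epsilon> n + \<delta> n) \<longlonglongrightarrow> 0" using tendsto_add[OF e(1,2)] by simp
  ultimately have "asymp_perp Kn a I (u + v)"
    unfolding asymp_perp_def by (intro exI[of _ "\<lambda>n. \<epsilon> n + \<delta> n"]) auto
  then show "u + v \<in> {y \<in> carr K. asymp_perp Kn a I y}" using u v by (simp add: W.K.add_carr)
next
  fix s u assume "u \<in> {y \<in> carr K. asymp_perp Kn a I y}"
  then have u: "u \<in> carr K" "asymp_perp Kn a I u" by auto
  obtain \<epsilon> where e: "\<epsilon> \<longlonglongrightarrow> (0::real)"
    "\<And>n w. w \<in> carr (Kn n) \<Longrightarrow> \<forall>i\<in>I. a i w = 0 \<Longrightarrow> cmod (ip (Kn n) w u) \<le> \<epsilon> n * hnorm (Kn n) w"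
    using u(2) unfolding asymp_perp_def by blast
  have "cmod (ip (Kn n) w (cscale s u)) \<le> (cmod s * \<epsilon> n) * hnorm (Kn n) w"
    if w: "w \<in> carr (Kn n)" "\<forall>i\<in>I. a i w = 0" for n w
  proof -
    interpret Wn: form_operator "Kn n" H a b I by (rule Wn)
    have "cmod (ip (Kn n) w (cscale s u)) = cmod s * cmod (ip (Kn n) w u)"
      using w u carr_Kn by (simp add: Wn.K.ip_scale_right norm_mult)
    also have "\<dots> \<le> cmod s * (\<epsilon> n * hnorm (Kn n) w)" using e(2)[OF w] by (intro mult_left_mono) auto
    finally show ?thesis by (simp add: mult.assoc)
  qed
  moreover have "(\<lambda>n. cmod s * \<epsilon> n) \<longlonglongrightarrow> 0" using tendsto_mult_left[OF e(1), of "cmod s"] by simp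
  ultimately have "asymp_perp Kn a I (cscale s u)"
    unfolding asymp_perp_def by (intro exI[of _ "\<lambda>n. cmod s * \<epsilon> n"]) auto
  then show "cscale s u \<in> {y \<in> carr K. asymp_perp Kn a I y}" using u by (simp add: W.K.scale_carr)
qed auto

text \<open>The identity \<open>kv\<close> holds for the component of v n in the kernel of the n-th
  operator. As x is only a limit of asymptotically orthogonal vectors y, the square of k n is split
  into <k n, v n - y> and <k n, y>: the first is small by \<open>nrm_Kn\<close>, the second by
  \<open>asymp_perp\<close>.\<close>

lemma component_tendsto_zero:
  assumes x: "x \<in> W.perp" and v: "\<And>n. v n \<in> carr K" and v0: "(\<lambda>n. hnorm K (v n - x)) \<longlonglongrightarrow> 0"
    and k: "\<And>n. k n \<in> carr (Kn n)" "\<And>n i. i \<in> I \<Longrightarrow> a i (k n) = 0"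
    and kv: "\<And>n. ip (Kn n) (k n) (k n) = ip (Kn n) (k n) (v n)"
  shows "(\<lambda>n. hnorm (Kn n) (k n)) \<longlonglongrightarrow> 0"
proof (rule LIMSEQ_I)
  fix r :: real assume r: "r > 0"
  \<comment> \<open>The distance of v n and y becomes at most 2 e in \<open>K\<close>, so at most r
    / 2 in \<open>Kn n\<close>; together with r / 4 from the pairing with y this stays below
    r.\<close>
  define e where "e = r / (4 * (C + 1))"
  have e: "e > 0" "C * e \<le> r / 4" using r C_nonneg by (auto simp: e_def field_simps)
  have xc: "x \<in> carr K" using x by (simp add: W.perp_def)
  have "\<exists>y\<in>{y \<in> carr K. asymp_perp Kn a I y}. W.K.nrm (x - y) < e"
    by (rule W.perp_approx[OF csub_asymp_perp x e(1)]) (auto intro: asymp_perp_functional)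
  then obtain y where y: "y \<in> carr K" "asymp_perp Kn a I y" "W.K.nrm (x - y) < e" by blast
  obtain \<epsilon> where \<epsilon>: "\<epsilon> \<longlonglongrightarrow> (0::real)"
    "\<And>n w. w \<in> carr (Kn n) \<Longrightarrow> \<forall>i\<in>I. a i w = 0 \<Longrightarrow> cmod (ip (Kn n) w y) \<le> \<epsilon> n * hnorm (Kn n) w"
    using y(2) unfolding asymp_perp_def by blast
  have "\<forall>\<^sub>F n in sequentially. W.K.nrm (v n - x) < e \<and> \<epsilon> n < r / 4"
    using order_tendstoD(2)[OF v0 e(1)] order_tendstoD(2)[OF \<epsilon>(1), of "r/4"] r
    by (auto intro: eventually_conj)
  then obtain N where N: "\<And>n. n \<ge> N \<Longrightarrow> W.K.nrm (v n - x) < e \<and> \<epsilon> n < r / 4"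
    by (auto simp: eventually_sequentially)
  have "norm (hnorm (Kn n) (k n) - 0) < r" if n: "n \<ge> N" for n
  proof -
    interpret Wn: form_operator "Kn n" H a b I by (rule Wn)
    have kc: "k n \<in> carr (Kn n)" by (rule k)
    have "W.K.nrm (v n - y) \<le> W.K.nrm (v n - x) + W.K.nrm (x - y)"
      by (rule W.K.nrm_triangle_diff[OF v xc y(1)])
    also have "\<dots> \<le> 2 * e" using N[OF n] y(3) by simp
    finally have "C * W.K.nrm (v n - y) \<le> C * (2 * e)" using C_nonneg by (intro mult_left_mono)
    then have vy: "Wn.K.nrm (v n - y) \<le> r / 2"
      using nrm_Kn[OF W.K.diff_carr[OF v y(1)], of n n] e(2) by linarith
    have c: "v n \<in> carr (Kn n)" "y \<in> carr (Kn n)" using carr_Kn v y by auto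
    have "(Wn.K.nrm (k n))\<^sup>2 = Re (ip (Kn n) (k n) (v n - y)) + Re (ip (Kn n) (k n) y)"
      using kc c kv[of n] by (simp add: Wn.K.nrm_sq Wn.K.ip_diff_right)
    also have "\<dots> \<le> Wn.K.nrm (k n) * Wn.K.nrm (v n - y) + \<epsilon> n * Wn.K.nrm (k n)"
      using \<epsilon>(2)[OF kc] k(2) complex_Re_le_cmod[of "ip (Kn n) (k n) y"]
      by (intro add_mono Wn.K.Re_ip_le Wn.K.diff_carr kc c) auto
    also have "\<dots> \<le> Wn.K.nrm (k n) * (r / 2) + (r / 4) * Wn.K.nrm (k n)"
      using vy N[OF n] Wn.K.nrm_nonneg[OF kc] by (intro add_mono mult_left_mono mult_right_mono) auto
    finally have "Wn.K.nrm (k n) * Wn.K.nrm (k n) \<le> (3 * r / 4) * Wn.K.nrm (k n)"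
      by (simp add: power2_eq_square algebra_simps)
    then have "Wn.K.nrm (k n) \<le> 3 * r / 4"
      using Wn.K.nrm_nonneg[OF kc] r by (cases "Wn.K.nrm (k n) = 0") auto
    then show ?thesis using Wn.K.nrm_nonneg[OF kc] r by simp
  qed
  then show "\<exists>N. \<forall>n\<ge>N. norm (hnorm (Kn n) (k n) - 0) < r" by blast
qed

text \<open>A subsequence staying away from x has, by compactness of \<open>G\<close>, a further one
  along which v converges to some w in \<open>perp\<close>. All \<open>a i\<close> agree on w and x,
  and they separate the points of \<open>perp\<close> up to norm 0, which is a
  contradiction.\<close>

lemma compact_weak_to_strong:
  assumes cp: "compact_op H K G" and bd: "\<And>n. \<alpha> n \<in> carr H" "\<And>n. hnorm H (\<alpha> n) \<le> M"
    and v: "\<And>n. v n \<in> W.perp" "\<And>n. hnorm K (G (\<alpha> n) - v n) = 0"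
    and x: "x \<in> W.perp" and lim: "\<And>i. i \<in> I \<Longrightarrow> (\<lambda>n. a i (v n)) \<longlonglongrightarrow> a i x"
  shows "(\<lambda>n. hnorm K (v n - x)) \<longlonglongrightarrow> 0"
proof (rule ccontr)
  assume "\<not> ?thesis"
  then obtain r where r: "r > 0" "\<And>N. \<exists>n\<ge>N. \<not> norm (hnorm K (v n - x) - 0) < r"
    unfolding LIMSEQ_iff by blast
  have pc: "y \<in> carr K" if "y \<in> W.perp" for y using that by (simp add: W.perp_def)
  have xc: "x \<in> carr K" and vc: "v n \<in> carr K" for n using x v pc by auto
  have "\<exists>\<^sub>\<infinity>n. r \<le> hnorm K (v n - x)"
    unfolding INFM_nat_le using r(2) W.K.nrm_nonneg[OF W.K.diff_carr[OF vc xc]]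
    by (metis abs_of_nonneg diff_zero not_le real_norm_def)
  then have inf: "infinite {n. r \<le> hnorm K (v n - x)}" by (simp add: INFM_iff_infinite)
  define f where "f = enumerate {n. r \<le> hnorm K (v n - x)}"
  have f: "strict_mono f" "\<And>n. r \<le> hnorm K (v (f n) - x)"
    using strict_mono_enumerate[OF inf] enumerate_in_set[OF inf] by (auto simp: f_def)
  have "(\<forall>n. (\<alpha> \<circ> f) n \<in> carr H) \<and> (\<exists>C. \<forall>n. hnorm H ((\<alpha> \<circ> f) n) \<le> C)" using bd by auto
  then obtain g w where gw: "strict_mono g" "w \<in> carr K"
    "(\<lambda>n. hnorm K (G ((\<alpha> \<circ> f) (g n)) - w)) \<longlonglongrightarrow> 0"
    using cp unfolding compact_op_def by blast
  define h where "h = f \<circ> g"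
  have h: "strict_mono h" using f gw by (simp add: h_def strict_mono_o)
  have Gc: "G (\<alpha> n) \<in> carr K" for n using cp bd by (auto simp: compact_op_def bounded_op_def)
  have vw: "(\<lambda>n. hnorm K (v (h n) - w)) \<longlonglongrightarrow> 0"
  proof (rule tendsto_sandwich[OF _ _ tendsto_const gw(3)])
    show "\<forall>\<^sub>F n in sequentially. hnorm K (v (h n) - w) \<le> hnorm K (G ((\<alpha> \<circ> f) (g n)) - w)"
    proof (intro always_eventually allI)
      fix n
      show "hnorm K (v (h n) - w) \<le> hnorm K (G ((\<alpha> \<circ> f) (g n)) - w)"
        using W.K.nrm_triangle_diff[OF vc Gc gw(2), of "h n" "h n"] v(2)[of "h n"]
          W.K.nrm_diff_sym[OF vc Gc, of "h n" "h n"] by (simp add: h_def)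
    qed
    show "\<forall>\<^sub>F n in sequentially. 0 \<le> hnorm K (v (h n) - w)"
      by (intro always_eventually allI W.K.nrm_nonneg W.K.diff_carr vc gw)
  qed
  have "w \<in> W.perp"
    using W.closed_perp[unfolded W.K.closedH_def, rule_format, of "\<lambda>n. v (h n)" w] v(1) gw(2) vw by simp
  then have wx: "w - x \<in> W.perp" using W.K.csub_diff[OF W.csub_perp] x by blast
  have "a i w = a i x" if i: "i \<in> I" for i
  proof (rule LIMSEQ_unique)
    show "(\<lambda>n. a i (v (h n))) \<longlonglongrightarrow> a i w" by (rule W.K.bfun_tendsto[OF W.bfun_a[OF i] vc gw(2) vw])
    show "(\<lambda>n. a i (v (h n))) \<longlonglongrightarrow> a i x" using LIMSEQ_subseq_LIMSEQ[OF lim[OF i] h] by (simp add: o_def)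
  qed
  then have "w - x \<in> W.ker"
    using gw(2) xc by (auto simp: W.ker_def W.K.diff_carr W.K.bfun_diff[OF W.bfun_a])
  then have wx0: "hnorm K (w - x) = 0" using wx W.perp_ker_null by blast
  have "r \<le> hnorm K (v (h n) - w)" for n
    using f(2)[of "g n"] W.K.nrm_triangle_diff[OF vc gw(2) xc, of "h n"] wx0 by (simp add: h_def)
  then have "r \<le> 0" by (intro LIMSEQ_le_const[OF vw]) auto
  then show False using r by simp
qed

text \<open>As the ranges coincide, one projection P serves for all n, and \<open>G\<close> applied
  to P (\<alpha> n) is a solution in \<open>K\<close>, hence in every \<open>Kn n\<close>, of the
  equation whose minimal solution the n-th Green operator gives. Compactness makes these solutions
  converge; what remains are kernel components, to which \<open>component_tendsto_zero\<close>
  applies.\<close>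

theorem green_compactly_converges:
  assumes cl: "W.H.closedH (Range W.T)"
    and R: "\<And>n. Range (weak_graph (Kn n) H a b I) = Range W.T"
    and cp: "compact_op H K (green K H W.T)"
  shows "compactly_converges H K Kn (\<lambda>n. green (Kn n) H (weak_graph (Kn n) H a b I)) (green K H W.T)"
  unfolding compactly_converges_def
proof (intro conjI allI impI)
  let ?G = "green K H W.T"
  let ?Gn = "\<lambda>n. green (Kn n) H (weak_graph (Kn n) H a b I)"
  have G: "is_green K H W.T ?G" by (rule W.is_green_green[OF cl])
  have Gn: "is_green (Kn n) H (weak_graph (Kn n) H a b I) (?Gn n)" for n
  proof -
    interpret Wn: form_operator "Kn n" H a b I by (rule Wn)
    show ?thesis by (rule Wn.is_green_green) (simp add: R cl)
  qed
  show "bounded_op H K ?G" using G by (simp add: is_green_def)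
  show "bounded_op H (Kn n) (?Gn n)" for n using Gn by (simp add: is_green_def)
  fix \<alpha> \<alpha>' assume wc: "weakly_converges H \<alpha> \<alpha>'"
  then have ac: "\<alpha> n \<in> carr H" "\<alpha>' \<in> carr H" for n by (auto simp: weakly_converges_def)
  have "\<exists>p. p \<in> Range W.T \<and> (\<forall>w\<in>Range W.T. ip H (u - p) w = 0)" if "u \<in> carr H" for u
    using W.Range_projection[OF cl that] by blast
  then obtain P where P: "\<And>u. u \<in> carr H \<Longrightarrow> P u \<in> Range W.T"
    "\<And>u. u \<in> carr H \<Longrightarrow> \<forall>w\<in>Range W.T. ip H (u - P u) w = 0" by metis
  define v where "v n = ?G (P (\<alpha> n))" for n
  define x where "x = ?G (P \<alpha>')"
  have Pc: "P u \<in> carr H" if "u \<in> carr H" for u using P(1)[OF that] W.T_carr by blast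
  have v: "v n \<in> W.perp" "(v n, P (\<alpha> n)) \<in> W.T" "hnorm K (?G (\<alpha> n) - v n) = 0" for n
    unfolding v_def using W.green_decomp[OF cl G ac(1) P(1)[OF ac(1)] P(2)[OF ac(1)]] by auto
  have x: "x \<in> W.perp" "(x, P \<alpha>') \<in> W.T" "hnorm K (?G \<alpha>' - x) = 0" "?G \<alpha>' \<in> carr K"
    unfolding x_def using W.green_decomp[OF cl G ac(2) P(1)[OF ac(2)] P(2)[OF ac(2)]] by auto
  have vc: "v n \<in> carr K" and xc: "x \<in> carr K" for n using v(2) x(2) W.T_carr by blast+
  obtain M where M: "\<And>n. hnorm H (\<alpha> n) \<le> M" using W.H.weakly_convergent_bounded[OF wc] by blast
  have pair: "ip H (P u) w = ip H u w" if u: "u \<in> carr H" and w: "w \<in> Range W.T" for u w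
  proof -
    have "ip H (u - P u) w = 0" using P(2)[OF u] w by blast
    moreover have "w \<in> carr H" using w W.T_carr by blast
    ultimately show ?thesis using u Pc by (simp add: W.H.ip_diff)
  qed
  \<comment> \<open>Weak convergence passes to each functional: \<open>b i\<close> after the
    self-adjoint projection P is again the pairing with a fixed vector, namely P z.\<close>
  have lim: "(\<lambda>n. a i (v n)) \<longlonglongrightarrow> a i x" if i: "i \<in> I" for i
  proof -
    obtain z where z: "z \<in> carr H" "\<And>u. u \<in> carr H \<Longrightarrow> b i u = ip H u z"
      using W.H.bfun_riesz[OF W.bfun_b[OF i]] by blast
    have eq: "b i (P u) = ip H u (P z)" if u: "u \<in> carr H" for u
    proof -
      have Pz: "P z \<in> Range W.T" "P u \<in> Range W.T" using P z u by auto
      have "ip H (P u) z = cnj (ip H z (P u))" using W.H.ip_cnj[OF z(1) Pc[OF u]] .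
      also have "ip H z (P u) = ip H (P z) (P u)" using pair[OF z(1) Pz(2)] by simp
      also have "cnj \<dots> = ip H (P u) (P z)" using W.H.ip_cnj[OF Pc[OF z(1)] Pc[OF u]] by simp
      also have "\<dots> = ip H u (P z)" by (rule pair[OF u Pz(1)])
      finally show ?thesis using z(2)[OF Pc[OF u]] by simp
    qed
    have "(\<lambda>n. ip H (\<alpha> n) (P z)) \<longlonglongrightarrow> ip H \<alpha>' (P z)"
      using wc Pc[OF z(1)] by (simp add: weakly_converges_def)
    then have "(\<lambda>n. b i (P (\<alpha> n))) \<longlonglongrightarrow> b i (P \<alpha>')" using eq ac by simp
    moreover have "a i (v n) = b i (P (\<alpha> n))" "a i x = b i (P \<alpha>')" for n
      using v(2)[of n] x(2) i by (auto simp: weak_graph_def)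
    ultimately show ?thesis by simp
  qed
  have vx: "(\<lambda>n. hnorm K (v n - x)) \<longlonglongrightarrow> 0"
    by (rule compact_weak_to_strong[OF cp ac(1) M v(1,3) x(1) lim])
  define y where "y n = ?Gn n (P (\<alpha> n))" for n
  \<comment> \<open>Both v n and y n solve the same equation and y n is orthogonal to the kernel, so
    v n - y n is the projection of v n to the kernel.\<close>
  have y: "hnorm (Kn n) (?Gn n (\<alpha> n) - y n) = 0" "?Gn n (\<alpha> n) \<in> carr (Kn n)" "y n \<in> carr (Kn n)"
    "v n - y n \<in> carr (Kn n)" "\<forall>i\<in>I. a i (v n - y n) = 0"
    "ip (Kn n) (v n - y n) (v n - y n) = ip (Kn n) (v n - y n) (v n)" for n
  proof -
    interpret Wn: form_operator "Kn n" H a b I by (rule Wn)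
    have cl': "W.H.closedH (Range Wn.T)" by (simp add: R cl)
    have P': "P (\<alpha> n) \<in> Range Wn.T" "\<forall>w\<in>Range Wn.T. ip H (\<alpha> n - P (\<alpha> n)) w = 0"
      using P[OF ac(1)] by (auto simp: R)
    note d = Wn.green_decomp[OF cl' Gn ac(1) P']
    show "hnorm (Kn n) (?Gn n (\<alpha> n) - y n) = 0" "?Gn n (\<alpha> n) \<in> carr (Kn n)"
      unfolding y_def using d by auto
    have yp: "y n \<in> Wn.perp" "(y n, P (\<alpha> n)) \<in> Wn.T" unfolding y_def using d by auto
    show yc: "y n \<in> carr (Kn n)" using yp Wn.T_carr by blast
    have vc': "v n \<in> carr (Kn n)" by (rule carr_Kn[OF vc])
    have "(v n, P (\<alpha> n)) \<in> Wn.T" using v(2)[of n] vc' by (auto simp: weak_graph_def)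
    then have k: "v n - y n \<in> Wn.ker" using Wn.T_eq_ker yp by blast
    then show "v n - y n \<in> carr (Kn n)" "\<forall>i\<in>I. a i (v n - y n) = 0" by (auto simp: Wn.ker_def)
    have "ip (Kn n) (y n) (v n - y n) = 0" using yp k by (simp add: Wn.perp_def)
    then have "ip (Kn n) (v n - y n) (y n) = 0"
      using Wn.K.ip_cnj[OF yc Wn.ker_carr[OF k]] by simp
    then show "ip (Kn n) (v n - y n) (v n - y n) = ip (Kn n) (v n - y n) (v n)"
      using Wn.K.ip_diff_right[OF vc' yc Wn.ker_carr[OF k]] by simp
  qed
  have k0: "(\<lambda>n. hnorm (Kn n) (v n - y n)) \<longlonglongrightarrow> 0"
    by (rule component_tendsto_zero[OF x(1) vc vx y(4) _ y(6)]) (use y(5) in auto)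
  have fin: "(\<lambda>n. hnorm (Kn n) (?G \<alpha>' - ?Gn n (\<alpha> n))) \<longlonglongrightarrow> 0"
  proof (rule tendsto_sandwich[OF _ _ tendsto_const])
    have "(\<lambda>n. C * hnorm K (v n - x) + hnorm (Kn n) (v n - y n)) \<longlonglongrightarrow> C * 0 + 0"
      by (intro tendsto_intros vx k0)
    then show "(\<lambda>n. C * hnorm K (v n - x) + hnorm (Kn n) (v n - y n)) \<longlonglongrightarrow> 0" by simp
    have "0 \<le> hnorm (Kn n) (?G \<alpha>' - ?Gn n (\<alpha> n)) \<and> hnorm (Kn n) (?G \<alpha>' - ?Gn n (\<alpha> n)) \<le>
        C * hnorm K (v n - x) + hnorm (Kn n) (v n - y n)" for n
    proof -
      interpret Wn: form_operator "Kn n" H a b I by (rule Wn)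
      have c: "?G \<alpha>' \<in> carr (Kn n)" "x \<in> carr (Kn n)" "v n \<in> carr (Kn n)"
        using carr_Kn x(4) xc vc by auto
      note tri = Wn.K.nrm_triangle_diff
      have 1: "Wn.K.nrm (?G \<alpha>' - ?Gn n (\<alpha> n)) \<le> Wn.K.nrm (?G \<alpha>' - x) + Wn.K.nrm (x - ?Gn n (\<alpha> n))"
        by (intro tri c y)
      have 2: "Wn.K.nrm (x - ?Gn n (\<alpha> n)) \<le> Wn.K.nrm (x - v n) + Wn.K.nrm (v n - ?Gn n (\<alpha> n))"
        by (intro tri c y)
      have 3: "Wn.K.nrm (v n - ?Gn n (\<alpha> n)) \<le> Wn.K.nrm (v n - y n) + Wn.K.nrm (y n - ?Gn n (\<alpha> n))"
        by (intro tri c y)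
      have 4: "Wn.K.nrm (?G \<alpha>' - x) = 0" by (intro null_Kn W.K.diff_carr x xc)
      have 5: "Wn.K.nrm (y n - ?Gn n (\<alpha> n)) = 0" using y(1) Wn.K.nrm_diff_sym[OF y(3) y(2)] by simp
      have 6: "Wn.K.nrm (x - v n) \<le> C * hnorm K (v n - x)"
        using nrm_Kn[OF W.K.diff_carr[OF vc xc], of n n] Wn.K.nrm_diff_sym[OF c(2,3)] by simp
      have "0 \<le> Wn.K.nrm (?G \<alpha>' - ?Gn n (\<alpha> n))" by (intro Wn.K.nrm_nonneg Wn.K.diff_carr c y)
      then show ?thesis using 1 2 3 4 5 6 by simp
    qed
    then show "\<forall>\<^sub>F n in sequentially. 0 \<le> hnorm (Kn n) (?G \<alpha>' - ?Gn n (\<alpha> n))"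
      "\<forall>\<^sub>F n in sequentially. hnorm (Kn n) (?G \<alpha>' - ?Gn n (\<alpha> n)) \<le>
        C * hnorm K (v n - x) + hnorm (Kn n) (v n - y n)" by auto
  qed
  then have "limsup (\<lambda>n. ereal (hnorm (Kn n) (?G \<alpha>' - ?Gn n (\<alpha> n)))) = 0"
    by (intro lim_imp_Limsup) (auto simp: zero_ereal_def)
  \<comment> \<open>The limit lies in \<open>K\<close> itself, so the net may be constant: the
    filter is principal.\<close>
  then show "strongly_converges K Kn (\<lambda>n. ?Gn n (\<alpha> n)) (?G \<alpha>')"
    unfolding strongly_converges_def using y(2) x(4)
    by (intro conjI allI exI[of _ "principal {?G \<alpha>'}"])
      (auto simp: principal_eq_bot_iff eventually_principal tendsto_principal_singleton intro!: tendsto_eventually)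
qed

end

section \<open>Hermitian forms\<close>

lemma linear_cscale: "linear (\<lambda>v::complex^'m. c *s v)"
  by (rule linearI) (auto simp: vec_eq_iff distrib_left)

lemma of_real_cscale: "complex_of_real r *s (v::complex^'m) = r *\<^sub>R v"
  by (simp add: vec_eq_iff) (simp add: scaleR_conv_of_real)

lemma ii_scaleR: "c *s (r *\<^sub>R v) = r *\<^sub>R (c *s (v::complex^'m))"
  by (auto simp: vec_eq_iff scaleR_conv_of_real)

definition J_inv :: "(complex^'m::finite \<Rightarrow> complex^'m \<Rightarrow> real) \<Rightarrow> bool" where
  "J_inv b \<longleftrightarrow> (\<forall>v w. b (\<i> *s v) (\<i> *s w) = b v w)"

definition real_frame :: "('m \<Rightarrow> complex^'m::finite) \<Rightarrow> 'm + 'm \<Rightarrow> complex^'m" where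
  "real_frame u a = (case a of Inl j \<Rightarrow> u j | Inr j \<Rightarrow> \<i> *s u j)"

definition frame_index :: "'m + 'm \<Rightarrow> 'm" where
  "frame_index a = (case a of Inl j \<Rightarrow> j | Inr j \<Rightarrow> j)"

text \<open>Hermitian forms are handled through their real parts. Definiteness is kept separate so
  that the pseudometric is covered outside \<open>A\<close> as well.\<close>

definition hform :: "(complex^'m::finite \<Rightarrow> complex^'m \<Rightarrow> real) \<Rightarrow> bool" where
  "hform b \<longleftrightarrow> symmetric_bilinear b \<and> J_inv b"

lemma hform_bilinear: "hform b \<Longrightarrow> bilinear b"
  by (simp add: hform_def symmetric_bilinear_def)

lemma hform_sym: "hform b \<Longrightarrow> b v w = b w v"
  by (simp add: hform_def symmetric_bilinear_def)

lemma hform_ii: "hform b \<Longrightarrow> b (\<i> *s v) (\<i> *s w) = b v w"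
  by (simp add: hform_def J_inv_def)

lemma hform_ii_right: assumes "hform b" shows "b v (\<i> *s w) = - b (\<i> *s v) w"
proof -
  have "b v (\<i> *s w) = b (\<i> *s v) (- w)" using hform_ii[OF assms, of v "\<i> *s w"] by simp
  then show ?thesis by (simp add: bilinear_rneg[OF hform_bilinear[OF assms]])
qed

lemma hform_ii_self: assumes "hform b" shows "b v (\<i> *s v) = 0"
  using hform_ii_right[OF assms, of v v] hform_sym[OF assms, of v "\<i> *s v"] by simp

lemma bilinear_continuous:
  fixes b :: "complex^'m::finite \<Rightarrow> complex^'m \<Rightarrow> real"
  assumes "bilinear b" shows "continuous_on S (\<lambda>v. b v v)"
  using bilinear_continuous_on_compose[OF continuous_on_id continuous_on_id assms] by simp

text \<open>The form may be degenerate; writing b u w as an inner product with A u reduces the claim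
  to the Euclidean one.\<close>

lemma bilinear_orthogonal_exists:
  fixes b :: "complex^'m::finite \<Rightarrow> complex^'m \<Rightarrow> real"
  assumes b: "bilinear b" and S: "finite S" "card S < DIM(complex^'m)"
  shows "\<exists>w. w \<noteq> 0 \<and> (\<forall>u\<in>S. b u w = 0)"
proof -
  define A where "A u = (\<Sum>i\<in>Basis. b u i *\<^sub>R i)" for u
  have A: "inner (A u) w = b u w" for u w
  proof -
    have "b u w = b u (\<Sum>i\<in>Basis. (w \<bullet> i) *\<^sub>R i)" by (simp add: euclidean_representation)
    also have "\<dots> = (\<Sum>i\<in>Basis. (w \<bullet> i) * b u i)"
      using b by (simp add: bilinear_def linear_sum linear_scale)
    finally show ?thesis by (simp add: A_def inner_sum_left inner_commute[of _ w] inner_sum_right mult.commute)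
  qed
  have "dim (A ` S) \<le> card (A ` S)" using S by (intro dim_le_card') auto
  also have "\<dots> \<le> card S" using S by (intro card_image_le)
  finally have "dim (A ` S) < DIM(complex^'m)" using S by simp
  from orthogonal_to_subspace_exists[OF this]
  obtain x where "x \<noteq> 0" "\<And>y. y \<in> span (A ` S) \<Longrightarrow> orthogonal x y" by blast
  then show ?thesis
    unfolding A[symmetric] by (intro exI[of _ x]) (metis orthogonal_def inner_commute imageI span_base)
qed

text \<open>The vector maximizing \<open>g\<close> relative to \<open>h\<close> on a complex subspace is orthogonal to its
  \<open>h\<close>-orthogonal complement also with respect to \<open>g\<close>.\<close>

lemma max_vector:
  fixes g h :: "complex^'m::finite \<Rightarrow> complex^'m \<Rightarrow> real"
  assumes g: "hform g" and h: "hform h" "pos_def h"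
    and W: "subspace W" "\<And>w. w \<in> W \<Longrightarrow> \<i> *s w \<in> W" "\<exists>w\<in>W. w \<noteq> 0"
  shows "\<exists>v\<in>W. h v v = 1 \<and> (\<forall>w\<in>W. h v w = 0 \<longrightarrow> h v (\<i> *s w) = 0 \<longrightarrow> g v w = 0 \<and> g v (\<i> *s w) = 0)"
proof -
  note bg = hform_bilinear[OF g] and bh = hform_bilinear[OF h(1)]
  obtain w0 where w0: "w0 \<in> W" "w0 \<noteq> 0" using W(3) by blast
  let ?S = "sphere 0 1 \<inter> W"
  have "compact ?S" using W(1) by (intro compact_Int_closed compact_sphere closed_subspace)
  moreover have "(1 / norm w0) *\<^sub>R w0 \<in> ?S" using w0 W(1) by (auto intro: subspace_scale)
  moreover have hp: "h v v > 0" if "v \<in> ?S" for v using h(2) that by (auto simp: pos_def_def) (metis norm_zero zero_neq_one)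
  then have "continuous_on ?S (\<lambda>v. g v v / h v v)"
    by (intro continuous_on_divide bilinear_continuous bg bh) fastforce
  ultimately obtain v where v: "v \<in> ?S" "\<And>w. w \<in> ?S \<Longrightarrow> g w w / h w w \<le> g v v / h v v"
    using continuous_attains_sup[of ?S "\<lambda>v. g v v / h v v"] by blast
  define M where "M = g v v / h v v"
  have M: "g w w \<le> M * h w w" if w: "w \<in> W" for w
  proof (cases "w = 0")
    case True then show ?thesis by (simp add: bilinear_lzero[OF bg] bilinear_lzero[OF bh])
  next
    case False
    let ?w = "(1 / norm w) *\<^sub>R w"
    have "?w \<in> ?S" using False w W(1) by (auto intro: subspace_scale)
    from v(2)[OF this] hp[OF this] have "g ?w ?w \<le> M * h ?w ?w" by (simp add: M_def field_simps)
    then have "(1 / norm w)\<^sup>2 * g w w \<le> (1 / norm w)\<^sup>2 * (M * h w w)"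
      by (simp add: bilinear_lmul[OF bg] bilinear_rmul[OF bg] bilinear_lmul[OF bh] bilinear_rmul[OF bh]
          power2_eq_square)
    then show ?thesis using False by (subst (asm) mult_le_cancel_left_pos) auto
  qed
  have vW: "v \<in> W" using v by simp
  have hv: "h v v > 0" by (rule hp[OF v(1)])
  have Mv: "g v v = M * h v v" using hv by (simp add: M_def)
  \<comment> \<open>The form M h - g is nonnegative on W and vanishes at v, so its first-order term
    along w vanishes; the contribution of h to that term is 0 by assumption.\<close>
  have orth: "g v w = 0" if w: "w \<in> W" "h v w = 0" for w
  proof (rule real_le_zero_if_quadratic[of "M * h w w - g w w"])
    show "0 \<le> M * h w w - g w w" using M[OF w(1)] by simp
    fix t :: real
    have "v + t *\<^sub>R w \<in> W" using W(1) vW w(1) by (intro subspace_add subspace_scale)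
    from M[OF this] show "2 * t * g v w \<le> t\<^sup>2 * (M * h w w - g w w)"
      using w(2) hform_sym[OF g, of w v] hform_sym[OF h(1), of w v] Mv
      by (simp add: bilinear_ladd[OF bg] bilinear_radd[OF bg] bilinear_ladd[OF bh] bilinear_radd[OF bh]
          bilinear_lmul[OF bg] bilinear_rmul[OF bg] bilinear_lmul[OF bh] bilinear_rmul[OF bh]
          power2_eq_square algebra_simps)
  qed
  let ?v = "(1 / sqrt (h v v)) *\<^sub>R v"
  show ?thesis
  proof (intro bexI[of _ ?v] conjI ballI impI)
    show "h ?v ?v = 1" using hv
      by (simp add: bilinear_lmul[OF bh] bilinear_rmul[OF bh] field_simps flip: power2_eq_square)
    show "?v \<in> W" using W(1) vW by (intro subspace_scale)
    fix w assume w: "w \<in> W" "h ?v w = 0" "h ?v (\<i> *s w) = 0"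
    then have "h v w = 0" "h v (\<i> *s w) = 0" using hv by (auto simp: bilinear_lmul[OF bh])
    then show "g ?v w = 0" "g ?v (\<i> *s w) = 0"
      using orth[OF w(1)] orth[OF W(2)[OF w(1)]] by (auto simp: bilinear_lmul[OF bg])
  qed
qed

text \<open>For a Hermitian form this is orthogonality over the complex numbers, since b v (\<i> w)
  is the imaginary part of the Hermitian product up to sign.\<close>

definition corth :: "(complex^'m::finite \<Rightarrow> complex^'m \<Rightarrow> real) \<Rightarrow> complex^'m \<Rightarrow> complex^'m \<Rightarrow> bool" where
  "corth b v w \<longleftrightarrow> b v w = 0 \<and> b v (\<i> *s w) = 0"

lemma corth_sym: "hform b \<Longrightarrow> corth b v w \<Longrightarrow> corth b w v"
  using hform_ii_right[of b w v] hform_sym[of b v w] hform_sym[of b v "\<i> *s w"]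
  by (simp add: corth_def)

text \<open>The third conjunct carries the induction: the next vector is chosen by
  \<open>max_vector\<close> in the h-complement of the previous ones, and it must be orthogonal to
  them for g, too.\<close>

lemma partial_diagonalization:
  fixes g h :: "complex^'m::finite \<Rightarrow> complex^'m \<Rightarrow> real"
  assumes g: "hform g" and h: "hform h" "pos_def h"
  shows "\<exists>u :: 'm \<Rightarrow> complex^'m. (\<forall>j\<in>F. h (u j) (u j) = 1) \<and> (\<forall>j\<in>F. \<forall>k\<in>F. j \<noteq> k \<longrightarrow> corth h (u j) (u k) \<and> corth g (u j) (u k)) \<and>
     (\<forall>w. (\<forall>j\<in>F. corth h (u j) w) \<longrightarrow> (\<forall>j\<in>F. corth g (u j) w))"
  (is "\<exists>u. ?P u F")
  using finite[of F]
proof (induction F)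
  case (insert k F)
  then obtain u where u: "?P u F" by blast
  note bg = hform_bilinear[OF g] and bh = hform_bilinear[OF h(1)]
  let ?S = "u ` F \<union> (\<lambda>j. \<i> *s u j) ` F"
  define W where "W = {w. \<forall>j\<in>F. corth h (u j) w}"
  \<comment> \<open>Each complex vector imposes two real conditions, so a nonzero vector remains as
    long as an index is left.\<close>
  have "card ?S \<le> 2 * card F"
    using card_Un_le[of "u ` F" "(\<lambda>j. \<i> *s u j) ` F"] card_image_le[OF finite, of u F]
      card_image_le[OF finite, of "\<lambda>j. \<i> *s u j" F] by linarith
  also have "\<dots> < 2 * CARD('m)"
    using insert(2) psubset_card_mono[of UNIV F] by auto
  finally have "card ?S < DIM(complex^'m)" by simp
  from bilinear_orthogonal_exists[OF bh _ this]
  obtain w0 where w0: "w0 \<noteq> 0" "\<forall>u\<in>?S. h u w0 = 0" by auto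
  have "corth h (u j) w0" if "j \<in> F" for j
    using w0(2) that hform_ii_right[OF h(1), of "u j" w0] by (auto simp: corth_def)
  then have "\<exists>w\<in>W. w \<noteq> 0" using w0 by (auto simp: W_def)
  moreover have "subspace W"
    by (auto simp: subspace_def W_def corth_def bilinear_rzero[OF bh] bilinear_radd[OF bh] bilinear_rmul[OF bh]
        ii_scaleR)
  moreover have "\<i> *s w \<in> W" if "w \<in> W" for w
    using that by (auto simp: W_def corth_def bilinear_rneg[OF bh])
  ultimately have "\<exists>v\<in>W. h v v = 1 \<and>
      (\<forall>w\<in>W. h v w = 0 \<longrightarrow> h v (\<i> *s w) = 0 \<longrightarrow> g v w = 0 \<and> g v (\<i> *s w) = 0)"
    by (intro max_vector[OF g h]) auto
  then obtain v where v: "v \<in> W" "h v v = 1"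
    "\<And>w. w \<in> W \<Longrightarrow> h v w = 0 \<Longrightarrow> h v (\<i> *s w) = 0 \<Longrightarrow> g v w = 0 \<and> g v (\<i> *s w) = 0"
    by blast
  have hv: "corth h (u j) v" if "j \<in> F" for j using v(1) that by (simp add: W_def)
  then have gv: "corth g (u j) v" if "j \<in> F" for j using u that by blast
  have "?P (u(k := v)) (insert k F)"
  proof (intro conjI ballI allI impI)
    fix j assume "j \<in> insert k F"
    then show "h ((u(k := v)) j) ((u(k := v)) j) = 1" using u v(2) by auto
  next
    fix i j assume "i \<in> insert k F" "j \<in> insert k F" "i \<noteq> j"
    then show "corth h ((u(k := v)) i) ((u(k := v)) j)" "corth g ((u(k := v)) i) ((u(k := v)) j)"
      using u hv gv corth_sym[OF h(1) hv] corth_sym[OF g gv] insert(2) by auto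
  next
    fix w j assume w: "\<forall>j\<in>insert k F. corth h ((u(k := v)) j) w" and j: "j \<in> insert k F"
    have wF: "\<forall>j\<in>F. corth h (u j) w"
    proof
      fix j assume "j \<in> F"
      then show "corth h (u j) w" using w insert(2) by (metis fun_upd_apply insertCI)
    qed
    have "corth h v w" using w by simp
    then have "corth g v w" using v(3)[of w] wF by (simp add: W_def corth_def)
    then show "corth g ((u(k := v)) j) w" using u wF j by auto
  qed
  then show ?case by blast
qed auto

text \<open>The eigenvalue depends on the complex index only. Hence each occurs twice in the real
  Gram determinant, whose square root is then a plain product over \<open>'m\<close>.\<close>

theorem simultaneous_diagonalization:
  fixes g h :: "complex^'m::finite \<Rightarrow> complex^'m \<Rightarrow> real"
  assumes g: "hform g" and h: "hform h" "pos_def h"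
  obtains u l where "\<And>a b. h (real_frame u a) (real_frame u b) = (if a = b then 1 else 0)"
    "\<And>a b. g (real_frame u a) (real_frame u b) = (if a = b then l (frame_index a) else 0)"
proof -
  obtain u :: "'m \<Rightarrow> complex^'m" where u: "\<And>j. h (u j) (u j) = 1"
    "\<And>j k. j \<noteq> k \<Longrightarrow> corth h (u j) (u k)" "\<And>j k. j \<noteq> k \<Longrightarrow> corth g (u j) (u k)"
    using partial_diagonalization[OF g h, of UNIV] by auto
  have *: "b (real_frame u a) (real_frame u c) = (if a = c then b (u (frame_index a)) (u (frame_index a)) else 0)"
    if b: "hform b" and o: "\<And>j k. j \<noteq> k \<Longrightarrow> corth b (u j) (u k)" for b a c
  proof -
    have 1: "b (\<i> *s v) w = - b v (\<i> *s w)" for v w using hform_ii_right[OF b, of v w] by simp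
    have 2: "b (u j) (u k) = 0" "b (u j) (\<i> *s u k) = 0" if "j \<noteq> k" for j k
      using o[OF that] by (auto simp: corth_def)
    show ?thesis
    proof (cases a; cases c)
      fix j k assume "a = Inr j" "c = Inl k"
      then show ?thesis using 2 hform_ii_self[OF b] by (cases "j = k") (auto simp: real_frame_def 1)
    qed (use 2 hform_ii_self[OF b] hform_ii[OF b] in \<open>auto simp: real_frame_def frame_index_def\<close>, metis+)
  qed
  show thesis
  proof (rule that)
    show "h (real_frame u a) (real_frame u b) = (if a = b then 1 else 0)" for a b
      using *[OF h(1) u(2)] u(1) by simp
    show "g (real_frame u a) (real_frame u b) =
        (if a = b then (\<lambda>j. g (u j) (u j)) (frame_index a) else 0)" for a b
      using *[OF g u(3)] by simp
  qed
qed

definition orthonormal :: "(complex^'m::finite \<Rightarrow> complex^'m \<Rightarrow> real) \<Rightarrow> ('m + 'm \<Rightarrow> complex^'m) \<Rightarrow> bool" where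
  "orthonormal b e \<longleftrightarrow> (\<forall>i j. b (e i) (e j) = (if i = j then 1 else 0))"

text \<open>Diagonalizing \<open>b\<close> against itself provides the basis that the choice in
  \<open>orthonormal_basis\<close> presupposes.\<close>

lemma orthonormal_orthonormal_basis:
  fixes b :: "complex^'m::finite \<Rightarrow> complex^'m \<Rightarrow> real"
  assumes "hform b" "pos_def b" shows "orthonormal b (orthonormal_basis b)"
proof -
  obtain u l where u: "\<And>a c. b (real_frame u a) (real_frame u c) = (if a = c then 1 else 0)"
    using simultaneous_diagonalization[OF assms(1) assms] by metis
  have "\<exists>e :: 'm + 'm \<Rightarrow> complex^'m. \<forall>i j. b (e i) (e j) = (if i = j then 1 else 0)"
    by (rule exI[of _ "real_frame u"]) (simp add: u)
  then show ?thesis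
    unfolding orthonormal_def orthonormal_basis_def by (rule someI_ex)
qed

text \<open>Orthonormality gives independence, and the number of vectors is the real dimension, so
  they span.\<close>

lemma parseval:
  fixes b :: "complex^'m::finite \<Rightarrow> complex^'m \<Rightarrow> real"
  assumes b: "bilinear b" and e: "orthonormal b e"
  shows "v = (\<Sum>a\<in>UNIV. b v (e a) *\<^sub>R e a)"
proof -
  have bsum: "b (\<Sum>a\<in>UNIV. f a *\<^sub>R e a) (e c) = f c" for f c
  proof -
    have "b (\<Sum>a\<in>UNIV. f a *\<^sub>R e a) (e c) = (\<Sum>a\<in>UNIV. f a * b (e a) (e c))"
      using b by (simp add: bilinear_def linear_sum[of "\<lambda>x. b x (e c)"] linear_scale[of "\<lambda>x. b x (e c)"])
    also have "\<dots> = (\<Sum>a\<in>UNIV. if a = c then f c else 0)"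
      using e by (intro sum.cong) (auto simp: orthonormal_def)
    also have "\<dots> = f c" by simp
    finally show ?thesis .
  qed
  have inj: "inj e"
    by (rule injI) (use e in \<open>auto simp: orthonormal_def\<close>, metis zero_neq_one)
  have ind: "independent (range e)"
  proof (rule independent_if_scalars_zero)
    fix f x assume s: "(\<Sum>x\<in>range e. f x *\<^sub>R x) = 0" and x: "x \<in> range e"
    have "(\<Sum>a\<in>UNIV. f (e a) *\<^sub>R e a) = 0" using s by (simp add: sum.reindex[OF inj] o_def)
    then have "f (e c) = 0" for c using bsum[of "\<lambda>a. f (e a)" c] bilinear_lzero[OF b] by simp
    then show "f x = 0" using x by auto
  qed simp
  have "span (range e) = UNIV"
  proof -
    have "card (range e) = DIM(complex^'m)" by (simp add: card_image[OF inj] card_UNIV_sum)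
    then show ?thesis using ind card_ge_dim_independent[of "range e" UNIV] by (simp add: top.extremum_uniqueI)
  qed
  then have "v \<in> span (range e)" by simp
  then obtain f where "v = (\<Sum>x\<in>range e. f x *\<^sub>R x)" by (auto simp: span_finite)
  then have v: "v = (\<Sum>a\<in>UNIV. f (e a) *\<^sub>R e a)" by (simp add: sum.reindex[OF inj] o_def)
  then have "b v (e c) = f (e c)" for c using bsum[of "\<lambda>a. f (e a)" c] by simp
  then show ?thesis using v by simp
qed

section \<open>Covectors of bidegree (p, q)\<close>

abbreviation indices :: "nat \<Rightarrow> (nat \<Rightarrow> 'b) set" where
  "indices k \<equiv> {..<k} \<rightarrow>\<^sub>E UNIV"

lemma finite_indices [simp]: "finite (indices k :: (nat \<Rightarrow> 'b::finite) set)"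
  by (rule finite_PiE) auto

text \<open>With the permutation moved from the vectors to the covectors, the j-th factor contains
  only v j, and each argument can be expanded separately.\<close>

lemma wedge_reindex:
  "wedge k \<theta> v = (\<Sum>\<pi> | \<pi> permutes {..<k}. of_int (sign \<pi>) * (\<Prod>j<k. \<theta> (inv \<pi> j) (v j)))"
  unfolding wedge_def
proof (intro sum.cong refl arg_cong2[where f = "(*)"])
  fix \<pi> assume "\<pi> \<in> {\<pi>. \<pi> permutes {..<k}}"
  then have \<pi>: "\<pi> permutes {..<k}" by simp
  show "(\<Prod>i<k. \<theta> i (v (\<pi> i))) = (\<Prod>j<k. \<theta> (inv \<pi> j) (v j))"
    using prod.permute[OF \<pi>, of "\<lambda>j. \<theta> (inv \<pi> j) (v j)"] permutes_inverses(2)[OF \<pi>] by (simp add: o_def)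
qed

lemma wedge_expand:
  fixes f :: "'b::finite \<Rightarrow> complex^'m::finite"
  assumes \<theta>: "\<And>i. i < k \<Longrightarrow> linear (\<theta> i)" and v: "\<And>i. i < k \<Longrightarrow> v i = (\<Sum>b\<in>UNIV. c i b *\<^sub>R f b)"
  shows "wedge k \<theta> v = (\<Sum>I\<in>indices k. of_real (\<Prod>i<k. c i (I i)) * wedge k \<theta> (\<lambda>i. f (I i)))"
proof -
  have "wedge k \<theta> v = (\<Sum>\<pi> | \<pi> permutes {..<k}. of_int (sign \<pi>) *
      (\<Prod>j<k. \<Sum>b\<in>UNIV. of_real (c j b) * \<theta> (inv \<pi> j) (f b)))"
    unfolding wedge_reindex[of k \<theta> v]
  proof (intro sum.cong prod.cong refl arg_cong2[where f = "(*)"])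
    fix \<pi> j assume "\<pi> \<in> {\<pi>. \<pi> permutes {..<k}}" "j \<in> {..<k}"
    then have "inv \<pi> j < k" using permutes_in_image[OF permutes_inv, of \<pi> "{..<k}" j] by auto
    then have "linear (\<theta> (inv \<pi> j))" by (rule \<theta>)
    then show "\<theta> (inv \<pi> j) (v j) = (\<Sum>b\<in>UNIV. of_real (c j b) * \<theta> (inv \<pi> j) (f b))"
      using \<open>j \<in> {..<k}\<close> by (simp add: v linear_sum linear_scale) (simp add: scaleR_conv_of_real)
  qed
  also have "\<dots> = (\<Sum>\<pi> | \<pi> permutes {..<k}. of_int (sign \<pi>) *
      (\<Sum>I\<in>indices k. (\<Prod>j<k. of_real (c j (I j)) * \<theta> (inv \<pi> j) (f (I j)))))"
    by (subst prod_sum_PiE) auto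
  also have "\<dots> = (\<Sum>I\<in>indices k. of_real (\<Prod>i<k. c i (I i)) * wedge k \<theta> (\<lambda>i. f (I i)))"
    unfolding wedge_reindex sum_distrib_left
    by (subst sum.swap) (simp add: prod.distrib mult_ac of_real_prod)
  finally show ?thesis .
qed

lemma wedge_expand_covectors:
  fixes \<beta> :: "nat \<Rightarrow> 'b::finite \<Rightarrow> complex^'m::finite \<Rightarrow> complex"
  assumes "\<And>i w. i < k \<Longrightarrow> \<theta> i w = (\<Sum>j\<in>UNIV. c i j * \<beta> i j w)"
  shows "wedge k \<theta> v = (\<Sum>J\<in>indices k. (\<Prod>i<k. c i (J i)) * wedge k (\<lambda>i. \<beta> i (J i)) v)"
proof -
  have "wedge k \<theta> v = (\<Sum>\<pi> | \<pi> permutes {..<k}. of_int (sign \<pi>) *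
      (\<Prod>i<k. \<Sum>j\<in>UNIV. c i j * \<beta> i j (v (\<pi> i))))"
    unfolding wedge_def by (intro sum.cong prod.cong refl arg_cong2[where f = "(*)"]) (auto simp: assms)
  also have "\<dots> = (\<Sum>\<pi> | \<pi> permutes {..<k}. of_int (sign \<pi>) *
      (\<Sum>J\<in>indices k. (\<Prod>i<k. c i (J i) * \<beta> i (J i) (v (\<pi> i)))))"
    by (subst prod_sum_PiE) auto
  also have "\<dots> = (\<Sum>J\<in>indices k. (\<Prod>i<k. c i (J i)) * wedge k (\<lambda>i. \<beta> i (J i)) v)"
    unfolding wedge_def sum_distrib_left by (subst sum.swap) (simp add: prod.distrib mult_ac)
  finally show ?thesis .
qed

text \<open>Composing permutations with the transposition of a and b reverses the sign and leaves
  the products unchanged, so the sum equals its negative. Equality of the two covectors is required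
  on the given vectors only.\<close>

lemma wedge_equal_rows:
  assumes ab: "a < k" "b < k" "a \<noteq> b" and eq: "\<And>i. i < k \<Longrightarrow> \<theta> a (v i) = \<theta> b (v i)"
  shows "wedge k \<theta> v = 0"
proof -
  let ?t = "Transposition.transpose a b"
  let ?F = "\<lambda>\<pi>. of_int (sign \<pi>) * (\<Prod>i<k. \<theta> i (v (\<pi> i)))"
  have t: "?t permutes {..<k}" using ab by (intro permutes_swap_id) auto
  have neg: "?F (\<pi> \<circ> ?t) = - ?F \<pi>" if \<pi>: "\<pi> permutes {..<k}" for \<pi>
  proof -
    have "sign (\<pi> \<circ> ?t) = - sign \<pi>"
      using sign_compose[OF permutation_permutes[THEN iffD2] permutation_permutes[THEN iffD2], of \<pi> ?t] \<pi> t ab(3)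
      by (auto simp: sign_swap_id)
    moreover have "(\<Prod>i<k. \<theta> i (v ((\<pi> \<circ> ?t) i))) = (\<Prod>i<k. \<theta> (?t i) (v (\<pi> i)))"
      using prod.permute[OF t, of "\<lambda>i. \<theta> (?t i) (v (\<pi> i))"] by (simp add: o_def)
    moreover have "\<dots> = (\<Prod>i<k. \<theta> i (v (\<pi> i)))"
    proof (intro prod.cong refl)
      fix i assume "i \<in> {..<k}"
      then have "\<pi> i < k" using permutes_in_image[OF \<pi>, of i] by simp
      then show "\<theta> (?t i) (v (\<pi> i)) = \<theta> i (v (\<pi> i))"
        using eq by (auto simp: Transposition.transpose_def)
    qed
    ultimately show ?thesis by simp
  qed
  have "wedge k \<theta> v = (\<Sum>\<pi> | \<pi> permutes {..<k}. ?F (\<pi> \<circ> ?t))"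
    unfolding wedge_def by (rule sum_permutations_compose_right[OF t])
  also have "\<dots> = (\<Sum>\<pi> | \<pi> permutes {..<k}. - ?F \<pi>)" by (intro sum.cong neg) auto
  also have "\<dots> = - wedge k \<theta> v" unfolding wedge_def by (simp add: sum_negf)
  finally show ?thesis by simp
qed

definition pq_basis ::
  "('m \<Rightarrow> complex^'m \<Rightarrow> complex) \<Rightarrow> nat \<Rightarrow> nat \<Rightarrow> 'm \<Rightarrow> complex^'m::finite \<Rightarrow> complex" where
  "pq_basis d p i j = (if i < p then d j else (\<lambda>v. cnj (d j v)))"

definition coords :: "('m \<Rightarrow> complex^'m) \<Rightarrow> ('m \<Rightarrow> complex^'m::finite \<Rightarrow> complex) \<Rightarrow> bool" where
  "coords u d \<longleftrightarrow> (\<forall>j. complex_linear (d j)) \<and> (\<forall>v. v = (\<Sum>j\<in>UNIV. d j v *s u j))"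

lemma complex_linear_sum:
  assumes "complex_linear f" shows "f (\<Sum>j\<in>S. c j *s u j) = (\<Sum>j\<in>S. c j * f (u j))"
proof -
  have "f 0 = 0" using assms unfolding complex_linear_def by (metis add_cancel_right_right)
  then show ?thesis using assms
    by (induction S rule: infinite_finite_induct) (auto simp: complex_linear_def)
qed

lemma complex_antilinear_sum:
  assumes "complex_antilinear f" shows "f (\<Sum>j\<in>S. c j *s u j) = (\<Sum>j\<in>S. cnj (c j) * f (u j))"
proof -
  have "f 0 = 0" using assms unfolding complex_antilinear_def by (metis add_cancel_right_right)
  then show ?thesis using assms
    by (induction S rule: infinite_finite_induct) (auto simp: complex_antilinear_def)
qed

lemma complex_linear_linear: "complex_linear f \<Longrightarrow> linear f"
  by (rule linearI) (auto simp: complex_linear_def simp flip: of_real_cscale scaleR_conv_of_real)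

lemma complex_antilinear_linear: "complex_antilinear f \<Longrightarrow> linear f"
  by (rule linearI) (auto simp: complex_antilinear_def simp flip: of_real_cscale scaleR_conv_of_real)

lemma pq_covectors_expand:
  assumes \<omega>: "\<omega> \<in> pq_covectors p q" and d: "coords u d"
  obtains A where "\<And>v. \<omega> v = (\<Sum>J\<in>indices (p + q). wedge (p + q) (\<lambda>i. pq_basis d p i (J i)) v *s A J)"
proof -
  obtain N :: nat and \<theta> e where \<omega>': "\<omega> = (\<lambda>v. \<Sum>j<N. wedge (p + q) (\<theta> j) v *s e j)"
    and \<theta>: "\<And>j i. j < N \<Longrightarrow> i < p \<Longrightarrow> complex_linear (\<theta> j i)"
      "\<And>j i. j < N \<Longrightarrow> p \<le> i \<Longrightarrow> i < p + q \<Longrightarrow> complex_antilinear (\<theta> j i)"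
    using \<omega> unfolding pq_covectors_def by auto
  have th: "\<theta> j i w = (\<Sum>l\<in>UNIV. \<theta> j i (u l) * pq_basis d p i l w)" if "j < N" "i < p + q" for j i w
  proof -
    have w: "w = (\<Sum>l\<in>UNIV. d l w *s u l)" using d by (simp add: coords_def)
    show ?thesis
    proof (cases "i < p")
      case True
      have "\<theta> j i w = (\<Sum>l\<in>UNIV. d l w * \<theta> j i (u l))"
        by (subst w) (rule complex_linear_sum[OF \<theta>(1)[OF that(1) True]])
      then show ?thesis using True by (simp add: pq_basis_def mult.commute)
    next
      case False
      have "\<theta> j i w = (\<Sum>l\<in>UNIV. cnj (d l w) * \<theta> j i (u l))"
        by (subst w) (rule complex_antilinear_sum[OF \<theta>(2)], use that False in auto)
      then show ?thesis using False by (simp add: pq_basis_def mult.commute)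
    qed
  qed
  show thesis
  proof (rule that[of "\<lambda>J. \<Sum>j<N. (\<Prod>i<p+q. \<theta> j i (u (J i))) *s e j"])
    fix v
    let ?W = "\<lambda>J. wedge (p + q) (\<lambda>i. pq_basis d p i (J i)) v"
    have "\<omega> v = (\<Sum>j<N. (\<Sum>J\<in>indices (p + q). (\<Prod>i<p+q. \<theta> j i (u (J i))) * ?W J) *s e j)"
      unfolding \<omega>'
    proof (intro sum.cong refl arg_cong2[where f = "(*s)"])
      fix j assume "j \<in> {..<N}"
      then show "wedge (p + q) (\<theta> j) v = (\<Sum>J\<in>indices (p + q). (\<Prod>i<p+q. \<theta> j i (u (J i))) * ?W J)"
        by (intro wedge_expand_covectors th) auto
    qed
    also have "\<dots> = (\<Sum>J\<in>indices (p + q). ?W J *s (\<Sum>j<N. (\<Prod>i<p+q. \<theta> j i (u (J i))) *s e j))"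
      unfolding vec.scale_sum_left vec.scale_sum_right by (subst sum.swap) (simp add: mult.commute)
    finally show "\<omega> v = (\<Sum>J\<in>indices (p + q). ?W J *s (\<Sum>j<N. (\<Prod>i<p+q. \<theta> j i (u (J i))) *s e j))" .
  qed
qed

lemma coords_standard: "coords (\<lambda>j. axis j 1) (\<lambda>j v. v $ j :: complex)"
  unfolding coords_def complex_linear_def
  by (auto simp: vec_eq_iff axis_def sum.delta if_distrib cong: if_cong)

lemma pq_basis_linear:
  assumes "coords u d"
  shows "i < p \<Longrightarrow> complex_linear (pq_basis d p i j)" "p \<le> i \<Longrightarrow> complex_antilinear (pq_basis d p i j)"
  using assms by (auto simp: coords_def pq_basis_def complex_linear_def complex_antilinear_def)

text \<open>Replaces sums of arbitrary length by combinations of a fixed finite family, which makes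
  the set visibly a linear space and, with \<open>finite_span_limit\<close>, closed under pointwise
  limits.\<close>

lemma pq_covectors_iff:
  fixes \<omega> :: "(nat \<Rightarrow> complex^'m::finite) \<Rightarrow> complex^'r::finite"
  shows "\<omega> \<in> pq_covectors p q \<longleftrightarrow>
    (\<exists>A. \<forall>v. \<omega> v = (\<Sum>J\<in>indices (p + q). wedge (p + q) (\<lambda>i. pq_basis (\<lambda>j v. v $ j) p i (J i)) v *s A J))"
    (is "_ \<longleftrightarrow> (\<exists>A. \<forall>v. \<omega> v = (\<Sum>J\<in>_. ?W J v *s A J))")
proof
  assume "\<omega> \<in> pq_covectors p q"
  then show "\<exists>A. \<forall>v. \<omega> v = (\<Sum>J\<in>indices (p + q). ?W J v *s A J)"
    by (rule pq_covectors_expand[OF _ coords_standard]) blast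
next
  assume "\<exists>A. \<forall>v. \<omega> v = (\<Sum>J\<in>indices (p + q). ?W J v *s A J)"
  then obtain A where A: "\<And>v. \<omega> v = (\<Sum>J\<in>indices (p + q). ?W J v *s A J)" by blast
  obtain \<phi> :: "nat \<Rightarrow> nat \<Rightarrow> 'm" where \<phi>: "bij_betw \<phi> {0..<card (indices (p+q) :: (nat \<Rightarrow> 'm) set)} (indices (p + q))"
    using ex_bij_betw_nat_finite[OF finite_indices] by blast
  let ?N = "card (indices (p+q) :: (nat \<Rightarrow> 'm) set)"
  have "\<omega> = (\<lambda>v. \<Sum>j<?N. wedge (p + q) (\<lambda>i. pq_basis (\<lambda>j v. v $ j) p i (\<phi> j i)) v *s A (\<phi> j))"
    using sum.reindex_bij_betw[OF \<phi>, of "\<lambda>J. ?W J _ *s A J"] by (simp add: A fun_eq_iff atLeast0LessThan)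
  then show "\<omega> \<in> pq_covectors p q"
    unfolding pq_covectors_def using pq_basis_linear[OF coords_standard]
    by (intro CollectI exI[of _ ?N] exI[of _ "\<lambda>j i. pq_basis (\<lambda>j v. v $ j) p i (\<phi> j i)"] exI[of _ "\<lambda>j. A (\<phi> j)"]) auto
qed

lemma pq_covectors_zero: "(\<lambda>v. 0) \<in> pq_covectors p q"
  unfolding pq_covectors_iff by (intro exI[of _ "\<lambda>_. 0"]) simp

lemma pq_covectors_add: "\<omega> \<in> pq_covectors p q \<Longrightarrow> \<eta> \<in> pq_covectors p q \<Longrightarrow> (\<lambda>v. \<omega> v + \<eta> v) \<in> pq_covectors p q"
  unfolding pq_covectors_iff
  by (elim exE, rename_tac A B, rule_tac x = "\<lambda>J. A J + B J" in exI)
    (simp add: vec.scale_right_distrib sum.distrib)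

lemma pq_covectors_scale: "\<omega> \<in> pq_covectors p q \<Longrightarrow> (\<lambda>v. c *s \<omega> v) \<in> pq_covectors p q"
  unfolding pq_covectors_iff
  by (elim exE, rename_tac A, rule_tac x = "\<lambda>J. c *s A J" in exI)
    (simp add: vec.scale_sum_right mult.commute)

lemma finite_span_limit:
  fixes w :: "'j \<Rightarrow> 'x \<Rightarrow> complex"
  assumes "finite S" "\<And>n::nat. \<exists>a. \<forall>x. X n x = (\<Sum>j\<in>S. a j * w j x)" "\<And>x. (\<lambda>n. X n x) \<longlonglongrightarrow> Y x"
  shows "\<exists>a. \<forall>x. Y x = (\<Sum>j\<in>S. a j * w j x)"
  using assms
proof (induction S arbitrary: X Y rule: finite_induct)
  case empty
  then have "X = (\<lambda>n x. 0)" by (auto simp: fun_eq_iff)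
  then have "Y x = 0" for x using empty(2)[of x] by (simp add: LIMSEQ_const_iff)
  then show ?case by simp
next
  case (insert k S)
  show ?case
  proof (cases "\<exists>a. \<forall>x. w k x = (\<Sum>j\<in>S. a j * w j x)")
    case True
    then obtain a where a: "\<And>x. w k x = (\<Sum>j\<in>S. a j * w j x)" by blast
    have "\<exists>a. \<forall>x. X n x = (\<Sum>j\<in>S. a j * w j x)" for n
    proof -
      obtain b where b: "\<And>x. X n x = (\<Sum>j\<in>insert k S. b j * w j x)" using insert.prems(1) by blast
      have "X n x = (\<Sum>j\<in>S. (b k * a j + b j) * w j x)" for x
        using insert.hyps by (simp add: b a sum_distrib_left sum.distrib distrib_right mult.assoc)
      then show ?thesis by (intro exI[of _ "\<lambda>j. b k * a j + b j"]) simp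
    qed
    then obtain b where b: "\<And>x. Y x = (\<Sum>j\<in>S. b j * w j x)"
      using insert.IH[of X Y] insert.prems(2) by blast
    have "Y x = (\<Sum>j\<in>insert k S. (b(k := 0)) j * w j x)" for x
    proof -
      have "(\<Sum>j\<in>S. (b(k := 0)) j * w j x) = (\<Sum>j\<in>S. b j * w j x)"
        using insert.hyps by (intro sum.cong) auto
      then show ?thesis using insert.hyps b by simp
    qed
    then show ?thesis by blast
  next
    case False
    have "\<exists>a. \<forall>n x. X n x = (\<Sum>j\<in>insert k S. a n j * w j x)" using insert.prems(1) by metis
    then obtain a where a: "\<And>n x. X n x = a n k * w k x + (\<Sum>j\<in>S. a n j * w j x)"
      using insert.hyps by auto
    have "bounded (range (\<lambda>n. a n k))"
    proof (rule ccontr)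
      assume "\<not> ?thesis"
      then have "\<forall>n::nat. \<exists>m. real n < cmod (a m k)"
        unfolding bounded_iff by (metis not_le_imp_less rangeE)
      \<comment> \<open>Dividing X (f n) by its exploding coefficient would exhibit
        \<open>w k\<close> as a limit of combinations of the others. The indices f n need not
        increase, as X n x is bounded in n for each x.\<close>
      then obtain f where f: "\<And>n. real n < cmod (a (f n) k)" by metis
      have nz: "a (f n) k \<noteq> 0" for n using f[of n] by auto
      have inv0: "(\<lambda>n. inverse (a (f n) k)) \<longlonglongrightarrow> 0"
      proof (rule Lim_null_comparison)
        show "\<forall>\<^sub>F n in sequentially. norm (inverse (a (f n) k)) \<le> inverse (real n)"
        proof (rule eventually_sequentiallyI[of 1])
          fix n :: nat assume "1 \<le> n"
          then show "norm (inverse (a (f n) k)) \<le> inverse (real n)"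
            using f[of n] by (simp add: norm_inverse le_imp_inverse_le)
        qed
        show "(\<lambda>n. inverse (real n)) \<longlonglongrightarrow> 0" by (rule lim_inverse_n)
      qed
      have "\<exists>c. \<forall>x. w k x = (\<Sum>j\<in>S. c j * w j x)"
      proof (rule insert.IH)
        show "\<exists>c. \<forall>x. w k x - X (f n) x * inverse (a (f n) k) = (\<Sum>j\<in>S. c j * w j x)" for n
        proof (intro exI[of _ "\<lambda>j. - a (f n) j * inverse (a (f n) k)"] allI)
          fix x
          have "(\<Sum>j\<in>S. (- a (f n) j * inverse (a (f n) k)) * w j x) =
              - ((\<Sum>j\<in>S. a (f n) j * w j x) * inverse (a (f n) k))"
            unfolding sum_distrib_right sum_negf[symmetric] by (intro sum.cong) (auto simp: mult_ac)
          then show "w k x - X (f n) x * inverse (a (f n) k) =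
              (\<Sum>j\<in>S. (- a (f n) j * inverse (a (f n) k)) * w j x)"
            using nz by (simp add: a field_simps)
        qed
        fix x
        have "Bseq (\<lambda>n. X n x)" using insert.prems(2) by (intro convergent_imp_Bseq convergentI)
        then obtain B where B: "\<And>n. norm (X n x) \<le> B" by (auto simp: Bseq_def)
        have "(\<lambda>n. X (f n) x * inverse (a (f n) k)) \<longlonglongrightarrow> 0"
        proof (rule Lim_null_comparison)
          show "\<forall>\<^sub>F n in sequentially. norm (X (f n) x * inverse (a (f n) k)) \<le> B * norm (inverse (a (f n) k))"
            unfolding norm_mult by (intro always_eventually allI mult_right_mono B) auto
          show "(\<lambda>n. B * norm (inverse (a (f n) k))) \<longlonglongrightarrow> 0"
            using tendsto_mult_left[OF tendsto_norm_zero[OF inv0], of B] by simp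
        qed
        then have "(\<lambda>n. w k x - X (f n) x * inverse (a (f n) k)) \<longlonglongrightarrow> w k x - 0"
          by (intro tendsto_intros)
        then show "(\<lambda>n. w k x - X (f n) x * inverse (a (f n) k)) \<longlonglongrightarrow> w k x" by simp
      qed
      then show False using False by blast
    qed
    then obtain \<alpha> r where r: "strict_mono (r :: nat \<Rightarrow> nat)" "((\<lambda>n. a n k) \<circ> r) \<longlonglongrightarrow> \<alpha>"
      using bounded_imp_convergent_subsequence by blast
    have "\<exists>b. \<forall>x. Y x - \<alpha> * w k x = (\<Sum>j\<in>S. b j * w j x)"
    proof (rule insert.IH)
      show "\<exists>b. \<forall>x. X (r n) x - a (r n) k * w k x = (\<Sum>j\<in>S. b j * w j x)" for n
        by (rule exI[of _ "a (r n)"]) (simp add: a)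
      have "(\<lambda>n. X (r n) x) \<longlonglongrightarrow> Y x" for x
        using LIMSEQ_subseq_LIMSEQ[OF insert.prems(2) r(1)] by (simp add: o_def)
      then show "(\<lambda>n. X (r n) x - a (r n) k * w k x) \<longlonglongrightarrow> Y x - \<alpha> * w k x" for x
        using r(2) by (auto intro!: tendsto_intros simp: o_def)
    qed
    then obtain b where b: "\<And>x. Y x - \<alpha> * w k x = (\<Sum>j\<in>S. b j * w j x)" by blast
    have "Y x = (\<Sum>j\<in>insert k S. (b(k := \<alpha>)) j * w j x)" for x
    proof -
      have "(\<Sum>j\<in>S. (b(k := \<alpha>)) j * w j x) = (\<Sum>j\<in>S. b j * w j x)"
        using insert.hyps by (intro sum.cong) auto
      then show ?thesis using insert.hyps b[of x] by (simp add: algebra_simps)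
    qed
    then show ?thesis by blast
  qed
qed

lemma pq_covectors_limit:
  fixes X :: "nat \<Rightarrow> (nat \<Rightarrow> complex^'m::finite) \<Rightarrow> complex^'r::finite"
  assumes X: "\<And>n. X n \<in> pq_covectors p q" and lim: "\<And>v. (\<lambda>n. X n v) \<longlonglongrightarrow> Y v"
  shows "Y \<in> pq_covectors p q"
proof -
  let ?W = "\<lambda>J. wedge (p + q) (\<lambda>i. pq_basis (\<lambda>j (v::complex^'m). v $ j) p i (J i))"
  have "\<forall>r. \<exists>a. \<forall>v. Y v $ r = (\<Sum>J\<in>indices (p + q). a J * ?W J v)"
  proof (rule allI, rule finite_span_limit)
    fix r n
    obtain A where "\<And>v. X n v = (\<Sum>J\<in>indices (p + q). ?W J v *s A J)" using X[of n] unfolding pq_covectors_iff by blast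
    then show "\<exists>a. \<forall>v. X n v $ r = (\<Sum>J\<in>indices (p + q). a J * ?W J v)"
      by (intro exI[of _ "\<lambda>J. A J $ r"]) (simp add: mult.commute)
  qed (auto intro: tendsto_vec_nth lim)
  from choice[OF this]
  obtain a where a: "\<And>r v. Y v $ r = (\<Sum>J\<in>indices (p + q). a r J * ?W J v)" by blast
  show ?thesis unfolding pq_covectors_iff
    by (intro exI[of _ "\<lambda>J. \<chi> r. a r J"]) (simp add: vec_eq_iff a mult.commute)
qed

text \<open>Multilinearity in the only form used: expansion along a family of as many vectors as a
  real basis has. The coefficients are real because the slots of a (p, q)-covector are partly linear
  and partly antilinear.\<close>

definition rmult :: "nat \<Rightarrow> ((nat \<Rightarrow> complex^'m::finite) \<Rightarrow> complex^'r::finite) \<Rightarrow> bool" where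
  "rmult k \<omega> \<longleftrightarrow> (\<forall>(c :: nat \<Rightarrow> 'm + 'm \<Rightarrow> real) f v. (\<forall>i<k. v i = (\<Sum>b\<in>UNIV. c i b *\<^sub>R f b)) \<longrightarrow>
     \<omega> v = (\<Sum>I\<in>indices k. (\<Prod>i<k. c i (I i)) *\<^sub>R \<omega> (\<lambda>i. f (I i))))"

lemma pq_covectors_rmult:
  fixes \<omega> :: "(nat \<Rightarrow> complex^'m::finite) \<Rightarrow> complex^'r::finite"
  assumes "\<omega> \<in> pq_covectors p q" shows "rmult (p + q) \<omega>"
proof -
  let ?W = "\<lambda>J. wedge (p + q) (\<lambda>i. pq_basis (\<lambda>j (v::complex^'m). v $ j) p i (J i))"
  obtain A where A: "\<And>v. \<omega> v = (\<Sum>J\<in>indices (p + q). ?W J v *s A J)"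
    using assms unfolding pq_covectors_iff by blast
  have lin: "linear (pq_basis (\<lambda>j v. v $ j) p i j)" for i j
    using pq_basis_linear(1)[OF coords_standard, of i p j, THEN complex_linear_linear]
      pq_basis_linear(2)[OF coords_standard, of p i j, THEN complex_antilinear_linear]
    by (cases "i < p") (auto simp: not_less)
  show ?thesis
    unfolding rmult_def
  proof (intro allI impI)
    fix c :: "nat \<Rightarrow> 'm + 'm \<Rightarrow> real" and f and v :: "nat \<Rightarrow> complex^'m" assume v: "\<forall>i<p+q. v i = (\<Sum>b\<in>UNIV. c i b *\<^sub>R f b)"
    have "?W J v = (\<Sum>I\<in>indices (p + q). of_real (\<Prod>i<p+q. c i (I i)) * ?W J (\<lambda>i. f (I i)))" for J
      by (rule wedge_expand) (use v lin in auto)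
    then have "\<omega> v = (\<Sum>J\<in>indices (p + q). \<Sum>I\<in>indices (p + q).
        of_real (\<Prod>i<p+q. c i (I i)) *s (?W J (\<lambda>i. f (I i)) *s A J))"
      by (simp add: A vec.scale_sum_left del: of_real_prod)
    also have "\<dots> = (\<Sum>I\<in>indices (p + q). \<Sum>J\<in>indices (p + q).
        of_real (\<Prod>i<p+q. c i (I i)) *s (?W J (\<lambda>i. f (I i)) *s A J))"
      by (rule sum.swap)
    also have "\<dots> = (\<Sum>I\<in>indices (p + q). (\<Prod>i<p+q. c i (I i)) *\<^sub>R \<omega> (\<lambda>i. f (I i)))"
      unfolding A by (intro sum.cong refl) (simp only: of_real_cscale scaleR_sum_right)
    finally show "\<omega> v = (\<Sum>I\<in>indices (p + q). (\<Prod>i<p+q. c i (I i)) *\<^sub>R \<omega> (\<lambda>i. f (I i)))" .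
  qed
qed

text \<open>A nonzero component of an (m, q)-covector needs all m holomorphic coordinates. If the
  holomorphic slots of a wedge carry distinct coordinates, they include the missing
  \<open>j0\<close>, which kills every product; otherwise two slots coincide.\<close>

lemma top_degree_vanishes:
  fixes \<omega> :: "(nat \<Rightarrow> complex^'m::finite) \<Rightarrow> complex^'r::finite"
  assumes \<omega>: "\<omega> \<in> pq_covectors CARD('m) q" and d: "coords u d"
    and du: "\<And>j l. d j (u l) = (if j = l then 1 else 0)"
    and miss: "\<And>i. i < CARD('m) + q \<Longrightarrow> frame_index (I i) \<noteq> j0"
  shows "\<omega> (\<lambda>i. real_frame u (I i)) = 0"
proof -
  let ?m = "CARD('m)" and ?v = "\<lambda>i. real_frame u (I i)"
  obtain A where A: "\<omega> ?v = (\<Sum>J\<in>indices (?m + q). wedge (?m + q) (\<lambda>i. pq_basis d ?m i (J i)) ?v *s A J)"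
    by (rule pq_covectors_expand[OF \<omega> d]) blast
  have d0: "d j0 (?v i) = 0" if "i < ?m + q" for i
  proof -
    have "frame_index (I i) \<noteq> j0" by (rule miss[OF that])
    moreover have "d j0 (\<i> *s w) = \<i> * d j0 w" for w using d by (simp add: coords_def complex_linear_def)
    ultimately show ?thesis by (cases "I i") (auto simp: real_frame_def frame_index_def du)
  qed
  have "wedge (?m + q) (\<lambda>i. pq_basis d ?m i (J i)) ?v = 0" for J
  proof (cases "inj_on J {..<?m}")
    case True
    then have "card (J ` {..<?m}) = CARD('m)" by (simp add: card_image)
    then have "J ` {..<?m} = UNIV" by (intro card_subset_eq) auto
    then obtain i where i: "i < ?m" "J i = j0" by (metis UNIV_I imageE lessThan_iff)
    have "(\<Prod>i<?m + q. pq_basis d ?m i (J i) (?v (\<pi> i))) = 0" if "\<pi> permutes {..<?m + q}" for \<pi>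
    proof (rule prod_zero)
      have "\<pi> i < ?m + q" using permutes_in_image[OF that, of i] i by simp
      then show "\<exists>i\<in>{..<?m + q}. pq_basis d ?m i (J i) (?v (\<pi> i)) = 0"
        using i d0 by (intro bexI[of _ i]) (auto simp: pq_basis_def)
    qed simp
    then show ?thesis unfolding wedge_def by (intro sum.neutral) auto
  next
    case False
    then obtain a b where ab: "a < ?m" "b < ?m" "a \<noteq> b" "J a = J b" by (auto simp: inj_on_def)
    then show ?thesis by (intro wedge_equal_rows[of a _ b]) (auto simp: pq_basis_def)
  qed
  then show ?thesis by (simp add: A)
qed

section \<open>Norms of covectors\<close>

definition fform :: "(complex^'r::finite \<Rightarrow> complex^'r \<Rightarrow> complex) \<Rightarrow> bool" where
  "fform r \<longleftrightarrow> (\<forall>u v w a. r (u + v) w = r u w + r v w \<and> r (a *s v) w = a * r v w) \<and>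
     (\<forall>v w. r w v = cnj (r v w)) \<and> (\<forall>v. v \<noteq> 0 \<longrightarrow> Re (r v v) > 0)"

lemma fform_add: "fform r \<Longrightarrow> r (u + v) w = r u w + r v w"
  and fform_scale: "fform r \<Longrightarrow> r (a *s v) w = a * r v w"
  and fform_cnj: "fform r \<Longrightarrow> r w v = cnj (r v w)"
  and fform_pos: "fform r \<Longrightarrow> v \<noteq> 0 \<Longrightarrow> Re (r v v) > 0"
  unfolding fform_def by blast+

lemma fform_zero: "fform r \<Longrightarrow> r 0 w = 0"
  using fform_scale[of r 0 0 w] by simp

lemma fform_nonneg: "fform r \<Longrightarrow> 0 \<le> Re (r v v)"
  using fform_pos[of r v] fform_zero[of r v] by (cases "v = 0") auto

lemma fform_self_real: "fform r \<Longrightarrow> r v v = of_real (Re (r v v))"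
  using fform_cnj[of r v v] by (simp add: complex_eq_iff)

lemma fform_scaleR: "fform r \<Longrightarrow> r (a *\<^sub>R v) w = of_real a * r v w"
  using fform_scale[of r "of_real a" v w] by (simp add: of_real_cscale)

lemma fform_add_right: "fform r \<Longrightarrow> r w (u + v) = r w u + r w v"
  using fform_cnj[of r w "u + v"] fform_cnj[of r w u] fform_cnj[of r w v] by (simp add: fform_add)

lemma fform_scaleR_right: "fform r \<Longrightarrow> r w (a *\<^sub>R v) = of_real a * r w v"
  using fform_cnj[of r w "a *\<^sub>R v"] fform_cnj[of r w v] by (simp add: fform_scaleR)

lemma fform_sum: "fform r \<Longrightarrow> r (\<Sum>i\<in>S. c i *\<^sub>R x i) w = (\<Sum>i\<in>S. of_real (c i) * r (x i) w)"
  by (induction S rule: infinite_finite_induct) (auto simp: fform_zero fform_add fform_scaleR)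

lemma fform_sum_right: assumes "fform r" shows "r w (\<Sum>i\<in>S. c i *\<^sub>R x i) = (\<Sum>i\<in>S. of_real (c i) * r w (x i))"
proof -
  have "r w (\<Sum>i\<in>S. c i *\<^sub>R x i) = cnj (\<Sum>i\<in>S. of_real (c i) * r (x i) w)"
    using fform_cnj[OF assms, of w "\<Sum>i\<in>S. c i *\<^sub>R x i"] by (simp add: fform_sum[OF assms])
  also have "\<dots> = (\<Sum>i\<in>S. of_real (c i) * r w (x i))"
    unfolding cnj_sum complex_cnj_mult complex_cnj_complex_of_real fform_cnj[OF assms, symmetric] ..
  finally show ?thesis .
qed

text \<open>Sum the nonnegative squares of c i x j - c j x i over all pairs, as in Lagrange's
  identity.\<close>

lemma fform_sum_le:
  assumes r: "fform r" and S: "finite S"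
  shows "Re (r (\<Sum>i\<in>S. c i *\<^sub>R x i) (\<Sum>i\<in>S. c i *\<^sub>R x i)) \<le> (\<Sum>i\<in>S. (c i)\<^sup>2) * (\<Sum>i\<in>S. Re (r (x i) (x i)))"
proof -
  have 1: "Re (r (\<Sum>i\<in>S. c i *\<^sub>R x i) (\<Sum>i\<in>S. c i *\<^sub>R x i)) = (\<Sum>i\<in>S. \<Sum>j\<in>S. c i * c j * Re (r (x i) (x j)))"
    unfolding fform_sum[OF r] unfolding fform_sum_right[OF r]
    by (simp add: sum_distrib_left mult.assoc)
  have 2: "(\<Sum>i\<in>S. (c i)\<^sup>2) * (\<Sum>i\<in>S. Re (r (x i) (x i))) = (\<Sum>i\<in>S. \<Sum>j\<in>S. (c i)\<^sup>2 * Re (r (x j) (x j)))"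
    by (simp add: sum_product)
  have 3: "\<dots> = (\<Sum>i\<in>S. \<Sum>j\<in>S. (c j)\<^sup>2 * Re (r (x i) (x i)))" by (rule sum.swap)
  have trm: "2 * (c i * c j * Re (r (x i) (x j))) \<le> (c i)\<^sup>2 * Re (r (x j) (x j)) + (c j)\<^sup>2 * Re (r (x i) (x i))" for i j
  proof -
    have e: "c i *\<^sub>R x j - c j *\<^sub>R x i = c i *\<^sub>R x j + (- c j) *\<^sub>R x i" by simp
    have "0 \<le> Re (r (c i *\<^sub>R x j - c j *\<^sub>R x i) (c i *\<^sub>R x j - c j *\<^sub>R x i))" by (rule fform_nonneg[OF r])
    also have "\<dots> = (c i)\<^sup>2 * Re (r (x j) (x j)) + (c j)\<^sup>2 * Re (r (x i) (x i)) - 2 * (c i * c j * Re (r (x i) (x j)))"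
      unfolding e using fform_cnj[OF r, of "x j" "x i"]
      by (simp only: fform_add[OF r] fform_scaleR[OF r] fform_add_right[OF r] fform_scaleR_right[OF r])
        (simp add: power2_eq_square algebra_simps)
    finally show ?thesis by simp
  qed
  have "2 * (\<Sum>i\<in>S. \<Sum>j\<in>S. c i * c j * Re (r (x i) (x j))) \<le>
     (\<Sum>i\<in>S. \<Sum>j\<in>S. (c i)\<^sup>2 * Re (r (x j) (x j))) + (\<Sum>i\<in>S. \<Sum>j\<in>S. (c j)\<^sup>2 * Re (r (x i) (x i)))"
    unfolding sum_distrib_left sum.distrib[symmetric] by (intro sum_mono trm)
  then show ?thesis unfolding 1 using 2 3 by linarith
qed

definition psum ::
  "nat \<Rightarrow> (complex^'r::finite \<Rightarrow> complex^'r \<Rightarrow> complex) \<Rightarrow> ('m + 'm \<Rightarrow> complex^'m::finite) \<Rightarrow>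
   ((nat \<Rightarrow> complex^'m) \<Rightarrow> complex^'r) \<Rightarrow> ((nat \<Rightarrow> complex^'m) \<Rightarrow> complex^'r) \<Rightarrow> complex" where
  "psum k r e \<omega> \<eta> = (\<Sum>I\<in>indices k. r (\<omega> (\<lambda>i. e (I i))) (\<eta> (\<lambda>i. e (I i))))"

lemma psum_nonneg: "fform r \<Longrightarrow> 0 \<le> Re (psum k r e \<omega> \<omega>)"
  unfolding psum_def Re_sum by (rule sum_nonneg, rule fform_nonneg)

lemma psum_cnj: "fform r \<Longrightarrow> psum k r e \<eta> \<omega> = cnj (psum k r e \<omega> \<eta>)"
  unfolding psum_def cnj_sum by (rule sum.cong[OF refl], rule fform_cnj)

lemma psum_add: "fform r \<Longrightarrow> psum k r e (\<lambda>v. \<omega> v + \<omega>' v) \<eta> = psum k r e \<omega> \<eta> + psum k r e \<omega>' \<eta>"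
  unfolding psum_def by (simp add: fform_add sum.distrib)

lemma psum_scale: "fform r \<Longrightarrow> psum k r e (\<lambda>v. c *s \<omega> v) \<eta> = c * psum k r e \<omega> \<eta>"
  unfolding psum_def by (simp add: fform_scale sum_distrib_left)

text \<open>After both arguments are expanded, the sum over the multi-indices of e factors into a
  product of entries of \<open>E^T E\<close>. This is used with orthonormal columns and, in
  \<open>psum_cramer\<close>, with \<open>E^T E\<close> the inverse of a Gram matrix.\<close>

lemma psum_change:
  fixes e f :: "'m + 'm \<Rightarrow> complex^'m::finite"
  assumes r: "fform r" and \<omega>: "rmult k \<omega>" and \<eta>: "rmult k \<eta>"
    and e: "\<And>a. e a = (\<Sum>b\<in>UNIV. E a b *\<^sub>R f b)"
  shows "psum k r e \<omega> \<eta> = (\<Sum>I\<in>indices k. \<Sum>J\<in>indices k.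
     of_real (\<Prod>i<k. \<Sum>a\<in>UNIV. E a (I i) * E a (J i)) * r (\<omega> (\<lambda>i. f (I i))) (\<eta> (\<lambda>i. f (J i))))"
proof -
  have ex: "\<theta> (\<lambda>i. e (K i)) = (\<Sum>I\<in>indices k. (\<Prod>i<k. E (K i) (I i)) *\<^sub>R \<theta> (\<lambda>i. f (I i)))"
    if "rmult k \<theta>" for \<theta> :: "(nat \<Rightarrow> complex^'m) \<Rightarrow> complex^'r" and K
    using that unfolding rmult_def by (elim allE[of _ "\<lambda>i. E (K i)"] allE[of _ f]) (auto simp: e)
  have "psum k r e \<omega> \<eta> = (\<Sum>K\<in>indices k. \<Sum>I\<in>indices k. \<Sum>J\<in>indices k.
      of_real (\<Prod>i<k. E (K i) (I i) * E (K i) (J i)) * r (\<omega> (\<lambda>i. f (I i))) (\<eta> (\<lambda>i. f (J i))))"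
    unfolding psum_def ex[OF \<omega>] ex[OF \<eta>] unfolding fform_sum[OF r] unfolding fform_sum_right[OF r]
    by (simp add: sum_distrib_left prod.distrib mult.assoc)
  also have "\<dots> = (\<Sum>I\<in>indices k. \<Sum>K\<in>indices k. \<Sum>J\<in>indices k.
      of_real (\<Prod>i<k. E (K i) (I i) * E (K i) (J i)) * r (\<omega> (\<lambda>i. f (I i))) (\<eta> (\<lambda>i. f (J i))))"
    by (rule sum.swap)
  also have "\<dots> = (\<Sum>I\<in>indices k. \<Sum>J\<in>indices k. \<Sum>K\<in>indices k.
      of_real (\<Prod>i<k. E (K i) (I i) * E (K i) (J i)) * r (\<omega> (\<lambda>i. f (I i))) (\<eta> (\<lambda>i. f (J i))))"
    by (rule sum.cong[OF refl]) (rule sum.swap)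
  also have "\<dots> = (\<Sum>I\<in>indices k. \<Sum>J\<in>indices k.
      of_real (\<Sum>K\<in>indices k. \<Prod>i<k. E (K i) (I i) * E (K i) (J i)) * r (\<omega> (\<lambda>i. f (I i))) (\<eta> (\<lambda>i. f (J i))))"
    by (simp only: sum_distrib_right of_real_sum)
  also have "\<dots> = (\<Sum>I\<in>indices k. \<Sum>J\<in>indices k.
     of_real (\<Prod>i<k. \<Sum>a\<in>UNIV. E a (I i) * E a (J i)) * r (\<omega> (\<lambda>i. f (I i))) (\<eta> (\<lambda>i. f (J i))))"
    by (subst prod_sum_PiE) auto
  finally show ?thesis .
qed

lemma sum_indices_delta:
  fixes F :: "(nat \<Rightarrow> 'b::finite) \<Rightarrow> 'c::real_vector"
  assumes I: "I \<in> indices k"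
  shows "(\<Sum>J\<in>indices k. (\<Prod>i<k. if I i = J i then s i else 0) *\<^sub>R F J) = (\<Prod>i<k. s i) *\<^sub>R F I"
proof -
  have "(\<Prod>i<k. if I i = J i then s i else 0) = (if I = J then \<Prod>i<k. s i else (0::real))"
    if J: "J \<in> indices k" for J
  proof (cases "I = J")
    case False
    then obtain i where "i < k" "I i \<noteq> J i" using I J by (metis PiE_ext lessThan_iff)
    then have "(\<Prod>i<k. if I i = J i then s i else (0::real)) = 0" by (intro prod_zero) auto
    then show ?thesis using False by simp
  qed simp
  then have "(\<Sum>J\<in>indices k. (\<Prod>i<k. if I i = J i then s i else 0) *\<^sub>R F J) =
      (\<Sum>J\<in>indices k. if I = J then (\<Prod>i<k. s i) *\<^sub>R F J else 0)"
    by (intro sum.cong) auto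
  then show ?thesis using I by simp
qed

text \<open>The basis in \<open>pointwise_inner\<close> is an arbitrary choice; this allows its
  replacement by one adapted to two metrics at once.\<close>

lemma psum_orthonormal:
  assumes r: "fform r" and \<omega>: "rmult k \<omega>" and \<eta>: "rmult k \<eta>"
    and b: "bilinear b" "\<And>v w. b v w = b w v" and e: "orthonormal b e" and f: "orthonormal b f"
  shows "psum k r e \<omega> \<eta> = psum k r f \<omega> \<eta>"
proof -
  have S: "(\<Sum>a\<in>UNIV. b (e a) (f i) * b (e a) (f j)) = (if i = j then 1 else 0)" for i j
  proof -
    have "b (f i) (f j) = b (\<Sum>a\<in>UNIV. b (f i) (e a) *\<^sub>R e a) (f j)"
      using parseval[OF b(1) e, of "f i"] by simp
    also have "\<dots> = (\<Sum>a\<in>UNIV. b (f i) (e a) * b (e a) (f j))"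
      using b(1) by (simp add: bilinear_def linear_sum[of "\<lambda>x. b x (f j)"] linear_scale[of "\<lambda>x. b x (f j)"])
    finally show ?thesis using f by (simp add: orthonormal_def b(2)[of "f i" "e _"])
  qed
  have "psum k r e \<omega> \<eta> = (\<Sum>I\<in>indices k. \<Sum>J\<in>indices k.
     of_real (\<Prod>i<k. \<Sum>a\<in>UNIV. b (e a) (f (I i)) * b (e a) (f (J i))) * r (\<omega> (\<lambda>i. f (I i))) (\<eta> (\<lambda>i. f (J i))))"
    by (rule psum_change[OF r \<omega> \<eta>]) (rule parseval[OF b(1) f])
  also have "\<dots> = (\<Sum>I\<in>indices k. \<Sum>J\<in>indices k.
     (\<Prod>i<k. if I i = J i then 1 else 0) *\<^sub>R r (\<omega> (\<lambda>i. f (I i))) (\<eta> (\<lambda>i. f (J i))))"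
    by (simp only: S scaleR_conv_of_real)
  also have "\<dots> = psum k r f \<omega> \<eta>"
    unfolding psum_def by (intro sum.cong refl) (subst sum_indices_delta, auto)
  finally show ?thesis .
qed

lemma rmult_scale:
  fixes f :: "'m + 'm \<Rightarrow> complex^'m::finite"
  assumes \<omega>: "rmult k \<omega>" and I: "I \<in> indices k"
  shows "\<omega> (\<lambda>i. s (I i) *\<^sub>R f (I i)) = (\<Prod>i<k. s (I i)) *\<^sub>R \<omega> (\<lambda>i. f (I i))"
proof -
  have "\<omega> (\<lambda>i. s (I i) *\<^sub>R f (I i)) =
      (\<Sum>J\<in>indices k. (\<Prod>i<k. (\<lambda>i b. if I i = b then s (I i) else 0) i (J i)) *\<^sub>R \<omega> (\<lambda>i. f (J i)))"
    using \<omega> unfolding rmult_def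
    by (elim allE[of _ "\<lambda>i b. if I i = b then s (I i) else 0"] allE[of _ f] allE[of _ "\<lambda>i. s (I i) *\<^sub>R f (I i)"])
      (auto simp: if_distrib[of "\<lambda>x. x *\<^sub>R _"] cong: if_cong)
  also have "\<dots> = (\<Prod>i<k. s (I i)) *\<^sub>R \<omega> (\<lambda>i. f (I i))" using sum_indices_delta[OF I, of "\<lambda>i. s (I i)" "\<lambda>J. \<omega> (\<lambda>i. f (J i))"] by simp
  finally show ?thesis .
qed

text \<open>Expand each v i in the orthonormal basis and apply Cauchy-Schwarz. Evaluation of a form
  at fixed vectors is thus continuous in the pointwise norm, on which completeness and the
  boundedness of the functionals rest.\<close>

lemma pointwise_bound:
  fixes b :: "complex^'m::finite \<Rightarrow> complex^'m \<Rightarrow> real"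
  assumes r: "fform r" and \<omega>: "rmult k \<omega>" and b: "bilinear b" "\<And>v w. b v w = b w v" and e: "orthonormal b e"
  shows "Re (r (\<omega> v) (\<omega> v)) \<le> (\<Prod>i<k. b (v i) (v i)) * Re (psum k r e \<omega> \<omega>)"
proof -
  have sq: "b w w = (\<Sum>a\<in>UNIV. (b w (e a))\<^sup>2)" for w
  proof -
    have "b w w = b (\<Sum>a\<in>UNIV. b w (e a) *\<^sub>R e a) w" using parseval[OF b(1) e, of w] by simp
    also have "\<dots> = (\<Sum>a\<in>UNIV. b w (e a) * b (e a) w)"
      using b(1) by (simp add: bilinear_def linear_sum[of "\<lambda>x. b x w"] linear_scale[of "\<lambda>x. b x w"])
    finally show ?thesis by (simp add: power2_eq_square b(2)[of "e _" w])
  qed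
  have ex: "\<omega> v = (\<Sum>I\<in>indices k. (\<Prod>i<k. b (v i) (e (I i))) *\<^sub>R \<omega> (\<lambda>i. e (I i)))"
    using \<omega> unfolding rmult_def
    by (elim allE[of _ "\<lambda>i a. b (v i) (e a)"] allE[of _ e] allE[of _ v]) (use parseval[OF b(1) e] in blast)
  have "Re (r (\<omega> v) (\<omega> v)) \<le> (\<Sum>I\<in>indices k. (\<Prod>i<k. b (v i) (e (I i)))\<^sup>2) *
      (\<Sum>I\<in>indices k. Re (r (\<omega> (\<lambda>i. e (I i))) (\<omega> (\<lambda>i. e (I i)))))"
    by (subst (1 2) ex) (rule fform_sum_le[OF r], simp)
  also have "(\<Sum>I\<in>indices k. (\<Prod>i<k. b (v i) (e (I i)))\<^sup>2) = (\<Prod>i<k. b (v i) (v i))"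
    unfolding sq prod_power_distrib by (subst prod_sum_PiE) auto
  finally show ?thesis by (simp add: psum_def)
qed

lemma gram_det:
  fixes Q :: "real^'n^'n::finite"
  assumes g: "bilinear g" and f: "\<And>a. f a = (\<Sum>c\<in>UNIV. Q $ a $ c *\<^sub>R u c)"
    and u: "\<And>c d. g (u c) (u d) = (if c = d then D c else 0)"
  shows "det (\<chi> a b. g (f a) (f b) :: real^'n^'n) = (det Q)\<^sup>2 * (\<Prod>c\<in>UNIV. D c)"
proof -
  let ?D = "\<chi> c d. if c = d then D c else 0"
  have ent: "g (f a) (f b) = (Q ** ?D ** transpose Q) $ a $ b" for a b
  proof -
    have "g (f a) (f b) = (\<Sum>d\<in>UNIV. \<Sum>c\<in>UNIV. Q $ a $ c * (Q $ b $ d * g (u c) (u d)))"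
      using g unfolding f bilinear_def
      by (simp add: linear_sum[of "\<lambda>x. g x _"] linear_scale[of "\<lambda>x. g x _"] linear_sum linear_scale sum_distrib_left mult_ac)
    also have "\<dots> = (\<Sum>c\<in>UNIV. \<Sum>d\<in>UNIV. Q $ a $ c * (Q $ b $ d * g (u c) (u d)))"
      by (rule sum.swap)
    also have "\<dots> = (\<Sum>c\<in>UNIV. Q $ a $ c * (Q $ b $ c * D c))"
      by (simp add: u if_distrib[of "\<lambda>x. _ * x"] cong: if_cong)
    also have "\<dots> = (Q ** ?D ** transpose Q) $ a $ b"
      by (simp add: matrix_matrix_mult_def transpose_def if_distrib[of "\<lambda>x. _ * x"] mult_ac cong: if_cong)
    finally show ?thesis .
  qed
  have "(\<chi> a b. g (f a) (f b)) = Q ** ?D ** transpose Q" by (simp add: vec_eq_iff ent)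
  moreover have "det ?D = (\<Prod>c\<in>UNIV. D c)" by (subst det_diagonal) auto
  ultimately show ?thesis by (simp add: det_mul det_transpose power2_eq_square)
qed

text \<open>Choose one slot s j for every index j: the m factors in these slots cancel the product
  of all l j, and each of the q remaining factors is at most 1 / c.\<close>

lemma prod_surj_le:
  fixes f :: "nat \<Rightarrow> 'm::finite" and l :: "'m \<Rightarrow> real"
  assumes f: "f ` {..<CARD('m) + q} = UNIV" and c: "c > 0" and l: "\<And>j. c \<le> l j"
  shows "(\<Prod>j\<in>UNIV. l j) * (\<Prod>i<CARD('m) + q. 1 / l (f i)) \<le> (1 / c) ^ q"
proof -
  let ?k = "CARD('m) + q"
  have lp: "l j > 0" for j using l[of j] c by linarith
  have "\<forall>j. \<exists>i. i < ?k \<and> f i = j" using f by (metis UNIV_I imageE lessThan_iff)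
  then obtain s where s: "\<And>j. s j < ?k" "\<And>j. f (s j) = j" by metis
  have inj: "inj s" by (rule injI) (metis s(2))
  have sub: "range s \<subseteq> {..<?k}" using s by auto
  have card: "card ({..<?k} - range s) = q" using sub inj by (simp add: card_Diff_subset card_image)
  have "(\<Prod>i<?k. 1 / l (f i)) = (\<Prod>i\<in>{..<?k} - range s. 1 / l (f i)) * (\<Prod>i\<in>range s. 1 / l (f i))"
    by (rule prod.subset_diff[OF sub]) simp
  also have "(\<Prod>i\<in>range s. 1 / l (f i)) = (\<Prod>j\<in>UNIV. 1 / l j)"
    by (simp add: prod.reindex[OF inj] s)
  finally have "(\<Prod>j\<in>UNIV. l j) * (\<Prod>i<?k. 1 / l (f i)) =
      (\<Prod>i\<in>{..<?k} - range s. 1 / l (f i)) * (\<Prod>j\<in>UNIV. l j * (1 / l j))"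
    by (simp only: prod.distrib mult_ac)
  also have "(\<Prod>j\<in>UNIV. l j * (1 / l j)) = 1" using lp by (intro prod.neutral) (simp add: less_imp_neq[symmetric])
  also have "(\<Prod>i\<in>{..<?k} - range s. 1 / l (f i)) \<le> (\<Prod>i\<in>{..<?k} - range s. 1 / c)"
    using lp l c by (intro prod_mono) (auto simp: less_imp_le intro!: divide_left_mono)
  finally show ?thesis by (simp add: card)
qed

lemma pos_def_rescale:
  assumes "\<And>a c. h (u a) (u c) = (if a = c then D a else 0)" "bilinear h" "\<And>a. D a > 0"
  shows "orthonormal h (\<lambda>a. (1 / sqrt (D a)) *\<^sub>R u a)"
proof -
  have "D a \<noteq> 0" "sqrt (D a) * sqrt (D a) = D a" for a using assms(3)[of a] by auto
  then show ?thesis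
    unfolding orthonormal_def by (simp add: bilinear_lmul[OF assms(2)] bilinear_rmul[OF assms(2)] assms(1))
qed

text \<open>Here \<open>d j\<close> is the Hermitian inner product with u j, expressed by its real
  part h.\<close>

lemma coords_of_orthonormal:
  fixes u :: "'m::finite \<Rightarrow> complex^'m"
  assumes h: "hform h" and u: "orthonormal h (real_frame u)"
  defines "d \<equiv> \<lambda>j v. Complex (h v (u j)) (h v (\<i> *s u j))"
  shows "coords u d" "d j (u l) = (if j = l then 1 else 0)"
proof -
  note b = hform_bilinear[OF h]
  have 1: "h (\<i> *s v) w = - h v (\<i> *s w)" for v w using hform_ii_right[OF h, of v w] by simp
  have cs: "c *s v = Re c *\<^sub>R v + Im c *\<^sub>R (\<i> *s v)" for c and v :: "complex^'m"
    by (simp add: vec_eq_iff complex_eq_iff)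
  show "coords u d"
    unfolding coords_def complex_linear_def
  proof (intro conjI allI)
    fix j v w show "d j (v + w) = d j v + d j w" by (simp add: d_def complex_eq_iff bilinear_ladd[OF b])
  next
    fix j c v
    have "h (c *s v) w = Re c * h v w - Im c * h v (\<i> *s w)" for w
      by (subst cs) (simp add: bilinear_ladd[OF b] bilinear_lmul[OF b] 1)
    then show "d j (c *s v) = c * d j v"
      by (simp add: d_def complex_eq_iff bilinear_rneg[OF b])
  next
    fix v
    have "v = (\<Sum>a\<in>UNIV. h v (real_frame u a) *\<^sub>R real_frame u a)" by (rule parseval[OF b u])
    also have "\<dots> = (\<Sum>j\<in>UNIV. h v (u j) *\<^sub>R u j) + (\<Sum>j\<in>UNIV. h v (\<i> *s u j) *\<^sub>R (\<i> *s u j))"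
      by (simp add: UNIV_Plus_UNIV[symmetric] sum.Plus real_frame_def del: UNIV_Plus_UNIV)
    also have "\<dots> = (\<Sum>j\<in>UNIV. d j v *s u j)" by (subst cs) (simp add: d_def sum.distrib)
    finally show "v = (\<Sum>j\<in>UNIV. d j v *s u j)" .
  qed
  have "h (u j) (u l) = (if j = l then 1 else 0)" "h (u j) (\<i> *s u l) = 0" for j l
    using u[unfolded orthonormal_def, rule_format, of "Inl j" "Inl l"]
      u[unfolded orthonormal_def, rule_format, of "Inl j" "Inr l"] by (auto simp: real_frame_def)
  then show "d j (u l) = (if j = l then 1 else 0)" by (simp add: d_def complex_eq_iff)
qed

text \<open>In a frame diagonalizing both metrics, passing from h to g multiplies the volume density
  by the product of the eigenvalues l, and the squared component with multi-index I by the product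
  of 1 / l over the slots of I. Components missing a complex index vanish by
  \<open>top_degree_vanishes\<close>; for the others \<open>prod_surj_le\<close> bounds the combined
  factor. The family \<open>f\<close> may be arbitrary since it contributes the same factor to both
  sides.\<close>

theorem weighted_norm_mono:
  fixes g h :: "complex^'m::finite \<Rightarrow> complex^'m \<Rightarrow> real"
  assumes g: "hform g" "pos_def g" and h: "hform h" "pos_def h" and c: "c > 0" "\<And>v. c * h v v \<le> g v v"
    and r: "fform r" and \<omega>: "\<omega> \<in> pq_covectors CARD('m) q" and eg: "orthonormal g eg" and eh: "orthonormal h eh"
  shows "sqrt (det (\<chi> a b. g (f a) (f b) :: real^('m+'m)^('m+'m))) * Re (psum (CARD('m) + q) r eg \<omega> \<omega>) \<le>
    (1 / c) ^ q * (sqrt (det (\<chi> a b. h (f a) (f b) :: real^('m+'m)^('m+'m))) * Re (psum (CARD('m) + q) r eh \<omega> \<omega>))"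
proof -
  let ?k = "CARD('m) + q"
  obtain u l where u: "\<And>a b. h (real_frame u a) (real_frame u b) = (if a = b then 1 else 0)"
    "\<And>a b. g (real_frame u a) (real_frame u b) = (if a = b then l (frame_index a) else 0)"
    by (rule simultaneous_diagonalization[OF g(1) h]) blast
  have uh: "orthonormal h (real_frame u)" by (simp add: orthonormal_def u)
  have lc: "c \<le> l j" for j
    using c(2)[of "real_frame u (Inl j)"] u(1)[of "Inl j" "Inl j"] u(2)[of "Inl j" "Inl j"] by (simp add: frame_index_def)
  then have lp: "l j > 0" for j using c(1) by (meson less_le_trans)
  have ug: "orthonormal g (\<lambda>a. (1 / sqrt (l (frame_index a))) *\<^sub>R real_frame u a)"
    by (rule pos_def_rescale[OF u(2) hform_bilinear[OF g(1)] lp])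
  have mult: "rmult ?k \<omega>" by (rule pq_covectors_rmult[OF \<omega>])
  let ?w = "\<lambda>I. Re (r (\<omega> (\<lambda>i. real_frame u (I i))) (\<omega> (\<lambda>i. real_frame u (I i))))"
  have wn: "?w I \<ge> 0" for I by (rule fform_nonneg[OF r])
  have ph: "Re (psum ?k r eh \<omega> \<omega>) = (\<Sum>I\<in>indices ?k. ?w I)"
    by (subst psum_orthonormal[OF r mult mult hform_bilinear[OF h(1)] hform_sym[OF h(1)] eh uh]) (simp add: psum_def)
  have pg: "Re (psum ?k r eg \<omega> \<omega>) = (\<Sum>I\<in>indices ?k. (\<Prod>i<?k. 1 / l (frame_index (I i))) * ?w I)"
  proof -
    have "Re (psum ?k r eg \<omega> \<omega>) = Re (psum ?k r (\<lambda>a. (1 / sqrt (l (frame_index a))) *\<^sub>R real_frame u a) \<omega> \<omega>)"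
      by (subst psum_orthonormal[OF r mult mult hform_bilinear[OF g(1)] hform_sym[OF g(1)] eg ug]) simp
    also have "\<dots> = (\<Sum>I\<in>indices ?k. (\<Prod>i<?k. 1 / l (frame_index (I i))) * ?w I)"
      unfolding psum_def Re_sum
    proof (intro sum.cong refl)
      fix I :: "nat \<Rightarrow> 'm + 'm" assume I: "I \<in> indices ?k"
      let ?s = "\<Prod>i<?k. 1 / sqrt (l (frame_index (I i)))"
      have s2: "?s * ?s = (\<Prod>i<?k. 1 / l (frame_index (I i)))"
        unfolding prod.distrib[symmetric] using lp by (intro prod.cong) (auto simp: less_imp_le)
      have e: "\<omega> (\<lambda>i. (1 / sqrt (l (frame_index (I i)))) *\<^sub>R real_frame u (I i)) = ?s *\<^sub>R \<omega> (\<lambda>i. real_frame u (I i))"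
        by (rule rmult_scale[OF mult I, of "\<lambda>a. 1 / sqrt (l (frame_index a))"])
      have "r (?s *\<^sub>R y) (?s *\<^sub>R y) = of_real (?s * ?s) * r y y" for y
        using fform_cnj[OF r, of y "?s *\<^sub>R y"] fform_self_real[OF r, of y]
        by (simp add: fform_scaleR[OF r] del: of_real_prod) (metis complex_cnj_complex_of_real complex_cnj_mult mult.assoc)
      then show "Re (r (\<omega> (\<lambda>i. (1 / sqrt (l (frame_index (I i)))) *\<^sub>R real_frame u (I i)))
            (\<omega> (\<lambda>i. (1 / sqrt (l (frame_index (I i)))) *\<^sub>R real_frame u (I i)))) =
          (\<Prod>i<?k. 1 / l (frame_index (I i))) * ?w I"
        unfolding e s2[symmetric] by (simp del: of_real_prod of_real_mult)
    qed
    finally show ?thesis .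
  qed
  define Q where "Q = (\<chi> a b. h (f a) (real_frame u b) :: real^('m+'m)^('m+'m))"
  have fQ: "f a = (\<Sum>b\<in>UNIV. Q $ a $ b *\<^sub>R real_frame u b)" for a
    unfolding Q_def using parseval[OF hform_bilinear[OF h(1)] uh, of "f a"] by simp
  have dh: "det (\<chi> a b. h (f a) (f b)) = (det Q)\<^sup>2"
    using gram_det[OF hform_bilinear[OF h(1)] fQ, of "\<lambda>_. 1"] u(1) by simp
  \<comment> \<open>Each eigenvalue occurs for u j and for \<i> u j, so the Gram determinant of g is
    a square and its root is available in closed form.\<close>
  have "(\<Prod>a\<in>UNIV. l (frame_index a)) = (\<Prod>j\<in>UNIV. l j) * (\<Prod>j\<in>UNIV. l j)"
    by (simp add: UNIV_Plus_UNIV[symmetric] prod.Plus frame_index_def del: UNIV_Plus_UNIV)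
  then have dg: "det (\<chi> a b. g (f a) (f b)) = (det Q * (\<Prod>j\<in>UNIV. l j))\<^sup>2"
    using gram_det[OF hform_bilinear[OF g(1)] fQ, of "\<lambda>a. l (frame_index a)"] u(2)
    by (simp add: power2_eq_square mult_ac)
  have lpp: "(\<Prod>j\<in>UNIV. l j) \<ge> 0" using lp by (intro prod_nonneg) (auto simp: less_imp_le)
  have trm: "(\<Prod>j\<in>UNIV. l j) * ((\<Prod>i<?k. 1 / l (frame_index (I i))) * ?w I) \<le> (1 / c) ^ q * ?w I" for I
  proof (cases "(\<lambda>i. frame_index (I i)) ` {..<?k} = UNIV")
    case True
    have "(\<Prod>j\<in>UNIV. l j) * (\<Prod>i<?k. 1 / l (frame_index (I i))) * ?w I \<le> (1 / c) ^ q * ?w I"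
      by (rule mult_right_mono[OF prod_surj_le[OF True c(1) lc] wn])
    then show ?thesis by (simp add: mult.assoc)
  next
    case False
    then obtain j0 where "j0 \<notin> (\<lambda>i. frame_index (I i)) ` {..<?k}" by blast
    then have "\<And>i. i < ?k \<Longrightarrow> frame_index (I i) \<noteq> j0" by blast
    then have "\<omega> (\<lambda>i. real_frame u (I i)) = 0"
      by (intro top_degree_vanishes[OF \<omega> coords_of_orthonormal[OF h(1) uh]])
    then show ?thesis using fform_zero[OF r] by simp
  qed
  have "(\<Prod>j\<in>UNIV. l j) * Re (psum ?k r eg \<omega> \<omega>) \<le> (1 / c) ^ q * Re (psum ?k r eh \<omega> \<omega>)"
    unfolding pg ph sum_distrib_left by (intro sum_mono trm)
  then have "\<bar>det Q\<bar> * ((\<Prod>j\<in>UNIV. l j) * Re (psum ?k r eg \<omega> \<omega>)) \<le> \<bar>det Q\<bar> * ((1 / c) ^ q * Re (psum ?k r eh \<omega> \<omega>))"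
    by (intro mult_left_mono) auto
  then show ?thesis using lpp unfolding dg dh by (simp add: abs_mult mult_ac)
qed

text \<open>Cramer's rule for the inverse of the Gram matrix shows that it depends continuously on the metric.\<close>

definition cramer_inv :: "real^'n^'n \<Rightarrow> 'n \<Rightarrow> 'n::finite \<Rightarrow> real" where
  "cramer_inv G a b = det (\<chi> i j. if j = a then axis b 1 $ i else G $ i $ j) / det G"

lemma inner_real_basis: "orthonormal inner (real_basis :: 'm + 'm \<Rightarrow> complex^'m::finite)"
  unfolding orthonormal_def
  by (auto simp: real_basis_def inner_axis_axis axis_eq_axis inner_complex_def split: sum.splits)

lemma real_basis_expansion: "(v :: complex^'m::finite) = (\<Sum>a\<in>UNIV. inner v (real_basis a) *\<^sub>R real_basis a)"
  by (rule parseval[OF _ inner_real_basis]) (simp add: bilinear_conv_bounded_bilinear bounded_bilinear_inner)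

text \<open>The rows of E are the coordinates of the orthonormal basis e in the frame f. From
  \<open>E G E^T = 1\<close> it follows that \<open>E^T E\<close> is the inverse of G, so the
  right-hand side no longer involves the choice of e. In charts this expresses the pointwise product
  by continuous functions of the coordinates and the coefficients of the forms.\<close>

lemma psum_cramer:
  fixes f :: "'m + 'm \<Rightarrow> complex^'m::finite"
  assumes r: "fform r" and \<omega>: "rmult k \<omega>" and \<eta>: "rmult k \<eta>" and g: "hform g" and e: "orthonormal g e"
    and L: "linear L" "surj L" and f: "\<And>a. f a = L (real_basis a)"
  defines "G \<equiv> \<chi> a b. g (f a) (f b)"
  shows "psum k r e \<omega> \<eta> = (\<Sum>I\<in>indices k. \<Sum>J\<in>indices k.
     of_real (\<Prod>i<k. cramer_inv G (I i) (J i)) * r (\<omega> (\<lambda>i. f (I i))) (\<eta> (\<lambda>i. f (J i))))"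
    and "det G > 0"
proof -
  have "\<forall>a. \<exists>w. e a = L w" using L(2) by (metis surjD)
  then obtain w where w: "\<And>a. e a = L (w a)" by metis
  define E where "E = (\<chi> a b. inner (w a) (real_basis b))"
  have eE: "e a = (\<Sum>b\<in>UNIV. E $ a $ b *\<^sub>R f b)" for a
  proof -
    have "e a = L (\<Sum>b\<in>UNIV. inner (w a) (real_basis b) *\<^sub>R real_basis b)"
      using real_basis_expansion[of "w a"] w by simp
    then show ?thesis using L(1) by (simp add: linear_sum linear_scale f E_def)
  qed
  have ent: "g (e a) (e b) = (E ** G ** transpose E) $ a $ b" for a b
  proof -
    have "g (e a) (e b) = (\<Sum>d\<in>UNIV. \<Sum>c\<in>UNIV. E $ a $ c * (E $ b $ d * g (f c) (f d)))"
      using hform_bilinear[OF g] unfolding eE bilinear_def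
      by (simp add: linear_sum[of "\<lambda>x. g x _"] linear_scale[of "\<lambda>x. g x _"] linear_sum linear_scale sum_distrib_left mult_ac)
    also have "\<dots> = (E ** G ** transpose E) $ a $ b"
      by (simp add: matrix_matrix_mult_def transpose_def G_def sum_distrib_left mult_ac)
    finally show ?thesis .
  qed
  have "E ** G ** transpose E = mat 1"
    using e by (simp add: vec_eq_iff ent[symmetric] orthonormal_def mat_def)
  then have EG: "E ** (G ** transpose E) = mat 1" by (simp add: matrix_mul_assoc)
  then have "(G ** transpose E) ** E = mat 1" by (simp add: matrix_left_right_inverse)
  then have GS: "G ** (transpose E ** E) = mat 1" by (simp add: matrix_mul_assoc)
  have "det E * (det G * det E) = 1" using arg_cong[OF EG, of det] by (simp add: det_mul det_transpose)
  then have "(det E)\<^sup>2 * det G = 1" by (simp add: power2_eq_square mult_ac)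
  then show dG: "det G > 0" by (metis mult_le_0_iff not_le zero_le_power2 zero_less_one)
  have S: "(\<Sum>a\<in>UNIV. E $ a $ b * E $ a $ c) = cramer_inv G b c" for b c
  proof -
    let ?x = "column c (transpose E ** E)"
    have "G *v ?x = column c (G ** (transpose E ** E))"
      by (simp add: matrix_vector_mult_def matrix_matrix_mult_def column_def vec_eq_iff)
    also have "\<dots> = axis c 1" unfolding GS by (auto simp: column_def mat_def vec_eq_iff axis_def)
    finally have "?x = (\<chi> k. det (\<chi> i j. if j = k then axis c 1 $ i else G $ i $ j) / det G)"
      using dG by (subst (asm) cramer) auto
    then have "?x $ b = cramer_inv G b c" by (simp add: cramer_inv_def)
    then show ?thesis by (simp add: column_def matrix_matrix_mult_def transpose_def)
  qed
  show "psum k r e \<omega> \<eta> = (\<Sum>I\<in>indices k. \<Sum>J\<in>indices k.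
     of_real (\<Prod>i<k. cramer_inv G (I i) (J i)) * r (\<omega> (\<lambda>i. f (I i))) (\<eta> (\<lambda>i. f (J i))))"
    using psum_change[OF r \<omega> \<eta>, of e "\<lambda>a b. E $ a $ b" f, OF eE] unfolding S .
qed

section \<open>Determinants and Lebesgue measure in real coordinates\<close>

lemma sign_conjugate:
  fixes s :: "'n::finite \<Rightarrow> 'k::finite"
  assumes s: "bij s" and p: "p permutes (UNIV :: 'n set)"
  shows "sign (s \<circ> p \<circ> inv s) = sign p"
proof -
  have "map_permutation UNIV s p = s \<circ> p \<circ> inv s"
    using s by (simp add: map_permutation_def restrict_id_def bij_is_surj fun_eq_iff)
  then show ?thesis using sign_map_permutation[of s UNIV p] s p by (simp add: bij_is_inj)
qed

text \<open>Conjugation by s carries the permutations of one index type to those of the other and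
  preserves signs.\<close>

lemma det_reindex:
  fixes s :: "'n::finite \<Rightarrow> 'k::finite" and M :: "'k \<Rightarrow> 'k \<Rightarrow> real"
  assumes s: "bij s"
  shows "det (\<chi> i j. M (s i) (s j)) = det (\<chi> a b. M a b)"
proof -
  have isx: "inv s (s i) = i" "s (inv s a) = a" for i a
    using s by (simp_all add: bij_is_inj bij_is_surj surj_f_inv_f)
  let ?c = "\<lambda>p. s \<circ> p \<circ> inv s"
  have bb: "bij_betw ?c {p. p permutes UNIV} {p. p permutes UNIV}"
  proof (rule bij_betw_byWitness[where f' = "\<lambda>p. inv s \<circ> p \<circ> s"])
    show "?c ` {p. p permutes UNIV} \<subseteq> {p. p permutes UNIV}"
      using s by (auto intro!: bij_imp_permutes bij_comp bij_imp_bij_inv simp: permutes_bij)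
    show "(\<lambda>p. inv s \<circ> p \<circ> s) ` {p. p permutes UNIV} \<subseteq> {p. p permutes UNIV}"
      using s by (auto intro!: bij_imp_permutes bij_comp bij_imp_bij_inv simp: permutes_bij)
  qed (auto simp: fun_eq_iff isx)
  have "det (\<chi> a b. M a b) = (\<Sum>p | p permutes UNIV. of_int (sign p) * (\<Prod>a\<in>UNIV. M a (p a)))"
    by (simp add: det_def)
  also have "\<dots> = (\<Sum>p | p permutes UNIV. of_int (sign (?c p)) * (\<Prod>a\<in>UNIV. M a (?c p a)))"
    by (rule sum.reindex_bij_betw[OF bb, symmetric])
  also have "\<dots> = (\<Sum>p | p permutes UNIV. of_int (sign p) * (\<Prod>i\<in>UNIV. M (s i) (s (p i))))"
  proof (intro sum.cong refl arg_cong2[where f = "(*)"])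
    fix p assume "p \<in> {p. p permutes (UNIV :: 'n set)}"
    then show "real_of_int (sign (?c p)) = of_int (sign p)" by (simp only: mem_Collect_eq sign_conjugate[OF s])
    show "(\<Prod>a\<in>UNIV. M a (?c p a)) = (\<Prod>i\<in>UNIV. M (s i) (s (p i)))"
      using prod.reindex_bij_betw[OF s, of "\<lambda>a. M a (?c p a)"] by (simp add: isx)
  qed
  finally show ?thesis by (simp add: det_def)
qed

text \<open>The index type \<open>'m bit0\<close> has the same size as \<open>'m + 'm\<close>, and it is well-ordered as required
  by the change of variables formula of the library.\<close>

definition bit0_index :: "'m::finite bit0 \<Rightarrow> 'm + 'm" where
  "bit0_index = (SOME s. bij s)"

lemma bij_bit0_index: "bij (bit0_index :: 'm::finite bit0 \<Rightarrow> 'm + 'm)"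
proof -
  have "card (UNIV :: 'm bit0 set) = card (UNIV :: ('m + 'm) set)" by (simp add: card_UNIV_sum)
  then have "\<exists>s :: 'm bit0 \<Rightarrow> 'm + 'm. bij s"
    using finite_same_card_bij[of "UNIV :: 'm bit0 set" "UNIV :: ('m + 'm) set"] by auto
  then show ?thesis unfolding bit0_index_def by (rule someI_ex)
qed

lemma inner_rb: "inner (real_basis a) (real_basis b :: complex^'m::finite) = (if a = b then 1 else 0)"
  by (rule inner_real_basis[unfolded orthonormal_def, rule_format])

definition to_real :: "complex^'m::finite \<Rightarrow> real^'m bit0" where
  "to_real v = (\<chi> i. inner v (real_basis (bit0_index i)))"

definition of_real_vec :: "real^'m::finite bit0 \<Rightarrow> complex^'m" where
  "of_real_vec w = (\<Sum>i\<in>UNIV. w $ i *\<^sub>R real_basis (bit0_index i))"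

lemma inner_of_real_vec: "inner (of_real_vec w) (real_basis (bit0_index i)) = w $ i"
proof -
  have "inner (of_real_vec w) (real_basis (bit0_index i)) =
      (\<Sum>j\<in>UNIV. w $ j * (if bit0_index j = bit0_index i then 1 else 0))"
    by (simp add: of_real_vec_def inner_sum_left inner_rb)
  also have "\<dots> = (\<Sum>j\<in>UNIV. if j = i then w $ j else 0)"
    using bij_bit0_index by (intro sum.cong) (auto simp: bij_def inj_def)
  finally show ?thesis by simp
qed

lemma to_of_real [simp]: "to_real (of_real_vec w) = w"
  by (simp add: to_real_def vec_eq_iff inner_of_real_vec)

lemma of_to_real [simp]: "of_real_vec (to_real v) = v"
proof -
  have "of_real_vec (to_real v) = (\<Sum>a\<in>UNIV. inner v (real_basis a) *\<^sub>R real_basis a)"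
    unfolding of_real_vec_def to_real_def
    using sum.reindex_bij_betw[OF bij_bit0_index, of "\<lambda>a. inner v (real_basis a) *\<^sub>R real_basis a"] by simp
  then show ?thesis using real_basis_expansion by metis
qed

lemma linear_to_real: "linear to_real"
  by (rule linearI) (auto simp: to_real_def vec_eq_iff inner_add_left)

lemma linear_of_real_vec: "linear of_real_vec"
  by (rule linearI) (auto simp: of_real_vec_def scaleR_left_distrib sum.distrib scaleR_sum_right)

lemma continuous_to_real: "continuous_on S to_real" and continuous_of_real_vec: "continuous_on S' of_real_vec"
  using linear_to_real linear_of_real_vec by (auto intro: linear_continuous_on simp: linear_conv_bounded_linear)

lemma measurable_to_real [measurable]: "to_real \<in> borel_measurable borel"
  and measurable_of_real_vec [measurable]: "of_real_vec \<in> borel_measurable borel"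
  by (auto intro: borel_measurable_continuous_onI continuous_to_real continuous_of_real_vec)

lemma Basis_complex_vec: "(Basis :: (complex^'m::finite) set) = range real_basis"
proof (intro set_eqI iffI)
  fix x :: "complex^'m" assume "x \<in> Basis"
  then obtain j u where "x = axis j u" "u = 1 \<or> u = \<i>" by (auto simp: Basis_vec_def Basis_complex_def)
  then have "x = real_basis (Inl j) \<or> x = real_basis (Inr j)" by (auto simp: real_basis_def)
  then show "x \<in> range real_basis" by blast
qed (auto simp: Basis_vec_def real_basis_def Basis_complex_def split: sum.splits)

lemma inj_real_basis: "inj (real_basis :: 'm + 'm \<Rightarrow> complex^'m::finite)"
  by (rule injI) (metis inner_rb zero_neq_one)

text \<open>The coordinates of \<open>to_real\<close> are those along the basis vectors, so boxes
  correspond to boxes of the same volume, and these determine the measure.\<close>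

lemma distr_to_real: "distr lborel borel (to_real :: complex^'m::finite \<Rightarrow> _) = lborel"
proof (rule lborel_eqI[symmetric])
  fix l u :: "real^'m bit0" assume le: "\<And>b. b \<in> Basis \<Longrightarrow> l \<bullet> b \<le> u \<bullet> b"
  have le': "l $ i \<le> u $ i" for i using le[of "axis i 1"] by (simp add: inner_axis)
  have inv: "bit0_index (inv bit0_index a) = a" for a :: "'m + 'm"
    by (rule surj_f_inv_f[OF bij_is_surj[OF bij_bit0_index]])
  have inv': "inv bit0_index (bit0_index i) = i" for i :: "'m bit0"
    by (rule inv_f_f[OF bij_is_inj[OF bij_bit0_index]])
  have io: "inner (of_real_vec w) (real_basis a) = w $ (inv bit0_index a)" for w and a :: "'m + 'm"
    using inner_of_real_vec[of w "inv bit0_index a"] by (simp add: inv)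
  have "to_real -` box l u = box (of_real_vec l) (of_real_vec u)"
  proof -
    have "to_real v \<in> box l u \<longleftrightarrow> v \<in> box (of_real_vec l) (of_real_vec u)" for v :: "complex^'m"
    proof -
      have "to_real v \<in> box l u \<longleftrightarrow> (\<forall>i. l $ i < inner v (real_basis (bit0_index i)) \<and> inner v (real_basis (bit0_index i)) < u $ i)"
        by (simp add: mem_box_cart to_real_def)
      also have "\<dots> \<longleftrightarrow> (\<forall>a. l $ (inv bit0_index a) < inner v (real_basis a) \<and> inner v (real_basis a) < u $ (inv bit0_index a))"
        by (metis inv inv')
      finally show ?thesis by (simp add: mem_box Basis_complex_vec io)
    qed
    then show ?thesis by auto
  qed
  then have "emeasure (distr lborel borel to_real) (box l u) = emeasure lborel (box (of_real_vec l) (of_real_vec u) :: (complex^'m) set)"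
    by (subst emeasure_distr) auto
  also have "\<dots> = (\<Prod>b\<in>Basis. (of_real_vec u - of_real_vec l) \<bullet> b)"
    by (rule emeasure_lborel_box) (auto simp: Basis_complex_vec io le')
  also have "(\<Prod>b\<in>Basis. (of_real_vec u - of_real_vec l) \<bullet> b) = (\<Prod>a\<in>UNIV. u $ (inv bit0_index a) - l $ (inv bit0_index a))"
    unfolding Basis_complex_vec by (simp add: prod.reindex[OF inj_real_basis] inner_diff_left io)
  also have "\<dots> = (\<Prod>i\<in>UNIV. u $ i - l $ i)"
    using prod.reindex_bij_betw[OF bij_imp_bij_inv[OF bij_bit0_index], of "\<lambda>i. u $ i - l $ i"] by simp
  also have "\<dots> = (\<Prod>b\<in>Basis. (u - l) \<bullet> b)"
  proof -
    have B: "(Basis :: (real^'m bit0) set) = range (\<lambda>i. axis i 1)" by (auto simp: Basis_vec_def)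
    have "inj (\<lambda>i :: 'm bit0. axis i (1::real))" by (rule injI) (simp add: axis_eq_axis)
    then show ?thesis unfolding B by (simp add: prod.reindex inner_axis)
  qed
  finally show "emeasure (distr lborel borel to_real) (box l u) = (\<Prod>b\<in>Basis. (u - l) \<bullet> b)" .
qed simp

definition real_det :: "(complex^'m::finite \<Rightarrow> complex^'m) \<Rightarrow> real" where
  "real_det D = det (\<chi> a b. inner (D (real_basis b)) (real_basis a))"

text \<open>Conjugating by \<open>to_real\<close> turns \<xi> into a map between spaces of real
  vectors, where the volume of a differentiable image is estimated by the integral of the Jacobian.
  An upper bound is all that is needed later, so overlaps in the image do no harm.\<close>

theorem emeasure_image_le:
  fixes \<xi> :: "complex^'m::finite \<Rightarrow> complex^'m"
  assumes Y: "Y \<in> sets borel" and img: "\<xi> ` Y \<in> sets borel"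
    and D: "\<And>y. y \<in> Y \<Longrightarrow> (\<xi> has_derivative D y) (at y within Y)"
    and m: "(\<lambda>y. indicator Y y * \<bar>real_det (D y)\<bar>) \<in> borel_measurable borel"
  shows "emeasure lborel (\<xi> ` Y) \<le> (\<integral>\<^sup>+y. ennreal (indicator Y y * \<bar>real_det (D y)\<bar>) \<partial>lborel)"
proof (cases "(\<integral>\<^sup>+y. ennreal (indicator Y y * \<bar>real_det (D y)\<bar>) \<partial>lborel) = \<infinity>")
  case False
  define r where "r = enn2real (\<integral>\<^sup>+y. ennreal (indicator Y y * \<bar>real_det (D y)\<bar>) \<partial>lborel)"
  have r: "(\<integral>\<^sup>+y. ennreal (indicator Y y * \<bar>real_det (D y)\<bar>) \<partial>lborel) = ennreal r" "r \<ge> 0"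
    using False by (auto simp: r_def less_top)
  define Y' where "Y' = to_real ` Y"
  define f where "f = to_real \<circ> \<xi> \<circ> of_real_vec"
  define f' where "f' x = to_real \<circ> D (of_real_vec x) \<circ> of_real_vec" for x
  have Y'eq: "Y' = of_real_vec -` Y" unfolding Y'_def by (auto simp: image_iff) (metis to_of_real)
  have Y'b: "Y' \<in> sets borel" unfolding Y'eq using measurable_sets[OF measurable_of_real_vec Y] by simp
  have fimg: "f ` Y' = of_real_vec -` (\<xi> ` Y)"
    unfolding f_def Y'_def by (auto simp: image_iff) (metis to_of_real)
  have fb: "f ` Y' \<in> sets borel" unfolding fimg using measurable_sets[OF measurable_of_real_vec img] by simp
  have der: "(f has_derivative f' x) (at x within Y')" if x: "x \<in> Y'" for x
  proof -
    have 1: "(of_real_vec has_derivative of_real_vec) (at x within Y')"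
      by (rule linear_imp_has_derivative[OF linear_of_real_vec])
    have im: "of_real_vec ` Y' = Y" unfolding Y'_def by (auto simp: image_image)
    have 2: "(\<xi> has_derivative D (of_real_vec x)) (at (of_real_vec x) within of_real_vec ` Y')"
      unfolding im using x by (intro D) (simp add: Y'eq)
    have 3: "(to_real has_derivative to_real) (at ((\<xi> \<circ> of_real_vec) x) within (\<xi> \<circ> of_real_vec) ` Y')"
      by (rule linear_imp_has_derivative[OF linear_to_real])
    show ?thesis
      using diff_chain_within[OF diff_chain_within[OF 1 2] 3] by (simp only: f_def f'_def o_assoc)
  qed
  have detf: "det (matrix (f' x)) = real_det (D (of_real_vec x))" for x
  proof -
    have ax: "of_real_vec (axis j 1) = real_basis (bit0_index j)" for j :: "'m bit0"
      by (simp add: of_real_vec_def axis_def if_distrib[of "\<lambda>c. c *\<^sub>R _"] cong: if_cong)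
    have "matrix (f' x) = (\<chi> i j. (\<lambda>a b. inner (D (of_real_vec x) (real_basis b)) (real_basis a)) (bit0_index i) (bit0_index j))"
      by (simp add: matrix_def f'_def ax to_real_def)
    then show ?thesis 
      unfolding real_det_def
      by (simp only: det_reindex[OF bij_bit0_index, of "\<lambda>a b. inner (D (of_real_vec x) (real_basis b)) (real_basis a)"])
  qed
  have "((\<lambda>x. indicator Y' x * \<bar>det (matrix (f' x))\<bar>) has_integral r) UNIV"
  proof (rule nn_integral_has_integral)
    have eq: "indicator Y' x * \<bar>det (matrix (f' x))\<bar> = (\<lambda>y. indicator Y y * \<bar>real_det (D y)\<bar>) (of_real_vec x)" for x
      by (simp add: detf Y'eq indicator_def)
    show "(\<lambda>x. indicator Y' x * \<bar>det (matrix (f' x))\<bar>) \<in> borel_measurable borel"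
      unfolding eq by (rule measurable_compose[OF measurable_of_real_vec m])
    have "(\<integral>\<^sup>+x. ennreal (indicator Y' x * \<bar>det (matrix (f' x))\<bar>) \<partial>lborel) =
        (\<integral>\<^sup>+x. ennreal (indicator Y' x * \<bar>det (matrix (f' x))\<bar>) \<partial>distr lborel borel (to_real :: complex^'m \<Rightarrow> _))"
      by (simp add: distr_to_real)
    also have "\<dots> = (\<integral>\<^sup>+y. ennreal (indicator Y y * \<bar>real_det (D y)\<bar>) \<partial>lborel)"
      unfolding eq
      by (subst nn_integral_distr) (auto intro!: measurable_compose[OF measurable_of_real_vec] m)
    finally show "(\<integral>\<^sup>+x. ennreal (indicator Y' x * \<bar>det (matrix (f' x))\<bar>) \<partial>lborel) = ennreal r" using r by simp
  qed (use r in auto)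
  then have hi: "((\<lambda>x. \<bar>det (matrix (f' x))\<bar>) has_integral r) Y'"
    by (subst has_integral_restrict_UNIV[symmetric]) (simp add: indicator_def if_distrib[of "\<lambda>c. c * _"] of_bool_def cong: if_cong)
  have Y'l: "Y' \<in> sets lebesgue" using Y'b by simp
  have int: "(\<lambda>x. \<bar>det (matrix (f' x))\<bar>) integrable_on Y'" using hi by blast
  have lm: "f ` Y' \<in> lmeasurable" by (rule measurable_differentiable_image[OF Y'l der int])
  have "measure lebesgue (f ` Y') \<le> r"
    using measure_differentiable_image[OF Y'l der int] hi by (simp add: integral_unique)
  then have "emeasure lebesgue (f ` Y') \<le> ennreal r"
    using lm by (simp add: emeasure_eq_measure2 ennreal_leI)
  moreover have "emeasure lebesgue (f ` Y') = emeasure lborel (f ` Y')" using fb by simp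
  moreover have "emeasure lborel (f ` Y') = emeasure lborel (\<xi> ` Y)"
  proof -
    have "emeasure lborel (f ` Y') = emeasure (distr lborel borel (to_real :: complex^'m \<Rightarrow> _)) (f ` Y')"
      by (simp add: distr_to_real)
    also have "\<dots> = emeasure lborel (to_real -` (f ` Y') :: (complex^'m) set)"
      using fb by (subst emeasure_distr) auto
    also have "to_real -` (f ` Y') = \<xi> ` Y" unfolding fimg by auto
    finally show ?thesis .
  qed
  ultimately show ?thesis using r by simp
qed simp

section \<open>Metrics in charts\<close>

lemma gram_change:
  fixes P :: "real^'n^'n::finite"
  assumes g: "bilinear g" and f: "\<And>a. f a = (\<Sum>c\<in>UNIV. P $ a $ c *\<^sub>R u c)"
  shows "det (\<chi> a b. g (f a) (f b) :: real^'n^'n) = (det P)\<^sup>2 * det (\<chi> a b. g (u a) (u b) :: real^'n^'n)"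
proof -
  let ?G = "\<chi> a b. g (u a) (u b)"
  have ent: "g (f a) (f b) = (P ** ?G ** transpose P) $ a $ b" for a b
  proof -
    have "g (f a) (f b) = (\<Sum>d\<in>UNIV. \<Sum>c\<in>UNIV. P $ a $ c * (P $ b $ d * g (u c) (u d)))"
      using g unfolding f bilinear_def
      by (simp add: linear_sum[of "\<lambda>x. g x _"] linear_scale[of "\<lambda>x. g x _"] linear_sum linear_scale sum_distrib_left mult_ac)
    also have "\<dots> = (P ** ?G ** transpose P) $ a $ b"
      by (simp add: matrix_matrix_mult_def transpose_def sum_distrib_left mult_ac)
    finally show ?thesis .
  qed
  have "(\<chi> a b. g (f a) (f b)) = P ** ?G ** transpose P" by (simp add: vec_eq_iff ent)
  then show ?thesis by (simp add: det_mul det_transpose power2_eq_square)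
qed

lemma smooth_on_continuous_on: "smooth_on S f \<Longrightarrow> continuous_on S f"
  unfolding smooth_on_def by (metis Ck_on.simps(1))

text \<open>A common notion for the pseudometric, which is definite on \<open>A\<close> only, and
  the metrics \<open>g s\<close>, which satisfy it for every set.\<close>

definition metric_on :: "('a, 'm::finite) chart set \<Rightarrow> 'a set \<Rightarrow> ('a, 'm) metric \<Rightarrow> bool" where
  "metric_on atlas A g \<longleftrightarrow> smooth_metric atlas g \<and> (\<forall>x. hform (g x)) \<and> (\<forall>x\<in>A. pos_def (g x))"

lemma metric_on_hform: "metric_on atlas A g \<Longrightarrow> hform (g x)"
  and metric_on_pos_def: "metric_on atlas A g \<Longrightarrow> x \<in> A \<Longrightarrow> pos_def (g x)"
  and metric_on_smooth: "metric_on atlas A g \<Longrightarrow> smooth_metric atlas g"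
  by (auto simp: metric_on_def)

locale cmanifold =
  fixes atlas :: "('a::t2_space, 'm::finite) chart set"
  assumes compact: "compact (UNIV :: 'a set)" and manifold: "complex_manifold atlas"
begin

lemma chart_open: "c \<in> atlas \<Longrightarrow> open (fst c)"
  and chart_image_open: "c \<in> atlas \<Longrightarrow> open (snd c ` fst c)"
  and chart_homeo: "c \<in> atlas \<Longrightarrow> homeomorphism (fst c) (snd c ` fst c) (snd c) (cinv c)"
  and transition_hol: "c \<in> atlas \<Longrightarrow> d \<in> atlas \<Longrightarrow>
    hol_on (snd c ` (fst c \<inter> fst d)) (\<lambda>z. snd d (cinv c z) $ j)"
  using manifold unfolding complex_manifold_def by blast+

lemma cinv_snd: "c \<in> atlas \<Longrightarrow> x \<in> fst c \<Longrightarrow> cinv c (snd c x) = x"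
  using chart_homeo by (auto simp: homeomorphism_def)

lemma snd_cinv: "c \<in> atlas \<Longrightarrow> z \<in> snd c ` fst c \<Longrightarrow> snd c (cinv c z) = z"
  by (auto simp: cinv_snd)

lemma cinv_in: "c \<in> atlas \<Longrightarrow> z \<in> snd c ` fst c \<Longrightarrow> cinv c z \<in> fst c"
  by (auto simp: cinv_snd)

lemma continuous_chart: "c \<in> atlas \<Longrightarrow> S \<subseteq> fst c \<Longrightarrow> continuous_on S (snd c)"
  by (rule continuous_on_subset[OF homeomorphism_cont1[OF chart_homeo]])

lemma continuous_cinv: "c \<in> atlas \<Longrightarrow> S \<subseteq> snd c ` fst c \<Longrightarrow> continuous_on S (cinv c)"
  by (rule continuous_on_subset[OF homeomorphism_cont2[OF chart_homeo]])

lemma image_chart_eq: "c \<in> atlas \<Longrightarrow> P \<subseteq> fst c \<Longrightarrow> snd c ` P = snd c ` fst c \<inter> cinv c -` P"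
  by (fastforce simp: cinv_snd subset_iff)

lemma open_chart_image: "c \<in> atlas \<Longrightarrow> open P \<Longrightarrow> open (snd c ` (fst c \<inter> P))"
proof -
  assume c: "c \<in> atlas" and P: "open P"
  have "snd c ` (fst c \<inter> P) = snd c ` fst c \<inter> cinv c -` P" by (auto simp: cinv_snd[OF c])
  then show ?thesis
    using continuous_open_preimage[OF continuous_cinv[OF c order_refl] chart_image_open[OF c] P] by simp
qed

lemma chart_at: "chart_at atlas x \<in> atlas" "x \<in> fst (chart_at atlas x)"
proof -
  have "\<exists>c. c \<in> atlas \<and> x \<in> fst c" using manifold unfolding complex_manifold_def by blast
  from someI_ex[OF this] show "chart_at atlas x \<in> atlas" "x \<in> fst (chart_at atlas x)"
    by (auto simp: chart_at_def)
qed

definition transition :: "('a, 'm) chart \<Rightarrow> ('a, 'm) chart \<Rightarrow> 'a \<Rightarrow> complex^'m \<Rightarrow> complex^'m" where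
  "transition c d x = frechet_derivative (snd d \<circ> cinv c) (at (snd c x))"

text \<open>The complex linear derivatives of the components assemble to one of the whole map.
  Complex linearity is what keeps pulled back metrics J-invariant.\<close>

lemma transition_derivative_ex:
  assumes c: "c \<in> atlas" and d: "d \<in> atlas" and x: "x \<in> fst c" "x \<in> fst d"
  shows "\<exists>D. ((snd d \<circ> cinv c) has_derivative D) (at (snd c x)) \<and> (\<forall>a v. D (a *s v) = a *s D v)"
proof -
  have "snd c x \<in> snd c ` (fst c \<inter> fst d)" using x by blast
  then have "\<forall>j. \<exists>f'. ((\<lambda>z. snd d (cinv c z) $ j) has_derivative f') (at (snd c x)) \<and> (\<forall>a v. f' (a *s v) = a * f' v)"
    using transition_hol[OF c d] unfolding hol_on_def by blast
  then obtain f' where f': "\<And>j. ((\<lambda>z. snd d (cinv c z) $ j) has_derivative f' j) (at (snd c x))"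
    "\<And>j a v. f' j (a *s v) = a * f' j v" by metis
  have ax: "v = (\<Sum>j\<in>UNIV. axis j (v $ j))" for v :: "complex^'m"
    by (simp add: vec_eq_iff axis_def)
  have lin: "bounded_linear (\<lambda>c :: complex. axis j c :: complex^'m)" for j
    by (auto simp: linear_conv_bounded_linear[symmetric] vec_eq_iff axis_def intro!: linearI)
  have "((\<lambda>z. \<Sum>j\<in>UNIV. axis j (snd d (cinv c z) $ j)) has_derivative (\<lambda>v. \<Sum>j\<in>UNIV. axis j (f' j v))) (at (snd c x))"
    by (intro has_derivative_sum bounded_linear.has_derivative[OF lin] f')
  then have "((snd d \<circ> cinv c) has_derivative (\<lambda>v. \<Sum>j\<in>UNIV. axis j (f' j v))) (at (snd c x))"
    by (simp add: ax[symmetric] o_def)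
  moreover have "(\<Sum>j\<in>UNIV. axis j (f' j (a *s v))) = a *s (\<Sum>j\<in>UNIV. axis j (f' j v))" for a v
    by (simp add: vec_eq_iff axis_def f'(2))
  ultimately show ?thesis by blast
qed

lemma transition_derivative:
  assumes "c \<in> atlas" "d \<in> atlas" "x \<in> fst c" "x \<in> fst d"
  shows "((snd d \<circ> cinv c) has_derivative transition c d x) (at (snd c x))"
  using transition_derivative_ex[OF assms] unfolding transition_def
  by (metis frechet_derivative_at)

lemma transition_cscale:
  assumes "c \<in> atlas" "d \<in> atlas" "x \<in> fst c" "x \<in> fst d"
  shows "transition c d x (a *s v) = a *s transition c d x v"
  using transition_derivative_ex[OF assms] unfolding transition_def
  by (metis frechet_derivative_at)

lemma transition_linear:
  assumes "c \<in> atlas" "d \<in> atlas" "x \<in> fst c" "x \<in> fst d"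
  shows "linear (transition c d x)"
  using has_derivative_linear[OF transition_derivative[OF assms]] .

lemma transition_self: assumes c: "c \<in> atlas" and x: "x \<in> fst c" shows "transition c c x = id"
proof -
  have "((snd c \<circ> cinv c) has_derivative id) (at (snd c x))"
    using has_derivative_id chart_image_open[OF c]
    by (rule has_derivative_transform_within_open) (use x snd_cinv[OF c] in auto)
  then show ?thesis
    using has_derivative_unique transition_derivative[OF c c x x] by blast
qed

lemma transition_comp:
  assumes c: "c \<in> atlas" and d: "d \<in> atlas" and e: "e \<in> atlas" and x: "x \<in> fst c" "x \<in> fst d" "x \<in> fst e"
  shows "transition c e x = transition d e x \<circ> transition c d x"
proof -
  have 1: "((snd d \<circ> cinv c) has_derivative transition c d x) (at (snd c x))"
    by (rule transition_derivative[OF c d x(1,2)])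
  have "(snd d \<circ> cinv c) (snd c x) = snd d x" using cinv_snd[OF c x(1)] by simp
  then have 2: "((snd e \<circ> cinv d) has_derivative transition d e x) (at ((snd d \<circ> cinv c) (snd c x)))"
    using transition_derivative[OF d e x(2,3)] by simp
  have "((snd e \<circ> cinv c) has_derivative transition d e x \<circ> transition c d x) (at (snd c x))"
    using diff_chain_at[OF 1 2]
  proof (rule has_derivative_transform_within_open)
    show "open (snd c ` (fst c \<inter> fst d))" by (rule open_chart_image[OF c chart_open[OF d]])
    show "snd c x \<in> snd c ` (fst c \<inter> fst d)" using x by blast
  qed (use cinv_snd[OF c] cinv_snd[OF d] in auto)
  then show ?thesis
    using has_derivative_unique transition_derivative[OF c e x(1,3)] by blast
qed

text \<open>The reference coordinates at x come from a chart as well, so the rules for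
  \<open>tangent\<close> are instances of the chain rule for coordinate changes.\<close>

lemma tangent_eq: "tangent atlas c x = transition c (chart_at atlas x) x"
  by (simp add: tangent_def transition_def)

lemma tangent_linear: "c \<in> atlas \<Longrightarrow> x \<in> fst c \<Longrightarrow> linear (tangent atlas c x)"
  unfolding tangent_eq using transition_linear chart_at by blast

lemma tangent_cscale: "c \<in> atlas \<Longrightarrow> x \<in> fst c \<Longrightarrow> tangent atlas c x (a *s v) = a *s tangent atlas c x v"
  unfolding tangent_eq using transition_cscale chart_at by blast

lemma tangent_comp: "c \<in> atlas \<Longrightarrow> d \<in> atlas \<Longrightarrow> x \<in> fst c \<Longrightarrow> x \<in> fst d \<Longrightarrow>
    tangent atlas d x = tangent atlas c x \<circ> transition d c x"
  unfolding tangent_eq using transition_comp chart_at by blast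

lemma tangent_surj: assumes c: "c \<in> atlas" "x \<in> fst c" shows "surj (tangent atlas c x)"
proof -
  let ?e = "chart_at atlas x"
  have "tangent atlas c x \<circ> transition ?e c x = id"
    unfolding tangent_eq using transition_comp[of ?e c ?e x] transition_self[of ?e x] chart_at c by auto
  then have "tangent atlas c x (transition ?e c x v) = v" for v by (metis comp_apply id_apply)
  then show ?thesis by (rule surjI)
qed

lemma local_metric_eq:
  "c \<in> atlas \<Longrightarrow> x \<in> fst c \<Longrightarrow>
     local_metric atlas c g (snd c x) v w = g x (tangent atlas c x v) (tangent atlas c x w)"
  by (simp add: local_metric_def cinv_snd)

definition gram :: "('a, 'm) chart \<Rightarrow> ('a, 'm) metric \<Rightarrow> complex^'m \<Rightarrow> real^('m + 'm)^('m + 'm)" where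
  "gram c g z = (\<chi> a b. local_metric atlas c g z (real_basis a) (real_basis b))"

lemma volume_density_gram: "volume_density atlas c g z = sqrt (det (gram c g z))"
  by (simp add: volume_density_def gram_def)

lemma continuous_local_metric:
  "smooth_metric atlas g \<Longrightarrow> c \<in> atlas \<Longrightarrow> S \<subseteq> snd c ` fst c \<Longrightarrow> continuous_on S (\<lambda>z. local_metric atlas c g z v w)"
  unfolding smooth_metric_def using smooth_on_continuous_on continuous_on_subset by blast

lemma continuous_det:
  fixes M :: "complex^'m \<Rightarrow> 'k::finite \<Rightarrow> 'k \<Rightarrow> real"
  assumes "\<And>a b. continuous_on S (\<lambda>z. M z a b)"
  shows "continuous_on S (\<lambda>z. det (\<chi> a b. M z a b))"
  unfolding det_def by (auto intro!: continuous_intros assms)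

lemma continuous_volume_density:
  "smooth_metric atlas g \<Longrightarrow> c \<in> atlas \<Longrightarrow> S \<subseteq> snd c ` fst c \<Longrightarrow> continuous_on S (volume_density atlas c g)"
  unfolding volume_density_gram[abs_def] gram_def
  by (intro continuous_on_real_sqrt continuous_det continuous_local_metric)

lemma gram_frame:
  assumes "c \<in> atlas" "x \<in> fst c"
  shows "gram c g (snd c x) = (\<chi> a b. g x (tangent atlas c x (real_basis a)) (tangent atlas c x (real_basis b)))"
  using assms by (simp add: gram_def local_metric_eq)

text \<open>The matrix P holds the coordinates of the transformed basis vectors; it is the transpose
  of the real Jacobian matrix, and the Gram determinants differ by its squared determinant.\<close>

lemma volume_density_change:
  assumes c: "c \<in> atlas" and d: "d \<in> atlas" and x: "x \<in> fst c" "x \<in> fst d" and g: "hform (g x)"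
  shows "volume_density atlas d g (snd d x) = \<bar>real_det (transition d c x)\<bar> * volume_density atlas c g (snd c x)"
proof -
  let ?D = "transition d c x" and ?T = "tangent atlas c x"
  define P where "P = (\<chi> a b. inner (?D (real_basis a)) (real_basis b) :: real^('m+'m)^('m+'m))"
  have lin: "linear ?T" "linear ?D" using tangent_linear transition_linear c d x by auto
  have "tangent atlas d x (real_basis a) = (\<Sum>b\<in>UNIV. P $ a $ b *\<^sub>R ?T (real_basis b))" for a
  proof -
    have "tangent atlas d x (real_basis a) = ?T (?D (real_basis a))"
      using tangent_comp[OF c d x] by simp
    also have "\<dots> = ?T (\<Sum>b\<in>UNIV. inner (?D (real_basis a)) (real_basis b) *\<^sub>R real_basis b)"
      using real_basis_expansion[of "?D (real_basis a)"] by simp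
    finally show ?thesis using lin by (simp add: linear_sum linear_scale P_def)
  qed
  from gram_change[OF hform_bilinear[OF g] this]
  have "det (gram d g (snd d x)) = (det P)\<^sup>2 * det (gram c g (snd c x))"
    using c d x by (simp add: gram_frame)
  moreover have "det P = real_det ?D"
  proof -
    have "transpose P = (\<chi> a b. inner (?D (real_basis b)) (real_basis a))"
      by (simp add: P_def transpose_def vec_eq_iff)
    then show ?thesis using det_transpose[of P] by (simp add: real_det_def)
  qed
  ultimately show ?thesis by (simp add: volume_density_gram real_sqrt_mult)
qed

lemma hform_pullback:
  assumes c: "c \<in> atlas" "x \<in> fst c" and g: "hform (g x)"
  shows "hform (local_metric atlas c g (snd c x))"
proof -
  note b = hform_bilinear[OF g]
  have "bilinear (local_metric atlas c g (snd c x))"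
    using b tangent_linear[OF c] unfolding local_metric_eq[OF c, abs_def] bilinear_def
    by (auto intro!: linearI simp: linear_add linear_scale bilinear_ladd[OF b] bilinear_radd[OF b] bilinear_lmul[OF b] bilinear_rmul[OF b])
  then show ?thesis
    using hform_sym[OF g] hform_ii[OF g] unfolding hform_def symmetric_bilinear_def J_inv_def
    by (simp add: local_metric_eq[OF c] tangent_cscale[OF c])
qed

lemma tangent_nonzero: assumes c: "c \<in> atlas" "x \<in> fst c" and v: "v \<noteq> 0" shows "tangent atlas c x v \<noteq> 0"
proof -
  have "inj (tangent atlas c x)"
    using linear_surj_imp_inj[OF tangent_linear[OF c] tangent_surj[OF c]] .
  then show ?thesis using v linear_0[OF tangent_linear[OF c]] by (metis injD)
qed

lemma pos_def_pullback:
  assumes c: "c \<in> atlas" "x \<in> fst c" and g: "pos_def (g x)"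
  shows "pos_def (local_metric atlas c g (snd c x))"
  using g tangent_nonzero[OF c] by (simp add: pos_def_def local_metric_eq[OF c])

lemma volume_density_pos:
  assumes c: "c \<in> atlas" "x \<in> fst c" and g: "hform (g x)" "pos_def (g x)"
  shows "volume_density atlas c g (snd c x) > 0"
proof -
  \<comment> \<open>Positivity of the Gram determinant is the second part of
    \<open>psum_cramer\<close>, instantiated with the zero form of degree 0 in a one-dimensional
    fibre.\<close>
  have "rmult 0 (\<lambda>_. 0 :: complex^unit)" by (simp add: rmult_def)
  moreover have "fform (\<lambda>v w :: complex^unit. v $ () * cnj (w $ ()))"
  proof -
    have "0 < Re (v $ () * cnj (v $ ()))" if "v \<noteq> 0" for v :: "complex^unit"
    proof -
      have "v $ () \<noteq> 0" using that by (auto simp: vec_eq_iff)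
      then show ?thesis by (simp only: complex_norm_square[symmetric] Re_complex_of_real) simp
    qed
    then show ?thesis unfolding fform_def by (simp add: algebra_simps)
  qed
  ultimately have "det (\<chi> a b. g x (tangent atlas c x (real_basis a)) (tangent atlas c x (real_basis b))) > 0"
    by (intro psum_cramer(2)[OF _ _ _ g(1) orthonormal_orthonormal_basis[OF g] tangent_linear[OF c] tangent_surj[OF c] refl])
  then show ?thesis by (simp add: volume_density_gram gram_frame[OF c])
qed

end

section \<open>The Riemannian measure\<close>

lemma nn_integral_le_of_emeasure_le:
  assumes sets: "sets M = sets N" and le: "\<And>X. X \<in> sets N \<Longrightarrow> emeasure M X \<le> C * emeasure N X"
    and f: "f \<in> borel_measurable N"
  shows "(\<integral>\<^sup>+x. f x \<partial>M) \<le> C * (\<integral>\<^sup>+x. f x \<partial>N)"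
  using f
proof (induction f rule: borel_measurable_induct)
  case (cong f g)
  have "space M = space N" using sets by (rule sets_eq_imp_space_eq)
  then show ?case using cong nn_integral_cong[of M f g] nn_integral_cong[of N f g] by simp
next
  case (set X)
  then show ?case using le sets by simp
next
  case (mult u c)
  have u: "u \<in> borel_measurable M" using mult sets by (simp cong: measurable_cong_sets)
  have "(\<integral>\<^sup>+x. c * u x \<partial>M) = c * (\<integral>\<^sup>+x. u x \<partial>M)" by (rule nn_integral_cmult[OF u])
  also have "\<dots> \<le> c * (C * (\<integral>\<^sup>+x. u x \<partial>N))" using mult by (intro mult_left_mono) auto
  also have "\<dots> = C * (\<integral>\<^sup>+x. c * u x \<partial>N)" using mult by (simp add: nn_integral_cmult mult_ac)
  finally show ?case .
next
  case (add u v)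
  have m: "u \<in> borel_measurable M" "v \<in> borel_measurable M" using add sets by (auto cong: measurable_cong_sets)
  show ?case using add m by (simp add: nn_integral_add distrib_left add_mono)
next
  case (seq U)
  have m: "\<And>i. U i \<in> borel_measurable M" using seq.hyps(1) sets by (simp cong: measurable_cong_sets)
  have e: "(\<lambda>x. (SUP i. U i) x) = (\<lambda>x. SUP i. U i x)" by (simp add: fun_eq_iff image_image)
  have "(\<integral>\<^sup>+x. (SUP i. U i x) \<partial>M) = (SUP i. (\<integral>\<^sup>+x. U i x \<partial>M))"
    by (rule nn_integral_monotone_convergence_SUP[OF seq.hyps(3) m])
  also have "\<dots> \<le> C * (SUP i. (\<integral>\<^sup>+x. U i x \<partial>N))"
    by (rule SUP_least) (rule order_trans[OF seq.IH], auto intro!: mult_left_mono SUP_upper)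
  also have "(SUP i. (\<integral>\<^sup>+x. U i x \<partial>N)) = (\<integral>\<^sup>+x. (SUP i. U i x) \<partial>N)"
    by (rule nn_integral_monotone_convergence_SUP[OF seq.hyps(3,1), symmetric])
  finally show ?case unfolding e .
qed

context cmanifold begin

definition cover where "cover = finite_cover atlas"

definition piece :: "nat \<Rightarrow> 'a set" where
  "piece k = fst (cover ! k) - (\<Union>j<k. fst (cover ! j))"

lemma cover: "set cover \<subseteq> atlas" "(\<Union>c\<in>set cover. fst c) = UNIV"
proof -
  have "UNIV \<subseteq> \<Union>(fst ` atlas)" using manifold unfolding complex_manifold_def by auto
  moreover have "\<And>B. B \<in> fst ` atlas \<Longrightarrow> open B" using chart_open by auto
  ultimately obtain \<C> where C: "\<C> \<subseteq> fst ` atlas" "finite \<C>" "UNIV \<subseteq> \<Union>\<C>"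
    using compactE[OF compact] by metis
  then obtain D where D: "D \<subseteq> atlas" "finite D" "\<C> = fst ` D" using finite_subset_image by metis
  then obtain cs where "set cs = D" using finite_list by blast
  then have "\<exists>cs. set cs \<subseteq> atlas \<and> (\<Union>c\<in>set cs. fst c) = UNIV" using C D by (intro exI[of _ cs]) auto
  from someI_ex[OF this] show "set cover \<subseteq> atlas" "(\<Union>c\<in>set cover. fst c) = UNIV"
    by (auto simp: cover_def finite_cover_def)
qed

lemma cover_atlas: "k < length cover \<Longrightarrow> cover ! k \<in> atlas"
  using cover(1) by auto

lemma piece_subset: "piece k \<subseteq> fst (cover ! k)" by (auto simp: piece_def)

lemma piece_borel: "k < length cover \<Longrightarrow> piece k \<in> sets borel"
  unfolding piece_def using chart_open[OF cover_atlas]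
  by (intro sets.Diff borel_open sets.finite_UN) (auto intro!: open_UN borel_open)

lemma piece_disjoint: "x \<in> piece j \<Longrightarrow> x \<in> piece k \<Longrightarrow> j = k"
  unfolding piece_def by (metis DiffE UN_I lessThan_iff linorder_neqE_nat)

lemma piece_ex: "\<exists>k<length cover. x \<in> piece k"
proof -
  have "\<exists>k. k < length cover \<and> x \<in> fst (cover ! k)"
    using cover(2) by (metis UNIV_I UN_E in_set_conv_nth)
  then obtain k where k: "k < length cover \<and> x \<in> fst (cover ! k)"
    and least: "\<And>j. j < k \<Longrightarrow> \<not> (j < length cover \<and> x \<in> fst (cover ! j))"
    using exists_least_iff[of "\<lambda>k. k < length cover \<and> x \<in> fst (cover ! k)"] by blast
  then have "x \<in> piece k" unfolding piece_def using order_less_trans by blast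
  then show ?thesis using k by blast
qed

lemma sum_pieces:
  fixes f :: "nat \<Rightarrow> 'b::{comm_monoid_add}"
  assumes "k < length cover" "x \<in> piece k"
  shows "(\<Sum>j<length cover. if x \<in> piece j then f j else 0) = f k"
proof -
  have "(\<Sum>j<length cover. if x \<in> piece j then f j else 0) = (\<Sum>j<length cover. if j = k then f j else 0)"
    using assms piece_disjoint by (intro sum.cong) auto
  then show ?thesis using assms by simp
qed

lemma cinv_measurable: "c \<in> atlas \<Longrightarrow> P \<subseteq> fst c \<Longrightarrow> cinv c \<in> borel_measurable (restrict_space borel (snd c ` P))"
  by (rule borel_measurable_continuous_on_restrict[OF continuous_cinv]) auto

lemma chart_borel: assumes c: "c \<in> atlas" and P: "P \<in> sets borel" "P \<subseteq> fst c" shows "snd c ` P \<in> sets borel"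
proof -
  have "cinv c -` P \<inter> space (restrict_space borel (snd c ` fst c)) \<in> sets (restrict_space borel (snd c ` fst c))"
    using measurable_sets[OF cinv_measurable[OF c order_refl] P(1)] .
  then have "snd c ` P \<in> sets (restrict_space borel (snd c ` fst c))"
    using image_chart_eq[OF c P(2)] by (simp add: Int_commute space_restrict_space)
  then show ?thesis
    using chart_image_open[OF c] by (auto simp: sets_restrict_space_iff)
qed

lemma cinv_borel: assumes c: "c \<in> atlas" and X: "X \<in> sets borel" "X \<subseteq> snd c ` fst c"
  shows "cinv c ` X \<in> sets borel"
proof -
  have "snd c \<in> borel_measurable (restrict_space borel (fst c))"
    by (rule borel_measurable_continuous_on_restrict[OF continuous_chart[OF c order_refl]])
  from measurable_sets[OF this X(1)]
  have "snd c -` X \<inter> fst c \<in> sets (restrict_space borel (fst c))" by (simp add: space_restrict_space)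
  moreover have "snd c -` X \<inter> fst c = cinv c ` X"
  proof (intro set_eqI iffI)
    fix x assume "x \<in> snd c -` X \<inter> fst c"
    then have "cinv c (snd c x) = x" "snd c x \<in> X" using cinv_snd[OF c] by auto
    then show "x \<in> cinv c ` X" by (metis imageI)
  next
    fix x assume "x \<in> cinv c ` X"
    then obtain z where "z \<in> X" "x = cinv c z" by blast
    then show "x \<in> snd c -` X \<inter> fst c" using X(2) snd_cinv[OF c] cinv_in[OF c] by auto
  qed
  ultimately show ?thesis using chart_open[OF c] by (auto simp: sets_restrict_space_iff)
qed

definition chart_measure :: "('a, 'm) chart \<Rightarrow> 'a set \<Rightarrow> 'a measure" where
  "chart_measure c P = distr (restrict_space lborel (snd c ` P)) borel (cinv c)"

lemma sets_chart_measure [simp]: "sets (chart_measure c P) = sets borel"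
  by (simp add: chart_measure_def)

lemma cinv_measurable': "c \<in> atlas \<Longrightarrow> P \<subseteq> fst c \<Longrightarrow> cinv c \<in> restrict_space lborel (snd c ` P) \<rightarrow>\<^sub>M borel"
  using cinv_measurable[of c P] measurable_cong_sets[OF sets_restrict_space_cong[OF sets_lborel] refl] by blast

lemma emeasure_chart_measure:
  assumes c: "c \<in> atlas" and P: "P \<in> sets borel" "P \<subseteq> fst c" and S: "S \<in> sets borel"
  shows "emeasure (chart_measure c P) S = emeasure lborel (snd c ` (S \<inter> P))"
proof -
  have "emeasure (chart_measure c P) S = emeasure (restrict_space lborel (snd c ` P)) (cinv c -` S \<inter> snd c ` P)"
    using cinv_measurable'[OF c P(2)] S by (simp add: chart_measure_def emeasure_distr space_restrict_space)
  also have "cinv c -` S \<inter> snd c ` P = snd c ` (S \<inter> P)" using P cinv_snd[OF c] by auto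
  finally show ?thesis using chart_borel[OF c P] by (subst (asm) emeasure_restrict_space) auto
qed

lemma nn_integral_chart_measure:
  assumes c: "c \<in> atlas" and P: "P \<in> sets borel" "P \<subseteq> fst c" and f: "f \<in> borel_measurable borel"
  shows "(\<integral>\<^sup>+x. f x \<partial>chart_measure c P) = (\<integral>\<^sup>+z. f (cinv c z) * indicator (snd c ` P) z \<partial>lborel)"
  unfolding chart_measure_def using cinv_measurable'[OF c P(2)] f chart_borel[OF c P]
  by (simp add: nn_integral_distr nn_integral_restrict_space)

text \<open>A reference measure that does not involve a metric. Every \<open>dvol\<close> has a
  density with respect to it, so pointwise inequalities between weighted norms for two metrics can
  be integrated.\<close>

definition base_measure :: "'a measure" where
  "base_measure = measure_of UNIV (sets borel)
     (\<lambda>S. \<Sum>k<length cover. emeasure (chart_measure (cover ! k) (piece k)) S)"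

lemma sets_base_measure [simp]: "sets base_measure = sets borel"
  and space_base_measure [simp]: "space base_measure = UNIV"
  using sets.sigma_sets_eq[of borel] by (simp_all add: base_measure_def)

lemma emeasure_base_measure: assumes "S \<in> sets borel"
  shows "emeasure base_measure S = (\<Sum>k<length cover. emeasure (chart_measure (cover ! k) (piece k)) S)"
  unfolding base_measure_def
proof (rule emeasure_measure_of_sigma)
  show "sigma_algebra UNIV (sets (borel :: 'a measure))" using sets.sigma_algebra_axioms[of borel] by simp
  show "countably_additive (sets borel) (\<lambda>S. \<Sum>k<length cover. emeasure (chart_measure (cover ! k) (piece k)) S)"
  proof (rule countably_additiveI)
    fix F :: "nat \<Rightarrow> 'a set" assume F: "range F \<subseteq> sets borel" "disjoint_family F"
    have "(\<Sum>i. \<Sum>k<length cover. emeasure (chart_measure (cover ! k) (piece k)) (F i)) =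
        (\<Sum>k<length cover. \<Sum>i. emeasure (chart_measure (cover ! k) (piece k)) (F i))"
      by (rule suminf_sum) (rule summableI)
    also have "\<dots> = (\<Sum>k<length cover. emeasure (chart_measure (cover ! k) (piece k)) (\<Union>i. F i))"
      using F by (intro sum.cong refl suminf_emeasure) auto
    finally show "(\<Sum>i. \<Sum>k<length cover. emeasure (chart_measure (cover ! k) (piece k)) (F i)) =
        (\<Sum>k<length cover. emeasure (chart_measure (cover ! k) (piece k)) (\<Union>i. F i))" .
  qed
qed (use assms in \<open>auto simp: positive_def\<close>)

lemma nn_integral_base_measure:
  assumes f: "f \<in> borel_measurable borel"
  shows "(\<integral>\<^sup>+x. f x \<partial>base_measure) = (\<Sum>k<length cover. \<integral>\<^sup>+x. f x \<partial>chart_measure (cover ! k) (piece k))"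
proof -
  have m: "u \<in> borel_measurable base_measure \<longleftrightarrow> u \<in> borel_measurable borel"
    "u \<in> borel_measurable (chart_measure c P) \<longleftrightarrow> u \<in> borel_measurable borel" for u :: "'a \<Rightarrow> ennreal" and c P
    by (auto cong: measurable_cong_sets)
  from f show ?thesis
  proof (induction f rule: borel_measurable_induct)
    case (cong f g) then show ?case by (simp add: fun_eq_iff[symmetric])
  next
    case (set X) then show ?case by (simp add: emeasure_base_measure)
  next
    case (mult u c) then show ?case by (simp add: nn_integral_cmult m sum_distrib_left)
  next
    case (add u v) then show ?case by (simp add: nn_integral_add m sum.distrib)
  next
    case (seq U)
    have e: "(\<lambda>x. (SUP i. U i) x) = (\<lambda>x. SUP i. U i x)" by (simp add: fun_eq_iff image_image)
    have mc: "(\<integral>\<^sup>+x. (SUP i. U i x) \<partial>M) = (SUP i. (\<integral>\<^sup>+x. U i x \<partial>M))" if "sets M = sets borel" for M :: "'a measure"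
      by (rule nn_integral_monotone_convergence_SUP[OF seq.hyps(3)]) (use seq.hyps(1) that in \<open>simp cong: measurable_cong_sets\<close>)
    have inc: "incseq (\<lambda>i. \<integral>\<^sup>+x. U i x \<partial>M)" for M
      using seq.hyps(3) by (auto simp: incseq_def le_fun_def intro!: nn_integral_mono)
    show ?case
      unfolding e by (simp add: mc seq.IH ennreal_SUP_sum[OF inc])
  qed
qed

definition vol :: "('a, 'm) metric \<Rightarrow> 'a \<Rightarrow> real" where
  "vol g x = (\<Sum>k<length cover. if x \<in> piece k then volume_density atlas (cover ! k) g (snd (cover ! k) x) else 0)"

lemma vol_piece: "k < length cover \<Longrightarrow> x \<in> piece k \<Longrightarrow> vol g x = volume_density atlas (cover ! k) g (snd (cover ! k) x)"
  unfolding vol_def by (rule sum_pieces)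

lemma vol_measurable [measurable]: assumes g: "smooth_metric atlas g" shows "vol g \<in> borel_measurable borel"
proof -
  have "(\<lambda>x. if x \<in> piece k then volume_density atlas (cover ! k) g (snd (cover ! k) x) else 0) \<in> borel_measurable borel"
    if k: "k < length cover" for k
  proof -
    let ?c = "cover ! k"
    have c: "?c \<in> atlas" by (rule cover_atlas[OF k])
    have "continuous_on (piece k) (\<lambda>x. volume_density atlas ?c g (snd ?c x))"
      by (rule continuous_on_compose2[OF continuous_volume_density[OF g c order_refl] continuous_chart[OF c piece_subset]])
        (use piece_subset in auto)
    from borel_measurable_continuous_on_indicator[OF piece_borel[OF k] this]
    moreover have "(\<lambda>x. indicator (piece k) x *\<^sub>R volume_density atlas ?c g (snd ?c x)) =
        (\<lambda>x. if x \<in> piece k then volume_density atlas ?c g (snd ?c x) else 0)"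
      by (auto simp: fun_eq_iff)
    ultimately show ?thesis by simp
  qed
  then show ?thesis unfolding vol_def[abs_def] by (intro borel_measurable_sum) auto
qed

lemma emeasure_density_vol:
  assumes g: "smooth_metric atlas g" and S: "S \<in> sets borel"
  shows "emeasure (density base_measure (\<lambda>x. ennreal (vol g x))) S =
    (\<Sum>k<length cover. \<integral>\<^sup>+z. ennreal (volume_density atlas (cover ! k) g z) *
      indicator (snd (cover ! k) ` (S \<inter> piece k)) z \<partial>lborel)"
proof -
  let ?D = "density base_measure (\<lambda>x. ennreal (vol g x))"
  have vm: "(\<lambda>x. ennreal (vol g x)) \<in> borel_measurable borel" using vol_measurable[OF g] by simp
  have "emeasure ?D S = (\<integral>\<^sup>+x. ennreal (vol g x) * indicator S x \<partial>base_measure)"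
    using vm S by (subst emeasure_density) (auto cong: measurable_cong_sets)
  also have "\<dots> = (\<Sum>k<length cover. \<integral>\<^sup>+x. ennreal (vol g x) * indicator S x \<partial>chart_measure (cover ! k) (piece k))"
    using vm S by (intro nn_integral_base_measure) auto
  also have "\<dots> = (\<Sum>k<length cover. \<integral>\<^sup>+z. ennreal (volume_density atlas (cover ! k) g z) *
    indicator (snd (cover ! k) ` (S \<inter> piece k)) z \<partial>lborel)"
  proof (intro sum.cong refl)
    fix k assume "k \<in> {..<length cover}"
    then have k: "k < length cover" by simp
    let ?c = "cover ! k"
    have c: "?c \<in> atlas" by (rule cover_atlas[OF k])
    have "(\<integral>\<^sup>+x. ennreal (vol g x) * indicator S x \<partial>chart_measure ?c (piece k)) =
      (\<integral>\<^sup>+z. ennreal (vol g (cinv ?c z)) * indicator S (cinv ?c z) * indicator (snd ?c ` piece k) z \<partial>lborel)"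
      using vm S by (intro nn_integral_chart_measure c piece_borel k piece_subset) auto
    also have "\<dots> = (\<integral>\<^sup>+z. ennreal (volume_density atlas ?c g z) * indicator (snd ?c ` (S \<inter> piece k)) z \<partial>lborel)"
    proof (intro nn_integral_cong)
      fix z
      show "ennreal (vol g (cinv ?c z)) * indicator S (cinv ?c z) * indicator (snd ?c ` piece k) z =
        ennreal (volume_density atlas ?c g z) * indicator (snd ?c ` (S \<inter> piece k)) z"
      proof (cases "z \<in> snd ?c ` piece k")
        case True
        then obtain x where x: "x \<in> piece k" "z = snd ?c x" by blast
        have cx: "cinv ?c z = x" using x piece_subset cinv_snd[OF c] by auto
        have "z \<in> snd ?c ` (S \<inter> piece k) \<longleftrightarrow> x \<in> S"
          using x piece_subset cinv_snd[OF c] by (auto simp: image_iff) (metis subsetD)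
        then show ?thesis using True by (simp add: cx vol_piece[OF k x(1)] x(2)[symmetric] indicator_def)
      qed (auto simp: indicator_def)
    qed
    finally show "(\<integral>\<^sup>+x. ennreal (vol g x) * indicator S x \<partial>chart_measure ?c (piece k)) =
      (\<integral>\<^sup>+z. ennreal (volume_density atlas ?c g z) * indicator (snd ?c ` (S \<inter> piece k)) z \<partial>lborel)" .
  qed
  finally show ?thesis .
qed

text \<open>A set function passed to \<open>measure_of\<close> is meaningful only if it is countably
  additive; identifying it with a density measure shows that this is so for
  \<open>dvol\<close>.\<close>

lemma dvol_eq: assumes g: "smooth_metric atlas g" shows "dvol atlas g = density base_measure (\<lambda>x. ennreal (vol g x))"
proof -
  let ?D = "density base_measure (\<lambda>x. ennreal (vol g x))"
  have "dvol atlas g = measure_of UNIV (sets borel) (emeasure ?D)"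
    unfolding dvol_def Let_def
  proof (rule measure_of_eq)
    fix S :: "'a set" assume "S \<in> sigma_sets UNIV (sets borel)"
    then have "S \<in> sets borel" using sets.sigma_sets_eq[of "borel :: 'a measure"] by simp
    from emeasure_density_vol[OF g this, symmetric] show "(\<Sum>k<length (finite_cover atlas). \<integral>\<^sup>+z. ennreal (volume_density atlas (finite_cover atlas ! k) g z) *
      indicator (snd (finite_cover atlas ! k) ` (S \<inter> (fst (finite_cover atlas ! k) - (\<Union>j<k. fst (finite_cover atlas ! j))))) z \<partial>lborel) = emeasure ?D S"
      unfolding piece_def cover_def .
  qed simp
  also have "\<dots> = ?D" using measure_of_of_measure[of ?D] by simp
  finally show ?thesis .
qed

lemma emeasure_dvol:
  "smooth_metric atlas g \<Longrightarrow> S \<in> sets borel \<Longrightarrow> emeasure (dvol atlas g) S =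
    (\<Sum>k<length cover. \<integral>\<^sup>+z. ennreal (volume_density atlas (cover ! k) g z) *
      indicator (snd (cover ! k) ` (S \<inter> piece k)) z \<partial>lborel)"
  by (simp add: dvol_eq emeasure_density_vol)

lemma vol_pos: "hform (g x) \<Longrightarrow> pos_def (g x) \<Longrightarrow> vol g x > 0"
proof -
  assume g: "hform (g x)" "pos_def (g x)"
  obtain k where k: "k < length cover" "x \<in> piece k" using piece_ex by blast
  then have "x \<in> fst (cover ! k)" using piece_subset by blast
  then show ?thesis using volume_density_pos[where g = g, OF cover_atlas[OF k(1)] _ g] by (simp add: vol_piece[OF k])
qed

text \<open>Functionals live in arbitrary charts, while \<open>dvol\<close> is computed in the
  charts of the cover. The set is split along the pieces; on each the Jacobian of the coordinate
  change is the density in the cover chart divided by the density in c, so only the positive lower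
  bound \<kappa> of the latter on the compact set enters.\<close>

lemma chart_measure_le:
  assumes c: "c \<in> atlas" and S: "compact S" "S \<subseteq> snd c ` (fst c \<inter> A)" and g: "metric_on atlas A g"
  shows "\<exists>C\<ge>0. \<forall>X\<in>sets borel. X \<subseteq> S \<longrightarrow> emeasure lborel X \<le> ennreal C * emeasure (dvol atlas g) (cinv c ` X)"
proof (cases "S = {}")
  case True
  then show ?thesis by (intro exI[of _ 0]) auto
next
  case False
  note sm = metric_on_smooth[OF g]
  have Sc: "S \<subseteq> snd c ` fst c" using S by auto
  have pos: "volume_density atlas c g z > 0" if z: "z \<in> S" for z
  proof -
    obtain x where "x \<in> fst c" "x \<in> A" "z = snd c x" using S z by blast
    then show ?thesis using volume_density_pos[OF c] metric_on_hform[OF g] metric_on_pos_def[OF g] by blast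
  qed
  obtain z0 where z0: "z0 \<in> S" "\<And>z. z \<in> S \<Longrightarrow> volume_density atlas c g z0 \<le> volume_density atlas c g z"
    using continuous_attains_inf[OF S(1) False continuous_volume_density[OF sm c Sc]] by blast
  define \<kappa> where "\<kappa> = volume_density atlas c g z0"
  have \<kappa>: "\<kappa> > 0" "\<And>z. z \<in> S \<Longrightarrow> \<kappa> \<le> volume_density atlas c g z" using pos z0 by (auto simp: \<kappa>_def)
  have "emeasure lborel X \<le> ennreal (1 / \<kappa>) * emeasure (dvol atlas g) (cinv c ` X)"
    if X: "X \<in> sets borel" "X \<subseteq> S" for X
  proof -
    have Xc: "X \<subseteq> snd c ` fst c" using X Sc by auto
    define Z where "Z = cinv c ` X"
    have Z: "Z \<in> sets borel" unfolding Z_def by (rule cinv_borel[OF c X(1) Xc])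
    have Zc: "Z \<subseteq> fst c" unfolding Z_def using Xc cinv_in[OF c] by auto
    have XZ: "X = snd c ` Z" unfolding Z_def image_image using snd_cinv[OF c] Xc by force
    let ?Xk = "\<lambda>k. snd c ` (Z \<inter> piece k)"
    have Xkb: "?Xk k \<in> sets borel" if "k < length cover" for k
      using Z piece_borel[OF that] Zc by (intro chart_borel[OF c]) auto
    have part: "emeasure lborel (?Xk k) \<le> ennreal (1 / \<kappa>) *
        (\<integral>\<^sup>+z. ennreal (volume_density atlas (cover ! k) g z) * indicator (snd (cover ! k) ` (Z \<inter> piece k)) z \<partial>lborel)"
      if k: "k < length cover" for k
    proof -
      let ?d = "cover ! k"
      define Y where "Y = snd ?d ` (Z \<inter> piece k)"
      define \<xi> where "\<xi> = snd c \<circ> cinv ?d"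
      have d: "?d \<in> atlas" by (rule cover_atlas[OF k])
      have sub: "Z \<inter> piece k \<subseteq> fst ?d" using piece_subset by auto
      have Yb: "Y \<in> sets borel" unfolding Y_def using Z piece_borel[OF k] sub by (intro chart_borel[OF d]) auto
      have img: "\<xi> ` Y = ?Xk k" unfolding Y_def \<xi>_def image_image o_def
        using sub cinv_snd[OF d] by (intro image_cong) auto
      have inY: "cinv ?d y \<in> Z" "cinv ?d y \<in> fst c" "cinv ?d y \<in> fst ?d" "snd ?d (cinv ?d y) = y" if "y \<in> Y" for y
        using that sub Zc cinv_snd[OF d] by (auto simp: Y_def subset_iff)
      have xiS: "\<xi> y \<in> S" if "y \<in> Y" for y
        using inY(1)[OF that] X XZ unfolding \<xi>_def by auto
      let ?D = "\<lambda>y. transition ?d c (cinv ?d y)"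
      have det: "\<bar>real_det (?D y)\<bar> = volume_density atlas ?d g y / volume_density atlas c g (\<xi> y)" if y: "y \<in> Y" for y
        using volume_density_change[OF c d inY(2,3)[OF y] metric_on_hform[OF g]] inY(4)[OF y] pos[OF xiS[OF y]]
        by (simp add: \<xi>_def field_simps)
      have Yd: "Y \<subseteq> snd ?d ` fst ?d" unfolding Y_def using sub by auto
      have cxi: "continuous_on Y \<xi>" unfolding \<xi>_def
        using inY(2) by (intro continuous_on_compose continuous_cinv[OF d Yd] continuous_chart[OF c]) auto
      have "continuous_on Y (\<lambda>y. volume_density atlas ?d g y / volume_density atlas c g (\<xi> y))"
        using pos xiS by (intro continuous_on_divide continuous_volume_density[OF sm d Yd]
            continuous_on_compose2[OF continuous_volume_density[OF sm c Sc] cxi]) fastforce+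
      from borel_measurable_continuous_on_indicator[OF Yb this]
      have "(\<lambda>y. indicator Y y *\<^sub>R (volume_density atlas ?d g y / volume_density atlas c g (\<xi> y))) \<in> borel_measurable borel" .
      moreover have "(\<lambda>y. indicator Y y *\<^sub>R (volume_density atlas ?d g y / volume_density atlas c g (\<xi> y))) =
          (\<lambda>y. indicator Y y * \<bar>real_det (?D y)\<bar>)"
        using det by (auto simp: indicator_def fun_eq_iff)
      ultimately have m: "(\<lambda>y. indicator Y y * \<bar>real_det (?D y)\<bar>) \<in> borel_measurable borel" by simp
      have "emeasure lborel (\<xi> ` Y) \<le> (\<integral>\<^sup>+y. ennreal (indicator Y y * \<bar>real_det (?D y)\<bar>) \<partial>lborel)"
      proof (rule emeasure_image_le[OF Yb _ _ m])
        show "\<xi> ` Y \<in> sets borel" unfolding img by (rule Xkb[OF k])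
        fix y assume y: "y \<in> Y"
        have "(\<xi> has_derivative ?D y) (at (snd ?d (cinv ?d y)))"
          unfolding \<xi>_def by (rule transition_derivative[OF d c inY(3,2)[OF y]])
        then show "(\<xi> has_derivative ?D y) (at y within Y)"
          using inY(4)[OF y] by (simp add: has_derivative_at_withinI)
      qed
      also have "\<dots> \<le> (\<integral>\<^sup>+y. ennreal (1 / \<kappa>) * (ennreal (volume_density atlas ?d g y) * indicator Y y) \<partial>lborel)"
      proof (rule nn_integral_mono)
        fix y
        show "ennreal (indicator Y y * \<bar>real_det (?D y)\<bar>) \<le> ennreal (1 / \<kappa>) * (ennreal (volume_density atlas ?d g y) * indicator Y y)"
        proof (cases "y \<in> Y")
          case True
          have dn: "volume_density atlas ?d g y \<ge> 0"
            using volume_density_change[OF c d inY(2,3)[OF True] metric_on_hform[OF g]] inY(4)[OF True] pos[OF xiS[OF True]]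
            by (simp add: \<xi>_def)
          have "\<bar>real_det (?D y)\<bar> \<le> 1 / \<kappa> * volume_density atlas ?d g y"
            unfolding det[OF True] using \<kappa>(2)[OF xiS[OF True]] \<kappa>(1) dn by (simp add: divide_left_mono)
          then show ?thesis using True dn \<kappa>(1) by (simp add: ennreal_mult'[symmetric] ennreal_leI)
        qed simp
      qed
      also have "\<dots> = ennreal (1 / \<kappa>) * (\<integral>\<^sup>+y. ennreal (volume_density atlas ?d g y) * indicator Y y \<partial>lborel)"
      proof (rule nn_integral_cmult)
        have "(\<lambda>y. indicator Y y *\<^sub>R volume_density atlas ?d g y) \<in> borel_measurable borel"
          by (rule borel_measurable_continuous_on_indicator[OF Yb continuous_volume_density[OF sm d Yd]])
        then have "(\<lambda>y. ennreal (indicator Y y *\<^sub>R volume_density atlas ?d g y)) \<in> borel_measurable borel" by simp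
        moreover have "(\<lambda>y. ennreal (indicator Y y *\<^sub>R volume_density atlas ?d g y)) =
          (\<lambda>y. ennreal (volume_density atlas ?d g y) * indicator Y y)" by (auto simp: indicator_def fun_eq_iff)
        ultimately show "(\<lambda>y. ennreal (volume_density atlas ?d g y) * indicator Y y) \<in> borel_measurable lborel" by simp
      qed
      finally show ?thesis unfolding img unfolding Y_def .
    qed
    have "Z = (\<Union>k<length cover. Z \<inter> piece k)" using piece_ex by blast
    then have "X = (\<Union>k<length cover. ?Xk k)" unfolding XZ by (metis image_UN)
    then have "emeasure lborel X \<le> (\<Sum>k<length cover. emeasure lborel (?Xk k))"
      using emeasure_subadditive_finite[of "{..<length cover}" ?Xk lborel] Xkb by auto
    also have "\<dots> \<le> (\<Sum>k<length cover. ennreal (1 / \<kappa>) *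
        (\<integral>\<^sup>+z. ennreal (volume_density atlas (cover ! k) g z) * indicator (snd (cover ! k) ` (Z \<inter> piece k)) z \<partial>lborel))"
      by (intro sum_mono part) auto
    also have "\<dots> = ennreal (1 / \<kappa>) * emeasure (dvol atlas g) Z"
      unfolding sum_distrib_left[symmetric] using sm Z by (simp add: emeasure_dvol)
    finally show ?thesis unfolding Z_def .
  qed
  then show ?thesis using \<kappa>(1) by (intro exI[of _ "1 / \<kappa>"]) auto
qed

end

section \<open>Bundle-valued forms\<close>

lemma fform_expand:
  assumes r: "fform r"
  shows "r v w = (\<Sum>i\<in>UNIV. \<Sum>j\<in>UNIV. v $ i * cnj (w $ j) * r (axis i 1) (axis j 1))"
proof -
  have ex: "v = (\<Sum>i\<in>UNIV. (v $ i) *s axis i 1)" for v :: "complex^'a"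
    by (simp add: vec_eq_iff axis_def if_distrib cong: if_cong)
  have l: "r (\<Sum>i\<in>S. c i *s x i) w = (\<Sum>i\<in>S. c i * r (x i) w)" for S c w and x :: "'a \<Rightarrow> _"
    by (induction S rule: infinite_finite_induct) (auto simp: fform_zero[OF r] fform_add[OF r] fform_scale[OF r])
  have rr: "r w (\<Sum>i\<in>S. c i *s x i) = (\<Sum>i\<in>S. cnj (c i) * r w (x i))" for S c w and x :: "'a \<Rightarrow> _"
    unfolding fform_cnj[OF r, of w "\<Sum>i\<in>S. c i *s x i"] l cnj_sum complex_cnj_mult
    using fform_cnj[OF r, of w] by simp
  have "r v w = r (\<Sum>i\<in>UNIV. (v $ i) *s axis i 1) (\<Sum>j\<in>UNIV. (w $ j) *s axis j 1)"
    using ex[of v] ex[of w] by simp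
  also have "\<dots> = (\<Sum>i\<in>UNIV. \<Sum>j\<in>UNIV. v $ i * cnj (w $ j) * r (axis i 1) (axis j 1))"
    unfolding l unfolding rr by (simp add: sum_distrib_left mult.assoc)
  finally show ?thesis .
qed

lemma fform_tendsto:
  assumes r: "fform r" and "(f \<longlongrightarrow> v) F" "(g \<longlongrightarrow> w) F"
  shows "((\<lambda>x. r (f x) (g x)) \<longlongrightarrow> r v w) F"
proof -
  have lim: "((\<lambda>x. \<Sum>i\<in>UNIV. \<Sum>j\<in>UNIV. f x $ i * cnj (g x $ j) * r (axis i 1) (axis j 1)) \<longlongrightarrow>
      (\<Sum>i\<in>UNIV. \<Sum>j\<in>UNIV. v $ i * cnj (w $ j) * r (axis i 1) (axis j 1))) F"
    by (intro tendsto_sum tendsto_mult tendsto_const tendsto_cnj tendsto_vec_nth assms(2,3))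
  have eq: "(\<lambda>x. r (f x) (g x)) = (\<lambda>x. \<Sum>i\<in>UNIV. \<Sum>j\<in>UNIV. f x $ i * cnj (g x $ j) * r (axis i 1) (axis j 1))"
    by (rule ext) (rule fform_expand[OF r])
  show ?thesis unfolding eq fform_expand[OF r, of v w] by (rule lim)
qed

lemma fform_scaled_lower:
  assumes r: "fform (r :: complex^'r::finite \<Rightarrow> _)" and \<kappa>: "\<And>w. norm w = 1 \<Longrightarrow> \<kappa> \<le> Re (r w w)"
  shows "\<kappa> * (norm w)\<^sup>2 \<le> Re (r w w)"
proof (cases "w = 0")
  case True then show ?thesis by (simp add: fform_zero[OF r])
next
  case False
  let ?u = "(1 / norm w) *\<^sub>R w"
  have "\<kappa> \<le> Re (r ?u ?u)" using False by (intro \<kappa>) simp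
  also have "\<dots> = (1 / norm w)\<^sup>2 * Re (r w w)"
    by (simp only: fform_scaleR[OF r] fform_scaleR_right[OF r]) (simp add: power2_eq_square)
  finally show ?thesis using False by (simp add: field_simps)
qed

lemma fform_lower:
  assumes r: "fform (r :: complex^'r::finite \<Rightarrow> _)"
  shows "\<exists>\<kappa>>0. \<forall>w. \<kappa> * (norm w)\<^sup>2 \<le> Re (r w w)"
proof -
  have cont: "continuous_on S (\<lambda>w. Re (r w w))" for S
    unfolding continuous_on_def by (intro ballI tendsto_Re fform_tendsto[OF r] tendsto_ident_at)
  have "compact (sphere 0 1 :: (complex^'r) set)" "sphere 0 1 \<noteq> ({} :: (complex^'r) set)" by auto
  from continuous_attains_inf[OF this cont] obtain w0 :: "complex^'r" where w0: "w0 \<in> sphere 0 1" "\<And>w. w \<in> sphere 0 1 \<Longrightarrow> Re (r w0 w0) \<le> Re (r w w)"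
    by blast
  have pos: "Re (r w0 w0) > 0" using w0(1) by (intro fform_pos[OF r]) auto
  have "Re (r w0 w0) * (norm w)\<^sup>2 \<le> Re (r w w)" for w
    by (rule fform_scaled_lower[OF r]) (simp add: w0(2))
  then show ?thesis using pos by blast
qed

text \<open>Multiply v by a phase that makes the product real and expand the square of the
  difference with w. This version without square roots suffices to integrate pointwise
  products.\<close>

lemma fform_cauchy_schwarz_weak:
  assumes r: "fform r" shows "2 * cmod (r v w) \<le> Re (r v v) + Re (r w w)"
proof (cases "r v w = 0")
  case True then show ?thesis using fform_nonneg[OF r, of v] fform_nonneg[OF r, of w] by simp
next
  case False
  let ?a = "cnj (r v w) / cmod (r v w)"
  let ?v = "?a *s v"
  have "cmod ?a = 1" using False by (simp add: norm_divide)
  then have aa: "?a * cnj ?a = 1" using complex_norm_square[of ?a] by simp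
  have avw: "r ?v w = of_real (cmod (r v w))"
    using False complex_norm_square[of "r v w"] by (simp add: fform_scale[OF r] field_simps power2_eq_square)
  have "r ?v ?v = ?a * cnj ?a * r v v"
    using fform_cnj[OF r, of v ?v] fform_cnj[OF r, of v v] by (simp add: fform_scale[OF r])
  then have vv: "r ?v ?v = r v v" using aa by simp
  have "0 \<le> Re (r (?v + (- 1) *\<^sub>R w) (?v + (- 1) *\<^sub>R w))" by (rule fform_nonneg[OF r])
  also have "\<dots> = Re (r v v) + Re (r w w) - 2 * cmod (r v w)"
    using fform_cnj[OF r, of w ?v] vv avw
    by (simp only: fform_add[OF r] fform_add_right[OF r] fform_scaleR[OF r] fform_scaleR_right[OF r]) simp
  finally show ?thesis by simp
qed

lemma psum_le:
  assumes r: "fform r" shows "2 * cmod (psum k r e \<omega> \<eta>) \<le> Re (psum k r e \<omega> \<omega>) + Re (psum k r e \<eta> \<eta>)"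
proof -
  have "2 * cmod (psum k r e \<omega> \<eta>) \<le> (\<Sum>I\<in>indices k. 2 * cmod (r (\<omega> (\<lambda>i. e (I i))) (\<eta> (\<lambda>i. e (I i)))))"
    unfolding psum_def sum_distrib_left[symmetric] by (intro mult_left_mono norm_sum) auto
  also have "\<dots> \<le> (\<Sum>I\<in>indices k. Re (r (\<omega> (\<lambda>i. e (I i))) (\<omega> (\<lambda>i. e (I i)))) + Re (r (\<eta> (\<lambda>i. e (I i))) (\<eta> (\<lambda>i. e (I i)))))"
    by (intro sum_mono fform_cauchy_schwarz_weak[OF r])
  finally show ?thesis by (simp add: psum_def sum.distrib)
qed

lemma psum_tendsto:
  assumes "fform r" "\<And>v. (\<lambda>n. \<omega> n v) \<longlonglongrightarrow> \<omega>' v" "\<And>v. (\<lambda>n. \<eta> n v) \<longlonglongrightarrow> \<eta>' v"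
  shows "(\<lambda>n. psum k r e (\<omega> n) (\<eta> n)) \<longlonglongrightarrow> psum k r e \<omega>' \<eta>'"
  unfolding psum_def by (intro tendsto_sum fform_tendsto assms)

lemma matrix_inv_inverse:
  assumes "invertible (M :: 'c::field^'n^'n)"
  shows "matrix_inv M ** M = mat 1" "M ** matrix_inv M = mat 1"
  using someI_ex[OF assms[unfolded invertible_def]] by (auto simp: matrix_inv_def)

lemma vector_space_cscale: "vector_space (cscale :: complex \<Rightarrow> ('a, 'm::finite, 'r::finite) form \<Rightarrow> _)"
  by (unfold_locales; auto simp: cscale_def fun_eq_iff vec.scale_right_distrib vec.scale_left_distrib)

locale hbundle = cmanifold atlas for atlas :: "('a::t2_space, 'm::finite) chart set" +
  fixes trivs :: "('a, 'r::finite) triv set" and \<rho> :: "('a, 'r) fibre_metric" and A :: "'a set"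
  assumes hol_bundle: "holomorphic_bundle atlas trivs" and fibre: "hermitian_fibre_metric atlas trivs \<rho>"
    and A_open: "open A"
begin

lemma fform_rho: "fform (\<rho> x)"
  using fibre unfolding hermitian_fibre_metric_def fform_def by blast

lemma triv_open: "t \<in> trivs \<Longrightarrow> open (fst t)"
  and triv_inv: "t \<in> trivs \<Longrightarrow> x \<in> fst t \<Longrightarrow> invertible (snd t x)"
  and triv_cover: "\<exists>t\<in>trivs. x \<in> fst t"
  using hol_bundle unfolding holomorphic_bundle_def by blast+

lemma triv_inverse: "t \<in> trivs \<Longrightarrow> x \<in> fst t \<Longrightarrow> matrix_inv (snd t x) *v (snd t x *v w) = w"
  using matrix_inv_inverse(1)[OF triv_inv] by (simp add: matrix_vector_mul_assoc)

definition rho_local :: "('a, 'm) chart \<Rightarrow> ('a, 'r) triv \<Rightarrow> complex^'m \<Rightarrow> complex^'r \<Rightarrow> complex^'r \<Rightarrow> complex" where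
  "rho_local c t z v w = (let x = cinv c z; \<sigma> = matrix_inv (snd t x) in \<rho> x (\<sigma> *v v) (\<sigma> *v w))"

lemma continuous_rho_local:
  "c \<in> atlas \<Longrightarrow> t \<in> trivs \<Longrightarrow> S \<subseteq> snd c ` (fst c \<inter> fst t) \<Longrightarrow> continuous_on S (\<lambda>z. rho_local c t z v w)"
proof -
  assume c: "c \<in> atlas" and t: "t \<in> trivs" and S: "S \<subseteq> snd c ` (fst c \<inter> fst t)"
  have "\<forall>c\<in>atlas. \<forall>t\<in>trivs. \<forall>v w. smooth_on (snd c ` (fst c \<inter> fst t)) (\<lambda>z. rho_local c t z v w)"
    using fibre unfolding hermitian_fibre_metric_def rho_local_def by (elim conjE)
  then have "smooth_on (snd c ` (fst c \<inter> fst t)) (\<lambda>z. rho_local c t z v w)" using c t by blast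
  from continuous_on_subset[OF smooth_on_continuous_on[OF this] S] show ?thesis .
qed

lemma fform_rho_local:
  assumes "t \<in> trivs" "cinv c z \<in> fst t" shows "fform (rho_local c t z)"
proof -
  let ?x = "cinv c z" and ?s = "matrix_inv (snd t (cinv c z))"
  note r = fform_rho[of ?x]
  have inj: "?s *v w = 0 \<Longrightarrow> w = 0" for w
    using matrix_inv_inverse(2)[OF triv_inv[OF assms]] by (metis matrix_vector_mul_assoc matrix_vector_mul_lid matrix_vector_mult_0_right)
  show ?thesis
    unfolding fform_def rho_local_def Let_def
  proof (intro conjI allI impI)
    show "\<rho> ?x (?s *v w) (?s *v v) = cnj (\<rho> ?x (?s *v v) (?s *v w))" for v w by (rule fform_cnj[OF r])
    show "0 < Re (\<rho> ?x (?s *v v) (?s *v v))" if "v \<noteq> 0" for v using inj that by (intro fform_pos[OF r]) blast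
  qed (simp_all add: matrix_vector_right_distrib vec.scale fform_add[OF r] fform_scale[OF r])
qed

lemma rho_eq_local:
  assumes c: "c \<in> atlas" and t: "t \<in> trivs" and x: "x \<in> fst c" "x \<in> fst t"
  shows "\<rho> x (\<omega> x (\<lambda>i. tangent atlas c x (v i))) (\<eta> x (\<lambda>i. tangent atlas c x (w i))) =
     rho_local c t (snd c x) (local_form atlas c t \<omega> (snd c x) v) (local_form atlas c t \<eta> (snd c x) w)"
  using x by (simp add: rho_local_def local_form_def Let_def cinv_snd[OF c] triv_inverse[OF t])

lemma Re_divide_fact: "Re (z / fact k) = Re z / fact k"
  by (metis Re_divide_of_real of_real_fact)

lemma Im_divide_fact: "Im (z / fact k) = Im z / fact k"
  by (metis Im_divide_of_real of_real_fact)

definition inner_at :: "('a, 'm) metric \<Rightarrow> nat \<Rightarrow> ('a, 'm, 'r) form \<Rightarrow> ('a, 'm, 'r) form \<Rightarrow> 'a \<Rightarrow> complex" where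
  "inner_at g k \<omega> \<eta> x = psum k (\<rho> x) (orthonormal_basis (g x)) (\<omega> x) (\<eta> x) / fact k"

lemma pointwise_inner_eq: "pointwise_inner g \<rho> k \<omega> \<eta> = inner_at g k \<omega> \<eta>"
  by (simp add: pointwise_inner_def inner_at_def psum_def Let_def fun_eq_iff)

definition pq_form :: "nat \<Rightarrow> nat \<Rightarrow> ('a, 'm, 'r) form \<Rightarrow> bool" where
  "pq_form p q \<omega> \<longleftrightarrow> measurable_form atlas trivs A \<omega> \<and> (\<forall>x\<in>A. \<omega> x \<in> pq_covectors p q)"

lemma local_form_measurable:
  assumes "measurable_form atlas trivs A \<omega>" "c \<in> atlas" "t \<in> trivs"
  shows "(\<lambda>z. indicator (snd c ` (fst c \<inter> fst t \<inter> A)) z *\<^sub>R local_form atlas c t \<omega> z v) \<in> borel_measurable borel"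
  using assms unfolding measurable_form_def set_borel_measurable_def by blast

text \<open>The first factor of each term is continuous in the coordinates, the other two are
  coefficients of the forms. The chosen orthonormal basis, whose dependence on x is not controlled,
  has disappeared, which makes measurability accessible.\<close>

lemma inner_at_chart:
  assumes g: "metric_on atlas A g" and c: "c \<in> atlas" and t: "t \<in> trivs" and x: "x \<in> fst c" "x \<in> fst t" "x \<in> A"
    and \<omega>: "rmult k (\<omega> x)" and \<eta>: "rmult k (\<eta> x)"
  shows "inner_at g k \<omega> \<eta> x = (\<Sum>I\<in>indices k. \<Sum>J\<in>indices k. \<Sum>i\<in>UNIV. \<Sum>j\<in>UNIV.
     (of_real (\<Prod>l<k. cramer_inv (gram c g (snd c x)) (I l) (J l)) * rho_local c t (snd c x) (axis i 1) (axis j 1)) *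
     (local_form atlas c t \<omega> (snd c x) (\<lambda>l. real_basis (I l)) $ i) *
     cnj (local_form atlas c t \<eta> (snd c x) (\<lambda>l. real_basis (J l)) $ j)) / fact k"
proof -
  have gx: "hform (g x)" "pos_def (g x)" using g x by (auto simp: metric_on_def)
  have fr: "fform (rho_local c t (snd c x))" using x by (intro fform_rho_local t) (simp add: cinv_snd[OF c])
  have "psum k (\<rho> x) (orthonormal_basis (g x)) (\<omega> x) (\<eta> x) = (\<Sum>I\<in>indices k. \<Sum>J\<in>indices k.
     of_real (\<Prod>l<k. cramer_inv (gram c g (snd c x)) (I l) (J l)) *
     rho_local c t (snd c x) (local_form atlas c t \<omega> (snd c x) (\<lambda>l. real_basis (I l))) (local_form atlas c t \<eta> (snd c x) (\<lambda>l. real_basis (J l))))"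
    unfolding gram_frame[OF c x(1)] rho_eq_local[OF c t x(1,2), symmetric]
    by (rule psum_cramer(1)[OF fform_rho \<omega> \<eta> gx(1) orthonormal_orthonormal_basis[OF gx] tangent_linear[OF c x(1)] tangent_surj[OF c x(1)] refl])
  then show ?thesis
    unfolding inner_at_def fform_expand[OF fr, of "local_form _ _ _ _ _ _"]
    by (simp add: sum_distrib_left mult_ac)
qed

lemma cramer_inv_continuous:
  assumes g: "metric_on atlas A g" and c: "c \<in> atlas" and S: "S \<subseteq> snd c ` (fst c \<inter> A)"
  shows "continuous_on S (\<lambda>z. cramer_inv (gram c g z) a b)"
  unfolding cramer_inv_def
proof (rule continuous_on_divide)
  have Sc: "S \<subseteq> snd c ` fst c" using S by auto
  have G: "continuous_on S (\<lambda>z. gram c g z $ i $ j)" for i j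
    unfolding gram_def by (simp add: continuous_local_metric[OF metric_on_smooth[OF g] c Sc])
  show "continuous_on S (\<lambda>z. det (\<chi> i j. if j = a then axis b 1 $ i else gram c g z $ i $ j))"
  proof (rule continuous_det)
    show "continuous_on S (\<lambda>z. if j = a then axis b 1 $ i else gram c g z $ i $ j)" for i j
      using G by (cases "j = a") auto
  qed
  show "continuous_on S (\<lambda>z. det (gram c g z))"
    unfolding gram_def by (rule continuous_det) (rule continuous_local_metric[OF metric_on_smooth[OF g] c Sc])
  show "\<forall>z\<in>S. det (gram c g z) \<noteq> 0"
  proof
    fix z assume "z \<in> S"
    then obtain x where x: "x \<in> fst c" "x \<in> A" "z = snd c x" using S by blast
    then have "volume_density atlas c g z > 0"
      using volume_density_pos[OF c] metric_on_hform[OF g] metric_on_pos_def[OF g] by blast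
    then show "det (gram c g z) \<noteq> 0" by (simp add: volume_density_gram)
  qed
qed

lemma chart_triv_cover: "\<exists>F. finite F \<and> F \<subseteq> atlas \<times> trivs \<and> (\<Union>(c, t)\<in>F. fst c \<inter> fst t) = UNIV"
proof -
  let ?U = "\<lambda>(c, t). fst c \<inter> fst t"
  have op: "\<And>B. B \<in> ?U ` (atlas \<times> trivs) \<Longrightarrow> open B" using chart_open triv_open by auto
  have cov: "UNIV \<subseteq> \<Union>(?U ` (atlas \<times> trivs))"
  proof
    fix x
    obtain t where "t \<in> trivs" "x \<in> fst t" using triv_cover by blast
    then show "x \<in> \<Union>(?U ` (atlas \<times> trivs))" using chart_at[of x] by force
  qed
  obtain \<C> where C: "\<C> \<subseteq> ?U ` (atlas \<times> trivs)" "finite \<C>" "UNIV \<subseteq> \<Union>\<C>"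
    by (rule compactE[OF compact cov op])
  obtain F where F: "F \<subseteq> atlas \<times> trivs" "finite F" "\<C> = ?U ` F"
    using finite_subset_image[OF C(2,1)] by auto
  have "\<Union>(?U ` F) = UNIV" using C(3) unfolding F(3) by (rule top.extremum_uniqueI)
  then show ?thesis using F(1,2) by (intro exI[of _ F] conjI)
qed

text \<open>Compactness gives a finite cover by domains carrying both a chart and a trivialization,
  so measurability is checked on finitely many pieces, one of them the complement of A.\<close>

lemma measurable_on_charts:
  fixes f :: "'a \<Rightarrow> 'b::{topological_space, zero}"
  assumes "\<And>c t. c \<in> atlas \<Longrightarrow> t \<in> trivs \<Longrightarrow> \<exists>F. F \<in> borel_measurable borel \<and> (\<forall>x\<in>fst c \<inter> fst t \<inter> A. f x = F (snd c x))"
    and 0: "\<And>x. x \<notin> A \<Longrightarrow> f x = 0"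
  shows "f \<in> borel_measurable borel"
proof -
  obtain P where P: "finite P" "P \<subseteq> atlas \<times> trivs" "(\<Union>(c, t)\<in>P. fst c \<inter> fst t) = UNIV"
    using chart_triv_cover by blast
  let ?C = "insert (- A) ((\<lambda>(c, t). fst c \<inter> fst t \<inter> A) ` P)"
  show ?thesis
  proof (rule measurable_piecewise_restrict[of ?C])
    show "countable ?C" using P(1) by (intro countable_finite) auto
    show "space borel \<subseteq> \<Union>?C" using P(3) by auto
  next
    fix \<Omega> assume \<Omega>: "\<Omega> \<in> ?C"
    show "\<Omega> \<inter> space borel \<in> sets borel"
    proof (cases "\<Omega> = - A")
      case True
      then show ?thesis using A_open by (simp add: borel_open)
    next
      case False
      then show ?thesis using \<Omega> P(2) A_open chart_open triv_open by (auto intro!: borel_open open_Int)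
    qed
    show "f \<in> borel_measurable (restrict_space borel \<Omega>)"
    proof (cases "\<Omega> = - A")
      case True
      then have "f \<in> borel_measurable (restrict_space borel \<Omega>) \<longleftrightarrow> (\<lambda>x. 0 :: 'b) \<in> borel_measurable (restrict_space borel \<Omega>)"
        by (intro measurable_cong) (auto simp: space_restrict_space 0)
      then show ?thesis by simp
    next
      case False
      then obtain c t where "(c, t) \<in> P" "\<Omega> = fst c \<inter> fst t \<inter> A" using \<Omega> by blast
      then have ct: "c \<in> atlas" "t \<in> trivs" "\<Omega> = fst c \<inter> fst t \<inter> A" using P(2) by auto
      obtain F where F: "F \<in> borel_measurable borel" "\<forall>x\<in>\<Omega>. f x = F (snd c x)" using assms(1)[OF ct(1,2)] ct(3) by blast
      have "snd c \<in> borel_measurable (restrict_space borel \<Omega>)"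
        by (rule borel_measurable_continuous_on_restrict[OF continuous_chart[OF ct(1)]]) (use ct in auto)
      then have "(\<lambda>x. F (snd c x)) \<in> borel_measurable (restrict_space borel \<Omega>)" using F(1) by (rule measurable_compose)
      moreover have "f \<in> borel_measurable (restrict_space borel \<Omega>) \<longleftrightarrow> (\<lambda>x. F (snd c x)) \<in> borel_measurable (restrict_space borel \<Omega>)"
        using F(2) by (intro measurable_cong) (auto simp: space_restrict_space)
      ultimately show ?thesis by simp
    qed
  qed
qed

lemma pq_form_rmult: "pq_form p q \<omega> \<Longrightarrow> x \<in> A \<Longrightarrow> rmult (p + q) (\<omega> x)"
  unfolding pq_form_def using pq_covectors_rmult by blast

lemma inner_at_measurable:
  assumes g: "metric_on atlas A g" and \<omega>: "pq_form p q \<omega>" and \<eta>: "pq_form p q \<eta>"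
  shows "(\<lambda>x. indicator A x *\<^sub>R inner_at g (p + q) \<omega> \<eta> x) \<in> borel_measurable borel"
proof (rule measurable_on_charts)
  fix c t assume c: "c \<in> atlas" and t: "t \<in> trivs"
  let ?k = "p + q" and ?V = "snd c ` (fst c \<inter> fst t \<inter> A)"
  have V: "open ?V" using open_chart_image[OF c open_Int[OF triv_open[OF t] A_open]] by (simp add: Int_assoc)
  let ?R = "\<lambda>I J i j z. of_real (\<Prod>l<?k. cramer_inv (gram c g z) (I l) (J l)) * rho_local c t z (axis i 1) (axis j 1)"
  let ?F = "\<lambda>z. (\<Sum>I\<in>indices ?k. \<Sum>J\<in>indices ?k. \<Sum>i\<in>UNIV. \<Sum>j\<in>UNIV. (indicator ?V z *\<^sub>R ?R I J i j z) *
     ((indicator ?V z *\<^sub>R local_form atlas c t \<omega> z (\<lambda>l. real_basis (I l))) $ i) *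
     cnj ((indicator ?V z *\<^sub>R local_form atlas c t \<eta> z (\<lambda>l. real_basis (J l))) $ j)) / fact ?k"
  show "\<exists>F. F \<in> borel_measurable borel \<and> (\<forall>x\<in>fst c \<inter> fst t \<inter> A. indicator A x *\<^sub>R inner_at g ?k \<omega> \<eta> x = F (snd c x))"
  proof (intro exI[of _ ?F] conjI ballI)
    have R: "(\<lambda>z. indicator ?V z *\<^sub>R ?R I J i j z) \<in> borel_measurable borel" for I J i j
      by (intro borel_measurable_continuous_on_indicator continuous_intros cramer_inv_continuous[OF g c] continuous_rho_local c t)
        (use V in auto)
    have nth: "(\<lambda>z. (f z :: complex^'r) $ i) \<in> borel_measurable borel" if "f \<in> borel_measurable borel" for f i
      using that by (rule borel_measurable_continuous_on[rotated]) (intro continuous_intros)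
    have cn: "(\<lambda>z. cnj (f z)) \<in> borel_measurable borel" if "f \<in> borel_measurable borel" for f
      using that by (rule borel_measurable_continuous_on[rotated]) (intro continuous_intros)
    have m: "measurable_form atlas trivs A \<omega>" "measurable_form atlas trivs A \<eta>" using \<omega> \<eta> by (auto simp: pq_form_def)
    show "?F \<in> borel_measurable borel"
      by (intro borel_measurable_divide borel_measurable_sum borel_measurable_times R cn nth local_form_measurable m c t) auto
    fix x assume x: "x \<in> fst c \<inter> fst t \<inter> A"
    then have "snd c x \<in> ?V" by blast
    then show "indicator A x *\<^sub>R inner_at g ?k \<omega> \<eta> x = ?F (snd c x)"
      using x inner_at_chart[OF g c t _ _ _ pq_form_rmult[OF \<omega>] pq_form_rmult[OF \<eta>], of x] by simp
  qed
qed simp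

lemma inner_at_nonneg: "0 \<le> Re (inner_at g k \<omega> \<omega> x)"
  unfolding inner_at_def Re_divide_fact by (intro divide_nonneg_nonneg psum_nonneg fform_rho) simp

lemma inner_at_self: "inner_at g k \<omega> \<omega> x = of_real (Re (inner_at g k \<omega> \<omega> x))"
  using psum_cnj[OF fform_rho, of k x "orthonormal_basis (g x)" "\<omega> x" "\<omega> x"] by (simp add: inner_at_def complex_eq_iff Im_divide_fact)

lemma inner_at_cnj: "inner_at g k \<eta> \<omega> x = cnj (inner_at g k \<omega> \<eta> x)"
  using psum_cnj[OF fform_rho, of k x "orthonormal_basis (g x)" "\<eta> x" "\<omega> x"] by (simp add: inner_at_def)

lemma inner_at_add: "inner_at g k (\<omega> + \<omega>') \<eta> x = inner_at g k \<omega> \<eta> x + inner_at g k \<omega>' \<eta> x"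
  using psum_add[OF fform_rho, of k x "orthonormal_basis (g x)" "\<omega> x" "\<omega>' x"]
  by (simp add: inner_at_def add_divide_distrib plus_fun_def)

lemma inner_at_scale: "inner_at g k (cscale a \<omega>) \<eta> x = a * inner_at g k \<omega> \<eta> x"
  using psum_scale[OF fform_rho, of k x "orthonormal_basis (g x)" a "\<omega> x"] by (simp add: inner_at_def cscale_def)

lemma inner_at_le: "2 * cmod (inner_at g k \<omega> \<eta> x) \<le> Re (inner_at g k \<omega> \<omega> x) + Re (inner_at g k \<eta> \<eta> x)"
  using divide_right_mono[OF psum_le[OF fform_rho, of k x "orthonormal_basis (g x)" "\<omega> x" "\<eta> x"], of "fact k"]
  by (simp add: inner_at_def norm_divide add_divide_distrib Re_divide_fact)

lemma inner_at_cong: "\<omega> x = \<omega>' x \<Longrightarrow> \<eta> x = \<eta>' x \<Longrightarrow> inner_at g k \<omega> \<eta> x = inner_at g k \<omega>' \<eta>' x"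
  by (simp add: inner_at_def)

section \<open>The spaces of square-integrable forms\<close>

abbreviation "L g p q \<equiv> L2 atlas trivs \<rho> A p q g"

text \<open>Valued in \<open>ennreal\<close>, so that estimates can be stated before integrability
  is known; \<open>carr_iff\<close> recovers the carrier from finiteness.\<close>

definition sq_norm :: "('a, 'm) metric \<Rightarrow> nat \<Rightarrow> ('a, 'm, 'r) form \<Rightarrow> ennreal" where
  "sq_norm g k \<omega> = (\<integral>\<^sup>+x. ennreal (indicator A x * Re (inner_at g k \<omega> \<omega> x)) \<partial>dvol atlas g)"

lemma sets_dvol [simp]: "sets (dvol atlas g) = sets borel"
  using sets.sigma_sets_eq[of "borel :: 'a measure"] by (simp add: dvol_def)

lemma space_dvol [simp]: "space (dvol atlas g) = UNIV"
  by (simp add: dvol_def)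

lemma measurable_dvol: "f \<in> borel_measurable (dvol atlas g) \<longleftrightarrow> f \<in> borel_measurable borel"
  using measurable_cong_sets[OF sets_dvol refl] by blast

lemma Re_inner_at_measurable:
  assumes "metric_on atlas A g" "pq_form p q \<omega>"
  shows "(\<lambda>x. indicator A x * Re (inner_at g (p + q) \<omega> \<omega> x)) \<in> borel_measurable borel"
proof -
  have "(\<lambda>x. Re (indicator A x *\<^sub>R inner_at g (p + q) \<omega> \<omega> x)) \<in> borel_measurable borel"
    by (rule borel_measurable_continuous_on[OF _ inner_at_measurable[OF assms(1) assms(2) assms(2)]])
      (intro continuous_intros)
  then show ?thesis by simp
qed

lemma carr_iff:
  assumes g: "metric_on atlas A g"
  shows "\<omega> \<in> carr (L g p q) \<longleftrightarrow> pq_form p q \<omega> \<and> sq_norm g (p + q) \<omega> < \<infinity>"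
proof (cases "pq_form p q \<omega>")
  case True
  let ?f = "\<lambda>x. indicator A x *\<^sub>R inner_at g (p + q) \<omega> \<omega> x"
  have m: "?f \<in> borel_measurable (dvol atlas g)"
    using inner_at_measurable[OF g True True] by (simp add: measurable_dvol)
  have "cmod (inner_at g (p + q) \<omega> \<omega> x) = Re (inner_at g (p + q) \<omega> \<omega> x)" for x
    using arg_cong[OF inner_at_self, of cmod] inner_at_nonneg[of g "p + q" \<omega> x] by simp
  then have "integrable (dvol atlas g) ?f \<longleftrightarrow> sq_norm g (p + q) \<omega> < \<infinity>"
    using m by (simp add: integrable_iff_bounded sq_norm_def)
  then show ?thesis using True by (auto simp: L2_def pq_form_def set_integrable_def pointwise_inner_eq)
qed (auto simp: L2_def pq_form_def)

lemma ip_eq: "ip (L g p q) \<omega> \<eta> = (LINT x|dvol atlas g. indicator A x *\<^sub>R inner_at g (p + q) \<omega> \<eta> x)"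
  by (simp add: L2_def set_lebesgue_integral_def pointwise_inner_eq)

lemma pq_form_zero: "pq_form p q 0"
  by (auto simp: pq_form_def measurable_form_def set_borel_measurable_def local_form_def zero_fun_def
      pq_covectors_zero)

lemma pq_form_add: assumes "pq_form p q \<omega>" "pq_form p q \<eta>" shows "pq_form p q (\<omega> + \<eta>)"
  unfolding pq_form_def measurable_form_def set_borel_measurable_def
proof (intro conjI ballI allI)
  fix x assume "x \<in> A"
  then show "(\<omega> + \<eta>) x \<in> pq_covectors p q"
    using pq_covectors_add[of "\<omega> x" p q "\<eta> x"] assms by (simp add: pq_form_def plus_fun_def)
next
  fix c t v assume "c \<in> atlas" "t \<in> trivs"
  then have "(\<lambda>z. indicator (snd c ` (fst c \<inter> fst t \<inter> A)) z *\<^sub>R local_form atlas c t \<omega> z v +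
      indicator (snd c ` (fst c \<inter> fst t \<inter> A)) z *\<^sub>R local_form atlas c t \<eta> z v) \<in> borel_measurable borel"
    using assms by (intro borel_measurable_add local_form_measurable) (auto simp: pq_form_def)
  then show "(\<lambda>z. indicator (snd c ` (fst c \<inter> fst t \<inter> A)) z *\<^sub>R local_form atlas c t (\<omega> + \<eta>) z v) \<in> borel_measurable borel"
    by (simp add: local_form_def Let_def matrix_vector_right_distrib scaleR_add_right)
qed

lemma pq_form_scale: assumes "pq_form p q \<omega>" shows "pq_form p q (cscale a \<omega>)"
  unfolding pq_form_def measurable_form_def set_borel_measurable_def
proof (intro conjI ballI allI)
  fix x assume "x \<in> A"
  then show "cscale a \<omega> x \<in> pq_covectors p q"
    using pq_covectors_scale[of "\<omega> x" p q a] assms by (simp add: pq_form_def cscale_def)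
next
  fix c t v assume ct: "c \<in> atlas" "t \<in> trivs"
  have "continuous_on UNIV (\<lambda>v :: complex^'r. a *s v)"
    by (rule linear_continuous_on) (simp add: linear_cscale flip: linear_conv_bounded_linear)
  then have "(\<lambda>z. a *s (indicator (snd c ` (fst c \<inter> fst t \<inter> A)) z *\<^sub>R local_form atlas c t \<omega> z v)) \<in> borel_measurable borel"
    using assms by (intro borel_measurable_continuous_on[OF _ local_form_measurable[OF _ ct]]) (auto simp: pq_form_def)
  then show "(\<lambda>z. indicator (snd c ` (fst c \<inter> fst t \<inter> A)) z *\<^sub>R local_form atlas c t (cscale a \<omega>) z v) \<in> borel_measurable borel"
    by (simp add: local_form_def Let_def cscale_def vec.scale ii_scaleR)
qed

lemma cross_integrable:
  assumes g: "metric_on atlas A g" and \<omega>: "\<omega> \<in> carr (L g p q)" and \<eta>: "\<eta> \<in> carr (L g p q)"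
  shows "integrable (dvol atlas g) (\<lambda>x. indicator A x *\<^sub>R inner_at g (p + q) \<omega> \<eta> x)"
proof -
  have i: "integrable (dvol atlas g) (\<lambda>x. indicator A x *\<^sub>R inner_at g (p + q) \<theta> \<theta> x)" if "\<theta> \<in> carr (L g p q)" for \<theta>
    using that by (simp add: L2_def set_integrable_def pointwise_inner_eq)
  have pq: "pq_form p q \<omega>" "pq_form p q \<eta>" using \<omega> \<eta> carr_iff[OF g] by auto
  show ?thesis
  proof (rule Bochner_Integration.integrable_bound[OF Bochner_Integration.integrable_add[OF integrable_norm[OF i[OF \<omega>]] integrable_norm[OF i[OF \<eta>]]]])
    show "(\<lambda>x. indicator A x *\<^sub>R inner_at g (p + q) \<omega> \<eta> x) \<in> borel_measurable (dvol atlas g)"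
      using inner_at_measurable[OF g pq] by (simp add: measurable_dvol)
    show "AE x in dvol atlas g. norm (indicator A x *\<^sub>R inner_at g (p + q) \<omega> \<eta> x) \<le>
       norm (norm (indicator A x *\<^sub>R inner_at g (p + q) \<omega> \<omega> x) + norm (indicator A x *\<^sub>R inner_at g (p + q) \<eta> \<eta> x))"
    proof (intro AE_I2)
      fix x
      have "cmod (inner_at g (p + q) \<omega> \<eta> x) \<le> cmod (inner_at g (p + q) \<omega> \<omega> x) + cmod (inner_at g (p + q) \<eta> \<eta> x)"
        using inner_at_le[of g "p + q" \<omega> \<eta> x] complex_Re_le_cmod[of "inner_at g (p + q) \<omega> \<omega> x"]
          complex_Re_le_cmod[of "inner_at g (p + q) \<eta> \<eta> x"] norm_ge_zero[of "inner_at g (p + q) \<omega> \<eta> x"] by linarith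
      then show "norm (indicator A x *\<^sub>R inner_at g (p + q) \<omega> \<eta> x) \<le>
       norm (norm (indicator A x *\<^sub>R inner_at g (p + q) \<omega> \<omega> x) + norm (indicator A x *\<^sub>R inner_at g (p + q) \<eta> \<eta> x))"
        by (simp add: indicator_def)
    qed
  qed
qed

lemma inner_at_parallelogram:
  "Re (inner_at g k (\<omega> + \<eta>) (\<omega> + \<eta>) x) \<le> 2 * Re (inner_at g k \<omega> \<omega> x) + 2 * Re (inner_at g k \<eta> \<eta> x)"
proof -
  have "inner_at g k (\<omega> + \<eta>) (\<omega> + \<eta>) x = inner_at g k \<omega> \<omega> x + inner_at g k \<eta> \<eta> x + inner_at g k \<omega> \<eta> x + cnj (inner_at g k \<omega> \<eta> x)"
    unfolding inner_at_add inner_at_cnj[of g k _ "\<omega> + \<eta>"] complex_cnj_add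
    using inner_at_cnj[of g k \<omega> \<eta> x] inner_at_cnj[of g k \<omega> \<omega> x] inner_at_cnj[of g k \<eta> \<eta> x] by (simp add: inner_at_cnj[of g k \<omega> \<eta> x])
  then show ?thesis
    using inner_at_le[of g k \<omega> \<eta> x] complex_Re_le_cmod[of "inner_at g k \<omega> \<eta> x"] by simp
qed

lemma carr_add:
  assumes g: "metric_on atlas A g" and \<omega>: "\<omega> \<in> carr (L g p q)" and \<eta>: "\<eta> \<in> carr (L g p q)"
  shows "\<omega> + \<eta> \<in> carr (L g p q)"
proof -
  let ?k = "p + q"
  have pq: "pq_form p q \<omega>" "pq_form p q \<eta>" and f: "sq_norm g ?k \<omega> < \<infinity>" "sq_norm g ?k \<eta> < \<infinity>"
    using \<omega> \<eta> carr_iff[OF g] by auto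
  have m: "(\<lambda>x. ennreal (indicator A x * Re (inner_at g ?k \<theta> \<theta> x))) \<in> borel_measurable (dvol atlas g)" if "pq_form p q \<theta>" for \<theta>
    using Re_inner_at_measurable[OF g that] by (simp add: measurable_dvol)
  have "sq_norm g ?k (\<omega> + \<eta>) \<le> (\<integral>\<^sup>+x. 2 * ennreal (indicator A x * Re (inner_at g ?k \<omega> \<omega> x)) +
      2 * ennreal (indicator A x * Re (inner_at g ?k \<eta> \<eta> x)) \<partial>dvol atlas g)"
    unfolding sq_norm_def
  proof (rule nn_integral_mono)
    fix x
    have e: "ennreal (2 * a + 2 * b) = 2 * ennreal a + 2 * ennreal b" if "a \<ge> 0" "b \<ge> 0" for a b
      using that by (simp add: ennreal_plus ennreal_mult')
    show "ennreal (indicator A x * Re (inner_at g ?k (\<omega> + \<eta>) (\<omega> + \<eta>) x)) \<le>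
      2 * ennreal (indicator A x * Re (inner_at g ?k \<omega> \<omega> x)) + 2 * ennreal (indicator A x * Re (inner_at g ?k \<eta> \<eta> x))"
      using ennreal_leI[OF inner_at_parallelogram[of g ?k \<omega> \<eta> x]] e[OF inner_at_nonneg inner_at_nonneg, of g ?k \<omega> x g ?k \<eta> x]
      by (simp add: indicator_def)
  qed
  also have "\<dots> = 2 * sq_norm g ?k \<omega> + 2 * sq_norm g ?k \<eta>"
    using m pq by (simp add: nn_integral_add nn_integral_cmult sq_norm_def)
  also have "\<dots> < \<infinity>" using f by (simp add: ennreal_mult_less_top)
  finally show ?thesis using carr_iff[OF g] pq_form_add[OF pq] by blast
qed

lemma inner_at_scale_self: "Re (inner_at g k (cscale a \<omega>) (cscale a \<omega>) x) = (cmod a)\<^sup>2 * Re (inner_at g k \<omega> \<omega> x)"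
proof -
  have "inner_at g k (cscale a \<omega>) (cscale a \<omega>) x = a * cnj a * inner_at g k \<omega> \<omega> x"
    using inner_at_cnj[of g k \<omega> "cscale a \<omega>" x] inner_at_cnj[of g k \<omega> \<omega> x] by (simp add: inner_at_scale)
  also have "\<dots> = of_real ((cmod a)\<^sup>2) * inner_at g k \<omega> \<omega> x" using complex_norm_square[of a] by simp
  finally show ?thesis by simp
qed

lemma carr_scale:
  assumes g: "metric_on atlas A g" and \<omega>: "\<omega> \<in> carr (L g p q)"
  shows "cscale a \<omega> \<in> carr (L g p q)"
proof -
  let ?k = "p + q"
  have pq: "pq_form p q \<omega>" and f: "sq_norm g ?k \<omega> < \<infinity>" using \<omega> carr_iff[OF g] by auto
  have m: "(\<lambda>x. ennreal (indicator A x * Re (inner_at g ?k \<omega> \<omega> x))) \<in> borel_measurable (dvol atlas g)"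
    using Re_inner_at_measurable[OF g pq] by (simp add: measurable_dvol)
  have "sq_norm g ?k (cscale a \<omega>) = (\<integral>\<^sup>+x. ennreal ((cmod a)\<^sup>2) * ennreal (indicator A x * Re (inner_at g ?k \<omega> \<omega> x)) \<partial>dvol atlas g)"
    unfolding sq_norm_def
    by (intro nn_integral_cong) (simp add: inner_at_scale_self ennreal_mult'[symmetric] mult_ac)
  also have "\<dots> = ennreal ((cmod a)\<^sup>2) * sq_norm g ?k \<omega>" using m by (simp add: nn_integral_cmult sq_norm_def)
  also have "\<dots> < \<infinity>" using f by (simp add: ennreal_mult_less_top)
  finally show ?thesis using carr_iff[OF g] pq_form_scale[OF pq] by blast
qed

lemma Re_ip_self: 
  assumes g: "metric_on atlas A g" and \<omega>: "\<omega> \<in> carr (L g p q)"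
  shows "Re (ip (L g p q) \<omega> \<omega>) = (LINT x|dvol atlas g. indicator A x * Re (inner_at g (p + q) \<omega> \<omega> x))"
  unfolding ip_eq using integral_Re[OF cross_integrable[OF g \<omega> \<omega>]] by simp

lemma semi_inner_L2: assumes g: "metric_on atlas A g" shows "semi_inner cscale (L g p q)"
proof -
  interpret vector_space "cscale :: complex \<Rightarrow> ('a, 'm, 'r) form \<Rightarrow> _" by (rule vector_space_cscale)
  show ?thesis
  proof (unfold_locales, goal_cases)
    case 1
    have "inner_at g (p + q) 0 0 x = 0" for x by (simp add: inner_at_def psum_def zero_fun_def fform_zero[OF fform_rho])
    then show ?case unfolding carr_iff[OF g] sq_norm_def using pq_form_zero by simp
  next
    case (2 u v) then show ?case by (rule carr_add[OF g])
  next
    case (3 u a) then show ?case by (rule carr_scale[OF g])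
  next
    case (4 u v w)
    then show ?case
      unfolding ip_eq inner_at_add scaleR_add_right by (intro Bochner_Integration.integral_add cross_integrable[OF g])
  next
    case (5 a u w)
    have e: "indicator A x *\<^sub>R (a * inner_at g (p + q) u w x) = a * (indicator A x *\<^sub>R inner_at g (p + q) u w x)" for x
      by simp
    show ?case unfolding ip_eq inner_at_scale e by (rule integral_mult_right_zero)
  next
    case (6 u v)
    have e: "indicator A x *\<^sub>R inner_at g (p + q) v u x = cnj (indicator A x *\<^sub>R inner_at g (p + q) u v x)" for x
      by (simp add: inner_at_cnj[of g _ v u])
    show ?case unfolding ip_eq e
      using integral_bounded_linear'[OF bounded_linear_cnj bounded_linear_cnj, of "dvol atlas g" "\<lambda>x. indicator A x *\<^sub>R inner_at g (p + q) u v x"]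
      by (metis (no_types, lifting) complex_cnj_cnj)
  next
    case (7 u)
    then show ?case unfolding Re_ip_self[OF g 7] by (intro Bochner_Integration.integral_nonneg) (simp add: inner_at_nonneg)
  qed
qed

lemma hnorm_sq_norm:
  assumes g: "metric_on atlas A g" and \<omega>: "\<omega> \<in> carr (L g p q)"
  shows "ennreal ((hnorm (L g p q) \<omega>)\<^sup>2) = sq_norm g (p + q) \<omega>"
proof -
  interpret semi_inner cscale "L g p q" by (rule semi_inner_L2[OF g])
  have int: "integrable (dvol atlas g) (\<lambda>x. indicator A x * Re (inner_at g (p + q) \<omega> \<omega> x))"
    using integrable_Re[OF cross_integrable[OF g \<omega> \<omega>]] by simp
  have "(nrm \<omega>)\<^sup>2 = (LINT x|dvol atlas g. indicator A x * Re (inner_at g (p + q) \<omega> \<omega> x))"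
    by (simp add: nrm_sq[OF \<omega>] Re_ip_self[OF g \<omega>])
  then show ?thesis
    unfolding sq_norm_def using nn_integral_eq_integral[OF int] inner_at_nonneg by simp
qed

lemma hnorm_sq_le:
  assumes g: "metric_on atlas A g" and g': "metric_on atlas A g'" and \<omega>: "\<omega> \<in> carr (L g p q)" and \<eta>: "\<eta> \<in> carr (L g' p' q')"
    and C: "C \<ge> 0" "sq_norm g (p + q) \<omega> \<le> ennreal C * sq_norm g' (p' + q') \<eta>"
  shows "(hnorm (L g p q) \<omega>)\<^sup>2 \<le> C * (hnorm (L g' p' q') \<eta>)\<^sup>2"
  using C unfolding hnorm_sq_norm[OF g \<omega>, symmetric] hnorm_sq_norm[OF g' \<eta>, symmetric]
  by (simp add: ennreal_mult'[symmetric])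

lemma norm_le_inner_at:
  assumes g: "metric_on atlas A g" and x: "x \<in> A" and \<omega>: "rmult k (\<omega> x)"
  shows "Re (\<rho> x (\<omega> x v) (\<omega> x v)) \<le> ((\<Prod>i<k. g x (v i) (v i)) * fact k) * Re (inner_at g k \<omega> \<omega> x)"
proof -
  have gx: "hform (g x)" "pos_def (g x)" using g x by (auto simp: metric_on_def)
  show ?thesis
    using pointwise_bound[OF fform_rho \<omega> hform_bilinear[OF gx(1)] hform_sym[OF gx(1)] orthonormal_orthonormal_basis[OF gx], of x v]
    by (simp add: inner_at_def Re_divide_fact)
qed

section \<open>Completeness of the spaces of forms\<close>

lemma geometric_convergent:
  fixes X :: "nat \<Rightarrow> complex^'k::finite"
  assumes "\<And>n. (norm (X (Suc n) - X n))\<^sup>2 \<le> D * (1/2) ^ n" and D: "D \<ge> 0"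
  shows "convergent X"
proof -
  have le: "norm (X (Suc n) - X n) \<le> sqrt D * sqrt (1/2) ^ n" for n
  proof (rule power2_le_imp_le)
    show "(norm (X (Suc n) - X n))\<^sup>2 \<le> (sqrt D * sqrt (1/2) ^ n)\<^sup>2"
      using assms by (simp add: power_mult_distrib flip: power_mult) (simp add: power_mult mult.commute[of n] power_divide real_sqrt_divide)
  qed (use D in auto)
  have "summable (\<lambda>n. sqrt D * sqrt (1/2) ^ n)"
    by (intro summable_mult summable_geometric) (simp add: real_sqrt_divide divide_less_eq)
  then have "summable (\<lambda>n. X (Suc n) - X n)" by (rule summable_comparison_test'[where N = 0]) (rule le)
  from summable_LIMSEQ[OF this]
  have "(\<lambda>n. X n - X 0) \<longlonglongrightarrow> (\<Sum>n. X (Suc n) - X n)" by (simp add: sum_lessThan_telescope)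
  from tendsto_add[OF this tendsto_const[of "X 0"]] show ?thesis by (auto simp: convergent_def)
qed

text \<open>The Riesz-Fischer argument, with limits taken pointwise at each family of tangent
  vectors. The limit has to be a measurable (p, q)-form again, which
  \<open>pq_covectors_limit\<close> and the convergence of the local coefficients provide.\<close>

lemma semi_hilbert_L2: assumes g: "metric_on atlas A g" shows "semi_hilbert cscale (L g p q)"
proof -
  let ?H = "L g p q" and ?k = "p + q"
  interpret semi_inner cscale ?H by (rule semi_inner_L2[OF g])
  show ?thesis
  proof
    fix X :: "nat \<Rightarrow> ('a, 'm, 'r) form"
    assume Xc: "\<And>n. X n \<in> carr ?H" and Cauchy: "\<And>e. e > 0 \<Longrightarrow> \<exists>N. \<forall>m\<ge>N. \<forall>n\<ge>N. nrm (X m - X n) < e"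
    have "\<forall>k::nat. \<exists>N. \<forall>m\<ge>N. \<forall>n\<ge>N. nrm (X m - X n) < (1/2) ^ k" using Cauchy by simp
    then obtain N where N: "\<And>k m n. m \<ge> N k \<Longrightarrow> n \<ge> N k \<Longrightarrow> nrm (X m - X n) < (1/2) ^ k" by metis
    \<comment> \<open>Partial sums dominate every earlier N k; f need not be injective, it only has
      to pass each N k.\<close>
    define f where "f k = (\<Sum>j\<le>k. N j)" for k
    have fN: "N k \<le> f i" if "k \<le> i" for k i
      unfolding f_def using that by (intro member_le_sum) auto
    have small: "nrm (X (f i) - X (f j)) < (1/2) ^ k" if "k \<le> i" "k \<le> j" for i j k
      using N fN that by blast
    define d where "d k = X (f (Suc k)) - X (f k)" for k
    have dc: "d k \<in> carr ?H" for k unfolding d_def by (intro diff_carr Xc)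
    have pq: "pq_form p q \<omega>" if "\<omega> \<in> carr ?H" for \<omega> using that carr_iff[OF g] by blast
    have dn: "sq_norm g ?k (d k) \<le> ennreal ((1/4) ^ k)" for k
    proof -
      have "(nrm (d k))\<^sup>2 \<le> ((1/2) ^ k)\<^sup>2"
        unfolding d_def using small[of k "Suc k" k] by (intro power_mono nrm_nonneg diff_carr Xc) auto
      also have "\<dots> = (1/4) ^ k" by (simp add: power2_eq_square flip: power_mult_distrib)
      finally show ?thesis using hnorm_sq_norm[OF g dc] by (metis ennreal_leI)
    qed
    define P where "P k x = ennreal (indicator A x * Re (inner_at g ?k (d k) (d k) x))" for k x
    have Pm: "P k \<in> borel_measurable borel" for k
      unfolding P_def using Re_inner_at_measurable[OF g pq[OF dc]] by measurable
    \<comment> \<open>The squared increments have integral at most 4^-k. The weights 2^k keep the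
      sum integrable and, where it is finite, force the increments to be of order 2^(-k/2), hence
      summable.\<close>
    define S where "S x = (\<Sum>k. ennreal (2 ^ k) * P k x)" for x
    have Sm: "S \<in> borel_measurable borel" unfolding S_def using Pm by measurable
    have "(\<integral>\<^sup>+x. S x \<partial>dvol atlas g) = (\<Sum>k. \<integral>\<^sup>+x. ennreal (2 ^ k) * P k x \<partial>dvol atlas g)"
      unfolding S_def by (rule nn_integral_suminf) (use Pm in \<open>simp add: measurable_dvol\<close>)
    also have "\<dots> = (\<Sum>k. ennreal (2 ^ k) * sq_norm g ?k (d k))"
      unfolding sq_norm_def P_def[symmetric] using Pm by (simp add: nn_integral_cmult measurable_dvol)
    also have "\<dots> \<le> (\<Sum>k. ennreal ((1/2) ^ k))"
    proof (intro suminf_le summableI)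
      fix k
      have "ennreal (2 ^ k) * sq_norm g ?k (d k) \<le> ennreal (2 ^ k) * ennreal ((1/4) ^ k)" by (intro mult_left_mono dn) simp
      also have "\<dots> = ennreal ((1/2) ^ k)" by (simp add: ennreal_mult'[symmetric] flip: power_mult_distrib)
      finally show "ennreal (2 ^ k) * sq_norm g ?k (d k) \<le> ennreal ((1/2) ^ k)" .
    qed
    also have "\<dots> < \<infinity>" by (simp add: suminf_ennreal2 ennreal_less_top)
    finally have "AE x in dvol atlas g. S x \<noteq> \<infinity>"
      using Sm by (intro nn_integral_noteq_infinite) (auto simp: measurable_dvol)
    then have AES: "AE x in dvol atlas g. S x < \<infinity>" by (simp add: less_top)
    define B where "B = {x \<in> A. S x < \<infinity>}"
    have Bb: "B \<in> sets borel"
    proof -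
      have "{x \<in> space borel. S x < \<infinity>} \<in> sets borel" using Sm by measurable
      then show ?thesis unfolding B_def using A_open borel_open[of A] by (simp add: Collect_conj_eq sets.Int)
    qed
    have conv: "convergent (\<lambda>k. X (f k) x v)" if x: "x \<in> B" for x v
    proof -
      have xA: "x \<in> A" and fin: "S x < \<infinity>" using x by (auto simp: B_def)
      obtain \<kappa> where \<kappa>: "\<kappa> > 0" "\<And>w. \<kappa> * (norm w)\<^sup>2 \<le> Re (\<rho> x w w)" using fform_lower[OF fform_rho] by blast
      let ?M = "(\<Prod>i<?k. g x (v i) (v i)) * fact ?k"
      have M: "?M \<ge> 0"
        using metric_on_pos_def[OF g xA] bilinear_lzero[OF hform_bilinear[OF metric_on_hform[OF g]], of x]
        by (intro mult_nonneg_nonneg prod_nonneg) (metis order_le_less pos_def_def, simp)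
      let ?b = "enn2real (S x)"
      have Pb: "Re (inner_at g ?k (d k) (d k) x) \<le> ?b * (1/2) ^ k" for k
      proof -
        have "ennreal (2 ^ k) * P k x \<le> S x"
          unfolding S_def using sum_le_suminf[of "\<lambda>k. ennreal (2 ^ k) * P k x" "{k}"] by (simp add: summableI)
        also have "S x = ennreal ?b" using fin by simp
        finally have "2 ^ k * Re (inner_at g ?k (d k) (d k) x) \<le> ?b"
          using xA by (simp add: P_def ennreal_mult'[symmetric])
        then show ?thesis by (simp add: field_simps)
      qed
      have "(norm (X (f (Suc k)) x v - X (f k) x v))\<^sup>2 \<le> (?M * ?b / \<kappa>) * (1/2) ^ k" for k
      proof -
        have "\<kappa> * (norm (d k x v))\<^sup>2 \<le> ?M * Re (inner_at g ?k (d k) (d k) x)"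
          using \<kappa>(2)[of "d k x v"] norm_le_inner_at[where \<omega> = "d k" and v = v, OF g xA pq_form_rmult[OF pq[OF dc] xA]] by linarith
        also have "\<dots> \<le> ?M * (?b * (1/2) ^ k)" by (intro mult_left_mono Pb M)
        finally have "(norm (d k x v))\<^sup>2 \<le> (?M * ?b / \<kappa>) * (1/2) ^ k" using \<kappa>(1) by (simp add: field_simps)
        then show ?thesis by (simp add: d_def)
      qed
      then show ?thesis by (rule geometric_convergent) (use M \<kappa>(1) in auto)
    qed
    \<comment> \<open>Off B the limit may fail to exist; the value 0 is still a covector and keeps Y
      measurable.\<close>
    define Y where "Y x v = (if x \<in> B then lim (\<lambda>k. X (f k) x v) else 0)" for x v
    have Ylim: "(\<lambda>k. X (f k) x v) \<longlonglongrightarrow> Y x v" if "x \<in> B" for x v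
      using conv[OF that, of v] that by (simp add: Y_def convergent_LIMSEQ_iff)
    have Ypq: "pq_form p q Y"
      unfolding pq_form_def measurable_form_def set_borel_measurable_def
    proof (intro conjI ballI allI)
      fix x assume xA: "x \<in> A"
      show "Y x \<in> pq_covectors p q"
      proof (cases "x \<in> B")
        case True
        then show ?thesis using pq[OF Xc] xA by (intro pq_covectors_limit[OF _ Ylim]) (auto simp: pq_form_def)
      next
        case False
        then have "Y x = (\<lambda>v. 0)" by (simp add: Y_def fun_eq_iff)
        then show ?thesis by (simp add: pq_covectors_zero)
      qed
    next
      fix c t v assume c: "c \<in> atlas" and t: "t \<in> trivs"
      let ?V = "snd c ` (fst c \<inter> fst t \<inter> A)" and ?VB = "snd c ` (fst c \<inter> fst t \<inter> B)"
      have VB: "?VB \<in> sets borel"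
        using sets.Int[OF sets.Int[OF borel_open[OF chart_open[OF c]] borel_open[OF triv_open[OF t]]] Bb] by (intro chart_borel[OF c]) auto
      show "(\<lambda>z. indicator ?V z *\<^sub>R local_form atlas c t Y z v) \<in> borel_measurable borel"
      proof (rule borel_measurable_LIMSEQ_metric)
        show "(\<lambda>z. indicator ?VB z *\<^sub>R (indicator ?V z *\<^sub>R local_form atlas c t (X (f k)) z v)) \<in> borel_measurable borel" for k
          using pq[OF Xc] by (intro borel_measurable_scaleR[OF borel_measurable_indicator[OF VB] local_form_measurable[OF _ c t]]) (simp add: pq_form_def)
        fix z
        show "(\<lambda>k. indicator ?VB z *\<^sub>R (indicator ?V z *\<^sub>R local_form atlas c t (X (f k)) z v)) \<longlonglongrightarrow> indicator ?V z *\<^sub>R local_form atlas c t Y z v"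
        proof (cases "z \<in> ?VB")
          case True
          then have zV: "z \<in> ?V" and cz: "cinv c z \<in> B" using cinv_snd[OF c] by (auto simp: B_def)
          have "(\<lambda>k. local_form atlas c t (X (f k)) z v) \<longlonglongrightarrow> local_form atlas c t Y z v"
            unfolding local_form_def Let_def
            by (intro bounded_linear.tendsto[OF matrix_vector_mul_bounded_linear] Ylim cz)
          then show ?thesis using True zV by simp
        next
          case False
          have "indicator ?V z *\<^sub>R local_form atlas c t Y z v = 0"
          proof (cases "z \<in> ?V")
            case True
            then have "cinv c z \<notin> B" using False cinv_snd[OF c] by auto
            then show ?thesis by (simp add: local_form_def Let_def Y_def)
          qed simp
          have "indicator ?VB z = (0::real)" using \<open>z \<notin> ?VB\<close> by (rule indicator_simps(2))
          with \<open>indicator ?V z *\<^sub>R local_form atlas c t Y z v = 0\<close> show ?thesis by (simp only: scaleR_zero_left tendsto_const)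
        qed
      qed
    qed
    have Yd: "sq_norm g ?k (X (f j) - Y) \<le> ennreal ((1/4) ^ j)" for j
    proof -
      let ?u = "\<lambda>k x. ennreal (indicator A x * Re (inner_at g ?k (X (f j) - X (f k)) (X (f j) - X (f k)) x))"
      have um: "?u k \<in> borel_measurable (dvol atlas g)" for k
        using Re_inner_at_measurable[OF g pq[OF diff_carr[OF Xc Xc]]] unfolding measurable_dvol by measurable
      \<comment> \<open>Fatou's lemma: almost everywhere the integrand is the limit in k of those
        for X (f j) - X (f k), whose integrals are at most 4^-j once k >= j.\<close>
      have "sq_norm g ?k (X (f j) - Y) = (\<integral>\<^sup>+x. liminf (\<lambda>k. ?u k x) \<partial>dvol atlas g)"
        unfolding sq_norm_def
      proof (rule nn_integral_cong_AE, use AES in \<open>eventually_elim\<close>)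
        fix x assume Sx: "S x < \<infinity>"
        have "(\<lambda>k. ?u k x) \<longlonglongrightarrow> ennreal (indicator A x * Re (inner_at g ?k (X (f j) - Y) (X (f j) - Y) x))"
        proof (cases "x \<in> A")
          case True
          then have xB: "x \<in> B" using Sx by (simp add: B_def)
          have "(\<lambda>k. inner_at g ?k (X (f j) - X (f k)) (X (f j) - X (f k)) x) \<longlonglongrightarrow> inner_at g ?k (X (f j) - Y) (X (f j) - Y) x"
            unfolding inner_at_def
            by (intro tendsto_divide psum_tendsto fform_rho tendsto_const) (auto intro!: tendsto_diff Ylim xB)
          then show ?thesis by (intro tendsto_ennrealI tendsto_mult tendsto_const tendsto_Re)
        qed simp
        then show "ennreal (indicator A x * Re (inner_at g ?k (X (f j) - Y) (X (f j) - Y) x)) = liminf (\<lambda>k. ?u k x)"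
          by (intro lim_imp_Liminf[symmetric]) auto
      qed
      also have "\<dots> \<le> liminf (\<lambda>k. \<integral>\<^sup>+x. ?u k x \<partial>dvol atlas g)" by (rule nn_integral_liminf[OF um])
      also have "\<dots> \<le> ennreal ((1/4) ^ j)"
      proof (rule Liminf_le)
        show "\<forall>\<^sub>F k in sequentially. (\<integral>\<^sup>+x. ?u k x \<partial>dvol atlas g) \<le> ennreal ((1/4) ^ j)"
        proof (rule eventually_sequentiallyI[of j])
          fix k assume k: "j \<le> k"
          have "(nrm (X (f j) - X (f k)))\<^sup>2 \<le> ((1/2) ^ j)\<^sup>2"
            using small[of j j k] k by (intro power_mono nrm_nonneg diff_carr Xc) auto
          also have "\<dots> = (1/4) ^ j" by (simp add: power2_eq_square flip: power_mult_distrib)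
          finally show "(\<integral>\<^sup>+x. ?u k x \<partial>dvol atlas g) \<le> ennreal ((1/4) ^ j)"
            using hnorm_sq_norm[OF g diff_carr[OF Xc Xc], of "f j" "f k"] unfolding sq_norm_def by (metis ennreal_leI)
        qed
      qed simp
      finally show ?thesis .
    qed
    have pqd: "pq_form p q (X (f j) - Y)" for j
    proof -
      have "X (f j) - Y = X (f j) + cscale (- 1) Y" by (simp add: cscale_def fun_eq_iff)
      then show ?thesis using pq_form_add[OF pq[OF Xc] pq_form_scale[OF Ypq]] by (rule ssubst[where P = "pq_form p q"])
    qed
    have XYc: "X (f j) - Y \<in> carr ?H" for j
      unfolding carr_iff[OF g] using pqd le_less_trans[OF Yd] by (simp add: ennreal_less_top)
    have Yc: "Y \<in> carr ?H" using diff_carr[OF Xc[of "f 0"] XYc[of 0]] by simp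
    have XYn: "nrm (X (f j) - Y) \<le> (1/2) ^ j" for j
    proof (rule power2_le_imp_le)
      have "ennreal ((nrm (X (f j) - Y))\<^sup>2) \<le> ennreal ((1/4) ^ j)" using Yd hnorm_sq_norm[OF g XYc] by simp
      then have "(nrm (X (f j) - Y))\<^sup>2 \<le> (1/4) ^ j" by simp
      also have "\<dots> = ((1/2) ^ j)\<^sup>2" by (simp add: power2_eq_square flip: power_mult_distrib)
      finally show "(nrm (X (f j) - Y))\<^sup>2 \<le> ((1/2) ^ j)\<^sup>2" .
    qed simp
    have "(\<lambda>n. nrm (X n - Y)) \<longlonglongrightarrow> 0"
    proof (rule LIMSEQ_I)
      fix e :: real assume e: "e > 0"
      obtain j where j: "(1/2::real) ^ j < e / 2" using real_arch_pow_inv[of "e/2" "1/2"] e by auto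
      have "norm (nrm (X n - Y) - 0) < e" if n: "n \<ge> N j" for n
      proof -
        have "nrm (X n - Y) \<le> nrm (X n - X (f j)) + nrm (X (f j) - Y)"
          by (rule nrm_triangle_diff[OF Xc Xc Yc])
        also have "\<dots> < e" using N[OF n fN[of j j]] XYn[of j] j by simp
        finally show ?thesis using nrm_nonneg[OF diff_carr[OF Xc Yc]] by simp
      qed
      then show "\<exists>N. \<forall>n\<ge>N. norm (nrm (X n - Y) - 0) < e" by blast
    qed
    then show "\<exists>l\<in>carr ?H. (\<lambda>n. nrm (X n - l)) \<longlonglongrightarrow> 0" using Yc by blast
  qed
qed

section \<open>Truncation and the comparison of norms for two metrics\<close>

definition cut :: "'a set \<Rightarrow> ('a, 'm, 'r) form \<Rightarrow> ('a, 'm, 'r) form" where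
  "cut S \<omega> = (\<lambda>x. if x \<in> S then \<omega> x else 0)"

lemma pq_form_cut: assumes S: "S \<in> sets borel" and \<omega>: "pq_form p q \<omega>" shows "pq_form p q (cut S \<omega>)"
  unfolding pq_form_def measurable_form_def set_borel_measurable_def
proof (intro conjI ballI allI)
  fix x assume "x \<in> A"
  then show "cut S \<omega> x \<in> pq_covectors p q"
    using \<omega> pq_covectors_zero by (auto simp: pq_form_def cut_def zero_fun_def)
next
  fix c t v assume c: "c \<in> atlas" and t: "t \<in> trivs"
  let ?V = "snd c ` (fst c \<inter> fst t \<inter> A)" and ?VS = "snd c ` (fst c \<inter> S)"
  have VS: "?VS \<in> sets borel" using sets.Int[OF borel_open[OF chart_open[OF c]] S] by (intro chart_borel[OF c]) auto
  have m: "(\<lambda>z. indicator ?VS z *\<^sub>R (indicator ?V z *\<^sub>R local_form atlas c t \<omega> z v)) \<in> borel_measurable borel"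
    using \<omega> by (intro borel_measurable_scaleR[OF borel_measurable_indicator[OF VS] local_form_measurable[OF _ c t]]) (simp add: pq_form_def)
  have "indicator ?V z *\<^sub>R local_form atlas c t (cut S \<omega>) z v =
      indicator ?VS z *\<^sub>R (indicator ?V z *\<^sub>R local_form atlas c t \<omega> z v)" for z
  proof (cases "z \<in> ?V")
    case True
    then have cz: "z = snd c (cinv c z)" "cinv c z \<in> fst c" using cinv_snd[OF c] by auto
    have "z \<in> ?VS \<longleftrightarrow> cinv c z \<in> S" using cz cinv_snd[OF c] by auto
    then show ?thesis using True by (simp add: local_form_def cut_def Let_def indicator_def)
  qed simp
  then show "(\<lambda>z. indicator ?V z *\<^sub>R local_form atlas c t (cut S \<omega>) z v) \<in> borel_measurable borel" using m by simp
qed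

lemma inner_at_null: "\<omega> x = 0 \<Longrightarrow> inner_at g k \<omega> \<eta> x = 0"
  by (simp add: inner_at_def psum_def fform_zero[OF fform_rho])

lemma sq_norm_cut_le: "sq_norm g k (cut S \<omega>) \<le> sq_norm g k \<omega>"
  unfolding sq_norm_def
proof (intro nn_integral_mono ennreal_leI mult_left_mono)
  fix x show "Re (inner_at g k (cut S \<omega>) (cut S \<omega>) x) \<le> Re (inner_at g k \<omega> \<omega> x)"
  proof (cases "x \<in> S")
    case True then show ?thesis using inner_at_cong[of "cut S \<omega>" x \<omega> "cut S \<omega>" \<omega>] by (simp add: cut_def)
  next
    case False then show ?thesis using inner_at_null[of "cut S \<omega>" x] inner_at_nonneg by (simp add: cut_def)
  qed
qed simp

text \<open>Moves the norm to the metric-free measure, so that the volume density joins the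
  pointwise norm as in \<open>weighted_norm_mono\<close>.\<close>

lemma sq_norm_base:
  assumes g: "metric_on atlas A g" and \<omega>: "pq_form p q \<omega>"
  shows "sq_norm g (p + q) \<omega> = (\<integral>\<^sup>+x. ennreal (indicator A x * (vol g x * Re (inner_at g (p + q) \<omega> \<omega> x))) \<partial>base_measure)"
proof -
  have m: "(\<lambda>x. ennreal (vol g x)) \<in> borel_measurable base_measure"
    "(\<lambda>x. ennreal (indicator A x * Re (inner_at g (p + q) \<omega> \<omega> x))) \<in> borel_measurable base_measure"
    using vol_measurable[OF metric_on_smooth[OF g]] Re_inner_at_measurable[OF g \<omega>]
      measurable_cong_sets[OF sets_base_measure refl] by (auto intro!: measurable_compose[OF _ measurable_ennreal])
  show ?thesis
    unfolding sq_norm_def dvol_eq[OF metric_on_smooth[OF g]] nn_integral_density[OF m]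
  proof (rule nn_integral_cong)
    fix x
    show "ennreal (vol g x) * ennreal (indicator A x * Re (inner_at g (p + q) \<omega> \<omega> x)) =
        ennreal (indicator A x * (vol g x * Re (inner_at g (p + q) \<omega> \<omega> x)))"
    proof (cases "x \<in> A")
      case True
      then have "vol g x > 0" using vol_pos metric_on_hform[OF g] metric_on_pos_def[OF g] by blast
      then show ?thesis using True by (simp add: ennreal_mult'[symmetric])
    qed simp
  qed
qed

text \<open>This is \<open>weighted_norm_mono\<close> under the integral. The metrics are compared
  only where the form is nonzero, so that a comparison on a compact set suffices for truncated
  forms.\<close>

lemma sq_norm_compare:
  assumes g: "metric_on atlas A g" and g': "metric_on atlas A g'" and \<omega>: "pq_form CARD('m) q \<omega>" and c: "c > 0"
    and le: "\<And>x v. x \<in> A \<Longrightarrow> \<omega> x \<noteq> 0 \<Longrightarrow> c * g' x v v \<le> g x v v"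
  shows "sq_norm g (CARD('m) + q) \<omega> \<le> ennreal ((1 / c) ^ q) * sq_norm g' (CARD('m) + q) \<omega>"
proof -
  let ?k = "CARD('m) + q"
  have "sq_norm g ?k \<omega> \<le> (\<integral>\<^sup>+x. ennreal ((1 / c) ^ q) * ennreal (indicator A x * (vol g' x * Re (inner_at g' ?k \<omega> \<omega> x))) \<partial>base_measure)"
    unfolding sq_norm_base[OF g \<omega>]
  proof (rule nn_integral_mono)
    fix x
    show "ennreal (indicator A x * (vol g x * Re (inner_at g ?k \<omega> \<omega> x))) \<le>
        ennreal ((1 / c) ^ q) * ennreal (indicator A x * (vol g' x * Re (inner_at g' ?k \<omega> \<omega> x)))"
    proof (cases "x \<in> A \<and> \<omega> x \<noteq> 0")
      case True
      then have xA: "x \<in> A" and nz: "\<omega> x \<noteq> 0" by auto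
      have gx: "hform (g x)" "pos_def (g x)" "hform (g' x)" "pos_def (g' x)" using g g' xA by (auto simp: metric_on_def)
      obtain k where k: "k < length cover" "x \<in> piece k" using piece_ex by blast
      have xk: "x \<in> fst (cover ! k)" using k(2) piece_subset by blast
      note fr = gram_frame[OF cover_atlas[OF k(1)] xk]
      have wx: "\<omega> x \<in> pq_covectors CARD('m) q" using \<omega> xA by (simp add: pq_form_def)
      have "vol g x * Re (psum ?k (\<rho> x) (orthonormal_basis (g x)) (\<omega> x) (\<omega> x)) \<le>
          (1 / c) ^ q * (vol g' x * Re (psum ?k (\<rho> x) (orthonormal_basis (g' x)) (\<omega> x) (\<omega> x)))"
        unfolding vol_piece[OF k] volume_density_gram fr
        by (rule weighted_norm_mono[OF gx c le[OF xA nz] fform_rho wx orthonormal_orthonormal_basis[OF gx(1,2)] orthonormal_orthonormal_basis[OF gx(3,4)]])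
      then have "vol g x * Re (inner_at g ?k \<omega> \<omega> x) \<le> (1 / c) ^ q * (vol g' x * Re (inner_at g' ?k \<omega> \<omega> x))"
        using divide_right_mono[of _ _ "fact ?k :: real"] by (simp add: inner_at_def Re_divide_fact)
      then show ?thesis using xA c by (simp add: ennreal_mult'[symmetric] ennreal_leI)
    next
      case False
      then show ?thesis by (cases "x \<in> A") (auto simp: inner_at_null)
    qed
  qed
  also have "\<dots> = ennreal ((1 / c) ^ q) * sq_norm g' ?k \<omega>"
  proof -
    have "(\<lambda>x. ennreal (indicator A x * (vol g' x * Re (inner_at g' ?k \<omega> \<omega> x)))) \<in> borel_measurable borel"
    proof -
      have "(\<lambda>x. vol g' x * (indicator A x * Re (inner_at g' ?k \<omega> \<omega> x))) \<in> borel_measurable borel"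
        by (intro borel_measurable_times vol_measurable Re_inner_at_measurable g' \<omega> metric_on_smooth[OF g'])
      then show ?thesis by (intro measurable_compose[OF _ measurable_ennreal]) (simp add: mult_ac)
    qed
    then have "(\<lambda>x. ennreal (indicator A x * (vol g' x * Re (inner_at g' ?k \<omega> \<omega> x)))) \<in> borel_measurable base_measure"
      using measurable_cong_sets[OF sets_base_measure refl] by blast
    then show ?thesis unfolding sq_norm_base[OF g' \<omega>] by (rule nn_integral_cmult)
  qed
  finally show ?thesis .
qed

end

section \<open>The weak Dolbeault operator\<close>

lemma norm_cscale_vec: "norm (a *s (v :: complex^'k::finite)) = cmod a * norm v"
  by (simp add: norm_vec_def L2_set_def norm_mult power_mult_distrib real_sqrt_mult flip: sum_distrib_left)

context semi_hilbert begin

text \<open>Homogeneity improves the bound: apply it to u / |u|, and if |u| = 0 to all multiples of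
  u, which forces F u = 0. The quadratic bound is what an L^2 estimate of an L^1 pairing on a set of
  finite measure gives directly.\<close>

lemma bfunI:
  assumes add: "\<And>u v. u \<in> carr H \<Longrightarrow> v \<in> carr H \<Longrightarrow> F (u + v) = F u + F v"
    and scale: "\<And>a u. u \<in> carr H \<Longrightarrow> F (sc a u) = a * F u"
    and bound: "\<And>u. u \<in> carr H \<Longrightarrow> cmod (F u) \<le> C * (1 + (nrm u)\<^sup>2)"
  shows "bfun F"
proof -
  have "cmod (F u) \<le> (2 * C) * nrm u" if u: "u \<in> carr H" for u
  proof (cases "nrm u = 0")
    case True
    have "real n * cmod (F u) \<le> C" for n :: nat
      using bound[OF scale_carr[OF u], of "of_nat n"] True u by (simp add: scale nrm_scale norm_mult)
    then have "cmod (F u) = 0"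
      by (metis ex_less_of_nat_mult norm_ge_zero not_le order_le_less)
    then show ?thesis using True by simp
  next
    case False
    then have pos: "nrm u > 0" using nrm_nonneg[OF u] by simp
    have "cmod (F (sc (of_real (1 / nrm u)) u)) \<le> C * (1 + (1 / nrm u * nrm u)\<^sup>2)"
      using bound[OF scale_carr[OF u], of "of_real (1 / nrm u)"] u pos by (simp add: nrm_scale norm_divide)
    then have "cmod (F u) / nrm u \<le> 2 * C"
      using pos by (simp only: scale[OF u]) (simp add: norm_mult norm_divide)
    then show ?thesis using pos by (simp add: field_simps)
  qed
  then show ?thesis unfolding bfun_def using add scale by blast
qed

lemma bfun_zero_fun: "bfun (\<lambda>u. 0)"
  unfolding bfun_def by (auto intro: exI[of _ 0])

lemma bfun_cmult: assumes "bfun F" shows "bfun (\<lambda>u. c * F u)"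
proof -
  obtain C where "\<forall>u\<in>carr H. cmod (F u) \<le> C * nrm u" using assms by (auto simp: bfun_def)
  then have "\<forall>u\<in>carr H. cmod (c * F u) \<le> (cmod c * C) * nrm u"
    by (simp add: norm_mult mult_left_mono mult.assoc)
  then have "\<exists>D. \<forall>u\<in>carr H. cmod (c * F u) \<le> D * nrm u" by blast
  then show ?thesis unfolding bfun_def using bfun_add[OF assms] bfun_scale[OF assms] by (simp add: distrib_left)
qed

lemma bfun_plus: assumes "bfun F" "bfun G" shows "bfun (\<lambda>u. F u + G u)"
proof -
  obtain C D where CD: "\<forall>u\<in>carr H. cmod (F u) \<le> C * nrm u" "\<forall>u\<in>carr H. cmod (G u) \<le> D * nrm u"
    using assms by (auto simp: bfun_def)
  have "cmod (F u + G u) \<le> (C + D) * nrm u" if "u \<in> carr H" for u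
    using bspec[OF CD(1) that] bspec[OF CD(2) that] norm_triangle_ineq[of "F u" "G u"] by (simp add: distrib_right)
  then have "\<exists>E. \<forall>u\<in>carr H. cmod (F u + G u) \<le> E * nrm u" by blast
  then show ?thesis unfolding bfun_def
    using bfun_add[OF assms(1)] bfun_scale[OF assms(1)] bfun_add[OF assms(2)] bfun_scale[OF assms(2)] by (simp add: distrib_left)
qed

lemma bfun_sum_fun: "(\<And>i. i \<in> J \<Longrightarrow> bfun (F i)) \<Longrightarrow> bfun (\<lambda>u. \<Sum>i\<in>J. F i u)"
  by (induction J rule: infinite_finite_induct) (simp_all add: bfun_zero_fun bfun_plus)

end

context hbundle begin

abbreviation region :: "('a, 'm) chart \<Rightarrow> ('a, 'r) triv \<Rightarrow> (complex^'m) set" where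
  "region c t \<equiv> snd c ` (fst c \<inter> fst t \<inter> A)"

text \<open>Minimize over S times the unit sphere; the expansion in the standard basis gives the
  joint continuity of the fibre metric.\<close>

lemma rho_local_uniform:
  assumes c: "c \<in> atlas" and t: "t \<in> trivs" and S: "compact S" "S \<subseteq> snd c ` (fst c \<inter> fst t)"
  shows "\<exists>\<kappa>>0. \<forall>z\<in>S. \<forall>w. \<kappa> * (norm w)\<^sup>2 \<le> Re (rho_local c t z w w)"
proof (cases "S = {}")
  case False
  have fz: "fform (rho_local c t z)" if "z \<in> S" for z
    using S that cinv_snd[OF c] by (intro fform_rho_local[OF t]) auto
  let ?P = "S \<times> (sphere 0 1 :: (complex^'r) set)"
  let ?F = "\<lambda>p. \<Sum>i\<in>UNIV. \<Sum>j\<in>UNIV. snd p $ i * cnj (snd p $ j) * rho_local c t (fst p) (axis i 1) (axis j 1)"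
  have "continuous_on ?P ?F"
    by (intro continuous_intros continuous_on_compose2[OF continuous_rho_local[OF c t S(2)]]) auto
  moreover have "?F p = rho_local c t (fst p) (snd p) (snd p)" if "p \<in> ?P" for p
    using that by (subst fform_expand[OF fz]) auto
  ultimately have "continuous_on ?P (\<lambda>p. rho_local c t (fst p) (snd p) (snd p))"
    by (rule continuous_on_eq)
  then have "continuous_on ?P (\<lambda>p. Re (rho_local c t (fst p) (snd p) (snd p)))" by (intro continuous_intros)
  moreover have "compact ?P" "?P \<noteq> {}" using S False by (auto intro!: compact_Times)
  ultimately have "\<exists>p0\<in>?P. \<forall>p\<in>?P. Re (rho_local c t (fst p0) (snd p0) (snd p0)) \<le> Re (rho_local c t (fst p) (snd p) (snd p))"
    by (intro continuous_attains_inf)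
  then obtain p0 where p0: "p0 \<in> ?P"
    "\<And>p. p \<in> ?P \<Longrightarrow> Re (rho_local c t (fst p0) (snd p0) (snd p0)) \<le> Re (rho_local c t (fst p) (snd p) (snd p))"
    by blast
  have "Re (rho_local c t (fst p0) (snd p0) (snd p0)) > 0" using p0(1) by (intro fform_pos[OF fz]) auto
  moreover have "Re (rho_local c t (fst p0) (snd p0) (snd p0)) * (norm w)\<^sup>2 \<le> Re (rho_local c t z w w)" if "z \<in> S" for z w
    using p0(2)[of "(z, _)"] that by (intro fform_scaled_lower[OF fz]) auto
  ultimately show ?thesis by blast
qed (auto intro: exI[of _ 1])

text \<open>On the compact set the fibre metric is uniformly definite and the lengths of the
  constant vector fields are bounded, so \<open>norm_le_inner_at\<close> becomes uniform in
  z.\<close>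

lemma local_form_bound:
  assumes g: "metric_on atlas A g" and c: "c \<in> atlas" and t: "t \<in> trivs" and S: "compact S" "S \<subseteq> region c t"
  shows "\<exists>D\<ge>0. \<forall>z\<in>S. \<forall>\<omega>. rmult k (\<omega> (cinv c z)) \<longrightarrow>
     (norm (local_form atlas c t \<omega> z v))\<^sup>2 \<le> D * Re (inner_at g k \<omega> \<omega> (cinv c z))"
proof -
  have S': "S \<subseteq> snd c ` (fst c \<inter> fst t)" "S \<subseteq> snd c ` fst c" using S by auto
  obtain \<kappa> where \<kappa>: "\<kappa> > 0" "\<And>z w. z \<in> S \<Longrightarrow> \<kappa> * (norm w)\<^sup>2 \<le> Re (rho_local c t z w w)"
    using rho_local_uniform[OF c t S(1) S'(1)] by blast
  have "continuous_on S (\<lambda>z. \<Prod>i<k. local_metric atlas c g z (v i) (v i))"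
    by (intro continuous_intros continuous_local_metric[OF metric_on_smooth[OF g] c S'(2)])
  then have "bounded ((\<lambda>z. \<Prod>i<k. local_metric atlas c g z (v i) (v i)) ` S)"
    using S(1) compact_continuous_image compact_imp_bounded by blast
  then obtain G where G: "\<And>z. z \<in> S \<Longrightarrow> \<bar>\<Prod>i<k. local_metric atlas c g z (v i) (v i)\<bar> \<le> G"
    unfolding bounded_iff by auto
  have "(norm (local_form atlas c t \<omega> z v))\<^sup>2 \<le> \<bar>G\<bar> * fact k / \<kappa> * Re (inner_at g k \<omega> \<omega> (cinv c z))"
    if z: "z \<in> S" and \<omega>: "rmult k (\<omega> (cinv c z))" for z \<omega>
  proof -
    obtain x where x: "x \<in> fst c" "x \<in> fst t" "x \<in> A" "z = snd c x" using S z by blast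
    have cz: "cinv c z = x" using cinv_snd[OF c x(1)] x by simp
    have "\<kappa> * (norm (local_form atlas c t \<omega> z v))\<^sup>2 \<le> Re (rho_local c t z (local_form atlas c t \<omega> z v) (local_form atlas c t \<omega> z v))"
      by (rule \<kappa>(2)[OF z])
    also have "\<dots> = Re (\<rho> x (\<omega> x (\<lambda>i. tangent atlas c x (v i))) (\<omega> x (\<lambda>i. tangent atlas c x (v i))))"
      using rho_eq_local[OF c t x(1,2), of \<omega> v \<omega> v] x(4) by simp
    also have "\<dots> \<le> ((\<Prod>i<k. g x (tangent atlas c x (v i)) (tangent atlas c x (v i))) * fact k) * Re (inner_at g k \<omega> \<omega> x)"
      using \<omega> cz by (intro norm_le_inner_at[OF g x(3)]) simp
    also have "\<dots> \<le> (\<bar>G\<bar> * fact k) * Re (inner_at g k \<omega> \<omega> x)"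
      using G[OF z] cz by (intro mult_right_mono inner_at_nonneg) (auto simp: local_metric_def Let_def)
    finally show ?thesis using \<kappa>(1) cz by (simp add: field_simps)
  qed
  then show ?thesis using \<kappa>(1) by (intro exI[of _ "\<bar>G\<bar> * fact k / \<kappa>"]) auto
qed

text \<open>Integrates \<open>local_form_bound\<close>; the passage from coordinates to the manifold
  is \<open>chart_measure_le\<close>.\<close>

lemma local_form_L2_bound:
  assumes g: "metric_on atlas A g" and c: "c \<in> atlas" and t: "t \<in> trivs" and S: "compact S" "S \<subseteq> region c t"
  shows "\<exists>C\<ge>0. \<forall>\<omega>. pq_form p q \<omega> \<longrightarrow>
     (\<integral>\<^sup>+z. ennreal ((norm (local_form atlas c t \<omega> z v))\<^sup>2) * indicator S z \<partial>lborel) \<le> ennreal C * sq_norm g (p + q) \<omega>"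
proof -
  have SA: "S \<subseteq> snd c ` (fst c \<inter> A)" using S by auto
  obtain D where D: "D \<ge> 0" "\<And>z \<omega>. z \<in> S \<Longrightarrow> rmult (p + q) (\<omega> (cinv c z)) \<Longrightarrow>
     (norm (local_form atlas c t \<omega> z v))\<^sup>2 \<le> D * Re (inner_at g (p + q) \<omega> \<omega> (cinv c z))"
    using local_form_bound[OF g c t S] by blast
  obtain E where E: "E \<ge> 0" "\<And>X. X \<in> sets borel \<Longrightarrow> X \<subseteq> S \<Longrightarrow> emeasure lborel X \<le> ennreal E * emeasure (dvol atlas g) (cinv c ` X)"
    using chart_measure_le[OF c S(1) SA g] by blast
  define P where "P = cinv c ` S"
  have P: "P \<subseteq> fst c" using SA cinv_snd[OF c] by (auto simp: P_def)
  have "snd c (cinv c z) = z" if "z \<in> S" for z using SA that by (intro snd_cinv[OF c]) auto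
  then have PS: "snd c ` P = S" by (force simp: P_def image_image)
  have "compact P" unfolding P_def using S SA by (intro compact_continuous_image continuous_cinv[OF c]) auto
  then have Pb: "P \<in> sets borel" by (rule borel_compact)
  have "(\<integral>\<^sup>+z. ennreal ((norm (local_form atlas c t \<omega> z v))\<^sup>2) * indicator S z \<partial>lborel) \<le> ennreal (D * E) * sq_norm g (p + q) \<omega>"
    if \<omega>: "pq_form p q \<omega>" for \<omega>
  proof -
    let ?f = "\<lambda>x. ennreal (indicator A x * Re (inner_at g (p + q) \<omega> \<omega> x))"
    have fm: "?f \<in> borel_measurable borel" using Re_inner_at_measurable[OF g \<omega>] by measurable
    have fm': "?f \<in> borel_measurable (dvol atlas g)" using fm by (simp add: measurable_dvol)
    have "(\<integral>\<^sup>+z. ennreal ((norm (local_form atlas c t \<omega> z v))\<^sup>2) * indicator S z \<partial>lborel) \<le>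
      (\<integral>\<^sup>+z. (ennreal D * ?f (cinv c z)) * indicator (snd c ` P) z \<partial>lborel)"
    unfolding PS
    proof (rule nn_integral_mono)
      fix z show "ennreal ((norm (local_form atlas c t \<omega> z v))\<^sup>2) * indicator S z \<le> (ennreal D * ?f (cinv c z)) * indicator S z"
      proof (cases "z \<in> S")
        case True
        then have zA: "cinv c z \<in> A" using SA cinv_snd[OF c] by auto
        have "(norm (local_form atlas c t \<omega> z v))\<^sup>2 \<le> D * Re (inner_at g (p + q) \<omega> \<omega> (cinv c z))"
          by (rule D(2)[where \<omega> = \<omega>, OF True pq_form_rmult[OF \<omega> zA]])
        then show ?thesis using True zA D(1) inner_at_nonneg by (simp add: ennreal_mult'[symmetric] ennreal_leI)
      qed simp
    qed
    also have "\<dots> = (\<integral>\<^sup>+x. ennreal D * ?f x \<partial>chart_measure c P)"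
      using fm by (intro nn_integral_chart_measure[symmetric] c Pb P) auto
    also have "\<dots> = ennreal D * (\<integral>\<^sup>+x. ?f x \<partial>chart_measure c P)"
      using fm measurable_cong_sets[OF sets_chart_measure refl] by (intro nn_integral_cmult) blast
    also have "(\<integral>\<^sup>+x. ?f x \<partial>chart_measure c P) \<le> ennreal E * (\<integral>\<^sup>+x. ?f x \<partial>dvol atlas g)"
    proof (rule nn_integral_le_of_emeasure_le[OF _ _ fm'])
      fix X assume "X \<in> sets (dvol atlas g)"
      then have X: "X \<in> sets borel" by simp
      have XS: "snd c ` (X \<inter> P) \<subseteq> S" "snd c ` (X \<inter> P) \<in> sets borel"
        using P PS X Pb by (auto intro!: chart_borel[OF c])
      have "cinv c ` snd c ` (X \<inter> P) = X \<inter> P" using P(1) cinv_snd[OF c] by (force simp: image_image)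
      then have "emeasure (chart_measure c P) X \<le> ennreal E * emeasure (dvol atlas g) (X \<inter> P)"
        using E(2)[OF XS(2,1)] emeasure_chart_measure[OF c Pb P(1) X] by simp
      also have "\<dots> \<le> ennreal E * emeasure (dvol atlas g) X"
        using X by (intro mult_left_mono emeasure_mono) auto
      finally show "emeasure (chart_measure c P) X \<le> ennreal E * emeasure (dvol atlas g) X" .
    qed simp
    finally show ?thesis
      using D(1) E(1) by (simp add: sq_norm_def ennreal_mult' mult.assoc mult_left_mono)
  qed
  then show ?thesis using D(1) E(1) by (intro exI[of _ "D * E"]) auto
qed

text \<open>Continuity and compact support are all that the pairing estimates use, so they cover
  test functions and their derivatives alike.\<close>

definition bump :: "('a, 'm) chart \<Rightarrow> ('a, 'r) triv \<Rightarrow> (complex^'m \<Rightarrow> complex) \<Rightarrow> bool" where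
  "bump c t \<phi> \<longleftrightarrow> continuous_on UNIV \<phi> \<and> (\<exists>S. compact S \<and> S \<subseteq> region c t \<and> (\<forall>z. z \<notin> S \<longrightarrow> \<phi> z = 0))"

text \<open>On the support, the norm of the coefficient is at most 1 plus its square, which turns
  the L^2 bound into an L^1 bound; the 1 integrates to the volume of the support. The right-hand
  side has the shape that \<open>bfunI\<close> expects.\<close>

lemma bump_pairing_bound:
  assumes g: "metric_on atlas A g" and c: "c \<in> atlas" and t: "t \<in> trivs" and \<phi>: "bump c t \<phi>"
  shows "\<exists>C\<ge>0. \<forall>\<omega>. pq_form p q \<omega> \<longrightarrow>
     (\<lambda>z. \<phi> z *s local_form atlas c t \<omega> z v) \<in> borel_measurable lborel \<and>
     (\<integral>\<^sup>+z. ennreal (norm (\<phi> z *s local_form atlas c t \<omega> z v)) \<partial>lborel) \<le> ennreal C * (1 + sq_norm g (p + q) \<omega>)"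
proof -
  obtain S where S: "compact S" "S \<subseteq> region c t" and \<phi>S: "\<And>z. z \<notin> S \<Longrightarrow> \<phi> z = 0" and \<phi>c: "continuous_on UNIV \<phi>"
    using \<phi> by (auto simp: bump_def)
  have "bounded (\<phi> ` S)"
    by (intro compact_imp_bounded compact_continuous_image S continuous_on_subset[OF \<phi>c]) simp
  then obtain B0 where "\<And>z. z \<in> S \<Longrightarrow> cmod (\<phi> z) \<le> B0" unfolding bounded_iff by auto
  then obtain B where B: "B \<ge> 0" "\<And>z. cmod (\<phi> z) \<le> B"
    using \<phi>S by (metis abs_ge_self abs_ge_zero norm_zero order_trans)
  obtain D where D: "D \<ge> 0" "\<And>\<omega>. pq_form p q \<omega> \<Longrightarrow>
     (\<integral>\<^sup>+z. ennreal ((norm (local_form atlas c t \<omega> z v))\<^sup>2) * indicator S z \<partial>lborel) \<le> ennreal D * sq_norm g (p + q) \<omega>"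
    using local_form_L2_bound[OF g c t S] by blast
  have Sb: "S \<in> sets borel" by (rule borel_compact[OF S(1)])
  define E where "E = measure lborel S"
  have "emeasure lborel S < \<infinity>" using emeasure_lborel_cbox_finite emeasure_bounded_finite[OF compact_imp_bounded[OF S(1)]] by simp
  then have E: "emeasure lborel S = ennreal E" "E \<ge> 0"
    by (auto simp: E_def emeasure_eq_ennreal_measure)
  have main: "(\<lambda>z. \<phi> z *s local_form atlas c t \<omega> z v) \<in> borel_measurable lborel \<and>
     (\<integral>\<^sup>+z. ennreal (norm (\<phi> z *s local_form atlas c t \<omega> z v)) \<partial>lborel) \<le> ennreal (B * (E + D)) * (1 + sq_norm g (p + q) \<omega>)"
    if \<omega>: "pq_form p q \<omega>" for \<omega>
  proof
    let ?l = "\<lambda>z. local_form atlas c t \<omega> z v"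
    let ?li = "\<lambda>z. indicator (region c t) z *\<^sub>R ?l z"
    have lm: "?li \<in> borel_measurable borel" using \<omega> by (intro local_form_measurable c t) (simp add: pq_form_def)
    have \<phi>m: "\<phi> \<in> borel_measurable borel" using \<phi>c by (rule borel_measurable_continuous_onI)
    have cont: "continuous_on UNIV (\<lambda>x :: complex \<times> (complex^'r). fst x *s snd x)"
      unfolding vector_scalar_mult_def by (intro continuous_on_vec_lambda continuous_intros)
    have "(\<lambda>z. fst (\<phi> z, ?li z) *s snd (\<phi> z, ?li z)) \<in> borel_measurable borel"
      by (rule borel_measurable_continuous_on[OF cont borel_measurable_Pair[OF \<phi>m lm]])
    moreover have "fst (\<phi> z, ?li z) *s snd (\<phi> z, ?li z) = \<phi> z *s ?l z" for z
      using S \<phi>S by (cases "z \<in> S") (auto simp: indicator_def)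
    ultimately show "(\<lambda>z. \<phi> z *s ?l z) \<in> borel_measurable lborel"
      by (simp only: measurable_lborel2)
    have m: "(\<lambda>z. ennreal ((norm (?l z))\<^sup>2) * indicator S z) \<in> borel_measurable lborel"
    proof -
      have "(\<lambda>z. ennreal ((norm (?li z))\<^sup>2) * indicator S z) \<in> borel_measurable borel"
        using lm Sb by measurable
      moreover have "ennreal ((norm (?li z))\<^sup>2) * indicator S z = ennreal ((norm (?l z))\<^sup>2) * indicator S z" for z
        using S by (auto simp: indicator_def)
      ultimately show ?thesis by simp
    qed
    have "(\<integral>\<^sup>+z. ennreal (norm (\<phi> z *s ?l z)) \<partial>lborel) \<le>
        (\<integral>\<^sup>+z. ennreal B * (indicator S z + ennreal ((norm (?l z))\<^sup>2) * indicator S z) \<partial>lborel)"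
    proof (rule nn_integral_mono)
      fix z
      show "ennreal (norm (\<phi> z *s ?l z)) \<le> ennreal B * (indicator S z + ennreal ((norm (?l z))\<^sup>2) * indicator S z)"
      proof (cases "z \<in> S")
        case True
        have "norm (?l z) \<le> 1 + (norm (?l z))\<^sup>2"
          using sum_squares_bound[of "norm (?l z)" 1] norm_ge_zero[of "?l z"] by (simp del: norm_ge_zero)
        then have "norm (\<phi> z *s ?l z) \<le> B * (1 + (norm (?l z))\<^sup>2)"
          unfolding norm_cscale_vec using B by (intro mult_mono) auto
        then have "ennreal (norm (\<phi> z *s ?l z)) \<le> ennreal (B * (1 + (norm (?l z))\<^sup>2))" by (rule ennreal_leI)
        also have "\<dots> = ennreal B * (1 + ennreal ((norm (?l z))\<^sup>2))"
          using B by (simp add: ennreal_mult' ennreal_plus flip: ennreal_1)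
        finally show ?thesis using True by simp
      qed (simp add: \<phi>S)
    qed
    also have "\<dots> = ennreal B * (ennreal E + (\<integral>\<^sup>+z. ennreal ((norm (?l z))\<^sup>2) * indicator S z \<partial>lborel))"
      using m Sb E by (simp add: nn_integral_cmult nn_integral_add)
    also have "\<dots> \<le> ennreal B * (ennreal E + ennreal D * sq_norm g (p + q) \<omega>)"
      using D(2)[OF \<omega>] by (intro mult_left_mono add_left_mono) auto
    also have "\<dots> \<le> ennreal B * (ennreal (E + D) * (1 + sq_norm g (p + q) \<omega>))"
    proof (intro mult_left_mono)
      have "ennreal E \<le> ennreal (E + D) * 1" using D(1) by (simp add: ennreal_leI)
      moreover have "ennreal D * sq_norm g (p + q) \<omega> \<le> ennreal (E + D) * sq_norm g (p + q) \<omega>"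
        using E(2) by (intro mult_right_mono ennreal_leI) auto
      ultimately show "ennreal E + ennreal D * sq_norm g (p + q) \<omega> \<le> ennreal (E + D) * (1 + sq_norm g (p + q) \<omega>)"
        unfolding distrib_left by (rule add_mono)
    qed simp
    also have "\<dots> = ennreal (B * (E + D)) * (1 + sq_norm g (p + q) \<omega>)"
      using B(1) by (simp add: ennreal_mult' mult.assoc)
    finally show "(\<integral>\<^sup>+z. ennreal (norm (\<phi> z *s ?l z)) \<partial>lborel) \<le> ennreal (B * (E + D)) * (1 + sq_norm g (p + q) \<omega>)" .
  qed
  show ?thesis using main B(1) D(1) E(2) by (intro exI[of _ "B * (E + D)"]) auto
qed

lemma bump_integrable:
  assumes g: "metric_on atlas A g" and c: "c \<in> atlas" and t: "t \<in> trivs" and \<phi>: "bump c t \<phi>" and \<omega>: "\<omega> \<in> carr (L g p q)"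
  shows "integrable lborel (\<lambda>z. \<phi> z *s local_form atlas c t \<omega> z v)"
proof -
  obtain C where C: "(\<lambda>z. \<phi> z *s local_form atlas c t \<omega> z v) \<in> borel_measurable lborel"
     "(\<integral>\<^sup>+z. ennreal (norm (\<phi> z *s local_form atlas c t \<omega> z v)) \<partial>lborel) \<le> ennreal C * (1 + sq_norm g (p + q) \<omega>)"
    using bump_pairing_bound[OF g c t \<phi>, of p q v] \<omega> unfolding carr_iff[OF g] by (elim exE conjE allE[of _ \<omega>] impE) blast+
  have "sq_norm g (p + q) \<omega> < \<infinity>" using \<omega> unfolding carr_iff[OF g] by simp
  then have "ennreal C * (1 + sq_norm g (p + q) \<omega>) < \<infinity>" by (simp add: ennreal_mult_less_top)
  then show ?thesis using C le_less_trans by (intro integrableI_bounded) auto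
qed

definition pairing :: "('a, 'm) chart \<Rightarrow> ('a, 'r) triv \<Rightarrow> (complex^'m \<Rightarrow> complex) \<Rightarrow> (nat \<Rightarrow> complex^'m) \<Rightarrow> 'r \<Rightarrow>
    ('a, 'm, 'r) form \<Rightarrow> complex" where
  "pairing c t \<phi> v j \<omega> = (\<integral>z. \<phi> z * local_form atlas c t \<omega> z v $ j \<partial>lborel)"

lemma pairing_integrable:
  assumes "metric_on atlas A g" "c \<in> atlas" "t \<in> trivs" "bump c t \<phi>" "\<omega> \<in> carr (L g p q)"
  shows "integrable lborel (\<lambda>z. \<phi> z * local_form atlas c t \<omega> z v $ j)"
  using integrable_bounded_linear[OF bounded_linear_vec_nth bump_integrable[OF assms, of v], of j] by simp

lemma pairing_component:
  assumes "metric_on atlas A g" "c \<in> atlas" "t \<in> trivs" "bump c t \<phi>" "\<omega> \<in> carr (L g p q)"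
  shows "(\<integral>z. \<phi> z *s local_form atlas c t \<omega> z v \<partial>lborel) $ j = pairing c t \<phi> v j \<omega>"
  using integral_bounded_linear[OF bounded_linear_vec_nth bump_integrable[OF assms, of v], of j]
  by (simp add: pairing_def)

lemma bfun_pairing:
  assumes g: "metric_on atlas A g" and c: "c \<in> atlas" and t: "t \<in> trivs" and \<phi>: "bump c t \<phi>"
  shows "semi_hilbert.bfun cscale (L g p q) (pairing c t \<phi> v j)"
proof -
  interpret H: semi_hilbert cscale "L g p q" by (rule semi_hilbert_L2[OF g])
  obtain C where C: "C \<ge> 0" "\<And>\<omega>. pq_form p q \<omega> \<Longrightarrow>
     (\<integral>\<^sup>+z. ennreal (norm (\<phi> z *s local_form atlas c t \<omega> z v)) \<partial>lborel) \<le> ennreal C * (1 + sq_norm g (p + q) \<omega>)"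
    using bump_pairing_bound[OF g c t \<phi>, of p q v] by (elim exE conjE) blast
  note int = pairing_integrable[OF g c t \<phi>]
  show ?thesis
  proof (rule H.bfunI)
    fix \<omega> \<eta> assume "\<omega> \<in> carr (L g p q)" "\<eta> \<in> carr (L g p q)"
    note i = int[OF this(1), of v j] int[OF this(2), of v j]
    have "\<phi> z * local_form atlas c t (\<omega> + \<eta>) z v $ j =
       \<phi> z * local_form atlas c t \<omega> z v $ j + \<phi> z * local_form atlas c t \<eta> z v $ j" for z
      by (simp add: local_form_def Let_def matrix_vector_right_distrib distrib_left)
    then show "pairing c t \<phi> v j (\<omega> + \<eta>) = pairing c t \<phi> v j \<omega> + pairing c t \<phi> v j \<eta>"
      unfolding pairing_def using Bochner_Integration.integral_add[OF i] by simp
  next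
    fix a \<omega>
    have "\<phi> z * local_form atlas c t (cscale a \<omega>) z v $ j = a * (\<phi> z * local_form atlas c t \<omega> z v $ j)" for z
      by (simp add: local_form_def Let_def cscale_def vec.scale mult_ac)
    then show "pairing c t \<phi> v j (cscale a \<omega>) = a * pairing c t \<phi> v j \<omega>"
      unfolding pairing_def by (simp only: integral_mult_right_zero)
  next
    fix \<omega> assume \<omega>: "\<omega> \<in> carr (L g p q)"
    let ?l = "\<lambda>z. local_form atlas c t \<omega> z v"
    have "cmod (pairing c t \<phi> v j \<omega>) \<le> (\<integral>z. norm (\<phi> z *s ?l z) \<partial>lborel)"
      unfolding pairing_component[OF g c t \<phi> \<omega>, symmetric]
      by (rule order_trans[OF Finite_Cartesian_Product.norm_nth_le integral_norm_bound])
    moreover have "ennreal (\<integral>z. norm (\<phi> z *s ?l z) \<partial>lborel) = (\<integral>\<^sup>+z. ennreal (norm (\<phi> z *s ?l z)) \<partial>lborel)"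
      using bump_integrable[OF g c t \<phi> \<omega>] by (intro nn_integral_eq_integral[symmetric]) auto
    moreover have "\<dots> \<le> ennreal C * (1 + ennreal ((H.nrm \<omega>)\<^sup>2))"
      using C(2) \<omega> unfolding hnorm_sq_norm[OF g \<omega>] by (simp add: carr_iff[OF g])
    moreover have "\<dots> = ennreal (C * (1 + (H.nrm \<omega>)\<^sup>2))"
      using C(1) by (simp add: ennreal_mult' ennreal_plus flip: ennreal_1)
    ultimately have "ennreal (\<integral>z. norm (\<phi> z *s ?l z) \<partial>lborel) \<le> ennreal (C * (1 + (H.nrm \<omega>)\<^sup>2))" by simp
    then have "(\<integral>z. norm (\<phi> z *s ?l z) \<partial>lborel) \<le> C * (1 + (H.nrm \<omega>)\<^sup>2)" using C(1) by simp
    then show "cmod (pairing c t \<phi> v j \<omega>) \<le> C * (1 + (H.nrm \<omega>)\<^sup>2)"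
      using \<open>cmod (pairing c t \<phi> v j \<omega>) \<le> _\<close> by linarith
  qed
qed

end

section \<open>Symmetry of second derivatives and calculus of \<open>dbar_fun\<close>\<close>

lemma has_real_derivative_along:
  fixes f :: "'v::real_normed_vector \<Rightarrow> real"
  assumes "\<And>x. (f has_derivative f' x) (at x)"
  shows "((\<lambda>t. f (u + t *\<^sub>R v)) has_real_derivative f' (u + t *\<^sub>R v) v) (at t)"
proof -
  have "((\<lambda>t. f (u + t *\<^sub>R v)) has_derivative (\<lambda>h. f' (u + t *\<^sub>R v) (h *\<^sub>R v))) (at t)"
    by (rule has_derivative_compose[of "\<lambda>t. u + t *\<^sub>R v", OF _ assms]) (auto intro!: derivative_eq_intros)
  moreover have "f' (u + t *\<^sub>R v) (h *\<^sub>R v) = f' (u + t *\<^sub>R v) v * h" for h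
    using linear_scale[OF has_derivative_linear[OF assms]] by (simp add: mult.commute)
  ultimately show ?thesis by (simp add: has_field_derivative_def)
qed

text \<open>The mean value theorem twice: along v for the difference of f in direction w, then along
  w for the derivative of f in direction v.\<close>

lemma second_difference:
  fixes f :: "'v::real_normed_vector \<Rightarrow> real"
  assumes f: "\<And>x. (f has_derivative f' x) (at x)" and f2: "\<And>x. ((\<lambda>x. f' x v) has_derivative f2 x) (at x)" and s: "s > 0"
  shows "\<exists>\<xi> \<eta>. 0 < \<xi> \<and> \<xi> < s \<and> 0 < \<eta> \<and> \<eta> < s \<and>
     f (z + s *\<^sub>R v + s *\<^sub>R w) - f (z + s *\<^sub>R v) - f (z + s *\<^sub>R w) + f z = s * (s * f2 (z + \<xi> *\<^sub>R v + \<eta> *\<^sub>R w) w)"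
proof -
  have "DERIV (\<lambda>t. f (z + s *\<^sub>R w + t *\<^sub>R v) - f (z + t *\<^sub>R v)) t :> f' (z + s *\<^sub>R w + t *\<^sub>R v) v - f' (z + t *\<^sub>R v) v" for t
    by (intro DERIV_diff has_real_derivative_along f)
  from MVT2[OF s this] obtain \<xi> where \<xi>: "0 < \<xi>" "\<xi> < s"
    "(f (z + s *\<^sub>R w + s *\<^sub>R v) - f (z + s *\<^sub>R v)) - (f (z + s *\<^sub>R w + 0 *\<^sub>R v) - f (z + 0 *\<^sub>R v))
      = (s - 0) * (f' (z + s *\<^sub>R w + \<xi> *\<^sub>R v) v - f' (z + \<xi> *\<^sub>R v) v)" by auto
  have "DERIV (\<lambda>t. f' (z + \<xi> *\<^sub>R v + t *\<^sub>R w) v) t :> f2 (z + \<xi> *\<^sub>R v + t *\<^sub>R w) w" for t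
    by (rule has_real_derivative_along[of "\<lambda>x. f' x v" f2, OF f2])
  from MVT2[OF s this] obtain \<eta> where \<eta>: "0 < \<eta>" "\<eta> < s"
    "f' (z + \<xi> *\<^sub>R v + s *\<^sub>R w) v - f' (z + \<xi> *\<^sub>R v + 0 *\<^sub>R w) v = (s - 0) * f2 (z + \<xi> *\<^sub>R v + \<eta> *\<^sub>R w) w" by auto
  have e: "z + s *\<^sub>R w + \<xi> *\<^sub>R v = z + \<xi> *\<^sub>R v + s *\<^sub>R w" "z + s *\<^sub>R w + s *\<^sub>R v = z + s *\<^sub>R v + s *\<^sub>R w" by simp_all
  have "f (z + s *\<^sub>R v + s *\<^sub>R w) - f (z + s *\<^sub>R v) - f (z + s *\<^sub>R w) + f z = s * (s * f2 (z + \<xi> *\<^sub>R v + \<eta> *\<^sub>R w) w)"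
    using \<xi>(3)[unfolded e] \<eta>(3) by simp
  then show ?thesis using \<xi>(1,2) \<eta>(1,2) by blast
qed

text \<open>The second difference is symmetric in v and w. Evaluated in both orders it gives the two
  mixed derivatives at points that approach z as s tends to 0, and continuity identifies them
  there.\<close>

lemma symmetric_second_derivative_real:
  fixes f :: "'v::real_normed_vector \<Rightarrow> real"
  assumes f: "\<And>x. (f has_derivative f' x) (at x)"
    and v: "\<And>x. ((\<lambda>x. f' x v) has_derivative f2v x) (at x)" and w: "\<And>x. ((\<lambda>x. f' x w) has_derivative f2w x) (at x)"
    and c: "continuous_on UNIV (\<lambda>x. f2v x w)" "continuous_on UNIV (\<lambda>x. f2w x v)"
  shows "f2v z w = f2w z v"
proof -
  have "\<exists>\<xi> \<eta> \<xi>' \<eta>'. 0 < \<xi> \<and> \<xi> < s \<and> 0 < \<eta> \<and> \<eta> < s \<and> 0 < \<xi>' \<and> \<xi>' < s \<and> 0 < \<eta>' \<and> \<eta>' < s \<and>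
     f2v (z + \<xi> *\<^sub>R v + \<eta> *\<^sub>R w) w = f2w (z + \<xi>' *\<^sub>R w + \<eta>' *\<^sub>R v) v" if s: "s > 0" for s
  proof -
    obtain \<xi> \<eta> where 1: "0 < \<xi>" "\<xi> < s" "0 < \<eta>" "\<eta> < s"
      "f (z + s *\<^sub>R v + s *\<^sub>R w) - f (z + s *\<^sub>R v) - f (z + s *\<^sub>R w) + f z = s * (s * f2v (z + \<xi> *\<^sub>R v + \<eta> *\<^sub>R w) w)"
      using second_difference[where f = f and z = z and w = w, OF f v s] by blast
    obtain \<xi>' \<eta>' where 2: "0 < \<xi>'" "\<xi>' < s" "0 < \<eta>'" "\<eta>' < s"
      "f (z + s *\<^sub>R w + s *\<^sub>R v) - f (z + s *\<^sub>R w) - f (z + s *\<^sub>R v) + f z = s * (s * f2w (z + \<xi>' *\<^sub>R w + \<eta>' *\<^sub>R v) v)"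
      using second_difference[where f = f and z = z and w = v, OF f w s] by blast
    have e: "z + s *\<^sub>R w + s *\<^sub>R v = z + s *\<^sub>R v + s *\<^sub>R w" by simp
    have "s * (s * f2v (z + \<xi> *\<^sub>R v + \<eta> *\<^sub>R w) w) = s * (s * f2w (z + \<xi>' *\<^sub>R w + \<eta>' *\<^sub>R v) v)"
      using 1(5) 2(5)[unfolded e] by (simp only:)
    then show ?thesis using 1(1-4) 2(1-4) s by (metis mult_left_cancel less_irrefl)
  qed
  then have "\<forall>n. \<exists>\<xi> \<eta> \<xi>' \<eta>'. 0 < \<xi> \<and> \<xi> < inverse (real (Suc n)) \<and> 0 < \<eta> \<and> \<eta> < inverse (real (Suc n)) \<and>
     0 < \<xi>' \<and> \<xi>' < inverse (real (Suc n)) \<and> 0 < \<eta>' \<and> \<eta>' < inverse (real (Suc n)) \<and>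
     f2v (z + \<xi> *\<^sub>R v + \<eta> *\<^sub>R w) w = f2w (z + \<xi>' *\<^sub>R w + \<eta>' *\<^sub>R v) v" by simp
  then obtain \<xi> \<eta> \<xi>' \<eta>' where n: "\<And>n. 0 < \<xi> n \<and> \<xi> n < inverse (real (Suc n)) \<and> 0 < \<eta> n \<and> \<eta> n < inverse (real (Suc n)) \<and>
     0 < \<xi>' n \<and> \<xi>' n < inverse (real (Suc n)) \<and> 0 < \<eta>' n \<and> \<eta>' n < inverse (real (Suc n)) \<and>
     f2v (z + \<xi> n *\<^sub>R v + \<eta> n *\<^sub>R w) w = f2w (z + \<xi>' n *\<^sub>R w + \<eta>' n *\<^sub>R v) v" by metis
  have lim: "x \<longlonglongrightarrow> 0" if "\<And>n. 0 < x n \<and> x n < inverse (real (Suc n))" for x :: "nat \<Rightarrow> real"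
    by (rule tendsto_sandwich[OF _ _ tendsto_const LIMSEQ_inverse_real_of_nat])
      (use that in \<open>auto intro!: always_eventually simp: order_less_imp_le\<close>)
  have p: "(\<lambda>n. z + x n *\<^sub>R a + y n *\<^sub>R b) \<longlonglongrightarrow> z" if "x \<longlonglongrightarrow> 0" "y \<longlonglongrightarrow> 0" for x y :: "nat \<Rightarrow> real" and a b
    using tendsto_add[OF tendsto_add[OF tendsto_const[of z] tendsto_scaleR[OF that(1) tendsto_const[of a]]] tendsto_scaleR[OF that(2) tendsto_const[of b]]]
    by simp
  have cc: "(\<lambda>n. F (x n)) \<longlonglongrightarrow> F z" if "continuous_on UNIV F" "x \<longlonglongrightarrow> z" for F :: "'v \<Rightarrow> real" and x
    using that by (simp add: continuous_on_eq_continuous_at isCont_tendsto_compose)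
  have "(\<lambda>n. f2v (z + \<xi> n *\<^sub>R v + \<eta> n *\<^sub>R w) w) \<longlonglongrightarrow> f2v z w"
    by (rule cc[OF c(1) p]) (use lim n in blast)+
  moreover have "(\<lambda>n. f2w (z + \<xi>' n *\<^sub>R w + \<eta>' n *\<^sub>R v) v) \<longlonglongrightarrow> f2w z v"
    by (rule cc[OF c(2) p]) (use lim n in blast)+
  ultimately show ?thesis using n LIMSEQ_unique by (metis (no_types, lifting) ext)
qed

lemma Ck_on_bounded_linear: "bounded_linear l \<Longrightarrow> Ck_on k S f \<Longrightarrow> Ck_on k S (\<lambda>x. l (f x))"
proof (induction k arbitrary: f)
  case 0 then show ?case by (simp add: bounded_linear.continuous_on)
next
  case (Suc k)
  then obtain f' where f': "\<And>x. x \<in> S \<Longrightarrow> (f has_derivative f' x) (at x within S)" "\<And>v. Ck_on k S (\<lambda>x. f' x v)" by auto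
  then show ?case using Suc.IH[OF Suc.prems(1)]
    by (auto intro!: exI[of _ "\<lambda>x v. l (f' x v)"] bounded_linear.has_derivative[OF Suc.prems(1)])
qed

lemma Ck_on_add: "Ck_on k S f \<Longrightarrow> Ck_on k S g \<Longrightarrow> Ck_on k S (\<lambda>x. f x + g x)"
proof (induction k arbitrary: f g)
  case 0 then show ?case by (simp add: continuous_on_add)
next
  case (Suc k)
  then obtain f' g' where f': "\<And>x. x \<in> S \<Longrightarrow> (f has_derivative f' x) (at x within S)" "\<And>v. Ck_on k S (\<lambda>x. f' x v)"
    and g': "\<And>x. x \<in> S \<Longrightarrow> (g has_derivative g' x) (at x within S)" "\<And>v. Ck_on k S (\<lambda>x. g' x v)"
    unfolding Ck_on.simps by (elim exE conjE) blast
  then show ?case using Suc.IH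
    by (auto intro!: exI[of _ "\<lambda>x v. f' x v + g' x v"] has_derivative_add)
qed

lemma smooth_on_has_derivative:
  assumes "smooth_on UNIV f" shows "(f has_derivative frechet_derivative f (at z)) (at z)"
proof -
  have "Ck_on (Suc 0) UNIV f" using assms by (simp add: smooth_on_def del: Ck_on.simps)
  then have "f differentiable (at z)" by (auto simp: differentiable_def)
  then show ?thesis by (simp add: frechet_derivative_works)
qed

lemma smooth_on_frechet_derivative:
  assumes "smooth_on UNIV f" shows "smooth_on UNIV (\<lambda>z. frechet_derivative f (at z) v)"
  unfolding smooth_on_def
proof
  fix k
  have "Ck_on (Suc k) UNIV f" using assms by (simp add: smooth_on_def del: Ck_on.simps)
  then obtain f' where f': "\<And>x. (f has_derivative f' x) (at x)" "\<And>v. Ck_on k UNIV (\<lambda>x. f' x v)" by auto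
  have "f' = (\<lambda>z. frechet_derivative f (at z))" using frechet_derivative_at[OF f'(1)] by auto
  then show "Ck_on k UNIV (\<lambda>z. frechet_derivative f (at z) v)" using f'(2)[of v] by simp
qed

lemma symmetric_second_derivative:
  fixes f :: "'v::euclidean_space \<Rightarrow> complex"
  assumes f: "smooth_on UNIV f"
  shows "frechet_derivative (\<lambda>z. frechet_derivative f (at z) v) (at z) w =
     frechet_derivative (\<lambda>z. frechet_derivative f (at z) w) (at z) v"
proof -
  note D = bounded_linear.has_derivative[OF _ smooth_on_has_derivative]
  have main: "l (frechet_derivative (\<lambda>z. frechet_derivative f (at z) v) (at z) w) =
     l (frechet_derivative (\<lambda>z. frechet_derivative f (at z) w) (at z) v)" if l: "bounded_linear l" for l :: "complex \<Rightarrow> real"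
    by (rule symmetric_second_derivative_real[where f = "\<lambda>z. l (f z)", OF D[OF l f]
        D[OF l smooth_on_frechet_derivative[OF f]] D[OF l smooth_on_frechet_derivative[OF f]]
        bounded_linear.continuous_on[OF l smooth_on_continuous_on[OF smooth_on_frechet_derivative[OF smooth_on_frechet_derivative[OF f]]]]
        bounded_linear.continuous_on[OF l smooth_on_continuous_on[OF smooth_on_frechet_derivative[OF smooth_on_frechet_derivative[OF f]]]]])
  show ?thesis by (rule complex_eqI) (rule main[OF bounded_linear_Re] main[OF bounded_linear_Im])+
qed

lemma smooth_on_dbar_fun: assumes "smooth_on UNIV f" shows "smooth_on UNIV (\<lambda>z. dbar_fun f z v)"
proof -
  have l: "bounded_linear (\<lambda>x :: complex. a * x)" for a by (rule bounded_linear_mult_right)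
  have e: "dbar_fun f z v = (1 / 2) * frechet_derivative f (at z) v + (\<i> / 2) * frechet_derivative f (at z) (\<i> *s v)" for z
    by (simp add: dbar_fun_def add_divide_distrib)
  show ?thesis
    unfolding smooth_on_def e
    by (intro allI Ck_on_add Ck_on_bounded_linear[OF l] smooth_on_frechet_derivative[OF assms, unfolded smooth_on_def, rule_format])
qed

lemma frechet_derivative_dbar_fun:
  assumes f: "smooth_on UNIV f"
  shows "frechet_derivative (\<lambda>z. dbar_fun f z v) (at z) w =
     (frechet_derivative (\<lambda>z. frechet_derivative f (at z) v) (at z) w +
      \<i> * frechet_derivative (\<lambda>z. frechet_derivative f (at z) (\<i> *s v)) (at z) w) / 2"
proof -
  note D = smooth_on_has_derivative[OF smooth_on_frechet_derivative[OF f], of _ z]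
  have "((\<lambda>z. (1 / 2) * frechet_derivative f (at z) v + (\<i> / 2) * frechet_derivative f (at z) (\<i> *s v)) has_derivative
     (\<lambda>w. (1 / 2) * frechet_derivative (\<lambda>z. frechet_derivative f (at z) v) (at z) w +
      (\<i> / 2) * frechet_derivative (\<lambda>z. frechet_derivative f (at z) (\<i> *s v)) (at z) w)) (at z)"
    by (intro has_derivative_add has_derivative_mult_right D)
  from frechet_derivative_at[OF this]
  have "frechet_derivative (\<lambda>z. (1 / 2) * frechet_derivative f (at z) v + (\<i> / 2) * frechet_derivative f (at z) (\<i> *s v)) (at z) w =
    (1 / 2) * frechet_derivative (\<lambda>z. frechet_derivative f (at z) v) (at z) w +
      (\<i> / 2) * frechet_derivative (\<lambda>z. frechet_derivative f (at z) (\<i> *s v)) (at z) w" by (rule fun_cong[OF sym])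
  moreover have "(\<lambda>z. dbar_fun f z v) = (\<lambda>z. (1 / 2) * frechet_derivative f (at z) v + (\<i> / 2) * frechet_derivative f (at z) (\<i> *s v))"
    by (simp add: dbar_fun_def add_divide_distrib)
  ultimately show ?thesis by (simp add: add_divide_distrib)
qed

text \<open>Both sides expand into the same mixed second derivatives in the directions v or \<i> v
  and w or \<i> w, which are symmetric.\<close>

lemma dbar_fun_commute:
  assumes f: "smooth_on UNIV f"
  shows "dbar_fun (\<lambda>z. dbar_fun f z v) z w = dbar_fun (\<lambda>z. dbar_fun f z w) z v"
proof -
  define D where "D a b = frechet_derivative (\<lambda>z. frechet_derivative f (at z) a) (at z) b" for a b
  have s: "D a b = D b a" for a b unfolding D_def by (rule symmetric_second_derivative[OF f])
  have e: "frechet_derivative (\<lambda>z. dbar_fun f z a) (at z) b = (D a b + \<i> * D (\<i> *s a) b) / 2" for a b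
    unfolding D_def by (rule frechet_derivative_dbar_fun[OF f])
  show ?thesis
    unfolding dbar_fun_def[of "\<lambda>z. dbar_fun f z _"] e
    using s[of v w] s[of "\<i> *s v" w] s[of v "\<i> *s w"] s[of "\<i> *s v" "\<i> *s w"] by (simp add: field_simps)
qed

lemma dbar_fun_support:
  assumes "z \<notin> closure {z. f z \<noteq> 0}" shows "dbar_fun f z v = 0"
proof -
  have "(f has_derivative (\<lambda>v. 0)) (at z)"
  proof (rule has_derivative_transform_within_open[of "\<lambda>z. 0"])
    show "open (- closure {z. f z \<noteq> 0})" by (rule open_Compl[OF closed_closure])
    show "\<And>x. x \<in> - closure {z. f z \<noteq> 0} \<Longrightarrow> 0 = f x" using closure_subset[of "{z. f z \<noteq> 0}"] by auto
    show "z \<in> - closure {z. f z \<noteq> 0}" using assms unfolding Compl_iff .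
  qed simp
  from fun_cong[OF frechet_derivative_at[OF this]] have "frechet_derivative f (at z) u = 0" for u by (rule sym)
  then show ?thesis by (simp add: dbar_fun_def)
qed

lemma test_function_dbar_fun: assumes f: "test_function S f" shows "test_function S (\<lambda>z. dbar_fun f z v)"
proof -
  have "{z. dbar_fun f z v \<noteq> 0} \<subseteq> closure {z. f z \<noteq> 0}" using dbar_fun_support by blast
  then have c: "closure {z. dbar_fun f z v \<noteq> 0} \<subseteq> closure {z. f z \<noteq> 0}" by (rule closure_minimal) simp
  have k: "compact (closure {z. f z \<noteq> 0})" "closure {z. f z \<noteq> 0} \<subseteq> S" using f by (auto simp: test_function_def)
  have "compact (closure {z. dbar_fun f z v \<noteq> 0})"
    using compact_Int_closed[OF k(1) closed_closure, of "{z. dbar_fun f z v \<noteq> 0}"] c by (simp add: Int_absorb1)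
  then show ?thesis using f c k(2) smooth_on_dbar_fun by (auto simp: test_function_def)
qed

section \<open>The weak Dolbeault complex as operators given by functionals\<close>

definition omit :: "nat \<Rightarrow> (nat \<Rightarrow> 'b) \<Rightarrow> nat \<Rightarrow> 'b" where
  "omit i v = (\<lambda>j. if j < i then v j else v (Suc j))"

lemma omit_omit: "j < i \<Longrightarrow> omit j (omit i v) = omit (i - 1) (omit j v)"
  by (auto simp: omit_def fun_eq_iff)

text \<open>Terms with j < i cancel against those with i <= j under the bijection from (i, j) to (j,
  i - 1), which changes the parity of the index sum.\<close>

lemma alternating_sum_zero:
  fixes X :: "nat \<Rightarrow> nat \<Rightarrow> complex"
  assumes X: "\<And>i j. j < i \<Longrightarrow> i \<le> Suc k \<Longrightarrow> X i j = X j (i - 1)"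
  shows "(\<Sum>i\<le>Suc k. \<Sum>j\<le>k. (- 1) ^ (i + j) * X i j) = 0"
proof -
  let ?Y = "\<lambda>(i, j). (- 1) ^ (i + j) * X i j"
  let ?A = "{(i, j). i \<le> Suc k \<and> j < i}" and ?B = "{(i, j). i \<le> j \<and> j \<le> k}"
  have fin: "finite ?A" "finite ?B"
    by (rule finite_subset[of _ "{..Suc k} \<times> {..Suc k}"]; auto)+
  have "sum ?Y ?A = (\<Sum>x\<in>?B. - ?Y x)"
  proof (rule sum.reindex_bij_witness[where i = "\<lambda>(i, j). (Suc j, i)" and j = "\<lambda>(i, j). (j, i - 1)"])
    fix x assume "x \<in> ?A"
    then obtain i j where x: "x = (i, j)" "j < i" "i \<le> Suc k" by auto
    have "(- 1 :: complex) ^ (i + j) = - ((- 1) ^ (j + (i - 1)))" using x(2) by (cases i) (auto simp: add.commute)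
    then show "- ?Y (case x of (i, j) \<Rightarrow> (j, i - 1)) = ?Y x" using X[OF x(2,3)] x by simp
  qed auto
  then have "sum ?Y (?A \<union> ?B) = 0" using fin by (subst sum.union_disjoint) (auto simp: sum_negf)
  moreover have "?A \<union> ?B = {..Suc k} \<times> {..k}" by auto
  ultimately show ?thesis by (simp add: sum.cartesian_product)
qed

context hbundle begin

lemma test_function_bump: assumes "test_function (region c t) f" shows "bump c t f"
  unfolding bump_def
proof (intro conjI exI[of _ "closure {z. f z \<noteq> 0}"])
  show "\<forall>z. z \<notin> closure {z. f z \<noteq> 0} \<longrightarrow> f z = 0" using closure_subset[of "{z. f z \<noteq> 0}"] by auto
qed (use assms smooth_on_continuous_on in \<open>auto simp: test_function_def\<close>)

text \<open>Each test stands for one scalar component of the weak equation, so that the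
  vector-valued equation becomes a family of functionals as in \<open>weak_operator\<close>.\<close>

definition tests :: "(('a, 'm) chart \<times> ('a, 'r) triv \<times> (complex^'m \<Rightarrow> complex) \<times> (nat \<Rightarrow> complex^'m) \<times> 'r) set" where
  "tests = {(c, t, f, v, j). c \<in> atlas \<and> t \<in> trivs \<and> test_function (region c t) f}"

definition eval_form :: "('a, 'm) chart \<times> ('a, 'r) triv \<times> (complex^'m \<Rightarrow> complex) \<times> (nat \<Rightarrow> complex^'m) \<times> 'r \<Rightarrow>
    ('a, 'm, 'r) form \<Rightarrow> complex" where
  "eval_form = (\<lambda>(c, t, f, v, j). pairing c t f v j)"

definition eval_dbar :: "nat \<Rightarrow> ('a, 'm) chart \<times> ('a, 'r) triv \<times> (complex^'m \<Rightarrow> complex) \<times> (nat \<Rightarrow> complex^'m) \<times> 'r \<Rightarrow>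
    ('a, 'm, 'r) form \<Rightarrow> complex" where
  "eval_dbar k = (\<lambda>(c, t, f, v, j) \<omega>. - (\<Sum>i\<le>k. (- 1) ^ i * pairing c t (\<lambda>z. dbar_fun f z (v i)) (omit i v) j \<omega>))"

lemma dbar_max_weak_graph:
  assumes g: "metric_on atlas A g" and g': "metric_on atlas A g'"
  shows "dbar_max atlas trivs \<rho> A p q g g' = weak_graph (L g p q) (L g' p (q + 1)) (eval_dbar (p + q)) eval_form tests"
proof -
  have "weak_dbar atlas trivs A (p + q) \<omega> \<eta> \<longleftrightarrow> (\<forall>i\<in>tests. eval_dbar (p + q) i \<omega> = eval_form i \<eta>)"
    if \<omega>: "\<omega> \<in> carr (L g p q)" and \<eta>: "\<eta> \<in> carr (L g' p (q + 1))" for \<omega> \<eta>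
  proof -
    have "(\<integral>z. f z *s local_form atlas c t \<eta> z v \<partial>lborel) =
        - (\<Sum>i\<le>p + q. (-1) ^ i *s (\<integral>z. dbar_fun f z (v i) *s
                local_form atlas c t \<omega> z (\<lambda>j. if j < i then v j else v (Suc j)) \<partial>lborel)) \<longleftrightarrow>
        (\<forall>j. eval_dbar (p + q) (c, t, f, v, j) \<omega> = eval_form (c, t, f, v, j) \<eta>)"
      if c: "c \<in> atlas" and t: "t \<in> trivs" and f: "test_function (region c t) f" for c t f v
    proof -
      note 1 = pairing_component[OF g' c t test_function_bump[OF f] \<eta>]
      note 2 = pairing_component[OF g c t test_function_bump[OF test_function_dbar_fun[OF f]] \<omega>]
      show ?thesis
        unfolding vec_eq_iff by (simp add: 1 2 eval_form_def eval_dbar_def omit_def eq_commute[of "pairing c t f v _ \<eta>"])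
    qed
    then show ?thesis unfolding weak_dbar_def tests_def by fast
  qed
  then show ?thesis unfolding dbar_max_def weak_graph_def by blast
qed

lemma form_operator_dbar:
  assumes g: "metric_on atlas A g" and g': "metric_on atlas A g'"
  shows "form_operator (L g p q) (L g' p (q + 1)) (eval_dbar k) eval_form tests"
proof -
  interpret K: semi_hilbert cscale "L g p q" by (rule semi_hilbert_L2[OF g])
  interpret H: semi_hilbert cscale "L g' p (q + 1)" by (rule semi_hilbert_L2[OF g'])
  show ?thesis
  proof (unfold_locales, goal_cases)
    case (1 i)
    then obtain c t f v j where i: "i = (c, t, f, v, j)" "c \<in> atlas" "t \<in> trivs" "test_function (region c t) f"
      by (auto simp: tests_def)
    have "K.bfun (\<lambda>\<omega>. - 1 * (\<Sum>i\<le>k. (- 1) ^ i * pairing c t (\<lambda>z. dbar_fun f z (v i)) (omit i v) j \<omega>))"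
      by (intro K.bfun_cmult K.bfun_sum_fun bfun_pairing g i test_function_bump test_function_dbar_fun)
    then show ?case by (simp add: i eval_dbar_def)
  next
    case (2 i)
    then show ?case by (auto simp: tests_def eval_form_def intro!: bfun_pairing g' test_function_bump)
  qed
qed

text \<open>Testing the equation for \<eta> with the derivatives of f leaves second antilinear
  derivatives of f paired with \<omega>. These commute, so the alternating sum over the omitted
  vectors cancels.\<close>

lemma dbar_dbar:
  assumes g: "metric_on atlas A g" and g': "metric_on atlas A g'" and \<eta>: "(\<omega>, \<eta>) \<in> dbar_max atlas trivs \<rho> A p q g g'"
    and i: "i \<in> tests"
  shows "eval_dbar (p + q + 1) i \<eta> = 0"
proof -
  obtain c t f v j where ij: "i = (c, t, f, v, j)" and ct: "c \<in> atlas" "t \<in> trivs" and f: "test_function (region c t) f"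
    using i by (auto simp: tests_def)
  let ?k = "p + q"
  have fs: "smooth_on UNIV f" using f by (simp add: test_function_def)
  have d: "pairing c t (\<lambda>z. dbar_fun f z (v i)) (omit i v) j \<eta> =
     - (\<Sum>l\<le>?k. (- 1) ^ l * pairing c t (\<lambda>z. dbar_fun (\<lambda>z. dbar_fun f z (v i)) z (omit i v l)) (omit l (omit i v)) j \<omega>)" for i
  proof -
    have "(c, t, (\<lambda>z. dbar_fun f z (v i)), omit i v, j) \<in> tests"
      using ct test_function_dbar_fun[OF f] by (simp add: tests_def)
    then show ?thesis using \<eta> unfolding dbar_max_weak_graph[OF g g'] weak_graph_def
      by (auto simp: eval_form_def eval_dbar_def)
  qed
  define X where "X i l = pairing c t (\<lambda>z. dbar_fun (\<lambda>z. dbar_fun f z (v i)) z (omit i v l)) (omit l (omit i v)) j \<omega>" for i l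
  have "eval_dbar (p + q + 1) i \<eta> = (\<Sum>i\<le>Suc ?k. \<Sum>l\<le>?k. (- 1) ^ (i + l) * X i l)"
    unfolding ij eval_dbar_def by (simp add: d sum_negf sum_distrib_left power_add mult.assoc X_def)
  also have "\<dots> = 0"
  proof (rule alternating_sum_zero)
    fix i l assume l: "l < i" "i \<le> Suc ?k"
    have "omit i v l = v l" "omit l v (i - 1) = v i" using l by (auto simp: omit_def)
    then show "X i l = X l (i - 1)"
      unfolding X_def using omit_omit[OF l(1), of v] dbar_fun_commute[OF fs, of "v i" _ "v l"] by simp
  qed
  finally show ?thesis .
qed

text \<open>The kernel in the next degree is closed and contains the range by
  \<open>dbar_dbar\<close>; the cohomology assumption is exactly the codimension hypothesis of
  \<open>closed_Range_finite_codim\<close>.\<close>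

theorem closed_Range_dbar:
  assumes g: "metric_on atlas A g" and fin: "finite_dim_cohomology atlas trivs \<rho> A p q g"
  shows "semi_hilbert.closedH (L g p (q + 1)) (Range (dbar_max atlas trivs \<rho> A p q g g))"
proof -
  interpret W: form_operator "L g p q" "L g p (q + 1)" "eval_dbar (p + q)" eval_form tests
    by (rule form_operator_dbar[OF g g])
  interpret V: form_operator "L g p (q + 1)" "L g p (q + 1 + 1)" "eval_dbar (p + q + 1)" eval_form tests
    by (rule form_operator_dbar[OF g g])
  have T: "dbar_max atlas trivs \<rho> A p q g g = W.T" by (rule dbar_max_weak_graph[OF g g])
  have "dbar_max atlas trivs \<rho> A p (q + 1) g g = V.T"
    using dbar_max_weak_graph[OF g g, of p "q + 1"] by (simp add: add.assoc)
  then have k: "op_kernel (L g p (q + 2)) (dbar_max atlas trivs \<rho> A p (q + 1) g g) = V.ker"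
    using V.ker_iff by (auto simp: op_kernel_def)
  have R: "Range W.T \<subseteq> V.ker"
    unfolding T[symmetric] V.ker_def using dbar_dbar[OF g g] W.T_carr unfolding T[symmetric] by auto
  obtain B where "finite B" "B \<subseteq> V.ker" "\<And>u. u \<in> V.ker \<Longrightarrow> \<exists>a. u - (\<Sum>b\<in>B. cscale (a b) b) \<in> Range W.T"
    using fin unfolding finite_dim_cohomology_def finite_dim_quotient_def k T by blast
  from W.closed_Range_finite_codim[OF V.csub_ker V.closed_ker R this] show ?thesis unfolding T .
qed

end

section \<open>Comparison of metrics\<close>

lemma bilinear_diagonal_expand:
  fixes b :: "complex^'m::finite \<Rightarrow> complex^'m \<Rightarrow> real"
  assumes "bilinear b"
  shows "b v v = (\<Sum>i\<in>UNIV. \<Sum>j\<in>UNIV. inner v (real_basis i) * inner v (real_basis j) * b (real_basis i) (real_basis j))"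
proof -
  have "b v v = b (\<Sum>i\<in>UNIV. inner v (real_basis i) *\<^sub>R real_basis i) (\<Sum>j\<in>UNIV. inner v (real_basis j) *\<^sub>R real_basis j)"
    using real_basis_expansion[of v] by simp
  also have "\<dots> = (\<Sum>i\<in>UNIV. \<Sum>j\<in>UNIV. inner v (real_basis i) * inner v (real_basis j) * b (real_basis i) (real_basis j))"
    unfolding bilinear_sum[OF assms] sum.cartesian_product[symmetric] bilinear_lmul[OF assms] bilinear_rmul[OF assms]
    by (simp add: mult.left_commute mult.assoc)
  finally show ?thesis .
qed

lemma norm_real_basis: "norm (real_basis a :: complex^'m::finite) = 1"
  using inner_rb[of a a] by (simp add: norm_eq_sqrt_inner)

lemma bilinear_diagonal_bound:
  fixes b :: "complex^'m::finite \<Rightarrow> complex^'m \<Rightarrow> real"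
  assumes b: "bilinear b" and M: "\<And>i j. \<bar>b (real_basis i) (real_basis j)\<bar> \<le> M"
  shows "\<bar>b v v\<bar> \<le> (real CARD('m + 'm))\<^sup>2 * M * (norm v)\<^sup>2"
proof -
  have "\<bar>b v v\<bar> \<le> (\<Sum>i\<in>(UNIV :: ('m + 'm) set). \<Sum>j\<in>(UNIV :: ('m + 'm) set). norm v * norm v * M)"
    unfolding bilinear_diagonal_expand[OF b, of v]
  proof (rule order_trans[OF sum_abs sum_mono[OF order_trans[OF sum_abs sum_mono]]])
    fix i j :: "'m + 'm"
    have "\<bar>inner v (real_basis k)\<bar> \<le> norm v" for k using Cauchy_Schwarz_ineq2[of v "real_basis k"] by (simp add: norm_real_basis)
    then show "\<bar>inner v (real_basis i) * inner v (real_basis j) * b (real_basis i) (real_basis j)\<bar> \<le> norm v * norm v * M"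
      unfolding abs_mult by (intro mult_mono M) auto
  qed
  then show ?thesis by (simp add: power2_eq_square mult_ac)
qed

lemma metric_on_hermitian: "hermitian_metric atlas g \<Longrightarrow> metric_on atlas B g"
  by (auto simp: hermitian_metric_def riemannian_metric_def metric_on_def hform_def J_inv_def J_invariant_def)

lemma metric_on_pseudometric: "hermitian_pseudometric atlas A h \<Longrightarrow> metric_on atlas A h"
  by (auto simp: hermitian_pseudometric_def metric_on_def hform_def J_inv_def J_invariant_def)

context cmanifold begin

lemma local_metric_bilinear:
  assumes g: "metric_on atlas B g" and c: "c \<in> atlas" and z: "z \<in> snd c ` fst c"
  shows "bilinear (local_metric atlas c g z)"
  using hform_pullback[OF c cinv_in[OF c z] metric_on_hform[OF g]] by (simp add: snd_cinv[OF c z] hform_bilinear)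

lemma local_metric_upper:
  assumes g: "metric_on atlas B g" and c: "c \<in> atlas" and S: "compact S" "S \<subseteq> snd c ` fst c"
  shows "\<exists>K>0. \<forall>z\<in>S. \<forall>v. local_metric atlas c g z v v \<le> K * (norm v)\<^sup>2"
proof -
  have "bounded ((\<lambda>z. \<Sum>i\<in>UNIV. \<Sum>j\<in>UNIV. \<bar>local_metric atlas c g z (real_basis i) (real_basis j)\<bar>) ` S)"
    by (intro compact_imp_bounded compact_continuous_image S continuous_intros continuous_local_metric[OF metric_on_smooth[OF g] c])
  then obtain M0 where M0: "\<And>z. z \<in> S \<Longrightarrow> \<bar>\<Sum>i\<in>UNIV. \<Sum>j\<in>UNIV. \<bar>local_metric atlas c g z (real_basis i) (real_basis j)\<bar>\<bar> \<le> M0"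
    unfolding bounded_iff by auto
  have M: "\<bar>local_metric atlas c g z (real_basis i) (real_basis j)\<bar> \<le> \<bar>M0\<bar>" if z: "z \<in> S" for z i j
  proof -
    have "\<bar>local_metric atlas c g z (real_basis i) (real_basis j)\<bar> \<le> (\<Sum>j\<in>UNIV. \<bar>local_metric atlas c g z (real_basis i) (real_basis j)\<bar>)"
      by (rule member_le_sum) auto
    also have "\<dots> \<le> (\<Sum>i\<in>UNIV. \<Sum>j\<in>UNIV. \<bar>local_metric atlas c g z (real_basis i) (real_basis j)\<bar>)"
      by (rule member_le_sum[where f = "\<lambda>i. \<Sum>j\<in>UNIV. \<bar>local_metric atlas c g z (real_basis i) (real_basis j)\<bar>"]) (auto intro: sum_nonneg)
    also have "\<dots> \<le> \<bar>M0\<bar>" using M0[OF z] by linarith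
    finally show ?thesis .
  qed
  let ?K = "(real CARD('m + 'm))\<^sup>2 * \<bar>M0\<bar> + 1"
  have "local_metric atlas c g z v v \<le> ?K * (norm v)\<^sup>2" if z: "z \<in> S" for z v
  proof -
    have "\<bar>local_metric atlas c g z v v\<bar> \<le> (real CARD('m + 'm))\<^sup>2 * \<bar>M0\<bar> * (norm v)\<^sup>2"
      using z S by (intro bilinear_diagonal_bound local_metric_bilinear[OF g c] M) auto
    then show ?thesis using zero_le_power2[of "norm v"] by (simp only: distrib_right mult_1)
  qed
  then show ?thesis by (intro exI[of _ ?K]) (auto intro: add_nonneg_pos)
qed

text \<open>The constant is the minimum over S times the unit sphere, positive because S lies over
  B, where g is definite.\<close>

lemma local_metric_lower:
  assumes g: "metric_on atlas B g" and c: "c \<in> atlas" and S: "compact S" "S \<subseteq> snd c ` (fst c \<inter> B)"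
  shows "\<exists>\<kappa>>0. \<forall>z\<in>S. \<forall>v. \<kappa> * (norm v)\<^sup>2 \<le> local_metric atlas c g z v v"
proof (cases "S = {}")
  case False
  have S': "S \<subseteq> snd c ` fst c" using S by auto
  have b: "bilinear (local_metric atlas c g z)" if "z \<in> S" for z using S' that by (intro local_metric_bilinear[OF g c]) auto
  let ?P = "S \<times> (sphere 0 1 :: (complex^'m) set)"
  let ?F = "\<lambda>p. \<Sum>i\<in>UNIV. \<Sum>j\<in>UNIV. inner (snd p) (real_basis i) * inner (snd p) (real_basis j) * local_metric atlas c g (fst p) (real_basis i) (real_basis j)"
  have "continuous_on ?P ?F"
    by (intro continuous_intros continuous_on_compose2[OF continuous_local_metric[OF metric_on_smooth[OF g] c S']]) auto
  moreover have "?F p = local_metric atlas c g (fst p) (snd p) (snd p)" if "p \<in> ?P" for p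
    using that by (subst bilinear_diagonal_expand[OF b]) auto
  ultimately have "continuous_on ?P (\<lambda>p. local_metric atlas c g (fst p) (snd p) (snd p))"
    by (rule continuous_on_eq)
  moreover have "compact ?P" "?P \<noteq> {}" using S False by (auto intro!: compact_Times)
  ultimately have "\<exists>p0\<in>?P. \<forall>p\<in>?P. local_metric atlas c g (fst p0) (snd p0) (snd p0) \<le> local_metric atlas c g (fst p) (snd p) (snd p)"
    by (intro continuous_attains_inf)
  then obtain z0 v0 where p0: "z0 \<in> S" "norm v0 = 1"
    and min: "\<And>z v. z \<in> S \<Longrightarrow> norm v = 1 \<Longrightarrow> local_metric atlas c g z0 v0 v0 \<le> local_metric atlas c g z v v"
    by auto
  obtain x where x: "x \<in> fst c" "x \<in> B" "z0 = snd c x" using S p0(1) by blast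
  have pos: "local_metric atlas c g z0 v0 v0 > 0"
    using pos_def_pullback[where g = g, OF c x(1) metric_on_pos_def[OF g x(2)]] p0(2) unfolding x(3) pos_def_def by (metis norm_zero zero_neq_one)
  have "local_metric atlas c g z0 v0 v0 * (norm v)\<^sup>2 \<le> local_metric atlas c g z v v" if z: "z \<in> S" for z v
  proof (cases "v = 0")
    case True then show ?thesis by (simp add: bilinear_lzero[OF b[OF z]])
  next
    case False
    have "local_metric atlas c g z0 v0 v0 \<le> local_metric atlas c g z ((1 / norm v) *\<^sub>R v) ((1 / norm v) *\<^sub>R v)"
      using False by (intro min z) simp
    also have "\<dots> = (1 / norm v)\<^sup>2 * local_metric atlas c g z v v"
      by (simp only: bilinear_lmul[OF b[OF z]] bilinear_rmul[OF b[OF z]]) (simp add: power2_eq_square)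
    finally show ?thesis using False by (simp add: field_simps)
  qed
  then show ?thesis using pos by blast
qed (auto intro: exI[of _ 1])

lemma metric_le_of_local:
  assumes c: "c \<in> atlas" and x: "x \<in> fst c" and le: "\<And>v. a * local_metric atlas c g (snd c x) v v \<le> b * local_metric atlas c g' (snd c x) v v"
  shows "a * g x v v \<le> b * g' x v v"
proof -
  obtain u where "v = tangent atlas c x u" using tangent_surj[OF c x] by (metis surjD)
  then show ?thesis using le[of u] by (simp add: local_metric_def Let_def cinv_snd[OF c x])
qed

lemma local_comparison:
  assumes g: "metric_on atlas B g" and g': "metric_on atlas B' g'" and c: "c \<in> atlas"
    and S: "compact S" "S \<subseteq> snd c ` (fst c \<inter> B)"
  shows "\<exists>k>0. \<forall>x\<in>fst c. snd c x \<in> S \<longrightarrow> (\<forall>v. k * g' x v v \<le> g x v v)"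
proof -
  obtain \<kappa> where \<kappa>: "\<kappa> > 0" "\<And>z v. z \<in> S \<Longrightarrow> \<kappa> * (norm v)\<^sup>2 \<le> local_metric atlas c g z v v"
    using local_metric_lower[OF g c S] by blast
  have "S \<subseteq> snd c ` fst c" using S by auto
  from local_metric_upper[OF g' c S(1) this]
  obtain K where K: "K > 0" "\<And>z v. z \<in> S \<Longrightarrow> local_metric atlas c g' z v v \<le> K * (norm v)\<^sup>2" by blast
  have "(\<kappa> / K) * g' x v v \<le> g x v v" if x: "x \<in> fst c" "snd c x \<in> S" for x v
  proof -
    have "(\<kappa> / K) * local_metric atlas c g' (snd c x) v v \<le> 1 * local_metric atlas c g (snd c x) v v" for v
    proof -
      have "(\<kappa> / K) * local_metric atlas c g' (snd c x) v v \<le> (\<kappa> / K) * (K * (norm v)\<^sup>2)"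
        using \<kappa>(1) K x by (intro mult_left_mono) auto
      then show ?thesis using K(1) \<kappa>(2)[OF x(2), of v] by simp
    qed
    from metric_le_of_local[OF c x(1) this] show ?thesis by simp
  qed
  then show ?thesis using \<kappa>(1) K(1) by (intro exI[of _ "\<kappa> / K"]) auto
qed

text \<open>Each point has a neighbourhood with its own constant by \<open>local_comparison\<close>;
  compactness of the manifold leaves finitely many, whose minimum works.\<close>

lemma global_comparison:
  assumes g: "metric_on atlas UNIV g" and g': "metric_on atlas B g'"
  shows "\<exists>k>0. \<forall>x v. k * g' x v v \<le> g x v v"
proof -
  have "\<exists>U k. open U \<and> x \<in> U \<and> k > 0 \<and> (\<forall>y\<in>U. \<forall>v. k * g' y v v \<le> g y v v)" for x
  proof -
    let ?c = "chart_at atlas x"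
    note c = chart_at(1)[of x] and x = chart_at(2)[of x]
    obtain r where r: "r > 0" "cball (snd ?c x) r \<subseteq> snd ?c ` fst ?c"
      using chart_image_open[OF c] x open_contains_cball by blast
    have "cball (snd ?c x) r \<subseteq> snd ?c ` (fst ?c \<inter> UNIV)" using r by simp
    from local_comparison[OF g g' c compact_cball this] obtain k where
      k: "k > 0" "\<And>y v. y \<in> fst ?c \<Longrightarrow> snd ?c y \<in> cball (snd ?c x) r \<Longrightarrow> k * g' y v v \<le> g y v v" by blast
    let ?U = "fst ?c \<inter> snd ?c -` ball (snd ?c x) r"
    have "open ?U" by (rule continuous_open_preimage[OF continuous_chart[OF c order_refl] chart_open[OF c] open_ball])
    then show ?thesis using x r k by (intro exI[of _ ?U] exI[of _ k]) auto
  qed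
  then obtain U k where U: "\<And>x. open (U x)" "\<And>x. x \<in> U x" "\<And>x. k x > 0" "\<And>x y v. y \<in> U x \<Longrightarrow> k x * g' y v v \<le> g y v v"
    by metis
  have "UNIV \<subseteq> (\<Union>x\<in>UNIV. U x)" using U(2) by blast
  then obtain F where F: "finite F" "UNIV \<subseteq> (\<Union>x\<in>F. U x)"
    by (rule compactE_image[OF compact U(1)])
  have nF: "F \<noteq> {}" using F(2) by auto
  let ?k = "Min (k ` F)"
  have kp: "?k > 0" using F(1) nF U(3) by simp
  have "?k * g' y v v \<le> g y v v" for y v
  proof -
    obtain x where x: "x \<in> F" "y \<in> U x" using F(2) by blast
    have gp: "g y v v \<ge> 0"
      using metric_on_pos_def[OF g, of y] bilinear_lzero[OF hform_bilinear[OF metric_on_hform[OF g]], of y]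
      by (cases "v = 0") (auto simp: pos_def_def order_less_imp_le)
    \<comment> \<open>Away from B nothing is known about the sign of g', so lowering the constant
      requires this case distinction.\<close>
    show ?thesis
    proof (cases "g' y v v \<ge> 0")
      case True
      have "?k \<le> k x" using x F(1) by simp
      then have "?k * g' y v v \<le> k x * g' y v v" using True by (rule mult_right_mono)
      then show ?thesis using U(4)[OF x(2), of v] by linarith
    next
      case False
      then have "?k * g' y v v \<le> 0" using kp by (simp add: mult_le_0_iff)
      then show ?thesis using gp by linarith
    qed
  qed
  then show ?thesis using kp by blast
qed

text \<open>The components of the family are uniformly continuous on S times [0, 1], so those of g s
  are uniformly close to those of h for small s. Definiteness of h over S turns this additive
  closeness into a multiplicative one.\<close>

lemma family_comparison:
  assumes g: "metric_family atlas h g" and h: "metric_on atlas B h" and c: "c \<in> atlas"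
    and S: "compact S" "S \<subseteq> snd c ` (fst c \<inter> B)" and \<epsilon>: "\<epsilon> > 0"
  shows "\<exists>\<delta>>0. \<forall>s\<in>{0<..1}. s < \<delta> \<longrightarrow> (\<forall>x\<in>fst c. snd c x \<in> S \<longrightarrow>
     (\<forall>v. (1 - \<epsilon>) * h x v v \<le> g s x v v \<and> g s x v v \<le> (1 + \<epsilon>) * h x v v))"
proof -
  have S': "S \<subseteq> snd c ` fst c" using S by auto
  have g0: "g 0 = h" and gs: "\<And>s. s \<in> {0<..1} \<Longrightarrow> metric_on atlas UNIV (g s)"
    using g by (auto simp: metric_family_def intro!: metric_on_hermitian)
  obtain \<kappa> where \<kappa>: "\<kappa> > 0" "\<And>z v. z \<in> S \<Longrightarrow> \<kappa> * (norm v)\<^sup>2 \<le> local_metric atlas c h z v v"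
    using local_metric_lower[OF h c S] by blast
  define N where "N = (real CARD('m + 'm))\<^sup>2"
  have N: "N > 0" by (simp add: N_def)
  \<comment> \<open>N is the number of entries of a real form. Entries differing by at most \<mu>
    change the form by at most N \<mu> |u|^2 = \<epsilon> \<kappa> |u|^2, which is at most
    \<epsilon> times the value of h.\<close>
  define \<mu> where "\<mu> = \<epsilon> * \<kappa> / N"
  have \<mu>: "\<mu> > 0" using \<epsilon> \<kappa>(1) N by (simp add: \<mu>_def)
  let ?F = "\<lambda>i j (z, s). local_metric atlas c (g s) z (real_basis i) (real_basis j)"
  have "\<exists>\<delta>>0. \<forall>s\<in>{0..1}. s < \<delta> \<longrightarrow> (\<forall>z\<in>S. \<bar>?F i j (z, s) - ?F i j (z, 0)\<bar> < \<mu>)" for i j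
  proof -
    have "smooth_on ((snd c ` fst c) \<times> {0..1}) (?F i j)" using g c by (auto simp: metric_family_def)
    then have "continuous_on (S \<times> {0..1}) (?F i j)"
      using S' by (intro continuous_on_subset[OF smooth_on_continuous_on]) auto
    then have "uniformly_continuous_on (S \<times> {0..1::real}) (?F i j)"
      using S(1) by (intro compact_uniformly_continuous compact_Times) auto
    then obtain \<delta> where \<delta>: "\<delta> > 0"
      "\<And>p p'. p \<in> S \<times> {0..1} \<Longrightarrow> p' \<in> S \<times> {0..1} \<Longrightarrow> dist p' p < \<delta> \<Longrightarrow> dist (?F i j p') (?F i j p) < \<mu>"
      using \<mu> unfolding uniformly_continuous_on_def by metis
    have "\<bar>?F i j (z, s) - ?F i j (z, 0)\<bar> < \<mu>" if "s \<in> {0..1}" "s < \<delta>" "z \<in> S" for s z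
      using \<delta>(2)[of "(z, 0)" "(z, s)"] that by (simp add: dist_Pair_Pair dist_real_def)
    then show ?thesis using \<delta>(1) by blast
  qed
  then obtain d where d: "\<And>i j. d i j > 0"
    "\<And>i j s z. s \<in> {0..1} \<Longrightarrow> s < d i j \<Longrightarrow> z \<in> S \<Longrightarrow> \<bar>?F i j (z, s) - ?F i j (z, 0)\<bar> < \<mu>" by metis
  define \<delta> where "\<delta> = Min (range (\<lambda>(i, j). d i j))"
  have \<delta>: "\<delta> > 0" unfolding \<delta>_def using d(1) by (subst Min_gr_iff) auto
  have \<delta>d: "\<delta> \<le> d i j" for i j unfolding \<delta>_def by (rule Min_le) (auto intro: image_eqI[of _ _ "(i, j)"])
  have "(1 - \<epsilon>) * h x v v \<le> g s x v v \<and> g s x v v \<le> (1 + \<epsilon>) * h x v v"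
    if s: "s \<in> {0<..1}" "s < \<delta>" and x: "x \<in> fst c" "snd c x \<in> S" for s x v
  proof -
    let ?z = "snd c x"
    have zc: "?z \<in> snd c ` fst c" using x by auto
    note bs = local_metric_bilinear[OF gs[OF s(1)] c zc] and bh = local_metric_bilinear[OF h c zc]
    let ?b = "\<lambda>v w. local_metric atlas c (g s) ?z v w - local_metric atlas c h ?z v w"
    have b: "bilinear ?b"
      using bs bh unfolding bilinear_def by (auto intro: linear_compose_sub)
    have close: "\<bar>local_metric atlas c (g s) ?z u u - local_metric atlas c h ?z u u\<bar> \<le> \<epsilon> * local_metric atlas c h ?z u u" for u
    proof -
      have "\<bar>?b (real_basis i) (real_basis j)\<bar> \<le> \<mu>" for i j
        using d(2)[of s i j ?z] s x(2) \<delta>d[of i j] by (simp add: g0)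
      then have "\<bar>?b u u\<bar> \<le> N * \<mu> * (norm u)\<^sup>2" unfolding N_def by (rule bilinear_diagonal_bound[OF b])
      also have "\<dots> = \<epsilon> * (\<kappa> * (norm u)\<^sup>2)" using N by (simp add: \<mu>_def)
      also have "\<dots> \<le> \<epsilon> * local_metric atlas c h ?z u u" using \<epsilon> \<kappa>(2)[OF x(2)] by (intro mult_left_mono) auto
      finally show ?thesis .
    qed
    have "(1 - \<epsilon>) * local_metric atlas c h ?z u u \<le> 1 * local_metric atlas c (g s) ?z u u"
      and "1 * local_metric atlas c (g s) ?z u u \<le> (1 + \<epsilon>) * local_metric atlas c h ?z u u" for u
      using close[of u] by (simp_all add: algebra_simps abs_le_iff)
    from metric_le_of_local[OF c x(1) this(1)] metric_le_of_local[OF c x(1) this(2)] show ?thesis by simp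
  qed
  then show ?thesis using \<delta> by blast
qed

end

section \<open>Truncation to the support of a test function\<close>

context hbundle begin

lemma pairing_cut:
  assumes c: "c \<in> atlas" and \<phi>: "\<And>z. z \<notin> S \<Longrightarrow> \<phi> z = 0"
  shows "pairing c t \<phi> v j (cut (cinv c ` S) \<omega>) = pairing c t \<phi> v j \<omega>"
proof -
  have "\<phi> z * local_form atlas c t (cut (cinv c ` S) \<omega>) z v $ j = \<phi> z * local_form atlas c t \<omega> z v $ j" for z
    by (cases "z \<in> S") (auto simp: local_form_def Let_def cut_def \<phi>)
  then show ?thesis by (simp only: pairing_def)
qed

text \<open>Note the direction: a larger metric has a larger space of (m, q)-forms. Applied to h and
  g s, and to g s and g 1, it yields the chain of inclusions.\<close>

lemma carr_compare:
  assumes g: "metric_on atlas A g" and g': "metric_on atlas A g'" and c: "c > 0"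
    and le: "\<And>x v. x \<in> A \<Longrightarrow> c * g' x v v \<le> g x v v" and \<omega>: "\<omega> \<in> carr (L g' CARD('m) q)"
  shows "\<omega> \<in> carr (L g CARD('m) q)" "(hnorm (L g CARD('m) q) \<omega>)\<^sup>2 \<le> (1 / c) ^ q * (hnorm (L g' CARD('m) q) \<omega>)\<^sup>2"
proof -
  have pq: "pq_form CARD('m) q \<omega>" and f: "sq_norm g' (CARD('m) + q) \<omega> < \<infinity>" using \<omega> unfolding carr_iff[OF g'] by auto
  have s: "sq_norm g (CARD('m) + q) \<omega> \<le> ennreal ((1 / c) ^ q) * sq_norm g' (CARD('m) + q) \<omega>"
    by (rule sq_norm_compare[OF g g' pq c le])
  also have "\<dots> < \<infinity>" using f by (simp add: ennreal_mult_less_top)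
  finally show k: "\<omega> \<in> carr (L g CARD('m) q)" unfolding carr_iff[OF g] using pq by simp
  show "(hnorm (L g CARD('m) q) \<omega>)\<^sup>2 \<le> (1 / c) ^ q * (hnorm (L g' CARD('m) q) \<omega>)\<^sup>2"
    using c by (intro hnorm_sq_le[OF g g' k \<omega> _ s]) simp
qed

text \<open>The metrics are compared on P only, since truncated forms vanish elsewhere; no relation
  between the untruncated spaces is implied.\<close>

lemma cut_compare:
  assumes g: "metric_on atlas A g" and g': "metric_on atlas A g'" and c: "c > 0" and P: "P \<in> sets borel"
    and le: "\<And>x v. x \<in> P \<Longrightarrow> c * g' x v v \<le> g x v v" and \<omega>: "\<omega> \<in> carr (L g' CARD('m) q)"
  shows "cut P \<omega> \<in> carr (L g CARD('m) q)" "(hnorm (L g CARD('m) q) (cut P \<omega>))\<^sup>2 \<le> (1 / c) ^ q * (hnorm (L g' CARD('m) q) \<omega>)\<^sup>2"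
proof -
  have pq: "pq_form CARD('m) q \<omega>" and f: "sq_norm g' (CARD('m) + q) \<omega> < \<infinity>" using \<omega> unfolding carr_iff[OF g'] by auto
  note pqc = pq_form_cut[OF P pq]
  have "sq_norm g (CARD('m) + q) (cut P \<omega>) \<le> ennreal ((1 / c) ^ q) * sq_norm g' (CARD('m) + q) (cut P \<omega>)"
    by (rule sq_norm_compare[OF g g' pqc c le]) (auto simp: cut_def split: if_splits)
  also have "\<dots> \<le> ennreal ((1 / c) ^ q) * sq_norm g' (CARD('m) + q) \<omega>" by (intro mult_left_mono sq_norm_cut_le) simp
  finally have s: "sq_norm g (CARD('m) + q) (cut P \<omega>) \<le> ennreal ((1 / c) ^ q) * sq_norm g' (CARD('m) + q) \<omega>" .
  also have "\<dots> < \<infinity>" using f by (simp add: ennreal_mult_less_top)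
  finally show k: "cut P \<omega> \<in> carr (L g CARD('m) q)" unfolding carr_iff[OF g] using pqc by simp
  show "(hnorm (L g CARD('m) q) (cut P \<omega>))\<^sup>2 \<le> (1 / c) ^ q * (hnorm (L g' CARD('m) q) \<omega>)\<^sup>2"
    using c by (intro hnorm_sq_le[OF g g' k \<omega> _ s]) simp
qed

lemma eval_dbar_cut:
  assumes i: "(c, t, f, v, j) \<in> tests"
  shows "eval_dbar k (c, t, f, v, j) (cut (cinv c ` closure {z. f z \<noteq> 0}) \<omega>) = eval_dbar k (c, t, f, v, j) \<omega>"
  using i unfolding eval_dbar_def by (simp add: tests_def pairing_cut[OF _ dbar_fun_support])

text \<open>For a fixed n, \<open>local_comparison\<close> provides some constant, which only serves
  to place truncated forms in the space for h. Constants near 1 come from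
  \<open>family_comparison\<close> and are available for large n only.\<close>

lemma cutoff_ex:
  assumes h: "metric_on atlas A h" and fam: "metric_family atlas h g"
    and s: "\<And>n. s n \<in> {0<..1}" "s \<longlonglongrightarrow> 0" and i: "i \<in> tests"
  shows "\<exists>\<kappa>. (\<forall>n. \<forall>u\<in>carr (L (g (s n)) CARD('m) q). \<kappa> u \<in> carr (L h CARD('m) q) \<and> eval_dbar k i (\<kappa> u) = eval_dbar k i u) \<and>
      (\<forall>u\<in>carr (L h CARD('m) q). hnorm (L h CARD('m) q) (\<kappa> u) \<le> hnorm (L h CARD('m) q) u) \<and>
      (\<forall>b>1. \<forall>\<^sub>F n in sequentially.
         (\<forall>u\<in>carr (L (g (s n)) CARD('m) q). (hnorm (L h CARD('m) q) (\<kappa> u))\<^sup>2 \<le> b * (hnorm (L (g (s n)) CARD('m) q) u)\<^sup>2) \<and>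
         (\<forall>u\<in>carr (L h CARD('m) q). (hnorm (L (g (s n)) CARD('m) q) (\<kappa> u))\<^sup>2 \<le> b * (hnorm (L h CARD('m) q) u)\<^sup>2))"
proof -
  obtain c t f v j where ij: "i = (c, t, f, v, j)" and ct: "c \<in> atlas" "t \<in> trivs" and f: "test_function (region c t) f"
    using i by (auto simp: tests_def)
  have gs: "metric_on atlas A (g (s n))" for n
    using fam s(1)[of n] by (auto simp: metric_family_def intro!: metric_on_hermitian)
  define S where "S = closure {z. f z \<noteq> 0}"
  define P where "P = cinv c ` S"
  have S: "compact S" "S \<subseteq> snd c ` (fst c \<inter> A)" using f by (auto simp: test_function_def S_def)
  have "compact P" unfolding P_def using S by (intro compact_continuous_image continuous_cinv[OF ct(1)]) auto
  then have P: "P \<in> sets borel" by (rule borel_compact)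
  have PS: "x \<in> fst c" "snd c x \<in> S" if x: "x \<in> P" for x
  proof -
    obtain z where z: "x = cinv c z" "z \<in> S" using x by (auto simp: P_def)
    then have "z \<in> snd c ` fst c" using S(2) by auto
    then show "x \<in> fst c" "snd c x \<in> S" using z cinv_in[OF ct(1)] snd_cinv[OF ct(1)] by auto
  qed
  show ?thesis
  proof (intro exI[of _ "cut P"] conjI allI ballI impI)
    fix n u assume u: "u \<in> carr (L (g (s n)) CARD('m) q)"
    obtain k' where k: "k' > 0" "\<And>x v. x \<in> fst c \<Longrightarrow> snd c x \<in> S \<Longrightarrow> k' * g (s n) x v v \<le> h x v v"
      using local_comparison[OF h gs[of n] ct(1) S] by (elim exE conjE) blast
    show "cut P u \<in> carr (L h CARD('m) q)"
      by (rule cut_compare(1)[OF h gs k(1) P _ u]) (use k(2) PS in blast)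
    show "eval_dbar k i (cut P u) = eval_dbar k i u"
      unfolding P_def S_def ij by (rule eval_dbar_cut) (use i ij in simp)
  next
    fix u assume u: "u \<in> carr (L h CARD('m) q)"
    interpret H: semi_inner cscale "L h CARD('m) q" by (rule semi_inner_L2[OF h])
    have "(H.nrm (cut P u))\<^sup>2 \<le> (1 / 1) ^ q * (H.nrm u)\<^sup>2"
      by (rule cut_compare(2)[OF h h _ P _ u]) auto
    then show "H.nrm (cut P u) \<le> H.nrm u" by (intro power2_le_imp_le[OF _ H.nrm_nonneg[OF u]]) (simp only: power_one div_by_1 mult_1)
  next
    fix b :: real assume b: "b > 1"
    \<comment> \<open>Squared norms change by the q-th power of the constant between the metrics, so
      some d > 1 with d^q <= b is needed; the root of order q + 1 also serves q = 0.\<close>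
    define d where "d = root (Suc q) b"
    have d: "d > 1" using b by (simp add: d_def)
    have "d ^ q \<le> d ^ Suc q" using d by (intro power_increasing) auto
    also have "\<dots> = b" unfolding d_def using b by (intro real_root_pow_pos2) auto
    finally have db: "d ^ q \<le> b" .
    have e: "1 - 1 / d > 0" using d by simp
    obtain \<delta> where \<delta>: "\<delta> > 0" "\<And>s x v. s \<in> {0<..1} \<Longrightarrow> s < \<delta> \<Longrightarrow> x \<in> fst c \<Longrightarrow> snd c x \<in> S \<Longrightarrow>
       (1 - (1 - 1 / d)) * h x v v \<le> g s x v v \<and> g s x v v \<le> (1 + (1 - 1 / d)) * h x v v"
      using family_comparison[OF fam h ct(1) S e] by blast
    \<comment> \<open>With \<epsilon> = 1 - 1 / d the lower factor is exactly 1 / d, and the upper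
      factor 2 - 1 / d is at most d.\<close>
    have dd: "1 + (1 - 1 / d) \<le> d"
    proof -
      have "0 \<le> (d - 1)\<^sup>2 / d" using d by simp
      then show ?thesis using d by (simp add: field_simps power2_eq_square)
    qed
    have "\<forall>\<^sub>F n in sequentially. s n < \<delta>" using order_tendstoD(2)[OF s(2) \<delta>(1)] .
    then show "\<forall>\<^sub>F n in sequentially.
         (\<forall>u\<in>carr (L (g (s n)) CARD('m) q). (hnorm (L h CARD('m) q) (cut P u))\<^sup>2 \<le> b * (hnorm (L (g (s n)) CARD('m) q) u)\<^sup>2) \<and>
         (\<forall>u\<in>carr (L h CARD('m) q). (hnorm (L (g (s n)) CARD('m) q) (cut P u))\<^sup>2 \<le> b * (hnorm (L h CARD('m) q) u)\<^sup>2)"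
    proof eventually_elim
      case (elim n)
      have 1: "(1 / d) * g (s n) x v v \<le> h x v v" if x: "x \<in> P" for x v
      proof -
        have lo: "(1 / d) * h x v v \<le> g (s n) x v v" and hi: "g (s n) x v v \<le> (1 + (1 - 1 / d)) * h x v v"
          using \<delta>(2)[OF s(1) elim PS[OF x], of v] by auto
        \<comment> \<open>Raising the upper factor to d requires h to be nonnegative at x, which
          follows from the two bounds together because 2 - 1 / d exceeds 1 / d.\<close>
        have "0 \<le> (1 + (1 - 1 / d) - 1 / d) * h x v v" using lo hi by (simp add: algebra_simps)
        moreover have "1 + (1 - 1 / d) - 1 / d > 0" using d by (simp add: field_simps)
        ultimately have "h x v v \<ge> 0" by (simp add: zero_le_mult_iff)
        then have "g (s n) x v v \<le> d * h x v v" using hi mult_right_mono[OF dd] by (meson order_trans)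
        then show ?thesis using d by (simp add: field_simps)
      qed
      have 2: "(1 / d) * h x v v \<le> g (s n) x v v" if x: "x \<in> P" for x v
        using \<delta>(2)[OF s(1) elim PS[OF x], of v] by auto
      have d1: "1 / d > 0" using d by simp
      have up: "r * y\<^sup>2 \<le> b * y\<^sup>2" if "r = (1 / (1 / d)) ^ q" for r y using that db by (simp add: mult_right_mono)
      show ?case
        using cut_compare(2)[OF h gs d1 P 1] cut_compare(2)[OF gs h d1 P 2] up[OF refl] by (meson order_trans)
    qed
  qed
qed

end

theorem theorem2p2:
  fixes atlas :: "('a::t2_space, 'm::finite) chart set"
    and trivs :: "('a, 'r::finite) triv set"
    and \<rho> :: "('a, 'r) fibre_metric"
    and A :: "'a set"
    and h :: "('a, 'm) metric"
    and g :: "real \<Rightarrow> ('a, 'm) metric"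
    and q :: nat
    and s :: "nat \<Rightarrow> real"
  assumes "compact (UNIV :: 'a set)"
    and "complex_manifold atlas"
    and "holomorphic_bundle atlas trivs"
    and "hermitian_fibre_metric atlas trivs \<rho>"
    and "hermitian_pseudometric atlas A h"
    and "\<exists>g'. riemannian_metric atlas g' \<and> parabolic atlas A g'"
    and "q \<le> CARD('m)"
    and "finite_dim_cohomology atlas trivs \<rho> A CARD('m) q h"
    and "metric_family atlas h g"
    and "\<forall>n. s n \<in> {0<..1}" and "s \<longlonglongrightarrow> 0"
    and "compact_op (L2 atlas trivs \<rho> A CARD('m) (q + 1) h) (L2 atlas trivs \<rho> A CARD('m) q h)
           (green_dbar atlas trivs \<rho> A CARD('m) q h h)"
    and "Range (dbar_max atlas trivs \<rho> A CARD('m) q h h) =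
         Range (dbar_max atlas trivs \<rho> A CARD('m) q (g 1) h)"
  shows "compactly_converges
           (L2 atlas trivs \<rho> A CARD('m) (q + 1) h)
           (L2 atlas trivs \<rho> A CARD('m) q h)
           (\<lambda>n. L2 atlas trivs \<rho> A CARD('m) q (g (s n)))
           (\<lambda>n. green_dbar atlas trivs \<rho> A CARD('m) q (g (s n)) h)
           (green_dbar atlas trivs \<rho> A CARD('m) q h h)"
proof -
  interpret hbundle atlas trivs \<rho> A
    by unfold_locales (use assms(1-5) in \<open>auto simp: hermitian_pseudometric_def\<close>)
  let ?p = "CARD('m)"
  note fam = assms(9) and s = assms(10)[rule_format] assms(11)
  have h: "metric_on atlas A h" by (rule metric_on_pseudometric[OF assms(5)])
  have gU: "metric_on atlas B (g \<sigma>)" if "\<sigma> \<in> {0<..1}" for \<sigma> B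
    using fam that by (auto simp: metric_family_def intro!: metric_on_hermitian)
  have gs: "metric_on atlas A (g (s n))" for n by (rule gU[OF s(1)])
  obtain a where a: "a > 0" "\<And>\<sigma> x v. \<sigma> \<in> {0..1} \<Longrightarrow> h x v v \<le> a * g \<sigma> x v v"
    using fam unfolding metric_family_def by metis
  have a': "(1 / a) * h x v v \<le> g (s n) x v v" for n x v
    using a(2)[of "s n" x v] s(1)[of n] a(1) by (simp add: field_simps)
  have a1: "1 / a > 0" using a(1) by simp
  note K_Kn = carr_compare[OF gs h a1 a']
  interpret W: form_operator "L h ?p q" "L h ?p (q + 1)" "eval_dbar (?p + q)" eval_form tests
    by (rule form_operator_dbar[OF h h])
  note T = dbar_max_weak_graph[OF h h, of ?p q]
  \<comment> \<open>By \<open>carr_compare\<close> with the constant 1 / a, squared norms grow by at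
    most a^q, hence the square root as the constant for the norms.\<close>
  interpret V: varying_operators "L h ?p q" "L h ?p (q + 1)" "eval_dbar (?p + q)" eval_form tests "\<lambda>n. L (g (s n)) ?p q" "sqrt (a ^ q)"
  proof (rule varying_operators.intro[OF form_operator_dbar[OF h h] varying_operators_axioms.intro])
    show "form_operator (L (g (s n)) ?p q) (L h ?p (q + 1)) (eval_dbar (?p + q)) eval_form tests" for n
      by (rule form_operator_dbar[OF gs h])
    show "sqrt (a ^ q) \<ge> 0" using a(1) by simp
    show "v \<in> carr (L (g (s n)) ?p q)" if "v \<in> carr (L h ?p q)" for n v by (rule K_Kn(1)[OF that])
    show "hnorm (L (g (s n)) ?p q) v \<le> sqrt (a ^ q) * hnorm (L h ?p q) v" if v: "v \<in> carr (L h ?p q)" for n v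
    proof (rule power2_le_imp_le)
      show "(hnorm (L (g (s n)) ?p q) v)\<^sup>2 \<le> (sqrt (a ^ q) * hnorm (L h ?p q) v)\<^sup>2"
        using K_Kn(2)[OF v, of n] a(1) by (simp add: power_mult_distrib)
      show "0 \<le> sqrt (a ^ q) * hnorm (L h ?p q) v" using a(1) W.K.nrm_nonneg[OF v] by simp
    qed
  qed (rule cutoff_ex[OF h fam s])
  \<comment> \<open>Enlarging the domain space enlarges the range, so the range for g (s n) lies
    between those for h and for g 1, which coincide by assumption. The upper inclusion needs a
    comparison of g (s n) with g 1 on the whole manifold; its constant may depend on n.\<close>
  have R: "Range (weak_graph (L (g (s n)) ?p q) (L h ?p (q + 1)) (eval_dbar (?p + q)) eval_form tests) = Range W.T" for n
  proof
    obtain k where k: "k > 0" "\<And>x v. k * g (s n) x v v \<le> g 1 x v v"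
      using global_comparison[OF gU[of 1 UNIV] gU[OF s(1), of UNIV n]] by auto
    have g1: "metric_on atlas A (g 1)" by (rule gU) simp
    have "Range (weak_graph (L (g (s n)) ?p q) (L h ?p (q + 1)) (eval_dbar (?p + q)) eval_form tests) \<subseteq>
        Range (weak_graph (L (g 1) ?p q) (L h ?p (q + 1)) (eval_dbar (?p + q)) eval_form tests)"
      using carr_compare(1)[OF g1 gs k] by (fastforce simp: weak_graph_def)
    then show "Range (weak_graph (L (g (s n)) ?p q) (L h ?p (q + 1)) (eval_dbar (?p + q)) eval_form tests) \<subseteq> Range W.T"
      using assms(13) unfolding T dbar_max_weak_graph[OF g1 h] by simp
    show "Range W.T \<subseteq> Range (weak_graph (L (g (s n)) ?p q) (L h ?p (q + 1)) (eval_dbar (?p + q)) eval_form tests)"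
      using K_Kn(1) by (fastforce simp: weak_graph_def)
  qed
  have cl: "W.H.closedH (Range W.T)" using closed_Range_dbar[OF h assms(8)] unfolding T .
  have cp: "compact_op (L h ?p (q + 1)) (L h ?p q) (green (L h ?p q) (L h ?p (q + 1)) W.T)"
    using assms(12) unfolding green_dbar_def T .
  from V.green_compactly_converges[OF cl R cp] show ?thesis
    unfolding green_dbar_def T dbar_max_weak_graph[OF gs h] .
qed

end
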